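(* Let $\rho,\mu$ be constants (density, dynamic viscosity), $\nu=\mu/\rho$, and consider the incompressible Navier--Stokes equations $$\nabla\cdot\mathbf U=0,\qquad \rho\left(\frac{\partial \mathbf U}{\partial t}+\mathbf U\cdot\nabla\mathbf U\right)=-\nabla P+\mu\nabla^2\mathbf U+\rho\,\mathbf g ,$$ with body accelerations given by power series $g^\alpha=\sum_{\omega,p,q,r=0}^\infty g^\alpha_{\omega,p,q,r}t^\omega x^py^qz^r$ and solutions sought as power series $$U^\alpha=\sum_{\omega,p,q,r=0}^\infty u^\alpha_{\omega,p,q,r}t^\omega x^py^qz^r\ (\alpha=0,1,2),\qquad P=\sum_{\omega,p,q,r=0}^\infty P_{\omega,p,q,r}t^\omega x^py^qz^r$$ (superscripts $1,0,2$ denote the $x,y,z$ components respectively). The domains of convergence of these power series are assumed non-empty. The following coefficients are prescribed: the initial velocity coefficients $u^\alpha_{0,p,q,r}$; the boundary velocity coefficients $u^\alpha_{\omega,p,q,r}$ for which at least one of $p,q,r$ is $0$ or $1$; the pressure coefficients $P_{\omega,p,q,r}$ for which $p=0$ or $q=0$ or $r=0$. Then, with the functions $\eta,\Gamma,\rho_x,\aleph_x,\Theta$ (and the convention on coefficients with negative indices) defined in the context: (1) The velocity coefficients of the power series solution are, for $\alpha\in\{0,1,2\}$, $\omega\ge 1$ and $p,q,r\ge 0$, $$u^\alpha_{\omega,p,q,r}=\sum_{i=0}^{\eta(p,q,r,\alpha,\omega,\omega-1)}\Bigg\{\Bigg[\prod_{j=1}^{\omega}\prod_{k=1}^{2^{j-1}}\Gamma\Big(\rho_\omega(i,1,k,j,\psi),\rho_1(i,1,k,j,\psi),\rho_0(i,1,k,j,\psi),\rho_2(i,1,k,j,\psi),\rho_\alpha(i,1,k,j,\psi),\Theta(k-2+2^{j-1},i,\psi,0)\Big)\Bigg]\Bigg[\prod_{k=1}^{2^\omega}u^{\aleph_\alpha(i,1,k,\psi)}_{\aleph_\omega(i,1,k,\psi),\,\aleph_1(i,1,k,\psi),\,\aleph_0(i,1,k,\psi),\,\aleph_2(i,1,k,\psi)}\Bigg]\Bigg\},$$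 where $\psi$ abbreviates the argument list $p,q,r,\alpha,\omega$. (2) The pressure coefficients are given, for $\omega\ge0,\ p\ge0,\ q\ge-1,\ r\ge-1$, by $$-\frac1\rho P_{\omega,p+1,q+1,r+1}=\frac{1}{p+1}\Big\{(\omega+1)u^1_{\omega+1,p,q+1,r+1}+\sum_{k=0}^{\omega}\sum_{i=0}^{p}\sum_{j=0}^{q+1}\sum_{l=0}^{r+1}\big[(i+1)u^1_{\omega-k,p-i,q+1-j,r+1-l}u^1_{k,i+1,j,l}+(j+1)u^0_{\omega-k,p-i,q+1-j,r+1-l}u^1_{k,i,j+1,l}+(l+1)u^2_{\omega-k,p-i,q+1-j,r+1-l}u^1_{k,i,j,l+1}\big]$$ $$-\nu\big[(p+1)(p+2)u^1_{\omega,p+2,q+1,r+1}+(q+2)(q+3)u^1_{\omega,p,q+3,r+1}+(r+2)(r+3)u^1_{\omega,p,q+1,r+3}\big]-g^1_{\omega,p,q+1,r+1}\Big\}.$$ (3) With these coefficients (the prescribed ones together with those given by (1) and (2)), the power series $U^\alpha=\sum u^\alpha_{\omega,p,q,r}t^\omega x^py^qz^r$ ($\alpha=0,1,2$) and $P=\sum P_{\omega,p,q,r}t^\omega x^py^qz^r$ satisfy the incompressible Navier--Stokes equations above.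
   Context: **General notation.** $\sum_{\omega,p,q,r=0}^\infty$ means $\sum_{\omega=0}^\infty\sum_{p=0}^\infty\sum_{q=0}^\infty\sum_{r=0}^\infty$. The domain of convergence of a series is the set of $(t,x,y,z)\in\mathbb R^4$ where it converges. Convention: if at least one of $\omega,p,q,r$ is negative then $u^\alpha_{\omega,p,q,r}=1$. $E$ is the floor function; $E_+$ is the floor function set equal to $0$ when its argument is negative; $\mathcal H$ is the Heaviside step function with $\mathcal H(0)=1$; $\delta$ is the Kronecker delta; $\mathcal{M}od(x,y)$ is $x$ modulo $y$; $\mathcal R(x,y)=x-yE(x/y)$. In any function of $p,q,r$ write $X_0=q,\ X_1=p,\ X_2=r$ (for the arguments of that function), and write $e=E(q/2)$. Empty sums are $0$. "Otherwise" and successive cases are read in order (if / else if). $Ip(x)=2$ if $E(x/2)=x/2$, and $1$ otherwise. $Ip_b(j,k)=0$ if $j=0$, and $Ip\left(E\left(\frac{k+1-2^{j-1}}{2^{j-1}}\right)\right)$ if $j\neq0$. **Functions $\xi,\Delta,\epsilon,\kappa$** (index $z=0,\dots,8$). $\xi(z,p,q,\alpha,n)$: $z=0$: $-1$; $z=1$: $p+2(\alpha-1)$; $z=2$: $p$; $z=3$: $p+2-\alpha$; $z=4$: $p+1$; $z=5$: $p+(2-\alpha)(2e+1)$; $z=6$: $p+(-1)^{\alpha+1}2n+3\alpha-4+2(\alpha-1)e$; $z=7$: $p+(-1)^{\alpha+1}2n+2(\alpha-1)e$; $z=8$: $p+(-1)^{\alpha+1}(2n-1)+2(\alpha-1)e$.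 $\Delta(z,q)$: $z=0$: $-1$; $z=1$: $q$; $z=2$: $q+2$; $z=3$: $q+1$; $z=4$: $q$; $z=5,6$: $q-2e+1$; $z=7,8$: $q-2e+2$. $\epsilon(z,q,r,\alpha,n)$: $z=0$: $-1$; $z=1$: $r+2(2-\alpha)$; $z=2$: $r$; $z=3$: $r+\alpha-1$; $z=4$: $r+1$; $z=5$: $r+(\alpha-1)(2e+1)$; $z=6$: $r+(-1)^{\alpha}2n-3\alpha+5+2(2-\alpha)e$; $z=7$: $r+(-1)^\alpha2n+2(2-\alpha)e$; $z=8$: $r+(-1)^\alpha(2n-1)+2(2-\alpha)e$. $\kappa(z,\alpha)$: $z=0$: $-1$; $z=1,2,7$: $\alpha$; $z=3,5,6$: $0$; $z=4,8$: $3-\alpha$. **Functions $s_1,s_2,s_3$.** $s_1(p,q,\alpha,a,n,m,b)$: $a=0$: $p+(2-\alpha)(2e+1-b-2n)$; $a=1$: $p+(-1)^\alpha(2m-b)+(2-\alpha)(2n+1-b)$; $a=2$: $p+2(-1)^\alpha m+(2-\alpha)(2n+3-b)$. $s_2(q,a,n,b)$: $a=0$: $q-(2e+1-b-2n)$; $a=1$: $q-1-2n+b$; $a=2$: $q-2n-3+b$. $s_3(q,r,\alpha,a,n,m,b)$: $a=0$: $r+(\alpha-1)(2e+1-b-2n)$; $a=1$: $r+(-1)^{\alpha+1}(2m-b)+(\alpha-1)(2n+1-b)$; $a=2$: $r+2(-1)^{\alpha+1}m+(\alpha-1)(2n+3-b)$. **Index functions of $(d,q)$.** Put $c=\frac32e^2-\frac32e+1$.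 $B(d,q)=E\left(\frac14\left(1+E\left(\frac dc\right)\right)\right)$; $\varphi(d,q)=E\left(\frac dc\right)-3E\left(\frac14\left(1+E\left(\frac dc\right)\right)\right)$. $A(d,q)=0$ if $\mathcal{M}od(d,c)<\frac12e(e+1)$; $1$ if $\frac12e(e+1)-1<\mathcal{M}od(d,c)<e^2$; $2$ if $\mathcal{M}od(d,c)>e^2-1$. $\gamma(d,q)=d+1-cE\left(\frac dc\right)-\frac12\left(A(d,q)e^2+A(d,q)(2-A(d,q))e\right)$. $N(d,q)=E\left(\frac12\left(1+\sqrt{8\gamma(d,q)-7}\right)\right)$; $M(d,q)=\gamma(d,q)-\frac12\left((N(d,q)-1)^2+N(d,q)-1\right)$. Below, when $d$ and $q$ are given, abbreviate $A=A(d,q)$, $B=B(d,q)$, $N=N(d,q)$, $M=M(d,q)$, $\varphi=\varphi(d,q)$, and $\bar s_1=s_1(p,q,\alpha,A,N,M,B)$, $\bar s_2=s_2(q,A,N,B)$, $\bar s_3=s_3(q,r,\alpha,A,N,M,B)$. $S(p,q,r,\alpha,d)=(\bar s_1+1)(\bar s_2+1)(\bar s_3+1)$. **Functions $Y_0,Y_1,Y_2,H$.** $Y_0(q,a,n,b)$: $a=0$: $b-1+q-2e+2n$; $a=1$: $b-1+q-2n$; $a=2$: $b+q-2n-3$. $Y_1(p,q,\alpha,a,n,m,b)$: $a=0$: $p+(2-\alpha)(1-b)+(2-\alpha)(2e-2n)$; $a=1$: $p+(\alpha-1)(1-b)+(-1)^\alpha(2m-1)+2n(2-\alpha)$; $a=2$: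 $p+(2-\alpha)(1-b)+(-1)^\alpha2m+(2n+2)(2-\alpha)$. $Y_2(q,r,\alpha,a,n,m,b)$: $a=0$: $r+(\alpha-1)(1-b)+(\alpha-1)(2e-2n)$; $a=1$: $r+(2-\alpha)(1-b)+(-1)^{\alpha+1}(2m-1)+2n(\alpha-1)$; $a=2$: $r+(\alpha-1)(1-b)+(-1)^{\alpha+1}2m+(2n+2)(\alpha-1)$. $H(q,a,n,m,b)=\delta_{n,m}(-1)^{n+b+e}$ if $a=0$, and $(-1)^{n+b+\frac12a(a-1)+\frac12(a-1)(a-2)e}\dfrac{(n-2+a)!}{(m-2+a)!\,(n-m)!}$ if $a>0$. Abbreviate $\bar Y_0=Y_0(q,A,N,B)$, $\bar Y_1=Y_1(p,q,\alpha,A,N,M,B)$, $\bar Y_2=Y_2(q,r,\alpha,A,N,M,B)$. **Functions $L,G,W,V$.** $L_0(q,r,\alpha,d,i)=E\left(\frac{i-1}{\bar s_3+1}\right)$; $L_1(q,r,\alpha,d,i)=E\left(\frac{i-1}{(\bar s_3+1)(\bar s_2+1)}\right)$. Write $L_0,L_1$ for these values. $$G(p,q,r,\alpha,d,i)=H(q,A,N,M,B)\Big\{\tfrac12(\varphi-1)(\varphi-2)\left[L_0-(\bar s_2+1)L_1\right]+\varphi(2-\varphi)L_1+\tfrac12\varphi(\varphi-1)\mathcal{M}od(i-1,\bar s_3+1)+1\Big\}\frac{\bar Y_0!\,\bar Y_1!\,\bar Y_2!}{p!\,q!\,r!}.$$ $W_0(p,q,r,\alpha,d,i)=\frac12(\varphi-1)(\varphi-2)+L_0-(\bar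 s_2+1)L_1$; $W_1(p,q,r,\alpha,d,i)=\varphi(2-\varphi)+L_1$; $W_2(p,q,r,\alpha,d,i)=\frac12\varphi(\varphi-1)+\mathcal{M}od(i-1,\bar s_3+1)$. $V_0(q,r,\alpha,d,i)=\bar Y_0-L_0+(\bar s_2+1)L_1$; $V_1(p,q,r,\alpha,d,i)=\bar Y_1-L_1$; $V_2(q,r,\alpha,d,i)=\bar Y_2-\mathcal{M}od(i-1,\bar s_3+1)$. **Functions $F_0,\widetilde{F_0},F$.** $$F_0(\omega,p,q,r,\alpha)=\sum_{n=1}^{e}(-1)^{e}\binom{e-1}{n-1}\Big(\frac{(X_\alpha+2n)!(X_{3-\alpha}+2e-2n)!}{p!q!r!}u^\alpha_{\omega,\,p+(-1)^{\alpha+1}2n+(\alpha-1)2e,\,q-2e,\,r+(-1)^\alpha2n+2(2-\alpha)e}$$ $$+\frac{(X_\alpha+2n-1)!(X_{3-\alpha}+2e-2n+1)!}{p!q!r!}u^{3-\alpha}_{\omega,\,p+(-1)^{\alpha+1}(2n-1)+(\alpha-1)2e,\,q-2e,\,r+(-1)^\alpha(2n-1)+2(2-\alpha)e}\Big).$$ $$\widetilde{F_0}(\omega,p,q,r,\alpha)=\frac1\omega\sum_{n=1}^{e}(-1)^{n+1}\Big(\frac{(q-2n+2)!(X_\alpha+2n-2)!}{X_\alpha!\,q!}g^\alpha_{\omega-1,\,p+(2-\alpha)(2n-2),\,q-2n+2,\,r+(\alpha-1)(2n-2)}-\frac{(q-2n+1)!(X_\alpha+2n-1)!}{X_\alpha!\,q!}g^0_{\omega-1,\,p+(2-\alpha)(2n-1),\,q-2n+1,\,r+(\alpha-1)(2n-1)}\Big)$$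 $$+\frac1\omega\sum_{n=1}^{e-1}\sum_{m=1}^{n}(-1)^n\Big(\binom{n-1}{m-1}\frac{(X_{3-\alpha}+2m-1)!(q-2n)!(X_\alpha-2m+2n+1)!}{p!q!r!}g^{3-\alpha}_{\omega-1,\,p+(-1)^\alpha(2m-1)+2n(2-\alpha),\,q-2n,\,r+(-1)^{\alpha+1}(2m-1)+2(\alpha-1)n}$$ $$-\binom nm\frac{(X_{3-\alpha}+2m)!(q-1-2n)!(X_\alpha-2m+2n+1)!}{p!q!r!}g^0_{\omega-1,\,p+2m(-1)^\alpha+(2-\alpha)(2n+1),\,q-1-2n,\,r+2m(-1)^{\alpha+1}+(\alpha-1)(2n+1)}\Big)$$ $$+\frac1\omega\sum_{n=1}^{e-2}\sum_{m=1}^{n}(-1)^{n+1}\binom nm\frac{(X_{3-\alpha}+2m)!(q-2-2n)!(X_\alpha-2m+2n+2)!}{p!q!r!}g^\alpha_{\omega-1,\,p+2m(-1)^\alpha+(2-\alpha)(2n+2),\,q-2-2n,\,r+2m(-1)^{\alpha+1}+(\alpha-1)(2n+2)}.$$ Three propositions on $(\omega,p,q,r)$: ($\mathsf P_1$) $\omega>0,\ p>1,\ q>1,\ r>1$; ($\mathsf P_2$) $\omega<0$ or $p<0$ or $q<0$ or $r<0$; ($\mathsf P_3$) $\omega=0$ or $0\le p\le1$ or $0\le q\le1$ or $0\le r\le1$. $F(z,\omega,p,q,r,\alpha,n)$ equals: - $z=0$: $F_0(\omega,p,q,r,\alpha)+\widetilde{F_0}(\omega,p,q,r,\alpha)$ if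 $\mathsf P_1$, and $u^\alpha_{\omega,p,q,r}$ if not $\mathsf P_1$; - $z=1,n=1$: $\frac\nu\omega(X_{3-\alpha}+1)(X_{3-\alpha}+2)$; - $z=2,n=1$: $\frac\nu\omega(q+1)(q+2)$; - $z=3,n=1$: $-\frac\nu\omega(q+1)(X_\alpha+1)$; - $z=4,n=1$: $-\frac\nu\omega(p+1)(r+1)\mathcal H(q-4)$; - $z=5,n=1$: $\frac\nu\omega(-1)^e\frac{(X_\alpha+2e+1)!(q-2e+1)}{X_\alpha!\,q!}$; - $z=6$: $\frac\nu\omega(-1)^e\binom{e}{n-1}\frac{(X_\alpha+2n-1)!(X_{3-\alpha}+2e-2n+2)!(1+q-2e)}{p!q!r!}$; - $z=7$: $2\frac\nu\omega(-1)^{e+1}\binom{e-1}{n-1}\frac{(X_\alpha+2n)!(X_{3-\alpha}+2e-2n)!(1+2q-4e)}{p!q!r!}$; - $z=8$: $2\mathcal H(q-4)\frac\nu\omega(-1)^{e+1}\binom{e-1}{n-1}\frac{(X_\alpha+2n-1)!(X_{3-\alpha}+2e-2n+1)!(1+2q-4e)}{p!q!r!}$; - otherwise: $0$. **Functions $D,\mathcal I,\sigma,\mathcal T,\chi,\mathcal N,\mathcal F$.** $D(p,q,r,\alpha,\tau)=\sum_{j=1}^{9e^2-9e+6}\mathcal H\left(\frac{\tau-1}{\sum_{k=0}^{j-1}S(p,q,r,\alpha,k)}-1\right)$; $\mathcal I(p,q,r,\alpha,\tau)=\tau-\sum_{j=1}^{9e^2-9e+6}S(p,q,r,\alpha,j-1)\,\mathcal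 H\left(\frac{\tau-1}{\sum_{k=0}^{j-1}S(p,q,r,\alpha,k)}-1\right)$. $$\sigma(p,q,r,\alpha)=\big[2e^4+(4X_\alpha+6X_{3-\alpha}+8)e^3+(9X_\alpha X_{3-\alpha}+1.5X_\alpha+3X_{3-\alpha}-8)e^2-(9X_{3-\alpha}X_\alpha+5.5X_\alpha+9X_{3-\alpha}+2)e+6X_\alpha X_{3-\alpha}+6X_\alpha+9X_{3-\alpha}+9\big]q$$ $$-3.2e^5-(6X_\alpha+8X_{3-\alpha}+8)e^4+(6X_{3-\alpha}+6X_\alpha-10X_{3-\alpha}X_\alpha+24)e^3+(14X_{3-\alpha}+9X_\alpha+22.5X_\alpha X_{3-\alpha}-7)e^2$$ $$-(9X_\alpha+12X_{3-\alpha}+12.5X_\alpha X_{3-\alpha}-2.2)e+3(X_{3-\alpha}+1)(X_\alpha+1)-8e$$ (a closed form of $\sum_{d=0}^{9e^2-9e+5}S(p,q,r,\alpha,d)$). $\mathcal T(p,q,r,\alpha,j)=j+1-\sigma(p,q,r,\alpha)E\left(\frac{j}{\sigma(p,q,r,\alpha)}\right)$; $\chi(\omega,p,q,r,\alpha,i)=i-\sigma(p,q,r,\alpha)\omega$; $\mathcal N(\omega,p,q,r,\alpha,i)=E\left(\frac{\chi(\omega,p,q,r,\alpha,i)-1}{8}\right)+1$. $\mathcal F(p,q,r,\alpha,\omega)$: $0$ if $p<2$ or $q<2$ or $r<2$ or $\omega\le0$; $1$ if $\alpha=0$ and $q=2$; $\sigma(p,q,r,\alpha)\omega+8E(q/2)$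 if $\alpha\ne0$, $\omega>0$ and $p,q,r>1$; otherwise $\sigma(p+1,q-1,r,1)\omega+\sigma(p,q-1,r+1,2)\omega+16E\left(\frac{q-1}2\right)+1$. **Functions $T_x,Z_x$ for $x\in\{0,1,2,\alpha,\omega\}$ and $\Gamma$.** Here $T_\alpha:=\beta$, $T_\omega:=\mathcal E$, $Z_\alpha:=\Phi$, $Z_\omega:=\Upsilon$. Propositions: ($\mathsf R_1$) $i<\sigma(p,q,r,\alpha)\omega$; ($\mathsf R_2$) $i\le\mathcal F(p+1,q-1,r,1,\omega)$. Abbreviate $d^*=D(p,q,r,\alpha,\mathcal T(p,q,r,\alpha,i))$, $i^*=\mathcal I(p,q,r,\alpha,\mathcal T(p,q,r,\alpha,i))$, $\chi=\chi(\omega,p,q,r,\alpha,i)$, $z^*=\chi-8E_+\left(\frac{\chi-1}8\right)$, $n^*=\mathcal N(\omega,p,q,r,\alpha,i)$. All of the functions $T_x,Z_x$ have arguments $(\omega,p,q,r,\alpha,i)$ and, for each of them (call it $Q$), when neither $\mathsf P_2$ nor $\mathsf P_3$ holds and $\alpha=0$: $Q(\omega,p,q,r,0,i)=Q(\omega,p+1,q-1,r,1,i)$ if $\mathsf R_2$, and $Q(\omega,p,q-1,r+1,2,\,i-\mathcal F(p+1,q-1,r,1,\omega)-1)$ otherwise. The remaining cases are: - $T_0$: $-1$ if $\mathsf P_2$; $q$ if $\mathsf P_3$ and not $\mathsf P_2$; else for $\alpha\in\{1,2\}$: $W_0(p,q,r,\alpha,d^*,i^* )$ if $\mathsf R_1$,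 $\Delta(z^*,q)$ if not $\mathsf R_1$. - $T_1$: $-1$ if $\mathsf P_2$; $p$ if $\mathsf P_3$ and not $\mathsf P_2$; else for $\alpha\in\{1,2\}$: $W_1(p,q,r,\alpha,d^*,i^* )$ if $\mathsf R_1$, $\xi(z^*,p,q,\alpha,n^* )$ if not. - $T_2$: $-1$ if $\mathsf P_2$; $r$ if $\mathsf P_3$ and not $\mathsf P_2$; else for $\alpha\in\{1,2\}$: $W_2(p,q,r,\alpha,d^*,i^* )$ if $\mathsf R_1$, $\epsilon(z^*,q,r,\alpha,n^* )$ if not. - $\beta$: $\alpha$ if $\mathsf P_2$ or $\mathsf P_3$; else for $\alpha\in\{1,2\}$: $B(d^*,q)\big(\alpha+A(d^*,q)(A(d^*,q)-2)(2\alpha-3)\big)$ if $\mathsf R_1$, $\kappa(z^*,\alpha)$ if not. - $\mathcal E$: $-1$ if $\mathsf P_2$; $\omega$ if $\mathsf P_3$ and not $\mathsf P_2$; else for $\alpha\in\{1,2\}$: $E\left(\frac i{\sigma(p,q,r,\alpha)}\right)$ if this is $<\omega$, and $\omega-1$ otherwise. - $Z_0,Z_1,Z_2$: $-1$ if $\mathsf P_2$ or $\mathsf P_3$; else for $\alpha\in\{1,2\}$: $V_0(q,r,\alpha,d^*,i^* )$, $V_1(p,q,r,\alpha,d^*,i^* )$, $V_2(q,r,\alpha,d^*,i^* )$ respectively (computed with the given $p$). - $\Phi$: $\alpha$ if $\mathsf P_2$ or $\mathsf P_3$; else for $\alpha\in\{1,2\}$: $\varphi(d^*,q)$. - $\Upsilon$: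 $-1$ if $\mathsf P_2$ or $\mathsf P_3$; else for $\alpha\in\{1,2\}$: $\omega-1-E\left(\frac i{\sigma(p,q,r,\alpha)}\right)$. $\Gamma(\omega,p,q,r,\alpha,i)$: $1$ if $\mathsf P_2$ or $\mathsf P_3$; else for $\alpha\in\{1,2\}$: $\frac1\omega G(p,q,r,\alpha,d^*,i^* )$ if $\mathsf R_1$, $F(z^*,\omega,p,q,r,\alpha,n^* )$ if not $\mathsf R_1$; else for $\alpha=0$: $-\frac{p+1}q\Gamma(\omega,p+1,q-1,r,1,i)$ if $\mathsf R_2$, $-\frac{r+1}q\Gamma(\omega,p,q-1,r+1,2,\,i-\mathcal F(p+1,q-1,r,1,\omega)-1)$ if not $\mathsf R_2$. **Functions $\eta,\widetilde{\eta_1},\widetilde{\eta_2},\mathcal S\widetilde\eta,\theta$.** In the following $T_x,Z_x,\beta,\Phi,\mathcal E,\Upsilon$ are evaluated at $(\omega,p,q,r,\alpha,k)$. $\eta(p,q,r,\alpha,\omega,ind)$: $0$ if $\mathsf P_2$ or $\mathsf P_3$; $1$ if $\alpha=0$ and $q=2$; $\mathcal F(p,q,r,\alpha,\omega)$ if $ind=0$ (and neither $\mathsf P_2$ nor $\mathsf P_3$); otherwise $$\sum_{k=0}^{\mathcal F(p,q,r,\alpha,\omega)}\big[\eta(T_1,T_0,T_2,\beta,\mathcal E,ind-1)+1\big]\big[\eta(Z_1,Z_0,Z_2,\Phi,\Upsilon,ind-1)+1\big]-1 .$$ $\widetilde{\eta_1}(p,q,r,\alpha,\omega,k,ind)=\mathcal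 F(T_1,T_0,T_2,\beta,\mathcal E)$ if $ind=0$, $\eta(T_1,T_0,T_2,\beta,\mathcal E,ind)$ if $ind>0$. $\widetilde{\eta_2}(p,q,r,\alpha,\omega,k,ind)=\mathcal F(Z_1,Z_0,Z_2,\Phi,\Upsilon)$ if $ind=0$, $\eta(Z_1,Z_0,Z_2,\Phi,\Upsilon,ind)$ if $ind>0$. $\mathcal S\widetilde\eta(j,p,q,r,\alpha,\omega,ind)=\sum_{k=0}^{j-1}[\widetilde{\eta_1}(p,q,r,\alpha,\omega,k,ind)+1][\widetilde{\eta_2}(p,q,r,\alpha,\omega,k,ind)+1]$. $\theta(i,p,q,r,\alpha,\omega,n,ind)$: $0$ if $\mathsf P_2$ or $\mathsf P_3$; else $i$ if $ind=0$; else, for $ind>0$, let $j$ be the integer with $\mathcal S\widetilde\eta(j,p,q,r,\alpha,\omega,ind-1)\le i<\mathcal S\widetilde\eta(j+1,p,q,r,\alpha,\omega,ind-1)$, and put $a_j=\mathcal S\widetilde\eta(j,p,q,r,\alpha,\omega,ind-1)$, $b_j=\widetilde{\eta_2}(p,q,r,\alpha,\omega,j,ind-1)+1$; then $\theta=j$ if $n=0$, $\theta=E\left(\frac{i-a_j}{b_j}\right)$ if $n=1$, $\theta=\mathcal R(i-a_j,b_j)$ if $n=2$. **Recursive functions $C_x,\Theta,\rho_x,\aleph_x$** for $x\in\{0,1,2,\alpha,\omega\}$. Let $\psi$ be the list $p,q,r,\alpha,\omega$, and $v_0=q,\ v_1=p,\ v_2=r,\ v_\alpha=\alpha,\ v_\omega=\omega$.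 Let $\lambda(m)=E\left(\frac{\ln(m+1)}{\ln2}\right)$. $C_x$ and $\Theta$ are defined by mutual recursion. $C_x(m,h,l,i,\psi)$: $v_x$ if $\lambda(m)-h<1$ or $l>\lambda(m)-1-h$; otherwise $$Q\Big(C_\omega(m,h,l+1,i,\psi),C_1(m,h,l+1,i,\psi),C_0(m,h,l+1,i,\psi),C_2(m,h,l+1,i,\psi),C_\alpha(m,h,l+1,i,\psi),\Theta\big(E\big(\tfrac{m+1-2^{l+1+h}}{2^{l+1+h}}\big),i,\psi,0\big)\Big)$$ with $Q=T_x$ if $Ip\left(E\left(\frac{m+1-2^{l+h}}{2^{l+h}}\right)\right)=1$ and $Q=Z_x$ otherwise. $\Theta(m,i,\psi,h)=\theta(i,\psi,Ip_b(h,m),\omega-1)$ if $h=\lambda(m)$; otherwise $$\Theta(m,i,\psi,h)=\theta\big(\Theta(m,i,\psi,h+1),C_1(m,h,0,i,\psi),C_0(m,h,0,i,\psi),C_2(m,h,0,i,\psi),C_\alpha(m,h,0,i,\psi),C_\omega(m,h,0,i,\psi),Ip_b(h,m),\omega-1+h-\lambda(m)\big).$$ $\rho_x(i,l,k,j,\psi)$: $v_x$ if $j<2$. Otherwise let $Q=T_x$ if $Ip\left(E\left(\frac{k-1+2^{j-1}}{2^{l-1}}-1\right)\right)=1$, $Q=Z_x$ otherwise, and $\vartheta=\Theta\left(E\left(\frac{k-1+2^{j-1}-2^l}{2^l}\right),i,\psi,0\right)$; then $\rho_x(i,l,k,j,\psi)=Q\big(\rho_\omega(i,l+1,k,j,\psi),\rho_1(i,l+1,k,j,\psi),\rho_0(i,l+1,k,j,\psi),\rho_2(i,l+1,k,j,\psi),\rho_\alpha(i,l+1,k,j,\psi),\vartheta\big)$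 if $l<j-1$, and $\rho_x(i,l,k,j,\psi)=Q(\omega,p,q,r,\alpha,\vartheta)$ if $j-1\le l$. $\aleph_x(i,l,k,\psi)$: let $Q=T_x$ if $Ip\left(E\left(\frac{k-1}{2^{l-1}}\right)+1\right)=1$, $Q=Z_x$ otherwise, and $\vartheta=\Theta\left(E\left(\frac{k-1}{2^l}\right)-1+2^{\omega-l},i,\psi,0\right)$; then $\aleph_x(i,l,k,\psi)=Q\big(\aleph_\omega(i,l+1,k,\psi),\aleph_1(i,l+1,k,\psi),\aleph_0(i,l+1,k,\psi),\aleph_2(i,l+1,k,\psi),\aleph_\alpha(i,l+1,k,\psi),\vartheta\big)$ if $l<\omega$, and $\aleph_x(i,l,k,\psi)=Q(\omega,p,q,r,\alpha,\vartheta)$ if $\omega\le l$.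
   Formalization: The prescribed coefficients are assumed to be those of some power series solution; for arbitrary prescribed data (3) fails, e.g. g=0, U=0, P=y. Non-empty domains of convergence are read as having non-empty interior (absolute convergence). *)

theory Defs
  imports "HOL-Analysis.Analysis"
begin

section \<open>Power series in four variables and the Navier--Stokes equations\<close>

text \<open>
  A coefficient family \<open>a\<close> is indexed in the order \<open>\<omega> p q r\<close> (powers of \<open>t x y z\<close>).
  Vector fields are indexed by \<open>\<alpha> \<in> {0, 1, 2}\<close>, where, as usual in this setting,
  \<open>1\<close> is the x-component, \<open>0\<close> the y-component and \<open>2\<close> the z-component.
\<close>

type_synonym coeffs = "nat \<Rightarrow> nat \<Rightarrow> nat \<Rightarrow> nat \<Rightarrow> real"
type_synonym field4 = "real \<Rightarrow> real \<Rightarrow> real \<Rightarrow> real \<Rightarrow> real"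

definition pseries :: "coeffs \<Rightarrow> field4" where
  "pseries a t x y z = (\<Sum>w. \<Sum>p. \<Sum>q. \<Sum>r. a w p q r * t ^ w * x ^ p * y ^ q * z ^ r)"

text \<open>
  For real families \<open>summable_on\<close> is absolute convergence; where it holds, all iterated sums
  exist and agree, in particular the one in \<open>pseries\<close>. The set below always contains the origin,
  so the meaningful non-emptiness condition is that its interior is non-empty (equivalently, that
  it contains a neighbourhood of the origin, or a point off the coordinate hyperplanes).
\<close>

definition conv_domain :: "coeffs \<Rightarrow> (real \<times> real \<times> real \<times> real) set" where
  "conv_domain a = {(t, x, y, z).
     (\<lambda>(w, p, q, r). a w p q r * t ^ w * x ^ p * y ^ q * z ^ r) summable_on UNIV}"

definition D_t :: "field4 \<Rightarrow> field4" where
  "D_t f t x y z = deriv (\<lambda>s. f s x y z) t"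

definition D_sp :: "int \<Rightarrow> field4 \<Rightarrow> field4" where
  "D_sp \<alpha> f t x y z =
     (if \<alpha> = 1 then deriv (\<lambda>s. f t s y z) x
      else if \<alpha> = 0 then deriv (\<lambda>s. f t x s z) y
      else deriv (\<lambda>s. f t x y s) z)"

definition navier_stokes_at ::
  "real \<Rightarrow> real \<Rightarrow> (int \<Rightarrow> field4) \<Rightarrow> (int \<Rightarrow> field4) \<Rightarrow> field4 \<Rightarrow> real \<times> real \<times> real \<times> real \<Rightarrow> bool" where
  "navier_stokes_at \<rho> \<mu> G U Q = (\<lambda>(t, x, y, z).
     (\<Sum>\<beta>\<in>{0, 1, 2}. D_sp \<beta> (U \<beta>) t x y z) = 0 \<and>
     (\<forall>\<alpha>\<in>{0, 1, 2}.
        \<rho> * (D_t (U \<alpha>) t x y z + (\<Sum>\<beta>\<in>{0, 1, 2}. U \<beta> t x y z * D_sp \<beta> (U \<alpha>) t x y z))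
        = - D_sp \<alpha> Q t x y z + \<mu> * (\<Sum>\<beta>\<in>{0, 1, 2}. D_sp \<beta> (D_sp \<beta> (U \<alpha>)) t x y z)
          + \<rho> * G \<alpha> t x y z))"

definition power_series_solution ::
  "real \<Rightarrow> real \<Rightarrow> (int \<Rightarrow> coeffs) \<Rightarrow> (int \<Rightarrow> coeffs) \<Rightarrow> coeffs \<Rightarrow> bool" where
  "power_series_solution \<rho> \<mu> g u P \<longleftrightarrow>
     (\<forall>\<alpha>\<in>{0, 1, 2}. interior (conv_domain (u \<alpha>)) \<noteq> {} \<and> interior (conv_domain (g \<alpha>)) \<noteq> {}) \<and>
     interior (conv_domain P) \<noteq> {} \<and>
     (\<forall>v \<in> interior (conv_domain P \<inter> (\<Inter>\<alpha>\<in>{0, 1, 2}. conv_domain (u \<alpha>) \<inter> conv_domain (g \<alpha>))).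
        navier_stokes_at \<rho> \<mu> (\<lambda>\<alpha>. pseries (g \<alpha>)) (\<lambda>\<alpha>. pseries (u \<alpha>)) (pseries P) v)"

definition same_prescribed_coeffs ::
  "(int \<Rightarrow> coeffs) \<Rightarrow> coeffs \<Rightarrow> (int \<Rightarrow> coeffs) \<Rightarrow> coeffs \<Rightarrow> bool" where
  "same_prescribed_coeffs u P u' P' \<longleftrightarrow>
     (\<forall>\<alpha>\<in>{0, 1, 2}. \<forall>p q r. u' \<alpha> 0 p q r = u \<alpha> 0 p q r) \<and>
     (\<forall>\<alpha>\<in>{0, 1, 2}. \<forall>w p q r. p \<in> {0, 1} \<or> q \<in> {0, 1} \<or> r \<in> {0, 1} \<longrightarrow>
        u' \<alpha> w p q r = u \<alpha> w p q r) \<and>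
     (\<forall>w p q r. p = 0 \<or> q = 0 \<or> r = 0 \<longrightarrow> P' w p q r = P w p q r)"

text \<open>
  Coefficients with integer indices. Velocity coefficients with a negative index are \<open>1\<close> by
  convention; \<open>cf\<close> itself is only used with non-negative indices.
\<close>

definition cf :: "coeffs \<Rightarrow> int \<Rightarrow> int \<Rightarrow> int \<Rightarrow> int \<Rightarrow> real" where
  "cf a w p q r = a (nat w) (nat p) (nat q) (nat r)"

definition ucf :: "(int \<Rightarrow> coeffs) \<Rightarrow> int \<Rightarrow> int \<Rightarrow> int \<Rightarrow> int \<Rightarrow> int \<Rightarrow> real" where
  "ucf u \<alpha> w p q r = (if w < 0 \<or> p < 0 \<or> q < 0 \<or> r < 0 then 1 else cf (u \<alpha>) w p q r)"


section \<open>Elementary functions\<close>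

text \<open>
  All indices are integers. For integers, \<open>E(x / y)\<close> is \<open>x div y\<close> and both
  \<open>x - y E(x / y)\<close> and the residue of \<open>x\<close> modulo \<open>y\<close> are \<open>x mod y\<close>; halves of
  products that are always even are written with \<open>div 2\<close>.
  Factorials and binomial coefficients are only ever needed at non-negative arguments
  (lower arguments \<open>k < 0\<close> give \<open>0\<close>).
\<close>

definition heav :: "real \<Rightarrow> int" where
  "heav x = (if x \<ge> 0 then 1 else 0)"

definition E_plus :: "real \<Rightarrow> int" where
  "E_plus x = (if x < 0 then 0 else \<lfloor>x\<rfloor>)"

definition sg :: "int \<Rightarrow> int" \<comment> \<open>\<open>(-1)\<^sup>n\<close>\<close> where
  "sg n = (if even n then 1 else -1)"

definition fct :: "int \<Rightarrow> real" where
  "fct n = fact (nat n)"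

definition bin :: "int \<Rightarrow> int \<Rightarrow> real" where
  "bin n k = (if k < 0 then 0 else of_nat (nat n choose nat k))"

abbreviation (input) ee :: "int \<Rightarrow> int" where
  "ee q \<equiv> q div 2"

definition X :: "int \<Rightarrow> int \<Rightarrow> int \<Rightarrow> int \<Rightarrow> int" where
  "X j p q r = (if j = 0 then q else if j = 1 then p else r)"

definition Ip :: "int \<Rightarrow> int" where
  "Ip x = (if even x then 2 else 1)"

definition Ip_b :: "nat \<Rightarrow> nat \<Rightarrow> int" where
  "Ip_b j k = (if j = 0 then 0 else Ip ((int k + 1 - 2 ^ (j - 1)) div 2 ^ (j - 1)))"


section \<open>The index functions\<close>

definition xi :: "int \<Rightarrow> int \<Rightarrow> int \<Rightarrow> int \<Rightarrow> int \<Rightarrow> int" where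
  "xi z p q \<alpha> n =
    (if z = 0 then -1
     else if z = 1 then p + 2 * (\<alpha> - 1)
     else if z = 2 then p
     else if z = 3 then p + 2 - \<alpha>
     else if z = 4 then p + 1
     else if z = 5 then p + (2 - \<alpha>) * (2 * ee q + 1)
     else if z = 6 then p + sg (\<alpha> + 1) * (2 * n) + 3 * \<alpha> - 4 + 2 * (\<alpha> - 1) * ee q
     else if z = 7 then p + sg (\<alpha> + 1) * (2 * n) + 2 * (\<alpha> - 1) * ee q
     else p + sg (\<alpha> + 1) * (2 * n - 1) + 2 * (\<alpha> - 1) * ee q)"

definition Delt :: "int \<Rightarrow> int \<Rightarrow> int" where
  "Delt z q =
    (if z = 0 then -1
     else if z = 1 then q
     else if z = 2 then q + 2
     else if z = 3 then q + 1
     else if z = 4 then q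
     else if z = 5 \<or> z = 6 then q - 2 * ee q + 1
     else q - 2 * ee q + 2)"

definition epsi :: "int \<Rightarrow> int \<Rightarrow> int \<Rightarrow> int \<Rightarrow> int \<Rightarrow> int" where
  "epsi z q r \<alpha> n =
    (if z = 0 then -1
     else if z = 1 then r + 2 * (2 - \<alpha>)
     else if z = 2 then r
     else if z = 3 then r + \<alpha> - 1
     else if z = 4 then r + 1
     else if z = 5 then r + (\<alpha> - 1) * (2 * ee q + 1)
     else if z = 6 then r + sg \<alpha> * (2 * n) - 3 * \<alpha> + 5 + 2 * (2 - \<alpha>) * ee q
     else if z = 7 then r + sg \<alpha> * (2 * n) + 2 * (2 - \<alpha>) * ee q
     else r + sg \<alpha> * (2 * n - 1) + 2 * (2 - \<alpha>) * ee q)"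

definition kapp :: "int \<Rightarrow> int \<Rightarrow> int" where
  "kapp z \<alpha> =
    (if z = 0 then -1
     else if z = 1 \<or> z = 2 \<or> z = 7 then \<alpha>
     else if z = 3 \<or> z = 5 \<or> z = 6 then 0
     else 3 - \<alpha>)"

definition s1 :: "int \<Rightarrow> int \<Rightarrow> int \<Rightarrow> int \<Rightarrow> int \<Rightarrow> int \<Rightarrow> int \<Rightarrow> int" where
  "s1 p q \<alpha> a n m b =
    (if a = 0 then p + (2 - \<alpha>) * (2 * ee q + 1 - b - 2 * n)
     else if a = 1 then p + sg \<alpha> * (2 * m - b) + (2 - \<alpha>) * (2 * n + 1 - b)
     else p + 2 * sg \<alpha> * m + (2 - \<alpha>) * (2 * n + 3 - b))"

definition s2 :: "int \<Rightarrow> int \<Rightarrow> int \<Rightarrow> int \<Rightarrow> int" where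
  "s2 q a n b =
    (if a = 0 then q - (2 * ee q + 1 - b - 2 * n)
     else if a = 1 then q - 1 - 2 * n + b
     else q - 2 * n - 3 + b)"

definition s3 :: "int \<Rightarrow> int \<Rightarrow> int \<Rightarrow> int \<Rightarrow> int \<Rightarrow> int \<Rightarrow> int \<Rightarrow> int" where
  "s3 q r \<alpha> a n m b =
    (if a = 0 then r + (\<alpha> - 1) * (2 * ee q + 1 - b - 2 * n)
     else if a = 1 then r + sg (\<alpha> + 1) * (2 * m - b) + (\<alpha> - 1) * (2 * n + 1 - b)
     else r + 2 * sg (\<alpha> + 1) * m + (\<alpha> - 1) * (2 * n + 3 - b))"

text \<open>\<open>cc q\<close> is \<open>3/2 e\<^sup>2 - 3/2 e + 1\<close>, an integer because \<open>e\<^sup>2 - e\<close> is even.\<close>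

definition cc :: "int \<Rightarrow> int" where
  "cc q = (3 * (ee q)\<^sup>2 - 3 * ee q + 2) div 2"

definition B_ix :: "int \<Rightarrow> int \<Rightarrow> int" where
  "B_ix d q = (1 + d div cc q) div 4"

definition phi_ix :: "int \<Rightarrow> int \<Rightarrow> int" where
  "phi_ix d q = d div cc q - 3 * ((1 + d div cc q) div 4)"

definition A_ix :: "int \<Rightarrow> int \<Rightarrow> int" where
  "A_ix d q =
    (if d mod cc q < ee q * (ee q + 1) div 2 then 0
     else if ee q * (ee q + 1) div 2 - 1 < d mod cc q \<and> d mod cc q < (ee q)\<^sup>2 then 1
     else 2)"

definition gamma_ix :: "int \<Rightarrow> int \<Rightarrow> int" where
  "gamma_ix d q = d + 1 - cc q * (d div cc q)
     - (A_ix d q * (ee q)\<^sup>2 + A_ix d q * (2 - A_ix d q) * ee q) div 2"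

definition N_ix :: "int \<Rightarrow> int \<Rightarrow> int" where
  "N_ix d q = \<lfloor>(1 + sqrt (8 * real_of_int (gamma_ix d q) - 7)) / 2\<rfloor>"

definition M_ix :: "int \<Rightarrow> int \<Rightarrow> int" where
  "M_ix d q = gamma_ix d q - ((N_ix d q - 1)\<^sup>2 + N_ix d q - 1) div 2"

definition s1b :: "int \<Rightarrow> int \<Rightarrow> int \<Rightarrow> int \<Rightarrow> int" where
  "s1b p q \<alpha> d = s1 p q \<alpha> (A_ix d q) (N_ix d q) (M_ix d q) (B_ix d q)"

definition s2b :: "int \<Rightarrow> int \<Rightarrow> int" where
  "s2b q d = s2 q (A_ix d q) (N_ix d q) (B_ix d q)"

definition s3b :: "int \<Rightarrow> int \<Rightarrow> int \<Rightarrow> int \<Rightarrow> int" where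
  "s3b q r \<alpha> d = s3 q r \<alpha> (A_ix d q) (N_ix d q) (M_ix d q) (B_ix d q)"

definition S_blk :: "int \<Rightarrow> int \<Rightarrow> int \<Rightarrow> int \<Rightarrow> int \<Rightarrow> int" where
  "S_blk p q r \<alpha> d = (s1b p q \<alpha> d + 1) * (s2b q d + 1) * (s3b q r \<alpha> d + 1)"

definition Y0 :: "int \<Rightarrow> int \<Rightarrow> int \<Rightarrow> int \<Rightarrow> int" where
  "Y0 q a n b =
    (if a = 0 then b - 1 + q - 2 * ee q + 2 * n
     else if a = 1 then b - 1 + q - 2 * n
     else b + q - 2 * n - 3)"

definition Y1 :: "int \<Rightarrow> int \<Rightarrow> int \<Rightarrow> int \<Rightarrow> int \<Rightarrow> int \<Rightarrow> int \<Rightarrow> int" where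
  "Y1 p q \<alpha> a n m b =
    (if a = 0 then p + (2 - \<alpha>) * (1 - b) + (2 - \<alpha>) * (2 * ee q - 2 * n)
     else if a = 1 then p + (\<alpha> - 1) * (1 - b) + sg \<alpha> * (2 * m - 1) + 2 * n * (2 - \<alpha>)
     else p + (2 - \<alpha>) * (1 - b) + sg \<alpha> * (2 * m) + (2 * n + 2) * (2 - \<alpha>))"

definition Y2 :: "int \<Rightarrow> int \<Rightarrow> int \<Rightarrow> int \<Rightarrow> int \<Rightarrow> int \<Rightarrow> int \<Rightarrow> int" where
  "Y2 q r \<alpha> a n m b =
    (if a = 0 then r + (\<alpha> - 1) * (1 - b) + (\<alpha> - 1) * (2 * ee q - 2 * n)
     else if a = 1 then r + (2 - \<alpha>) * (1 - b) + sg (\<alpha> + 1) * (2 * m - 1) + 2 * n * (\<alpha> - 1)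
     else r + (\<alpha> - 1) * (1 - b) + sg (\<alpha> + 1) * (2 * m) + (2 * n + 2) * (\<alpha> - 1))"

definition Y0b :: "int \<Rightarrow> int \<Rightarrow> int" where
  "Y0b q d = Y0 q (A_ix d q) (N_ix d q) (B_ix d q)"

definition Y1b :: "int \<Rightarrow> int \<Rightarrow> int \<Rightarrow> int \<Rightarrow> int" where
  "Y1b p q \<alpha> d = Y1 p q \<alpha> (A_ix d q) (N_ix d q) (M_ix d q) (B_ix d q)"

definition Y2b :: "int \<Rightarrow> int \<Rightarrow> int \<Rightarrow> int \<Rightarrow> int" where
  "Y2b q r \<alpha> d = Y2 q r \<alpha> (A_ix d q) (N_ix d q) (M_ix d q) (B_ix d q)"

definition H_cf :: "int \<Rightarrow> int \<Rightarrow> int \<Rightarrow> int \<Rightarrow> int \<Rightarrow> real" where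
  "H_cf q a n m b =
    (if a = 0 then (if n = m then of_int (sg (n + b + ee q)) else 0)
     else of_int (sg (n + b + a * (a - 1) div 2 + ((a - 1) * (a - 2) div 2) * ee q))
          * (fct (n - 2 + a) / (fct (m - 2 + a) * fct (n - m))))"

definition L0 :: "int \<Rightarrow> int \<Rightarrow> int \<Rightarrow> int \<Rightarrow> int \<Rightarrow> int" where
  "L0 q r \<alpha> d i = (i - 1) div (s3b q r \<alpha> d + 1)"

definition L1 :: "int \<Rightarrow> int \<Rightarrow> int \<Rightarrow> int \<Rightarrow> int \<Rightarrow> int" where
  "L1 q r \<alpha> d i = (i - 1) div ((s3b q r \<alpha> d + 1) * (s2b q d + 1))"

definition G_cf :: "int \<Rightarrow> int \<Rightarrow> int \<Rightarrow> int \<Rightarrow> int \<Rightarrow> int \<Rightarrow> real" where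
  "G_cf p q r \<alpha> d i =
     H_cf q (A_ix d q) (N_ix d q) (M_ix d q) (B_ix d q)
     * of_int (((phi_ix d q - 1) * (phi_ix d q - 2) div 2)
                 * (L0 q r \<alpha> d i - (s2b q d + 1) * L1 q r \<alpha> d i)
               + phi_ix d q * (2 - phi_ix d q) * L1 q r \<alpha> d i
               + (phi_ix d q * (phi_ix d q - 1) div 2) * ((i - 1) mod (s3b q r \<alpha> d + 1))
               + 1)
     * (fct (Y0b q d) * fct (Y1b p q \<alpha> d) * fct (Y2b q r \<alpha> d) / (fct p * fct q * fct r))"

definition W0 :: "int \<Rightarrow> int \<Rightarrow> int \<Rightarrow> int \<Rightarrow> int \<Rightarrow> int \<Rightarrow> int" where
  "W0 p q r \<alpha> d i =
     (phi_ix d q - 1) * (phi_ix d q - 2) div 2 + L0 q r \<alpha> d i - (s2b q d + 1) * L1 q r \<alpha> d i"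

definition W1 :: "int \<Rightarrow> int \<Rightarrow> int \<Rightarrow> int \<Rightarrow> int \<Rightarrow> int \<Rightarrow> int" where
  "W1 p q r \<alpha> d i = phi_ix d q * (2 - phi_ix d q) + L1 q r \<alpha> d i"

definition W2 :: "int \<Rightarrow> int \<Rightarrow> int \<Rightarrow> int \<Rightarrow> int \<Rightarrow> int \<Rightarrow> int" where
  "W2 p q r \<alpha> d i = phi_ix d q * (phi_ix d q - 1) div 2 + (i - 1) mod (s3b q r \<alpha> d + 1)"

definition V0 :: "int \<Rightarrow> int \<Rightarrow> int \<Rightarrow> int \<Rightarrow> int \<Rightarrow> int" where
  "V0 q r \<alpha> d i = Y0b q d - L0 q r \<alpha> d i + (s2b q d + 1) * L1 q r \<alpha> d i"

definition V1 :: "int \<Rightarrow> int \<Rightarrow> int \<Rightarrow> int \<Rightarrow> int \<Rightarrow> int \<Rightarrow> int" where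
  "V1 p q r \<alpha> d i = Y1b p q \<alpha> d - L1 q r \<alpha> d i"

definition V2 :: "int \<Rightarrow> int \<Rightarrow> int \<Rightarrow> int \<Rightarrow> int \<Rightarrow> int" where
  "V2 q r \<alpha> d i = Y2b q r \<alpha> d - (i - 1) mod (s3b q r \<alpha> d + 1)"


section \<open>The coefficient functions\<close>

definition P1 :: "int \<Rightarrow> int \<Rightarrow> int \<Rightarrow> int \<Rightarrow> bool" where
  "P1 w p q r \<longleftrightarrow> w > 0 \<and> p > 1 \<and> q > 1 \<and> r > 1"

definition P2 :: "int \<Rightarrow> int \<Rightarrow> int \<Rightarrow> int \<Rightarrow> bool" where
  "P2 w p q r \<longleftrightarrow> w < 0 \<or> p < 0 \<or> q < 0 \<or> r < 0"

definition P3 :: "int \<Rightarrow> int \<Rightarrow> int \<Rightarrow> int \<Rightarrow> bool" where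
  "P3 w p q r \<longleftrightarrow> w = 0 \<or> (0 \<le> p \<and> p \<le> 1) \<or> (0 \<le> q \<and> q \<le> 1) \<or> (0 \<le> r \<and> r \<le> 1)"

definition F0 :: "(int \<Rightarrow> coeffs) \<Rightarrow> int \<Rightarrow> int \<Rightarrow> int \<Rightarrow> int \<Rightarrow> int \<Rightarrow> real" where
  "F0 u w p q r \<alpha> =
    (\<Sum>n\<in>{1..ee q}. of_int (sg (ee q)) * bin (ee q - 1) (n - 1) *
      (fct (X \<alpha> p q r + 2 * n) * fct (X (3 - \<alpha>) p q r + 2 * ee q - 2 * n) / (fct p * fct q * fct r)
         * ucf u \<alpha> w (p + sg (\<alpha> + 1) * (2 * n) + (\<alpha> - 1) * (2 * ee q)) (q - 2 * ee q)
             (r + sg \<alpha> * (2 * n) + 2 * (2 - \<alpha>) * ee q)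
       + fct (X \<alpha> p q r + 2 * n - 1) * fct (X (3 - \<alpha>) p q r + 2 * ee q - 2 * n + 1)
           / (fct p * fct q * fct r)
         * ucf u (3 - \<alpha>) w (p + sg (\<alpha> + 1) * (2 * n - 1) + (\<alpha> - 1) * (2 * ee q)) (q - 2 * ee q)
             (r + sg \<alpha> * (2 * n - 1) + 2 * (2 - \<alpha>) * ee q)))"

definition F0t :: "(int \<Rightarrow> coeffs) \<Rightarrow> int \<Rightarrow> int \<Rightarrow> int \<Rightarrow> int \<Rightarrow> int \<Rightarrow> real" where
  "F0t g w p q r \<alpha> =
    1 / of_int w *
    (\<Sum>n\<in>{1..ee q}. of_int (sg (n + 1)) *
      (fct (q - 2 * n + 2) * fct (X \<alpha> p q r + 2 * n - 2) / (fct (X \<alpha> p q r) * fct q)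
         * cf (g \<alpha>) (w - 1) (p + (2 - \<alpha>) * (2 * n - 2)) (q - 2 * n + 2)
             (r + (\<alpha> - 1) * (2 * n - 2))
       - fct (q - 2 * n + 1) * fct (X \<alpha> p q r + 2 * n - 1) / (fct (X \<alpha> p q r) * fct q)
         * cf (g 0) (w - 1) (p + (2 - \<alpha>) * (2 * n - 1)) (q - 2 * n + 1)
             (r + (\<alpha> - 1) * (2 * n - 1))))
    + 1 / of_int w *
    (\<Sum>n\<in>{1..ee q - 1}. \<Sum>m\<in>{1..n}. of_int (sg n) *
      (bin (n - 1) (m - 1)
         * (fct (X (3 - \<alpha>) p q r + 2 * m - 1) * fct (q - 2 * n) * fct (X \<alpha> p q r - 2 * m + 2 * n + 1)
              / (fct p * fct q * fct r))
         * cf (g (3 - \<alpha>)) (w - 1) (p + sg \<alpha> * (2 * m - 1) + 2 * n * (2 - \<alpha>)) (q - 2 * n)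
             (r + sg (\<alpha> + 1) * (2 * m - 1) + 2 * (\<alpha> - 1) * n)
       - bin n m
         * (fct (X (3 - \<alpha>) p q r + 2 * m) * fct (q - 1 - 2 * n) * fct (X \<alpha> p q r - 2 * m + 2 * n + 1)
              / (fct p * fct q * fct r))
         * cf (g 0) (w - 1) (p + 2 * m * sg \<alpha> + (2 - \<alpha>) * (2 * n + 1)) (q - 1 - 2 * n)
             (r + 2 * m * sg (\<alpha> + 1) + (\<alpha> - 1) * (2 * n + 1))))
    + 1 / of_int w *
    (\<Sum>n\<in>{1..ee q - 2}. \<Sum>m\<in>{1..n}. of_int (sg (n + 1)) * bin n m
         * (fct (X (3 - \<alpha>) p q r + 2 * m) * fct (q - 2 - 2 * n) * fct (X \<alpha> p q r - 2 * m + 2 * n + 2)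
              / (fct p * fct q * fct r))
         * cf (g \<alpha>) (w - 1) (p + 2 * m * sg \<alpha> + (2 - \<alpha>) * (2 * n + 2)) (q - 2 - 2 * n)
             (r + 2 * m * sg (\<alpha> + 1) + (\<alpha> - 1) * (2 * n + 2)))"

definition F_cf ::
  "real \<Rightarrow> (int \<Rightarrow> coeffs) \<Rightarrow> (int \<Rightarrow> coeffs) \<Rightarrow>
   int \<Rightarrow> int \<Rightarrow> int \<Rightarrow> int \<Rightarrow> int \<Rightarrow> int \<Rightarrow> int \<Rightarrow> real" where
  "F_cf \<nu> g u z w p q r \<alpha> n =
    (if z = 0 then (if P1 w p q r then F0 u w p q r \<alpha> + F0t g w p q r \<alpha> else ucf u \<alpha> w p q r)
     else if z = 1 \<and> n = 1 then
       \<nu> / of_int w * of_int ((X (3 - \<alpha>) p q r + 1) * (X (3 - \<alpha>) p q r + 2))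
     else if z = 2 \<and> n = 1 then \<nu> / of_int w * of_int ((q + 1) * (q + 2))
     else if z = 3 \<and> n = 1 then - (\<nu> / of_int w) * of_int ((q + 1) * (X \<alpha> p q r + 1))
     else if z = 4 \<and> n = 1 then
       - (\<nu> / of_int w) * of_int ((p + 1) * (r + 1) * heav (of_int (q - 4)))
     else if z = 5 \<and> n = 1 then
       \<nu> / of_int w * of_int (sg (ee q)) *
       (fct (X \<alpha> p q r + 2 * ee q + 1) * of_int (q - 2 * ee q + 1) / (fct (X \<alpha> p q r) * fct q))
     else if z = 6 then
       \<nu> / of_int w * of_int (sg (ee q)) * bin (ee q) (n - 1) *
       (fct (X \<alpha> p q r + 2 * n - 1) * fct (X (3 - \<alpha>) p q r + 2 * ee q - 2 * n + 2)
          * of_int (1 + q - 2 * ee q) / (fct p * fct q * fct r))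
     else if z = 7 then
       2 * (\<nu> / of_int w) * of_int (sg (ee q + 1)) * bin (ee q - 1) (n - 1) *
       (fct (X \<alpha> p q r + 2 * n) * fct (X (3 - \<alpha>) p q r + 2 * ee q - 2 * n)
          * of_int (1 + 2 * q - 4 * ee q) / (fct p * fct q * fct r))
     else if z = 8 then
       2 * of_int (heav (of_int (q - 4))) * (\<nu> / of_int w) * of_int (sg (ee q + 1))
       * bin (ee q - 1) (n - 1) *
       (fct (X \<alpha> p q r + 2 * n - 1) * fct (X (3 - \<alpha>) p q r + 2 * ee q - 2 * n + 1)
          * of_int (1 + 2 * q - 4 * ee q) / (fct p * fct q * fct r))
     else 0)"


section \<open>Enumeration of the terms\<close>

definition D_pos :: "int \<Rightarrow> int \<Rightarrow> int \<Rightarrow> int \<Rightarrow> int \<Rightarrow> int" where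
  "D_pos p q r \<alpha> \<tau> = (\<Sum>j\<in>{1..9 * (ee q)\<^sup>2 - 9 * ee q + 6}.
     heav (of_int (\<tau> - 1) / of_int (\<Sum>k\<in>{0..j - 1}. S_blk p q r \<alpha> k) - 1))"

definition I_pos :: "int \<Rightarrow> int \<Rightarrow> int \<Rightarrow> int \<Rightarrow> int \<Rightarrow> int" where
  "I_pos p q r \<alpha> \<tau> = \<tau> - (\<Sum>j\<in>{1..9 * (ee q)\<^sup>2 - 9 * ee q + 6}.
     S_blk p q r \<alpha> (j - 1)
     * heav (of_int (\<tau> - 1) / of_int (\<Sum>k\<in>{0..j - 1}. S_blk p q r \<alpha> k) - 1))"

definition sigma_real :: "int \<Rightarrow> int \<Rightarrow> int \<Rightarrow> int \<Rightarrow> real" where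
  "sigma_real p q r \<alpha> =
    (let e = real_of_int (ee q); Xa = real_of_int (X \<alpha> p q r); Xb = real_of_int (X (3 - \<alpha>) p q r) in
     (2 * e ^ 4 + (4 * Xa + 6 * Xb + 8) * e ^ 3 + (9 * Xa * Xb + 1.5 * Xa + 3 * Xb - 8) * e ^ 2
        - (9 * Xb * Xa + 5.5 * Xa + 9 * Xb + 2) * e + 6 * Xa * Xb + 6 * Xa + 9 * Xb + 9) * of_int q
     - 3.2 * e ^ 5 - (6 * Xa + 8 * Xb + 8) * e ^ 4
     + (6 * Xb + 6 * Xa - 10 * Xb * Xa + 24) * e ^ 3
     + (14 * Xb + 9 * Xa + 22.5 * Xa * Xb - 7) * e ^ 2
     - (9 * Xa + 12 * Xb + 12.5 * Xa * Xb - 2.2) * e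
     + 3 * (Xb + 1) * (Xa + 1) - 8 * e)"

text \<open>The closed form is integer-valued, see \<open>of_int_sigma\<close> below; the floor only changes the type.\<close>

definition sigma :: "int \<Rightarrow> int \<Rightarrow> int \<Rightarrow> int \<Rightarrow> int" where
  "sigma p q r \<alpha> = \<lfloor>sigma_real p q r \<alpha>\<rfloor>"

lemma five_dvd_power5_diff: "5 dvd (e :: int) ^ 5 - e"
proof -
  have "e ^ 5 - e = (e - 2) * (e - 1) * e * (e + 1) * (e + 2) + 5 * ((e - 1) * e * (e + 1))"
    by algebra
  moreover have "e mod 5 = 0 \<or> e mod 5 = 1 \<or> e mod 5 = 2 \<or> e mod 5 = 3 \<or> e mod 5 = 4"
    by presburger
  then have "5 dvd e \<or> 5 dvd e - 1 \<or> 5 dvd e - 2 \<or> 5 dvd e + 2 \<or> 5 dvd e + 1" by presburger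
  then have "5 dvd (e - 2) * (e - 1) * e * (e + 1) * (e + 2)"
    by (elim disjE) (simp_all only: dvd_mult dvd_mult2)
  ultimately show ?thesis by simp
qed

lemma of_int_sigma: "of_int (sigma p q r \<alpha>) = sigma_real p q r \<alpha>"
proof -
  define e where "e = ee q"
  define a where "a = X \<alpha> p q r"
  define b where "b = X (3 - \<alpha>) p q r"
  have "even (e * (3 * e - 11))" by simp
  then obtain k1 where k1: "e * (3 * e - 11) = 2 * k1" by blast
  have "even (e * (45 * e - 25))" by simp
  then obtain k2 where k2: "e * (45 * e - 25) = 2 * k2" by blast
  obtain k3 where k3: "e ^ 5 - e = 5 * k3" using five_dvd_power5_diff by blast
  have k: "real_of_int k1 = 1.5 * of_int e ^ 2 - 5.5 * of_int e"
    "real_of_int k2 = 22.5 * of_int e ^ 2 - 12.5 * of_int e"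
    "real_of_int k3 = of_int e ^ 5 / 5 - of_int e / 5"
    using arg_cong[OF k1, of real_of_int] arg_cong[OF k2, of real_of_int]
      arg_cong[OF k3, of real_of_int]
    by (simp_all add: algebra_simps power2_eq_square)
  define K where "K = (2 * e ^ 4 + (4 * a + 6 * b + 8) * e ^ 3 + (9 * a * b + 3 * b - 8) * e ^ 2
        - (9 * b * a + 9 * b + 2) * e + 6 * a * b + 6 * a + 9 * b + 9 + a * k1) * q
     - 16 * k3 - e - (6 * a + 8 * b + 8) * e ^ 4 + (6 * b + 6 * a - 10 * b * a + 24) * e ^ 3
     + (14 * b + 9 * a - 7) * e ^ 2 - (9 * a + 12 * b) * e + a * b * k2
     + 3 * (b + 1) * (a + 1) - 8 * e"
  have "sigma_real p q r \<alpha> = of_int K"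
    unfolding sigma_real_def Let_def K_def e_def[symmetric] a_def[symmetric] b_def[symmetric]
      of_int_add of_int_diff of_int_mult of_int_power of_int_numeral of_int_1 k
    by (simp add: algebra_simps)
  then show ?thesis by (simp add: sigma_def)
qed

definition T_pos :: "int \<Rightarrow> int \<Rightarrow> int \<Rightarrow> int \<Rightarrow> int \<Rightarrow> int" where
  "T_pos p q r \<alpha> j = j + 1 - sigma p q r \<alpha> * (j div sigma p q r \<alpha>)"

definition chi :: "int \<Rightarrow> int \<Rightarrow> int \<Rightarrow> int \<Rightarrow> int \<Rightarrow> int \<Rightarrow> int" where
  "chi w p q r \<alpha> i = i - sigma p q r \<alpha> * w"

definition N_pos :: "int \<Rightarrow> int \<Rightarrow> int \<Rightarrow> int \<Rightarrow> int \<Rightarrow> int \<Rightarrow> int" where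
  "N_pos w p q r \<alpha> i = (chi w p q r \<alpha> i - 1) div 8 + 1"

definition FF :: "int \<Rightarrow> int \<Rightarrow> int \<Rightarrow> int \<Rightarrow> int \<Rightarrow> int" where
  "FF p q r \<alpha> w =
    (if p < 2 \<or> q < 2 \<or> r < 2 \<or> w \<le> 0 then 0
     else if \<alpha> = 0 \<and> q = 2 then 1
     else if \<alpha> \<noteq> 0 \<and> w > 0 \<and> p > 1 \<and> q > 1 \<and> r > 1 then sigma p q r \<alpha> * w + 8 * ee q
     else sigma (p + 1) (q - 1) r 1 * w + sigma p (q - 1) (r + 1) 2 * w + 16 * ((q - 1) div 2) + 1)"

definition d_star :: "int \<Rightarrow> int \<Rightarrow> int \<Rightarrow> int \<Rightarrow> int \<Rightarrow> int" where
  "d_star p q r \<alpha> i = D_pos p q r \<alpha> (T_pos p q r \<alpha> i)"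

definition i_star :: "int \<Rightarrow> int \<Rightarrow> int \<Rightarrow> int \<Rightarrow> int \<Rightarrow> int" where
  "i_star p q r \<alpha> i = I_pos p q r \<alpha> (T_pos p q r \<alpha> i)"

definition z_star :: "int \<Rightarrow> int \<Rightarrow> int \<Rightarrow> int \<Rightarrow> int \<Rightarrow> int \<Rightarrow> int" where
  "z_star w p q r \<alpha> i = chi w p q r \<alpha> i - 8 * E_plus (of_int (chi w p q r \<alpha> i - 1) / 8)"

definition R1 :: "int \<Rightarrow> int \<Rightarrow> int \<Rightarrow> int \<Rightarrow> int \<Rightarrow> int \<Rightarrow> bool" where
  "R1 w p q r \<alpha> i \<longleftrightarrow> i < sigma p q r \<alpha> * w"

definition R2 :: "int \<Rightarrow> int \<Rightarrow> int \<Rightarrow> int \<Rightarrow> int \<Rightarrow> bool" where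
  "R2 w p q r i \<longleftrightarrow> i \<le> FF (p + 1) (q - 1) r 1 w"

text \<open>
  Each function \<open>Q\<close> among \<open>T\<^sub>x, Z\<^sub>x\<close> is first given (primed) by its clauses other than the one for
  \<open>\<alpha> = 0\<close>; \<open>reduce0\<close> adds that clause, which refers to \<open>Q\<close> at \<open>\<alpha> = 1\<close> or \<open>\<alpha> = 2\<close>.
\<close>

type_synonym index_fun = "int \<Rightarrow> int \<Rightarrow> int \<Rightarrow> int \<Rightarrow> int \<Rightarrow> int \<Rightarrow> int"

definition reduce0 :: "index_fun \<Rightarrow> index_fun" where
  "reduce0 Q w p q r \<alpha> i =
    (if \<not> P2 w p q r \<and> \<not> P3 w p q r \<and> \<alpha> = 0 then
       (if R2 w p q r i then Q w (p + 1) (q - 1) r 1 i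
        else Q w p (q - 1) (r + 1) 2 (i - FF (p + 1) (q - 1) r 1 w - 1))
     else Q w p q r \<alpha> i)"

definition T0' :: index_fun where
  "T0' w p q r \<alpha> i =
    (if P2 w p q r then -1 else if P3 w p q r then q
     else if R1 w p q r \<alpha> i then W0 p q r \<alpha> (d_star p q r \<alpha> i) (i_star p q r \<alpha> i)
     else Delt (z_star w p q r \<alpha> i) q)"

definition T1' :: index_fun where
  "T1' w p q r \<alpha> i =
    (if P2 w p q r then -1 else if P3 w p q r then p
     else if R1 w p q r \<alpha> i then W1 p q r \<alpha> (d_star p q r \<alpha> i) (i_star p q r \<alpha> i)
     else xi (z_star w p q r \<alpha> i) p q \<alpha> (N_pos w p q r \<alpha> i))"

definition T2' :: index_fun where
  "T2' w p q r \<alpha> i =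
    (if P2 w p q r then -1 else if P3 w p q r then r
     else if R1 w p q r \<alpha> i then W2 p q r \<alpha> (d_star p q r \<alpha> i) (i_star p q r \<alpha> i)
     else epsi (z_star w p q r \<alpha> i) q r \<alpha> (N_pos w p q r \<alpha> i))"

definition T\<alpha>' :: index_fun where
  "T\<alpha>' w p q r \<alpha> i =
    (if P2 w p q r \<or> P3 w p q r then \<alpha>
     else if R1 w p q r \<alpha> i then
       B_ix (d_star p q r \<alpha> i) q
       * (\<alpha> + A_ix (d_star p q r \<alpha> i) q * (A_ix (d_star p q r \<alpha> i) q - 2) * (2 * \<alpha> - 3))
     else kapp (z_star w p q r \<alpha> i) \<alpha>)"

definition T\<omega>' :: index_fun where
  "T\<omega>' w p q r \<alpha> i =
    (if P2 w p q r then -1 else if P3 w p q r then w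
     else if i div sigma p q r \<alpha> < w then i div sigma p q r \<alpha> else w - 1)"

definition Z0' :: index_fun where
  "Z0' w p q r \<alpha> i =
    (if P2 w p q r \<or> P3 w p q r then -1
     else V0 q r \<alpha> (d_star p q r \<alpha> i) (i_star p q r \<alpha> i))"

definition Z1' :: index_fun where
  "Z1' w p q r \<alpha> i =
    (if P2 w p q r \<or> P3 w p q r then -1
     else V1 p q r \<alpha> (d_star p q r \<alpha> i) (i_star p q r \<alpha> i))"

definition Z2' :: index_fun where
  "Z2' w p q r \<alpha> i =
    (if P2 w p q r \<or> P3 w p q r then -1
     else V2 q r \<alpha> (d_star p q r \<alpha> i) (i_star p q r \<alpha> i))"

definition Z\<alpha>' :: index_fun where
  "Z\<alpha>' w p q r \<alpha> i =
    (if P2 w p q r \<or> P3 w p q r then \<alpha> else phi_ix (d_star p q r \<alpha> i) q)"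

definition Z\<omega>' :: index_fun where
  "Z\<omega>' w p q r \<alpha> i =
    (if P2 w p q r \<or> P3 w p q r then -1 else w - 1 - i div sigma p q r \<alpha>)"

definition "T0 = reduce0 T0'"
definition "T1 = reduce0 T1'"
definition "T2 = reduce0 T2'"
definition "T\<alpha> = reduce0 T\<alpha>'"
definition "T\<omega> = reduce0 T\<omega>'"
definition "Z0 = reduce0 Z0'"
definition "Z1 = reduce0 Z1'"
definition "Z2 = reduce0 Z2'"
definition "Z\<alpha> = reduce0 Z\<alpha>'"
definition "Z\<omega> = reduce0 Z\<omega>'"

definition Gamma' ::
  "real \<Rightarrow> (int \<Rightarrow> coeffs) \<Rightarrow> (int \<Rightarrow> coeffs) \<Rightarrow>
   int \<Rightarrow> int \<Rightarrow> int \<Rightarrow> int \<Rightarrow> int \<Rightarrow> int \<Rightarrow> real" where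
  "Gamma' \<nu> g u w p q r \<alpha> i =
    (if P2 w p q r \<or> P3 w p q r then 1
     else if R1 w p q r \<alpha> i then
       1 / of_int w * G_cf p q r \<alpha> (d_star p q r \<alpha> i) (i_star p q r \<alpha> i)
     else F_cf \<nu> g u (z_star w p q r \<alpha> i) w p q r \<alpha> (N_pos w p q r \<alpha> i))"

definition Gamma_cf ::
  "real \<Rightarrow> (int \<Rightarrow> coeffs) \<Rightarrow> (int \<Rightarrow> coeffs) \<Rightarrow>
   int \<Rightarrow> int \<Rightarrow> int \<Rightarrow> int \<Rightarrow> int \<Rightarrow> int \<Rightarrow> real" where
  "Gamma_cf \<nu> g u w p q r \<alpha> i =
    (if \<not> P2 w p q r \<and> \<not> P3 w p q r \<and> \<alpha> = 0 then
       (if R2 w p q r i then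
          - (of_int (p + 1) / of_int q) * Gamma' \<nu> g u w (p + 1) (q - 1) r 1 i
        else
          - (of_int (r + 1) / of_int q)
          * Gamma' \<nu> g u w p (q - 1) (r + 1) 2 (i - FF (p + 1) (q - 1) r 1 w - 1))
     else Gamma' \<nu> g u w p q r \<alpha> i)"

fun eta :: "int \<Rightarrow> int \<Rightarrow> int \<Rightarrow> int \<Rightarrow> int \<Rightarrow> nat \<Rightarrow> int" where
  "eta p q r \<alpha> w 0 =
    (if P2 w p q r \<or> P3 w p q r then 0
     else if \<alpha> = 0 \<and> q = 2 then 1
     else FF p q r \<alpha> w)"
| "eta p q r \<alpha> w (Suc ind) =
    (if P2 w p q r \<or> P3 w p q r then 0
     else if \<alpha> = 0 \<and> q = 2 then 1
     else (\<Sum>k\<in>{0..FF p q r \<alpha> w}.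
        (eta (T1 w p q r \<alpha> k) (T0 w p q r \<alpha> k) (T2 w p q r \<alpha> k)
             (T\<alpha> w p q r \<alpha> k) (T\<omega> w p q r \<alpha> k) ind + 1)
        * (eta (Z1 w p q r \<alpha> k) (Z0 w p q r \<alpha> k) (Z2 w p q r \<alpha> k)
             (Z\<alpha> w p q r \<alpha> k) (Z\<omega> w p q r \<alpha> k) ind + 1)) - 1)"

definition eta1 :: "int \<Rightarrow> int \<Rightarrow> int \<Rightarrow> int \<Rightarrow> int \<Rightarrow> int \<Rightarrow> nat \<Rightarrow> int" where
  "eta1 p q r \<alpha> w k ind =
    (if ind = 0 then
       FF (T1 w p q r \<alpha> k) (T0 w p q r \<alpha> k) (T2 w p q r \<alpha> k) (T\<alpha> w p q r \<alpha> k) (T\<omega> w p q r \<alpha> k)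
     else
       eta (T1 w p q r \<alpha> k) (T0 w p q r \<alpha> k) (T2 w p q r \<alpha> k) (T\<alpha> w p q r \<alpha> k) (T\<omega> w p q r \<alpha> k) ind)"

definition eta2 :: "int \<Rightarrow> int \<Rightarrow> int \<Rightarrow> int \<Rightarrow> int \<Rightarrow> int \<Rightarrow> nat \<Rightarrow> int" where
  "eta2 p q r \<alpha> w k ind =
    (if ind = 0 then
       FF (Z1 w p q r \<alpha> k) (Z0 w p q r \<alpha> k) (Z2 w p q r \<alpha> k) (Z\<alpha> w p q r \<alpha> k) (Z\<omega> w p q r \<alpha> k)
     else
       eta (Z1 w p q r \<alpha> k) (Z0 w p q r \<alpha> k) (Z2 w p q r \<alpha> k) (Z\<alpha> w p q r \<alpha> k) (Z\<omega> w p q r \<alpha> k) ind)"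

definition S_eta :: "int \<Rightarrow> int \<Rightarrow> int \<Rightarrow> int \<Rightarrow> int \<Rightarrow> int \<Rightarrow> nat \<Rightarrow> int" where
  "S_eta j p q r \<alpha> w ind =
    (\<Sum>k\<in>{0..j - 1}. (eta1 p q r \<alpha> w k ind + 1) * (eta2 p q r \<alpha> w k ind + 1))"

definition theta :: "int \<Rightarrow> int \<Rightarrow> int \<Rightarrow> int \<Rightarrow> int \<Rightarrow> int \<Rightarrow> int \<Rightarrow> int \<Rightarrow> int" where
  "theta i p q r \<alpha> w n ind =
    (if P2 w p q r \<or> P3 w p q r then 0
     else if ind = 0 then i
     else
       (let ind' = nat (ind - 1);
            j = (THE j. S_eta j p q r \<alpha> w ind' \<le> i \<and> i < S_eta (j + 1) p q r \<alpha> w ind');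
            a = S_eta j p q r \<alpha> w ind';
            b = eta2 p q r \<alpha> w j ind' + 1
        in if n = 0 then j else if n = 1 then (i - a) div b else (i - a) mod b))"


section \<open>The recursive functions\<close>

text \<open>
  An argument list \<open>\<psi> = (p, q, r, \<alpha>, \<omega>)\<close>. The five functions \<open>C\<^sub>x\<close> (likewise \<open>\<rho>\<^sub>x\<close> and \<open>\<aleph>\<^sub>x\<close>)
  are computed simultaneously, as the tuple \<open>(C\<^sub>1, C\<^sub>0, C\<^sub>2, C\<^sub>\<alpha>, C\<^sub>\<omega>)\<close>, whose slots correspond to
  those of \<open>\<psi>\<close>. \<open>pick b\<close> selects the family \<open>T\<^sub>x\<close> (if \<open>b = 1\<close>) or \<open>Z\<^sub>x\<close>.
\<close>

type_synonym state = "int \<times> int \<times> int \<times> int \<times> int"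

definition pick :: "int \<Rightarrow> state \<Rightarrow> int \<Rightarrow> state" where
  "pick b = (\<lambda>(p, q, r, \<alpha>, w) i.
    if b = 1 then (T1 w p q r \<alpha> i, T0 w p q r \<alpha> i, T2 w p q r \<alpha> i, T\<alpha> w p q r \<alpha> i, T\<omega> w p q r \<alpha> i)
    else (Z1 w p q r \<alpha> i, Z0 w p q r \<alpha> i, Z2 w p q r \<alpha> i, Z\<alpha> w p q r \<alpha> i, Z\<omega> w p q r \<alpha> i))"

definition theta_at :: "int \<Rightarrow> state \<Rightarrow> int \<Rightarrow> int \<Rightarrow> int" where
  "theta_at i = (\<lambda>(p, q, r, \<alpha>, w) n ind. theta i p q r \<alpha> w n ind)"

definition omega_of :: "state \<Rightarrow> int" where
  "omega_of = (\<lambda>(p, q, r, \<alpha>, w). w)"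

definition lam :: "nat \<Rightarrow> nat" where
  "lam m = nat \<lfloor>ln (real m + 1) / ln 2\<rfloor>"

lemma lam_0 [simp]: "lam 0 = 0"
  by (simp add: lam_def)

lemma C_argument_decreases:
  assumes "0 < lam m"
  shows "nat ((int m + 1 - 2 ^ (l + 1 + h)) div 2 ^ (l + 1 + h)) < m"
proof -
  have m: "m > 0" using assms by (cases m) auto
  define k :: int where "k = 2 ^ (l + 1 + h)"
  have k: "k \<ge> 2" by (simp add: k_def)
  have "(int m + 1 - k) div k = (int m + 1) div k - 1"
    using k div_mult_self1[of k "int m + 1" "- 1"] by simp
  also have "\<dots> < int m"
    using zdiv_mono2[of "int m + 1" 2 k] k m by linarith
  finally show ?thesis using m unfolding k_def by linarith
qed

text \<open>
  \<open>Theta\<close> is only meant for \<open>h \<le> lam m\<close>; the test \<open>h \<ge> lam m\<close> instead of \<open>h = lam m\<close> makes the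
  recursion total without affecting these arguments.
\<close>

function (sequential) C_st :: "nat \<Rightarrow> nat \<Rightarrow> nat \<Rightarrow> int \<Rightarrow> state \<Rightarrow> state"
  and Theta :: "nat \<Rightarrow> int \<Rightarrow> state \<Rightarrow> nat \<Rightarrow> int"
where
  "C_st m h l i \<psi> =
    (if int (lam m) - int h < 1 \<or> int l > int (lam m) - 1 - int h then \<psi>
     else pick (Ip ((int m + 1 - 2 ^ (l + h)) div 2 ^ (l + h)))
            (C_st m h (l + 1) i \<psi>)
            (Theta (nat ((int m + 1 - 2 ^ (l + 1 + h)) div 2 ^ (l + 1 + h))) i \<psi> 0))"
| "Theta m i \<psi> h =
    (if h \<ge> lam m then theta_at i \<psi> (Ip_b h m) (omega_of \<psi> - 1)
     else theta_at (Theta m i \<psi> (h + 1)) (C_st m h 0 i \<psi>) (Ip_b h m)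
            (omega_of \<psi> - 1 + int h - int (lam m)))"
  by pat_completeness auto
termination
proof (relation "measures
    [\<lambda>x. case x of Inl (m, h, l, i, \<psi>) \<Rightarrow> m | Inr (m, i, \<psi>, h) \<Rightarrow> m,
     \<lambda>x. case x of Inl (m, h, l, i, \<psi>) \<Rightarrow> lam m - h | Inr (m, i, \<psi>, h) \<Rightarrow> lam m - h,
     \<lambda>x. case x of Inl (m, h, l, i, \<psi>) \<Rightarrow> 0 | Inr (m, i, \<psi>, h) \<Rightarrow> 1,
     \<lambda>x. case x of Inl (m, h, l, i, \<psi>) \<Rightarrow> lam m - l | Inr (m, i, \<psi>, h) \<Rightarrow> 0]", goal_cases)
  case (3 m h l i \<psi>)
  then have "0 < lam m" by linarith
  then show ?case using C_argument_decreases[of m l h] by simp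
qed auto

function rho_st :: "int \<Rightarrow> nat \<Rightarrow> nat \<Rightarrow> nat \<Rightarrow> state \<Rightarrow> state" where
  "rho_st i l k j \<psi> =
    (if j < 2 then \<psi>
     else pick (Ip ((int k - 1 + 2 ^ (j - 1)) div 2 ^ (l - 1) - 1))
            (if l < j - 1 then rho_st i (l + 1) k j \<psi> else \<psi>)
            (Theta (nat ((int k - 1 + 2 ^ (j - 1) - 2 ^ l) div 2 ^ l)) i \<psi> 0))"
  by pat_completeness auto
termination by (relation "Wellfounded.measure (\<lambda>(i, l, k, j, \<psi>). j - l)") auto

function aleph_st :: "int \<Rightarrow> nat \<Rightarrow> nat \<Rightarrow> state \<Rightarrow> state" where
  "aleph_st i l k \<psi> =
    pick (Ip ((int k - 1) div 2 ^ (l - 1) + 1))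
      (if int l < omega_of \<psi> then aleph_st i (l + 1) k \<psi> else \<psi>)
      (Theta (nat ((int k - 1) div 2 ^ l - 1 + 2 ^ nat (omega_of \<psi> - int l))) i \<psi> 0)"
  by pat_completeness auto
termination by (relation "Wellfounded.measure (\<lambda>(i, l, k, \<psi>). nat (omega_of \<psi>) - l)") auto

declare C_st.simps [simp del] Theta.simps [simp del] rho_st.simps [simp del] aleph_st.simps [simp del]


section \<open>The coefficient formulas\<close>

definition Gamma_at ::
  "real \<Rightarrow> (int \<Rightarrow> coeffs) \<Rightarrow> (int \<Rightarrow> coeffs) \<Rightarrow> state \<Rightarrow> int \<Rightarrow> real" where
  "Gamma_at \<nu> g u = (\<lambda>(p, q, r, \<alpha>, w) i. Gamma_cf \<nu> g u w p q r \<alpha> i)"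

definition ucf_at :: "(int \<Rightarrow> coeffs) \<Rightarrow> state \<Rightarrow> real" where
  "ucf_at u = (\<lambda>(p, q, r, \<alpha>, w). ucf u \<alpha> w p q r)"

definition velocity_formula :: "real \<Rightarrow> (int \<Rightarrow> coeffs) \<Rightarrow> (int \<Rightarrow> coeffs) \<Rightarrow> bool" where
  "velocity_formula \<nu> g u \<longleftrightarrow>
    (\<forall>\<alpha>\<in>{0, 1, 2}. \<forall>w\<ge>1. \<forall>p\<ge>0. \<forall>q\<ge>0. \<forall>r\<ge>0.
      let \<psi> = (p, q, r, \<alpha>, w) in
      ucf u \<alpha> w p q r =
        (\<Sum>i\<in>{0..eta p q r \<alpha> w (nat (w - 1))}.
           (\<Prod>j\<in>{1..nat w}. \<Prod>k\<in>{1..2 ^ (j - 1)}.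
              Gamma_at \<nu> g u (rho_st i 1 k j \<psi>) (Theta (nat (int k - 2 + 2 ^ (j - 1))) i \<psi> 0))
           * (\<Prod>k\<in>{1..2 ^ nat w}. ucf_at u (aleph_st i 1 k \<psi>))))"

definition pressure_formula ::
  "real \<Rightarrow> real \<Rightarrow> (int \<Rightarrow> coeffs) \<Rightarrow> (int \<Rightarrow> coeffs) \<Rightarrow> coeffs \<Rightarrow> bool" where
  "pressure_formula \<rho> \<nu> g u P \<longleftrightarrow>
    (\<forall>w\<ge>0. \<forall>p\<ge>0. \<forall>q\<ge>-1. \<forall>r\<ge>-1.
      - (1 / \<rho>) * cf P w (p + 1) (q + 1) (r + 1) =
      1 / of_int (p + 1) *
       (of_int (w + 1) * ucf u 1 (w + 1) p (q + 1) (r + 1)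
        + (\<Sum>k\<in>{0..w}. \<Sum>i\<in>{0..p}. \<Sum>j\<in>{0..q + 1}. \<Sum>l\<in>{0..r + 1}.
             of_int (i + 1) * ucf u 1 (w - k) (p - i) (q + 1 - j) (r + 1 - l) * ucf u 1 k (i + 1) j l
           + of_int (j + 1) * ucf u 0 (w - k) (p - i) (q + 1 - j) (r + 1 - l) * ucf u 1 k i (j + 1) l
           + of_int (l + 1) * ucf u 2 (w - k) (p - i) (q + 1 - j) (r + 1 - l) * ucf u 1 k i j (l + 1))
        - \<nu> * (of_int ((p + 1) * (p + 2)) * ucf u 1 w (p + 2) (q + 1) (r + 1)
              + of_int ((q + 2) * (q + 3)) * ucf u 1 w p (q + 3) (r + 1)
              + of_int ((r + 2) * (r + 3)) * ucf u 1 w p (q + 1) (r + 3))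
        - cf (g 1) w p (q + 1) (r + 1)))"

end

theory Submission
  imports Defs
begin

text \<open>
  A convergent power series is determined by its Taylor coefficients near \<open>0\<close>, so the Navier--Stokes
  equations become identities between coefficients.  Scaling the coefficients by factorials turns
  derivatives into index shifts.  Taking the divergence of the momentum equation gives a Poisson
  equation for the pressure; using it to lower the index \<open>q\<close> by two at a time until it is \<open>0\<close> or \<open>1\<close>
  eliminates the pressure and expresses \<open>u\<^sup>\<alpha>\<^sub>\<omega>\<close> by prescribed coefficients, by viscous terms at level
  \<open>\<omega> - 1\<close> and by products of two coefficients of levels that add up to \<open>\<omega> - 1\<close>.  This is a recursion
  \<open>u(s) = \<Sum>c. \<Gamma>(s, c) u(T(s, c)) u(Z(s, c))\<close>; the case \<open>\<alpha> = 0\<close> reduces to \<open>\<alpha> = 1, 2\<close> by incompressibility.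
  Expanding it \<open>\<omega>\<close> times gives a sum over complete binary trees of height \<open>\<omega>\<close>, whose choices of \<open>c\<close> at
  all nodes are coded in one integer \<open>i\<close> by prefix sums of subtree counts, and whose leaves carry
  prescribed coefficients.  Hence the formulas determine all coefficients from the prescribed ones.
\<close>

section \<open>Power series in four variables\<close>

text \<open>Linear terms fit a recursion of products because a coefficient with a negative index is
  1: a viscous term has such a second factor, and the term made of the body force and prescribed
  coefficients has two. In the same way a prescribed coefficient is reproduced as itself times 1,
  which pads every expansion to a complete tree. The viscous force is divergence free, and this is
  why eliminating the pressure leaves just eight kinds of viscous terms. The obstacle is that
  branches are selected by closed formulas with floors, square roots and step functions. They are
  treated as numberings: each is shown to turn a sum over codes into a sum over tuples, and even the
  ranges of the formulas are read off from such sum identities, applied to indicator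
  functions.\<close>

lemma powser_eq_0_imp_coeff_0:
  fixes c :: "nat \<Rightarrow> real"
  assumes "R > 0" and "\<And>s. \<bar>s\<bar> < R \<Longrightarrow> (\<lambda>n. c n * s ^ n) sums 0"
  shows "c n = 0"
  using assms(2)
proof (induction n arbitrary: c)
  case 0
  show ?case using 0[of 0] \<open>R > 0\<close> by (simp add: powser_sums_zero_iff)
next
  case (Suc n)
  \<comment> \<open>Differentiation moves coefficient n + 1 to place n, up to the factor n + 1, and
    keeps the sum 0 on the interval, so the induction hypothesis applies to
    \<open>diffs c\<close>.\<close>
  have "(\<lambda>n. diffs c n * s ^ n) sums 0" if s: "\<bar>s\<bar> < R" for s
  proof (rule termdiffs_sums_strong[where K = R])
    show "(\<lambda>n. c n * z ^ n) sums (\<lambda>_. 0) z" if "norm z < R" for z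
      using Suc.prems that by simp
  qed (use s in auto)
  then have "diffs c n = 0" by (rule Suc.IH)
  then show ?case by (simp add: diffs_def)
qed

lemma summable_on_abs_le:
  fixes f g :: "'a \<Rightarrow> real"
  assumes "g summable_on A" "\<And>x. x \<in> A \<Longrightarrow> \<bar>f x\<bar> \<le> \<bar>g x\<bar>"
  shows "f summable_on A"
proof -
  have "(\<lambda>x. norm (g x)) summable_on A"
    by (rule summable_on_iff_abs_summable_on_real[THEN iffD1, OF assms(1)])
  then have "(\<lambda>x. norm (f x)) summable_on A"
    by (rule Infinite_Sum.abs_summable_on_comparison_test) (simp add: assms(2))
  then show ?thesis by (rule summable_on_iff_abs_summable_on_real[THEN iffD2])
qed

lemma infsum_eq_suminf:
  fixes f :: "nat \<Rightarrow> real"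
  assumes "f summable_on UNIV"
  shows "f sums infsum f UNIV" "suminf f = infsum f UNIV"
proof -
  show "f sums infsum f UNIV" by (rule has_sum_imp_sums[OF has_sum_infsum[OF assms]])
  then show "suminf f = infsum f UNIV" by (rule sums_unique[symmetric])
qed

text \<open>Summing out \<open>i\<close> first leaves an ordinary power series in \<open>s\<close>,
  to which one-variable theorems apply.\<close>

lemma infsum_powser_sums:
  fixes c :: "nat \<Rightarrow> 'i \<Rightarrow> real"
  assumes "(\<lambda>(n, i). c n i * s ^ n) summable_on UNIV"
  shows "(\<lambda>n. (\<Sum>\<^sub>\<infinity>i. c n i) * s ^ n) sums (\<Sum>\<^sub>\<infinity>(n, i). c n i * s ^ n)"
proof -
  have *: "(\<lambda>(n, i). c n i * s ^ n) summable_on UNIV \<times> UNIV" using assms by simp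
  have "(\<lambda>n. \<Sum>\<^sub>\<infinity>i. c n i * s ^ n) sums (\<Sum>\<^sub>\<infinity>n. \<Sum>\<^sub>\<infinity>i. c n i * s ^ n)"
    by (rule infsum_eq_suminf(1)) (rule summable_on_Sigma_banach[OF *])
  moreover have "(\<Sum>\<^sub>\<infinity>n. \<Sum>\<^sub>\<infinity>i. c n i * s ^ n) = (\<Sum>\<^sub>\<infinity>(n, i). c n i * s ^ n)"
    using infsum_Sigma'_banach[OF *] by simp
  ultimately show ?thesis by (simp only: infsum_cmult_left')
qed

lemma infsum_powser_eq_0:
  fixes c :: "nat \<Rightarrow> 'i \<Rightarrow> real"
  assumes "R > 0"
    and "\<And>s. \<bar>s\<bar> < R \<Longrightarrow> (\<lambda>(n, i). c n i * s ^ n) summable_on UNIV"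
    and "\<And>s. \<bar>s\<bar> < R \<Longrightarrow> (\<Sum>\<^sub>\<infinity>(n, i). c n i * s ^ n) = 0"
  shows "(\<Sum>\<^sub>\<infinity>i. c n i) = 0"
  using assms(1)
proof (rule powser_eq_0_imp_coeff_0)
  show "(\<lambda>n. (\<Sum>\<^sub>\<infinity>i. c n i) * s ^ n) sums 0" if "\<bar>s\<bar> < R" for s
    using infsum_powser_sums[OF assms(2)[OF that]] assms(3)[OF that] by simp
qed

text \<open>The sequence n (s/K)^n tends to 0, hence is bounded. The bound lets the convergent
  family at \<open>K\<close> dominate the differentiated one at \<open>s\<close>.\<close>

lemma Suc_mult_power_bounded:
  fixes s K :: real
  assumes "0 \<le> s" "s < K"
  obtains B where "\<And>n. real (n + 1) * s ^ n \<le> B * K ^ (n + 1)"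
proof -
  have "K > 0" using assms by simp
  have "norm (s / K) < 1" using assms by simp
  then have "(\<lambda>n. real n * (s / K) ^ n) \<longlonglongrightarrow> 0" "(\<lambda>n. (s / K) ^ n) \<longlonglongrightarrow> 0"
    using powser_times_n_limit_0[of "s / K"] LIMSEQ_power_zero[of "s / K"] by auto
  then have "(\<lambda>n. real n * (s / K) ^ n + (s / K) ^ n) \<longlonglongrightarrow> 0 + 0" by (rule tendsto_add)
  then have "Bseq (\<lambda>n. real n * (s / K) ^ n + (s / K) ^ n)"
    by (intro convergent_imp_Bseq convergentI)
  then obtain B where B: "\<And>n. \<bar>real n * (s / K) ^ n + (s / K) ^ n\<bar> \<le> B"
    by (auto simp: Bseq_def)
  have "real (n + 1) * s ^ n \<le> B / K * K ^ (n + 1)" for n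
  proof -
    have "real (n + 1) * (s / K) ^ n \<le> B"
      using order_trans[OF abs_ge_self B[of n]] by (simp add: distrib_right)
    then have "real (n + 1) * (s / K) ^ n * K ^ n \<le> B * K ^ n"
      using \<open>K > 0\<close> by (intro mult_right_mono) auto
    then show ?thesis using \<open>K > 0\<close> by (simp add: power_divide)
  qed
  then show ?thesis by (rule that)
qed

lemma eventually_abs_less:
  fixes s :: real
  assumes "\<bar>s\<bar> < R"
  shows "eventually (\<lambda>z. \<bar>z\<bar> < R) (nhds s)"
proof -
  have "eventually (\<lambda>z. z \<in> {-R<..<R}) (nhds s)"
    by (rule eventually_nhds_in_open) (use assms in auto)
  then show ?thesis by (rule eventually_mono) auto
qed

lemma infsum_powser_derivative:
  fixes c :: "nat \<Rightarrow> 'i \<Rightarrow> real"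
  assumes K: "(\<lambda>(n, i). c n i * K ^ n) summable_on UNIV" and s: "\<bar>s\<bar> < K"
  shows "(\<lambda>(n, i). of_nat (n + 1) * c (n + 1) i * s ^ n) summable_on UNIV" (is ?S)
    and "((\<lambda>s. \<Sum>\<^sub>\<infinity>(n, i). c n i * s ^ n) has_real_derivative
           (\<Sum>\<^sub>\<infinity>(n, i). of_nat (n + 1) * c (n + 1) i * s ^ n)) (at s)" (is ?D)
proof -
  have "K > 0" using s by simp
  have conv: "(\<lambda>(n, i). c n i * z ^ n) summable_on UNIV" if "\<bar>z\<bar> \<le> K" for z
    using K by (rule summable_on_abs_le)
      (use that \<open>K > 0\<close> in \<open>auto simp: abs_mult power_abs intro!: mult_left_mono power_mono\<close>)
  obtain B where B: "\<And>n. real (n + 1) * \<bar>s\<bar> ^ n \<le> B * K ^ (n + 1)"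
    by (rule Suc_mult_power_bounded[of "\<bar>s\<bar>" K]) (use s in auto)
  \<comment> \<open>Dropping the terms with n = 0 aligns the family at \<open>K\<close> with the
    derivative, whose coefficients are indexed from n + 1.\<close>
  have "(\<lambda>(n, i). c n i * K ^ n) \<circ> (\<lambda>(n, i). (n + 1, i)) summable_on UNIV"
    by (subst summable_on_reindex[symmetric])
      (auto simp: inj_on_def intro: summable_on_subset_banach[OF K])
  then have "(\<lambda>x. B * (case x of (n, i) \<Rightarrow> c (n + 1) i * K ^ (n + 1))) summable_on UNIV"
    by (intro summable_on_cmult_right) (simp add: o_def case_prod_unfold)
  then show S: ?S
  proof (rule summable_on_abs_le, clarify)
    fix n i
    have "\<bar>real (n + 1) * c (n + 1) i * s ^ n\<bar> = (real (n + 1) * \<bar>s\<bar> ^ n) * \<bar>c (n + 1) i\<bar>"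
      by (simp add: abs_mult power_abs)
    also have "\<dots> \<le> B * K ^ (n + 1) * \<bar>c (n + 1) i\<bar>"
      by (intro mult_right_mono B) auto
    also have "\<dots> \<le> \<bar>B * K ^ (n + 1)\<bar> * \<bar>c (n + 1) i\<bar>"
      by (intro mult_right_mono abs_ge_self) auto
    also have "\<dots> = \<bar>B * (c (n + 1) i * K ^ (n + 1))\<bar>"
      by (simp add: abs_mult mult_ac)
    finally show "\<bar>real (n + 1) * c (n + 1) i * s ^ n\<bar> \<le> \<bar>B * (c (n + 1) i * K ^ (n + 1))\<bar>" .
  qed
  have eq: "(\<Sum>\<^sub>\<infinity>(n, i). c n i * z ^ n) = (\<Sum>n. (\<Sum>\<^sub>\<infinity>i. c n i) * z ^ n)" if "\<bar>z\<bar> < K" for z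
    using infsum_powser_sums[OF conv[of z]] that by (simp add: sums_iff)
  have D1: "((\<lambda>z. \<Sum>n. (\<Sum>\<^sub>\<infinity>i. c n i) * z ^ n) has_real_derivative
          (\<Sum>n. diffs (\<lambda>n. \<Sum>\<^sub>\<infinity>i. c n i) n * s ^ n)) (at s)"
  proof (rule termdiffs_strong'[where K = K])
    show "summable (\<lambda>n. (\<Sum>\<^sub>\<infinity>i. c n i) * z ^ n)" if "norm z < K" for z
      using sums_summable[OF infsum_powser_sums[OF conv[of z]]] that by simp
  qed (use s in simp)
  have D2: "(\<Sum>n. diffs (\<lambda>n. \<Sum>\<^sub>\<infinity>i. c n i) n * s ^ n)
      = (\<Sum>\<^sub>\<infinity>(n, i). of_nat (n + 1) * c (n + 1) i * s ^ n)"
    unfolding diffs_def infsum_cmult_right'[symmetric] Suc_eq_plus1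
    by (rule sums_unique[symmetric], rule infsum_powser_sums[OF S])
  have D: "((\<lambda>z. \<Sum>n. (\<Sum>\<^sub>\<infinity>i. c n i) * z ^ n) has_real_derivative
      (\<Sum>\<^sub>\<infinity>(n, i). of_nat (n + 1) * c (n + 1) i * s ^ n)) (at s)"
    using D1 unfolding D2 .
  have ev: "eventually (\<lambda>z. (\<Sum>\<^sub>\<infinity>(n, i). c n i * z ^ n) = (\<Sum>n. (\<Sum>\<^sub>\<infinity>i. c n i) * z ^ n)) (nhds s)"
    using eventually_abs_less[OF s] by (rule eventually_mono) (rule eq)
  show ?D by (rule DERIV_cong_ev[THEN iffD2, OF refl ev refl D])
qed

section \<open>Absolute convergence on cubes around the origin, and vanishing series\<close>

definition term4 :: "coeffs \<Rightarrow> real \<Rightarrow> real \<Rightarrow> real \<Rightarrow> real \<Rightarrow> nat \<times> nat \<times> nat \<times> nat \<Rightarrow> real" where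
  "term4 a t x y z = (\<lambda>(w, p, q, r). a w p q r * t ^ w * x ^ p * y ^ q * z ^ r)"

text \<open>Absolute convergence at the corner of a cube dominates the series on the whole closed
  cube, so a single number can stand for a domain of convergence.\<close>

definition conv_at :: "coeffs \<Rightarrow> real \<Rightarrow> bool" where
  "conv_at a R \<longleftrightarrow> R > 0 \<and> term4 a R R R R summable_on UNIV"

lemma term4_summable_mono:
  assumes "term4 a t x y z summable_on UNIV"
    and "\<bar>t'\<bar> \<le> \<bar>t\<bar>" "\<bar>x'\<bar> \<le> \<bar>x\<bar>" "\<bar>y'\<bar> \<le> \<bar>y\<bar>" "\<bar>z'\<bar> \<le> \<bar>z\<bar>"
  shows "term4 a t' x' y' z' summable_on UNIV"
  using assms(1)
proof (rule summable_on_abs_le, clarify)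
  fix w p q r :: nat
  have "\<bar>t'\<bar> ^ w \<le> \<bar>t\<bar> ^ w" "\<bar>x'\<bar> ^ p \<le> \<bar>x\<bar> ^ p" "\<bar>y'\<bar> ^ q \<le> \<bar>y\<bar> ^ q" "\<bar>z'\<bar> ^ r \<le> \<bar>z\<bar> ^ r"
    using assms(2-) by (simp_all add: power_mono)
  then have "\<bar>a w p q r\<bar> * \<bar>t'\<bar> ^ w * \<bar>x'\<bar> ^ p * \<bar>y'\<bar> ^ q * \<bar>z'\<bar> ^ r
      \<le> \<bar>a w p q r\<bar> * \<bar>t\<bar> ^ w * \<bar>x\<bar> ^ p * \<bar>y\<bar> ^ q * \<bar>z\<bar> ^ r"
    by (meson abs_ge_zero mult_mono mult_nonneg_nonneg order_refl zero_le_power)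
  then show "\<bar>term4 a t' x' y' z' (w, p, q, r)\<bar> \<le> \<bar>term4 a t x y z (w, p, q, r)\<bar>"
    by (simp add: term4_def abs_mult power_abs)
qed

lemma conv_at_summable:
  assumes "conv_at a R" "\<bar>t\<bar> \<le> R" "\<bar>x\<bar> \<le> R" "\<bar>y\<bar> \<le> R" "\<bar>z\<bar> \<le> R"
  shows "term4 a t x y z summable_on UNIV"
  by (rule term4_summable_mono[of a R R R R]) (use assms in \<open>auto simp: conv_at_def\<close>)

lemma conv_at_mono:
  assumes "conv_at a R" "0 < R'" "R' \<le> R"
  shows "conv_at a R'"
  using assms conv_at_summable[of a R R' R' R' R'] by (auto simp: conv_at_def)

lemma suminf_infsum_pair:
  fixes F :: "nat \<times> 'i \<Rightarrow> real"
  assumes "F summable_on UNIV"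
  shows "(\<Sum>n. \<Sum>\<^sub>\<infinity>i. F (n, i)) = infsum F UNIV" and "(\<lambda>i. F (n, i)) summable_on UNIV"
proof -
  have F: "F summable_on (UNIV \<times> UNIV)" using assms by simp
  have F': "(\<lambda>(n, i). F (n, i)) summable_on (UNIV \<times> UNIV)" using assms by simp
  show "(\<lambda>i. F (n, i)) summable_on UNIV"
    by (rule summable_on_SigmaD1[OF F']) simp
  have "(\<Sum>n. \<Sum>\<^sub>\<infinity>i. F (n, i)) = (\<Sum>\<^sub>\<infinity>n. \<Sum>\<^sub>\<infinity>i. F (n, i))"
    by (rule infsum_eq_suminf(2), rule summable_on_Sigma_banach[OF F'])
  also have "\<dots> = infsum F (UNIV \<times> UNIV)" by (rule infsum_Sigma_banach[OF F])
  finally show "(\<Sum>n. \<Sum>\<^sub>\<infinity>i. F (n, i)) = infsum F UNIV" by simp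
qed

lemma pseries_eq_infsum:
  assumes "term4 a t x y z summable_on UNIV"
  shows "pseries a t x y z = infsum (term4 a t x y z) UNIV"
proof -
  define F where "F = term4 a t x y z"
  have 1: "F summable_on UNIV" using assms by (simp add: F_def)
  have 2: "(\<lambda>v. F (w, v)) summable_on UNIV" for w by (rule suminf_infsum_pair(2)[OF 1])
  have 3: "(\<lambda>v. F (w, p, v)) summable_on UNIV" for w p
    by (rule suminf_infsum_pair(2)[OF 2])
  have 4: "(\<lambda>r. F (w, p, q, r)) summable_on UNIV" for w p q
    by (rule suminf_infsum_pair(2)[OF 3])
  have "pseries a t x y z = (\<Sum>w. \<Sum>p. \<Sum>q. \<Sum>r. F (w, p, q, r))"
    by (simp only: pseries_def F_def term4_def prod.case)
  also have "\<dots> = infsum F UNIV"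
    by (simp only: infsum_eq_suminf(2)[OF 4] suminf_infsum_pair(1)[OF 3]
        suminf_infsum_pair(1)[OF 2] suminf_infsum_pair(1)[OF 1])
  finally show ?thesis by (simp only: F_def)
qed

lemma infsum_powser_slice:
  fixes c :: "nat \<Rightarrow> 'i \<Rightarrow> real"
  assumes "R > 0" and "\<And>s. \<bar>s\<bar> < R \<Longrightarrow> (\<lambda>(n, i). c n i * s ^ n) summable_on UNIV"
  shows "c n summable_on UNIV"
proof -
  \<comment> \<open>\<open>R / 2\<close> is just a nonzero point of the interval; the factor
    \<open>(R / 2) ^ n\<close> is divided out below.\<close>
  have "(\<lambda>(n, i). c n i * (R / 2) ^ n) summable_on UNIV \<times> UNIV"
    using assms(2)[of "R / 2"] \<open>R > 0\<close> by simp
  then have "(\<lambda>i. c n i * (R / 2) ^ n) summable_on UNIV"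
    by (rule summable_on_SigmaD1) simp
  moreover have "(R / 2) ^ n \<noteq> 0" using \<open>R > 0\<close> by simp
  ultimately show ?thesis using summable_on_cmult_left'[of "(R / 2) ^ n" "c n" UNIV] by blast
qed

text \<open>The variables are removed one at a time in the order t, x, y, z: a series in one
  variable that vanishes near 0 has vanishing coefficients, and these are series in the remaining
  variables.\<close>

lemma coeffs_eq_0:
  assumes R: "R > 0"
    and sm: "\<And>t x y z. \<lbrakk>\<bar>t\<bar> < R; \<bar>x\<bar> < R; \<bar>y\<bar> < R; \<bar>z\<bar> < R\<rbrakk> \<Longrightarrow> term4 a t x y z summable_on UNIV"
    and zero: "\<And>t x y z. \<lbrakk>\<bar>t\<bar> < R; \<bar>x\<bar> < R; \<bar>y\<bar> < R; \<bar>z\<bar> < R\<rbrakk> \<Longrightarrow> pseries a t x y z = 0"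
  shows "a w p q r = 0"
proof -
  define c1 where "c1 x y z w = (\<lambda>(p, q, r). a w p q r * x ^ p * y ^ q * z ^ r)" for x y z w
  define c2 where "c2 w y z p = (\<lambda>(q, r). a w p q r * y ^ q * z ^ r)" for w y z p
  define c3 where "c3 w p z q = (\<lambda>r. a w p q r * z ^ r)" for w p z q
  have e1: "term4 a t x y z = (\<lambda>(w, v). c1 x y z w v * t ^ w)" for t x y z
    by (auto simp: term4_def c1_def)
  have e2: "c1 x y z w = (\<lambda>(p, v). c2 w y z p v * x ^ p)" for x y z w
    by (auto simp: c1_def c2_def)
  have e3: "c2 w y z p = (\<lambda>(q, v). c3 w p z q v * y ^ q)" for w y z p
    by (auto simp: c2_def c3_def)
  have sm1: "c1 x y z w summable_on UNIV" if "\<bar>x\<bar> < R" "\<bar>y\<bar> < R" "\<bar>z\<bar> < R" for x y z w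
    by (rule infsum_powser_slice[OF R]) (use sm[OF _ that] e1 in metis)
  have sm2: "c2 w y z p summable_on UNIV" if "\<bar>y\<bar> < R" "\<bar>z\<bar> < R" for w p y z
    by (rule infsum_powser_slice[OF R]) (use sm1[OF _ that] e2 in metis)
  have sm3: "c3 w p z q summable_on UNIV" if "\<bar>z\<bar> < R" for w p q z
    by (rule infsum_powser_slice[OF R]) (use sm2[OF _ that] e3 in metis)
  have z1: "infsum (c1 x y z w) UNIV = 0" if "\<bar>x\<bar> < R" "\<bar>y\<bar> < R" "\<bar>z\<bar> < R" for x y z w
  proof (rule infsum_powser_eq_0[OF R])
    fix t :: real assume t: "\<bar>t\<bar> < R"
    show "(\<lambda>(w, v). c1 x y z w v * t ^ w) summable_on UNIV" using sm[OF t that] unfolding e1 .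
    show "(\<Sum>\<^sub>\<infinity>(w, v). c1 x y z w v * t ^ w) = 0"
      using zero[OF t that] pseries_eq_infsum[OF sm[OF t that]] unfolding e1 by simp
  qed
  have z2: "infsum (c2 w y z p) UNIV = 0" if "\<bar>y\<bar> < R" "\<bar>z\<bar> < R" for w p y z
  proof (rule infsum_powser_eq_0[OF R])
    fix x :: real assume x: "\<bar>x\<bar> < R"
    show "(\<lambda>(p, v). c2 w y z p v * x ^ p) summable_on UNIV" using sm1[OF x that] unfolding e2 .
    show "(\<Sum>\<^sub>\<infinity>(p, v). c2 w y z p v * x ^ p) = 0" using z1[OF x that] unfolding e2 .
  qed
  have z3: "infsum (c3 w p z q) UNIV = 0" if "\<bar>z\<bar> < R" for w p q z
  proof (rule infsum_powser_eq_0[OF R])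
    fix y :: real assume y: "\<bar>y\<bar> < R"
    show "(\<lambda>(q, v). c3 w p z q v * y ^ q) summable_on UNIV" using sm2[OF y that] unfolding e3 .
    show "(\<Sum>\<^sub>\<infinity>(q, v). c3 w p z q v * y ^ q) = 0" using z2[OF y that] unfolding e3 .
  qed
  show ?thesis using R
  proof (rule powser_eq_0_imp_coeff_0)
    show "(\<lambda>r. a w p q r * z ^ r) sums 0" if "\<bar>z\<bar> < R" for z
      using infsum_eq_suminf(1)[OF sm3[OF that, of w p q]] z3[OF that, of w p q]
      by (simp add: c3_def)
  qed
qed

section \<open>Termwise partial derivatives\<close>

definition dt4 :: "coeffs \<Rightarrow> coeffs" where
  "dt4 a = (\<lambda>w p q r. real (w + 1) * a (w + 1) p q r)"

definition dsp4 :: "int \<Rightarrow> coeffs \<Rightarrow> coeffs" where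
  "dsp4 \<alpha> a = (\<lambda>w p q r. if \<alpha> = 1 then real (p + 1) * a w (p + 1) q r
     else if \<alpha> = 0 then real (q + 1) * a w p (q + 1) r
     else real (r + 1) * a w p q (r + 1))"

text \<open>The bijection \<open>h\<close> brings the differentiated index to the front, so that
  \<open>infsum_powser_derivative\<close> serves all four variables.\<close>

lemma reindexed_derivative:
  fixes h :: "nat \<times> nat \<times> nat \<times> nat \<Rightarrow> nat \<times> nat \<times> nat \<times> nat"
  assumes h: "bij h"
    and a: "\<And>s. (\<lambda>v. F s (h v)) = (\<lambda>(n, i). c n i * s ^ n)"
    and b: "\<And>s. (\<lambda>v. G s (h v)) = (\<lambda>(n, i). of_nat (n + 1) * c (n + 1) i * s ^ n)"
    and K: "F K summable_on UNIV" and s: "\<bar>s\<bar> < K"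
  shows "G s summable_on UNIV"
    and "((\<lambda>s. infsum (F s) UNIV) has_real_derivative infsum (G s) UNIV) (at s)"
proof -
  have sF: "(\<lambda>v. F s (h v)) summable_on UNIV \<longleftrightarrow> F s summable_on UNIV" for s
    by (rule summable_on_reindex_bij_betw) (use h in simp)
  have sG: "(\<lambda>v. G s (h v)) summable_on UNIV \<longleftrightarrow> G s summable_on UNIV" for s
    by (rule summable_on_reindex_bij_betw) (use h in simp)
  have iF: "(\<Sum>\<^sub>\<infinity>v. F s (h v)) = infsum (F s) UNIV" for s
    by (rule infsum_reindex_bij_betw) (use h in simp)
  have iG: "(\<Sum>\<^sub>\<infinity>v. G s (h v)) = infsum (G s) UNIV" for s
    by (rule infsum_reindex_bij_betw) (use h in simp)
  have K': "(\<lambda>(n, i). c n i * K ^ n) summable_on UNIV" using K sF a by metis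
  show "G s summable_on UNIV"
    using infsum_powser_derivative(1)[OF K' s] sG[of s] b[of s] by simp
  show "((\<lambda>s. infsum (F s) UNIV) has_real_derivative infsum (G s) UNIV) (at s)"
    using infsum_powser_derivative(2)[OF K' s] iF iG[of s] a b[of s] by simp
qed

lemma term4_derivative_t:
  assumes "term4 a K x y z summable_on UNIV" "\<bar>t\<bar> < K"
  shows "term4 (dt4 a) t x y z summable_on UNIV"
    and "((\<lambda>t. infsum (term4 a t x y z) UNIV) has_real_derivative
           infsum (term4 (dt4 a) t x y z) UNIV) (at t)"
proof -
  note * = reindexed_derivative[where h = id and F = "\<lambda>t. term4 a t x y z"
      and c = "\<lambda>w (p, q, r). a w p q r * x ^ p * y ^ q * z ^ r", OF bij_id _ _ assms]
  have e: "(\<lambda>v. term4 a s x y z (id v)) = (\<lambda>(n, i). (case i of (p, q, r) \<Rightarrow> a n p q r * x ^ p * y ^ q * z ^ r) * s ^ n)"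
    "(\<lambda>v. term4 (dt4 a) s x y z (id v)) = (\<lambda>(n, i). of_nat (n + 1) * (case i of (p, q, r) \<Rightarrow> a (n + 1) p q r * x ^ p * y ^ q * z ^ r) * s ^ n)" for s
    by (auto simp: term4_def dt4_def fun_eq_iff)
  show "term4 (dt4 a) t x y z summable_on UNIV" by (rule *(1)[OF e])
  show "((\<lambda>t. infsum (term4 a t x y z) UNIV) has_real_derivative
           infsum (term4 (dt4 a) t x y z) UNIV) (at t)" by (rule *(2)[OF e])
qed

lemma term4_derivative_x:
  assumes "term4 a t K y z summable_on UNIV" "\<bar>x\<bar> < K"
  shows "term4 (dsp4 1 a) t x y z summable_on UNIV"
    and "((\<lambda>x. infsum (term4 a t x y z) UNIV) has_real_derivative
           infsum (term4 (dsp4 1 a) t x y z) UNIV) (at x)"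
proof -
  define h :: "nat \<times> nat \<times> nat \<times> nat \<Rightarrow> nat \<times> nat \<times> nat \<times> nat"
    where "h = (\<lambda>(p, w, q, r). (w, p, q, r))"
  have h: "bij h" by (rule bijI') (auto simp: h_def)
  note * = reindexed_derivative[where h = h and F = "\<lambda>x. term4 a t x y z"
      and c = "\<lambda>p (w, q, r). a w p q r * t ^ w * y ^ q * z ^ r", OF h _ _ assms]
  have e: "(\<lambda>v. term4 a t s y z (h v)) = (\<lambda>(n, i). (case i of (w, q, r) \<Rightarrow> a w n q r * t ^ w * y ^ q * z ^ r) * s ^ n)"
    "(\<lambda>v. term4 (dsp4 1 a) t s y z (h v)) = (\<lambda>(n, i). of_nat (n + 1) * (case i of (w, q, r) \<Rightarrow> a w (n + 1) q r * t ^ w * y ^ q * z ^ r) * s ^ n)" for s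
    by (auto simp: term4_def dsp4_def fun_eq_iff h_def)
  show "term4 (dsp4 1 a) t x y z summable_on UNIV" by (rule *(1)[OF e])
  show "((\<lambda>x. infsum (term4 a t x y z) UNIV) has_real_derivative
           infsum (term4 (dsp4 1 a) t x y z) UNIV) (at x)" by (rule *(2)[OF e])
qed

lemma term4_derivative_y:
  assumes "term4 a t x K z summable_on UNIV" "\<bar>y\<bar> < K"
  shows "term4 (dsp4 0 a) t x y z summable_on UNIV"
    and "((\<lambda>y. infsum (term4 a t x y z) UNIV) has_real_derivative
           infsum (term4 (dsp4 0 a) t x y z) UNIV) (at y)"
proof -
  define h :: "nat \<times> nat \<times> nat \<times> nat \<Rightarrow> nat \<times> nat \<times> nat \<times> nat"
    where "h = (\<lambda>(q, w, p, r). (w, p, q, r))"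
  have h: "bij h" by (rule bijI') (auto simp: h_def)
  note * = reindexed_derivative[where h = h and F = "\<lambda>y. term4 a t x y z"
      and c = "\<lambda>q (w, p, r). a w p q r * t ^ w * x ^ p * z ^ r", OF h _ _ assms]
  have e: "(\<lambda>v. term4 a t x s z (h v)) = (\<lambda>(n, i). (case i of (w, p, r) \<Rightarrow> a w p n r * t ^ w * x ^ p * z ^ r) * s ^ n)"
    "(\<lambda>v. term4 (dsp4 0 a) t x s z (h v)) = (\<lambda>(n, i). of_nat (n + 1) * (case i of (w, p, r) \<Rightarrow> a w p (n + 1) r * t ^ w * x ^ p * z ^ r) * s ^ n)" for s
    by (auto simp: term4_def dsp4_def fun_eq_iff h_def)
  show "term4 (dsp4 0 a) t x y z summable_on UNIV" by (rule *(1)[OF e])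
  show "((\<lambda>y. infsum (term4 a t x y z) UNIV) has_real_derivative
           infsum (term4 (dsp4 0 a) t x y z) UNIV) (at y)" by (rule *(2)[OF e])
qed

lemma term4_derivative_z:
  assumes "term4 a t x y K summable_on UNIV" "\<bar>z\<bar> < K"
  shows "term4 (dsp4 2 a) t x y z summable_on UNIV"
    and "((\<lambda>z. infsum (term4 a t x y z) UNIV) has_real_derivative
           infsum (term4 (dsp4 2 a) t x y z) UNIV) (at z)"
proof -
  define h :: "nat \<times> nat \<times> nat \<times> nat \<Rightarrow> nat \<times> nat \<times> nat \<times> nat"
    where "h = (\<lambda>(r, w, p, q). (w, p, q, r))"
  have h: "bij h" by (rule bijI') (auto simp: h_def)
  note * = reindexed_derivative[where h = h and F = "\<lambda>z. term4 a t x y z"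
      and c = "\<lambda>r (w, p, q). a w p q r * t ^ w * x ^ p * y ^ q", OF h _ _ assms]
  have e: "(\<lambda>v. term4 a t x y s (h v)) = (\<lambda>(n, i). (case i of (w, p, q) \<Rightarrow> a w p q n * t ^ w * x ^ p * y ^ q) * s ^ n)"
    "(\<lambda>v. term4 (dsp4 2 a) t x y s (h v)) = (\<lambda>(n, i). of_nat (n + 1) * (case i of (w, p, q) \<Rightarrow> a w p q (n + 1) * t ^ w * x ^ p * y ^ q) * s ^ n)" for s
    by (auto simp: term4_def dsp4_def fun_eq_iff h_def)
  show "term4 (dsp4 2 a) t x y z summable_on UNIV" by (rule *(1)[OF e])
  show "((\<lambda>z. infsum (term4 a t x y z) UNIV) has_real_derivative
           infsum (term4 (dsp4 2 a) t x y z) UNIV) (at z)" by (rule *(2)[OF e])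
qed

definition in_box :: "real \<Rightarrow> real \<Rightarrow> real \<Rightarrow> real \<Rightarrow> real \<Rightarrow> bool" where
  "in_box R t x y z \<longleftrightarrow> \<bar>t\<bar> < R \<and> \<bar>x\<bar> < R \<and> \<bar>y\<bar> < R \<and> \<bar>z\<bar> < R"

lemma conv_at_dt4:
  assumes "conv_at a R" "0 < R'" "R' < R"
  shows "conv_at (dt4 a) R'"
  using assms term4_derivative_t(1)[of a R R' R' R' R'] conv_at_summable[of a R R R' R' R']
  by (simp add: conv_at_def)

lemma conv_at_dsp4:
  assumes "conv_at a R" "0 < R'" "R' < R"
  shows "conv_at (dsp4 \<beta> a) R'"
proof -
  have "conv_at (dsp4 1 a) R'" "conv_at (dsp4 0 a) R'" "conv_at (dsp4 2 a) R'"
    using assms term4_derivative_x(1)[of a R' R R' R' R'] conv_at_summable[of a R R' R R' R']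
       term4_derivative_y(1)[of a R' R' R R' R'] conv_at_summable[of a R R' R' R R']
       term4_derivative_z(1)[of a R' R' R' R R'] conv_at_summable[of a R R' R' R' R]
    by (simp_all add: conv_at_def)
  moreover have "dsp4 \<beta> a \<in> {dsp4 1 a, dsp4 0 a, dsp4 2 a}"
    by (auto simp: dsp4_def fun_eq_iff)
  ultimately show ?thesis by auto
qed

lemma deriv_cong_near:
  fixes f g :: "real \<Rightarrow> real"
  assumes "\<And>s. \<bar>s\<bar> < R \<Longrightarrow> f s = g s" and t: "\<bar>t\<bar> < R" and g: "(g has_real_derivative d) (at t)"
  shows "deriv f t = d"
proof -
  have ev: "eventually (\<lambda>s. f s = g s) (nhds t)"
    using eventually_abs_less[OF t] by (rule eventually_mono) (rule assms(1))
  show ?thesis by (rule DERIV_imp_deriv, rule DERIV_cong_ev[THEN iffD2, OF refl ev refl g])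
qed

lemma conv_at_pseries:
  assumes "conv_at a R" "in_box R t x y z"
  shows "pseries a t x y z = infsum (term4 a t x y z) UNIV"
  by (rule pseries_eq_infsum, rule conv_at_summable[OF assms(1)])
    (use assms(2) in \<open>simp_all add: in_box_def\<close>)

lemma D_t_pseries:
  assumes f: "\<And>t x y z. in_box R t x y z \<Longrightarrow> f t x y z = pseries a t x y z"
    and a: "conv_at a R" and b: "in_box R t x y z"
  shows "D_t f t x y z = pseries (dt4 a) t x y z"
proof -
  have t: "\<bar>t\<bar> < R" and sm: "term4 a R x y z summable_on UNIV"
    using b conv_at_summable[OF a, of R x y z] a by (simp_all add: in_box_def conv_at_def)
  have eq: "f s x y z = infsum (term4 a s x y z) UNIV" if "\<bar>s\<bar> < R" for s
    using f[of s x y z] conv_at_pseries[OF a, of s x y z] b that by (simp add: in_box_def)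
  show ?thesis
    unfolding D_t_def pseries_eq_infsum[OF term4_derivative_t(1)[OF sm t]]
    by (rule deriv_cong_near[OF eq t term4_derivative_t(2)[OF sm t]])
qed

text \<open>\<open>f\<close> is required to agree with the series on the box only. This is all that
  is known about a first derivative when the lemma is applied again to obtain second
  derivatives.\<close>

lemma D_sp_pseries:
  assumes f: "\<And>t x y z. in_box R t x y z \<Longrightarrow> f t x y z = pseries a t x y z"
    and a: "conv_at a R" and b: "in_box R t x y z" and \<beta>: "\<beta> \<in> {0, 1, 2}"
  shows "D_sp \<beta> f t x y z = pseries (dsp4 \<beta> a) t x y z"
proof -
  have v: "\<bar>x\<bar> < R" "\<bar>y\<bar> < R" "\<bar>z\<bar> < R"
    and sm: "term4 a t R y z summable_on UNIV" "term4 a t x R z summable_on UNIV"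
      "term4 a t x y R summable_on UNIV"
    using b conv_at_summable[OF a, of t R y z] conv_at_summable[OF a, of t x R z]
      conv_at_summable[OF a, of t x y R] a by (simp_all add: in_box_def conv_at_def)
  have eq: "f t s y z = infsum (term4 a t s y z) UNIV" "f t x s z = infsum (term4 a t x s z) UNIV"
    "f t x y s = infsum (term4 a t x y s) UNIV" if "\<bar>s\<bar> < R" for s
    using f[of t s y z] f[of t x s z] f[of t x y s]
      conv_at_pseries[OF a, of t s y z] conv_at_pseries[OF a, of t x s z]
      conv_at_pseries[OF a, of t x y s] b that by (simp_all add: in_box_def)
  have "deriv (\<lambda>s. f t s y z) x = pseries (dsp4 1 a) t x y z"
    unfolding pseries_eq_infsum[OF term4_derivative_x(1)[OF sm(1) v(1)]]
    by (rule deriv_cong_near[OF eq(1) v(1) term4_derivative_x(2)[OF sm(1) v(1)]])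
  moreover have "deriv (\<lambda>s. f t x s z) y = pseries (dsp4 0 a) t x y z"
    unfolding pseries_eq_infsum[OF term4_derivative_y(1)[OF sm(2) v(2)]]
    by (rule deriv_cong_near[OF eq(2) v(2) term4_derivative_y(2)[OF sm(2) v(2)]])
  moreover have "deriv (\<lambda>s. f t x y s) z = pseries (dsp4 2 a) t x y z"
    unfolding pseries_eq_infsum[OF term4_derivative_z(1)[OF sm(3) v(3)]]
    by (rule deriv_cong_near[OF eq(3) v(3) term4_derivative_z(2)[OF sm(3) v(3)]])
  ultimately show ?thesis using \<beta> by (auto simp: D_sp_def)
qed

section \<open>Cauchy products in four variables\<close>

definition conv4 :: "coeffs \<Rightarrow> coeffs \<Rightarrow> coeffs" where
  "conv4 a b = (\<lambda>w p q r. \<Sum>k\<le>w. \<Sum>i\<le>p. \<Sum>j\<le>q. \<Sum>l\<le>r. a (w - k) (p - i) (q - j) (r - l) * b k i j l)"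

lemma summable_on_product_real:
  fixes f :: "'a \<Rightarrow> real" and g :: "'b \<Rightarrow> real"
  assumes "f summable_on A" "g summable_on B"
  shows "(\<lambda>(u, v). f u * g v) summable_on A \<times> B"
proof -
  have f: "(\<lambda>u. norm (f u)) summable_on A"
    by (rule summable_on_iff_abs_summable_on_real[THEN iffD1, OF assms(1)])
  have g: "(\<lambda>v. norm (g v)) summable_on B"
    by (rule summable_on_iff_abs_summable_on_real[THEN iffD1, OF assms(2)])
  have "(\<lambda>(u, v). norm (f u) * norm (g v)) summable_on A \<times> B"
  proof (rule summable_on_SigmaI)
    show "((\<lambda>v. case (u, v) of (u, v) \<Rightarrow> norm (f u) * norm (g v)) has_sum
        norm (f u) * infsum (\<lambda>v. norm (g v)) B) B" for u
      using has_sum_cmult_right[OF has_sum_infsum[OF g]] by simp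
    show "(\<lambda>u. norm (f u) * infsum (\<lambda>v. norm (g v)) B) summable_on A"
      by (rule summable_on_cmult_left[OF f])
  qed simp
  then show ?thesis by (rule summable_on_abs_le) (auto simp: abs_mult)
qed

lemma term4_conv4:
  assumes a: "term4 a t x y z summable_on UNIV" and b: "term4 b t x y z summable_on UNIV"
  shows "term4 (conv4 a b) t x y z summable_on UNIV" (is ?S)
    and "infsum (term4 (conv4 a b) t x y z) UNIV
       = infsum (term4 a t x y z) UNIV * infsum (term4 b t x y z) UNIV" (is ?I)
proof -
  define box where "box = (\<lambda>(w, p, q, r). {..w} \<times> {..p} \<times> {..q} \<times> {..r} :: (nat \<times> nat \<times> nat \<times> nat) set)"
  define F where "F = (\<lambda>(u, v). term4 a t x y z u * term4 b t x y z v)"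
  \<comment> \<open>\<open>h\<close> sends a total index and its second summand to the pair of both
    summands. On \<open>box\<close> the subtractions are exact, which makes \<open>h\<close>
    bijective; summing over \<open>box\<close> first then yields the Cauchy coefficients.\<close>
  define h where "h = (\<lambda>((w, p, q, r), (k, i, j, l)). ((w - k, p - i, q - j, r - l), (k, i, j, l)) ::
     (nat \<times> nat \<times> nat \<times> nat) \<times> (nat \<times> nat \<times> nat \<times> nat))"
  have h: "bij_betw h (Sigma UNIV box) UNIV"
    by (rule bij_betw_byWitness[where f' = "\<lambda>((w, p, q, r), (k, i, j, l)). ((w + k, p + i, q + j, r + l), (k, i, j, l))"])
      (auto simp: h_def box_def)
  have F: "F summable_on UNIV"
    using summable_on_product_real[OF a b] by (simp only: F_def UNIV_Times_UNIV)
  have Fh: "(\<lambda>v. F (h v)) summable_on Sigma UNIV box"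
    using F by (subst summable_on_reindex_bij_betw[OF h])
  have inner: "(\<Sum>\<^sub>\<infinity>v\<in>box u. F (h (u, v))) = term4 (conv4 a b) t x y z u" for u
  proof -
    obtain w p q r where u: "u = (w, p, q, r)" by (cases u)
    have "(\<Sum>\<^sub>\<infinity>v\<in>box u. F (h (u, v))) = (\<Sum>v\<in>box u. F (h (u, v)))"
      by (rule infsum_finite) (simp add: box_def u)
    also have "\<dots> = (\<Sum>k\<le>w. \<Sum>i\<le>p. \<Sum>j\<le>q. \<Sum>l\<le>r. F (h (u, (k, i, j, l))))"
      unfolding box_def u by (simp add: sum.cartesian_product split_def)
    also have "\<dots> = (\<Sum>k\<le>w. \<Sum>i\<le>p. \<Sum>j\<le>q. \<Sum>l\<le>r. a (w - k) (p - i) (q - j) (r - l) * b k i j l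
         * (t ^ w * x ^ p * y ^ q * z ^ r))"
    proof (intro sum.cong refl)
      fix k i j l assume *: "k \<in> {..w}" "i \<in> {..p}" "j \<in> {..q}" "l \<in> {..r}"
      have e: "t ^ w = t ^ (w - k) * t ^ k" "x ^ p = x ^ (p - i) * x ^ i"
        "y ^ q = y ^ (q - j) * y ^ j" "z ^ r = z ^ (r - l) * z ^ l"
        using * by (simp_all flip: power_add)
      show "F (h (u, (k, i, j, l))) = a (w - k) (p - i) (q - j) (r - l) * b k i j l
         * (t ^ w * x ^ p * y ^ q * z ^ r)"
        unfolding e by (simp add: F_def h_def u term4_def)
    qed
    also have "\<dots> = term4 (conv4 a b) t x y z u"
      by (simp add: term4_def conv4_def u sum_distrib_right mult.assoc)
    finally show ?thesis .
  qed
  show ?S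
    using summable_on_Sigma_banach[of "\<lambda>u v. F (h (u, v))" UNIV box] Fh inner
    by (simp add: case_prod_unfold)
  have "infsum (term4 (conv4 a b) t x y z) UNIV = infsum (\<lambda>v. F (h v)) (Sigma UNIV box)"
    using infsum_Sigma_banach[OF Fh] inner by simp
  also have "\<dots> = infsum F UNIV" by (rule infsum_reindex_bij_betw[OF h])
  also have "\<dots> = (\<Sum>\<^sub>\<infinity>u. \<Sum>\<^sub>\<infinity>v. F (u, v))"
    using infsum_Sigma_banach[of F UNIV "\<lambda>_. UNIV"] F by simp
  also have "\<dots> = infsum (term4 a t x y z) UNIV * infsum (term4 b t x y z) UNIV"
    by (simp add: F_def infsum_cmult_right' infsum_cmult_left')
  finally show ?I .
qed

section \<open>From a power series solution to identities between its coefficients\<close>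

lemma open_real_ex_nonzero:
  fixes S :: "real set"
  assumes "open S" "x \<in> S"
  obtains y where "y \<in> S" "y \<noteq> 0"
proof -
  obtain e where e: "e > 0" "\<And>y. dist y x < e \<Longrightarrow> y \<in> S"
    using assms unfolding open_dist by metis
  show ?thesis
  proof (cases "x = 0")
    case True
    show ?thesis by (rule that[of "e / 2"]) (use e True in \<open>auto simp: dist_real_def\<close>)
  next
    case False
    then show ?thesis using assms(2) that by blast
  qed
qed

text \<open>A nonempty open set contains a point off all coordinate hyperplanes. Absolute
  convergence depends only on the moduli of the coordinates, so their minimum is an admissible
  radius.\<close>

lemma conv_domain_conv_at:
  assumes "interior (conv_domain a) \<noteq> {}"
  obtains R where "conv_at a R"
proof -
  obtain t x y z where v: "(t, x, y, z) \<in> interior (conv_domain a)"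
    using assms by (metis ex_in_conv prod_cases4)
  obtain A B where A: "open A" "t \<in> A" "open B" "(x, y, z) \<in> B" "A \<times> B \<subseteq> interior (conv_domain a)"
    using open_prod_elim[OF open_interior v] by (metis mem_Sigma_iff)
  obtain C D where C: "open C" "x \<in> C" "open D" "(y, z) \<in> D" "C \<times> D \<subseteq> B"
    using open_prod_elim[OF A(3,4)] by (metis mem_Sigma_iff)
  obtain F G where F: "open F" "y \<in> F" "open G" "z \<in> G" "F \<times> G \<subseteq> D"
    using open_prod_elim[OF C(3,4)] by (metis mem_Sigma_iff)
  obtain t' where t': "t' \<in> A" "t' \<noteq> 0" by (rule open_real_ex_nonzero[OF A(1,2)])
  obtain x' where x': "x' \<in> C" "x' \<noteq> 0" by (rule open_real_ex_nonzero[OF C(1,2)])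
  obtain y' where y': "y' \<in> F" "y' \<noteq> 0" by (rule open_real_ex_nonzero[OF F(1,2)])
  obtain z' where z': "z' \<in> G" "z' \<noteq> 0" by (rule open_real_ex_nonzero[OF F(3,4)])
  have "(t', x', y', z') \<in> interior (conv_domain a)"
    using t' x' y' z' A(5) C(5) F(5) by blast
  then have "(t', x', y', z') \<in> conv_domain a" using interior_subset by blast
  then have sm: "term4 a t' x' y' z' summable_on UNIV"
    by (simp add: conv_domain_def term4_def)
  define R where "R = min (min \<bar>t'\<bar> \<bar>x'\<bar>) (min \<bar>y'\<bar> \<bar>z'\<bar>)"
  have "R > 0" using t' x' y' z' by (simp add: R_def)
  moreover have "term4 a R R R R summable_on UNIV"
    by (rule term4_summable_mono[OF sm]) (use \<open>R > 0\<close> in \<open>auto simp: R_def\<close>)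
  ultimately show ?thesis using that by (auto simp: conv_at_def)
qed

lemma box_subset_conv_domain:
  assumes "conv_at a R"
  shows "{-R<..<R} \<times> {-R<..<R} \<times> {-R<..<R} \<times> {-R<..<R} \<subseteq> conv_domain a"
proof clarify
  fix t x y z :: real
  assume "t \<in> {-R<..<R}" "x \<in> {-R<..<R}" "y \<in> {-R<..<R}" "z \<in> {-R<..<R}"
  then have "term4 a t x y z summable_on UNIV"
    by (intro conv_at_summable[OF assms]) auto
  then show "(t, x, y, z) \<in> conv_domain a" by (simp add: conv_domain_def term4_def)
qed

text \<open>The interiors of the seven domains are only known to be nonempty, but by
  \<open>conv_domain_conv_at\<close> the series share a cube at the origin, and this open cube lies
  in the set where the equations hold.\<close>

lemma power_series_solution_near_0:
  assumes "power_series_solution \<rho> \<mu> g u P"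
  obtains R where "\<And>\<alpha>. \<alpha> \<in> {0, 1, 2} \<Longrightarrow> conv_at (u \<alpha>) R"
    "\<And>\<alpha>. \<alpha> \<in> {0, 1, 2} \<Longrightarrow> conv_at (g \<alpha>) R" "conv_at P R"
    "\<And>t x y z. in_box R t x y z \<Longrightarrow>
       navier_stokes_at \<rho> \<mu> (\<lambda>\<alpha>. pseries (g \<alpha>)) (\<lambda>\<alpha>. pseries (u \<alpha>)) (pseries P) (t, x, y, z)"
proof -
  have "\<exists>R. conv_at (u \<alpha>) R \<and> conv_at (g \<alpha>) R" if \<alpha>: "\<alpha> \<in> {0, 1, 2}" for \<alpha>
  proof -
    obtain R where R: "conv_at (u \<alpha>) R"
      using conv_domain_conv_at[of "u \<alpha>"] assms \<alpha> unfolding power_series_solution_def by metis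
    obtain R' where R': "conv_at (g \<alpha>) R'"
      using conv_domain_conv_at[of "g \<alpha>"] assms \<alpha> unfolding power_series_solution_def by metis
    have "min R R' > 0" using R R' by (simp add: conv_at_def)
    then have "conv_at (u \<alpha>) (min R R') \<and> conv_at (g \<alpha>) (min R R')"
      using conv_at_mono[OF R, of "min R R'"] conv_at_mono[OF R', of "min R R'"] by simp
    then show ?thesis by blast
  qed
  then obtain R where R: "\<And>\<alpha>. \<alpha> \<in> {0, 1, 2} \<Longrightarrow> conv_at (u \<alpha>) (R \<alpha>) \<and> conv_at (g \<alpha>) (R \<alpha>)"
    by metis
  obtain R' where R': "conv_at P R'"
    using conv_domain_conv_at[of P] assms unfolding power_series_solution_def by metis
  define r where "r = min (min (R 0) (R 1)) (min (R 2) R')"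
  have pos: "r > 0" using R[of 0] R[of 1] R[of 2] R' by (simp add: r_def conv_at_def)
  have le: "r \<le> R \<alpha>" if "\<alpha> \<in> {0, 1, 2}" for \<alpha> using that by (auto simp: r_def)
  have u: "conv_at (u \<alpha>) r" and g: "conv_at (g \<alpha>) r" if "\<alpha> \<in> {0, 1, 2}" for \<alpha>
    using R[OF that] conv_at_mono[OF _ pos le[OF that]] by blast+
  have P: "conv_at P r" by (rule conv_at_mono[OF R' pos]) (simp add: r_def)
  let ?box = "{-r<..<r} \<times> {-r<..<r} \<times> {-r<..<r} \<times> {-r<..<r}"
  let ?D = "conv_domain P \<inter> (\<Inter>\<alpha>\<in>{0, 1, 2}. conv_domain (u \<alpha>) \<inter> conv_domain (g \<alpha>))"
  have "?box \<subseteq> ?D"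
    using box_subset_conv_domain[OF P] box_subset_conv_domain[OF u] box_subset_conv_domain[OF g]
    by (intro Int_greatest INT_greatest) simp_all
  moreover have "open ?box" by (intro open_Times open_greaterThanLessThan)
  ultimately have box: "?box \<subseteq> interior ?D" by (rule interior_maximal)
  have "navier_stokes_at \<rho> \<mu> (\<lambda>\<alpha>. pseries (g \<alpha>)) (\<lambda>\<alpha>. pseries (u \<alpha>)) (pseries P) (t, x, y, z)"
    if "in_box r t x y z" for t x y z
  proof -
    have "(t, x, y, z) \<in> ?box" using that by (auto simp: in_box_def)
    then have "(t, x, y, z) \<in> interior ?D" using box by blast
    then show ?thesis using assms unfolding power_series_solution_def by blast
  qed
  with u g P show ?thesis by (rule that)
qed

lemma has_sum_term4_eq_0:
  assumes "R > 0" and "\<And>t x y z. in_box R t x y z \<Longrightarrow> (term4 a t x y z has_sum 0) UNIV"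
  shows "a w p q r = 0"
  using assms(1)
proof (rule coeffs_eq_0)
  fix t x y z :: real assume "\<bar>t\<bar> < R" "\<bar>x\<bar> < R" "\<bar>y\<bar> < R" "\<bar>z\<bar> < R"
  then have *: "(term4 a t x y z has_sum 0) UNIV" using assms(2) by (simp add: in_box_def)
  then show "term4 a t x y z summable_on UNIV" by (rule has_sum_imp_summable)
  then show "pseries a t x y z = 0" using pseries_eq_infsum infsumI[OF *] by simp
qed

lemma has_sum_pseries:
  assumes "conv_at a R" "in_box R t x y z"
  shows "(term4 a t x y z has_sum pseries a t x y z) UNIV"
  unfolding conv_at_pseries[OF assms]
  by (rule has_sum_infsum, rule conv_at_summable[OF assms(1)])
    (use assms(2) in \<open>simp_all add: in_box_def\<close>)

lemma coefficient_equations: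
  assumes sol: "power_series_solution \<rho> \<mu> g u P"
  shows "dsp4 0 (u 0) w p q r + dsp4 1 (u 1) w p q r + dsp4 2 (u 2) w p q r = 0" (is ?div)
    and "\<alpha> \<in> {0, 1, 2} \<Longrightarrow>
      \<rho> * (dt4 (u \<alpha>) w p q r + (conv4 (u 0) (dsp4 0 (u \<alpha>)) w p q r
         + conv4 (u 1) (dsp4 1 (u \<alpha>)) w p q r + conv4 (u 2) (dsp4 2 (u \<alpha>)) w p q r))
      = - dsp4 \<alpha> P w p q r + \<mu> * (dsp4 0 (dsp4 0 (u \<alpha>)) w p q r + dsp4 1 (dsp4 1 (u \<alpha>)) w p q r
         + dsp4 2 (dsp4 2 (u \<alpha>)) w p q r) + \<rho> * g \<alpha> w p q r" (is "_ \<Longrightarrow> ?mom")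
proof -
  from sol obtain R where u: "\<And>\<alpha>. \<alpha> \<in> {0, 1, 2} \<Longrightarrow> conv_at (u \<alpha>) R"
    and g: "\<And>\<alpha>. \<alpha> \<in> {0, 1, 2} \<Longrightarrow> conv_at (g \<alpha>) R" and P: "conv_at P R"
    and ns: "\<And>t x y z. in_box R t x y z \<Longrightarrow>
       navier_stokes_at \<rho> \<mu> (\<lambda>\<alpha>. pseries (g \<alpha>)) (\<lambda>\<alpha>. pseries (u \<alpha>)) (pseries P) (t, x, y, z)"
    using power_series_solution_near_0 by blast
  \<comment> \<open>Each differentiation costs some radius: first derivatives are used on the cube
    of radius \<open>S\<close>, second ones on that of radius \<open>T\<close>.\<close>
  define S where "S = R / 2"
  define T where "T = S / 2"
  have "R > 0" using P by (simp add: conv_at_def)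
  then have ST: "0 < S" "S < R" "0 < T" "T < S" by (simp_all add: S_def T_def)
  have boxS: "in_box S t x y z" and boxR: "in_box R t x y z" if "in_box T t x y z" for t x y z
    using that ST by (simp_all add: in_box_def)
  have boxSR: "in_box R t x y z" if "in_box S t x y z" for t x y z
    using that ST by (simp_all add: in_box_def)
  have uT: "conv_at (u \<alpha>) T" and gT: "conv_at (g \<alpha>) T" if "\<alpha> \<in> {0, 1, 2}" for \<alpha>
    using u[OF that] g[OF that] ST conv_at_mono[of _ R T] by simp_all
  have du: "conv_at (dsp4 \<beta> (u \<alpha>)) S" if "\<alpha> \<in> {0, 1, 2}" for \<alpha> \<beta>
    using conv_at_dsp4[OF u[OF that] ST(1,2)] .
  have duT: "conv_at (dsp4 \<beta> (u \<alpha>)) T" if "\<alpha> \<in> {0, 1, 2}" for \<alpha> \<beta>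
    using du[OF that] ST conv_at_mono[of _ S T] by simp
  have ddu: "conv_at (dsp4 \<gamma> (dsp4 \<beta> (u \<alpha>))) T" if "\<alpha> \<in> {0, 1, 2}" for \<alpha> \<beta> \<gamma>
    using conv_at_dsp4[OF du[OF that] ST(3,4)] .
  have dtu: "conv_at (dt4 (u \<alpha>)) T" if "\<alpha> \<in> {0, 1, 2}" for \<alpha>
    using conv_at_dt4[OF u[OF that]] ST by simp
  have dP: "conv_at (dsp4 \<alpha> P) T" for \<alpha>
    using conv_at_dsp4[OF P] ST by simp
  have Du: "D_sp \<beta> (pseries (u \<alpha>)) t x y z = pseries (dsp4 \<beta> (u \<alpha>)) t x y z"
    if "\<alpha> \<in> {0, 1, 2}" "\<beta> \<in> {0, 1, 2}" "in_box S t x y z" for \<alpha> \<beta> t x y z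
    by (rule D_sp_pseries[OF refl u[OF that(1)] boxSR[OF that(3)] that(2)])
  have DDu: "D_sp \<beta> (D_sp \<beta> (pseries (u \<alpha>))) t x y z = pseries (dsp4 \<beta> (dsp4 \<beta> (u \<alpha>))) t x y z"
    if "\<alpha> \<in> {0, 1, 2}" "\<beta> \<in> {0, 1, 2}" "in_box T t x y z" for \<alpha> \<beta> t x y z
    by (rule D_sp_pseries[OF _ du[OF that(1)] boxS[OF that(3)] that(2)]) (rule Du[OF that(1,2)])
  have DtU: "D_t (pseries (u \<alpha>)) t x y z = pseries (dt4 (u \<alpha>)) t x y z"
    if "\<alpha> \<in> {0, 1, 2}" "in_box T t x y z" for \<alpha> t x y z
    by (rule D_t_pseries[OF refl u[OF that(1)] boxR[OF that(2)]])
  have DP: "D_sp \<alpha> (pseries P) t x y z = pseries (dsp4 \<alpha> P) t x y z"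
    if "\<alpha> \<in> {0, 1, 2}" "in_box T t x y z" for \<alpha> t x y z
    by (rule D_sp_pseries[OF refl P boxR[OF that(2)] that(1)])
  show ?div
  proof (rule has_sum_term4_eq_0[OF ST(3), where
        a = "\<lambda>w p q r. dsp4 0 (u 0) w p q r + dsp4 1 (u 1) w p q r + dsp4 2 (u 2) w p q r"])
    fix t x y z assume b: "in_box T t x y z"
    have "pseries (dsp4 0 (u 0)) t x y z + pseries (dsp4 1 (u 1)) t x y z
        + pseries (dsp4 2 (u 2)) t x y z = 0"
      using ns[OF boxR[OF b]] Du[OF _ _ boxS[OF b]] by (simp add: navier_stokes_at_def)
    moreover have "((\<lambda>v. term4 (dsp4 0 (u 0)) t x y z v + term4 (dsp4 1 (u 1)) t x y z v
        + term4 (dsp4 2 (u 2)) t x y z v) has_sum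
        (pseries (dsp4 0 (u 0)) t x y z + pseries (dsp4 1 (u 1)) t x y z
        + pseries (dsp4 2 (u 2)) t x y z)) UNIV"
      by (intro has_sum_add has_sum_pseries[OF duT b]) simp_all
    moreover have "(\<lambda>v. term4 (dsp4 0 (u 0)) t x y z v + term4 (dsp4 1 (u 1)) t x y z v
        + term4 (dsp4 2 (u 2)) t x y z v)
      = term4 (\<lambda>w p q r. dsp4 0 (u 0) w p q r + dsp4 1 (u 1) w p q r + dsp4 2 (u 2) w p q r) t x y z"
      by (auto simp: term4_def distrib_right)
    ultimately show "(term4 (\<lambda>w p q r. dsp4 0 (u 0) w p q r + dsp4 1 (u 1) w p q r
        + dsp4 2 (u 2) w p q r) t x y z has_sum 0) UNIV" by simp
  qed
  show ?mom if \<alpha>: "\<alpha> \<in> {0, 1, 2}"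
  proof -
    \<comment> \<open>All terms are brought to one side, giving one coefficient family whose series
      vanishes. The signs are put into the scalars so that \<open>has_sum_cmult_right\<close> and
      \<open>has_sum_add\<close> suffice.\<close>
    let ?m = "\<lambda>w p q r. \<rho> * (dt4 (u \<alpha>) w p q r + (conv4 (u 0) (dsp4 0 (u \<alpha>)) w p q r
         + conv4 (u 1) (dsp4 1 (u \<alpha>)) w p q r + conv4 (u 2) (dsp4 2 (u \<alpha>)) w p q r))
      + (dsp4 \<alpha> P w p q r + ((- \<mu>) * (dsp4 0 (dsp4 0 (u \<alpha>)) w p q r + dsp4 1 (dsp4 1 (u \<alpha>)) w p q r
         + dsp4 2 (dsp4 2 (u \<alpha>)) w p q r) + (- \<rho>) * g \<alpha> w p q r))"
    have "?m w p q r = 0"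
    proof (rule has_sum_term4_eq_0[OF ST(3), where a = ?m])
      fix t x y z assume b: "in_box T t x y z"
      have hconv: "(term4 (conv4 (u \<beta>) (dsp4 \<beta> (u \<alpha>))) t x y z has_sum
          pseries (u \<beta>) t x y z * pseries (dsp4 \<beta> (u \<alpha>)) t x y z) UNIV" if \<beta>: "\<beta> \<in> {0, 1, 2}" for \<beta>
      proof -
        note s = has_sum_imp_summable[OF has_sum_pseries[OF uT[OF \<beta>] b]]
          has_sum_imp_summable[OF has_sum_pseries[OF duT[OF \<alpha>, of \<beta>] b]]
        show ?thesis
          unfolding conv_at_pseries[OF uT[OF \<beta>] b] conv_at_pseries[OF duT[OF \<alpha>] b]
            term4_conv4(2)[OF s, symmetric]
          by (rule has_sum_infsum[OF term4_conv4(1)[OF s]])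
      qed
      let ?M = "\<rho> * (pseries (dt4 (u \<alpha>)) t x y z + (pseries (u 0) t x y z * pseries (dsp4 0 (u \<alpha>)) t x y z
         + pseries (u 1) t x y z * pseries (dsp4 1 (u \<alpha>)) t x y z
         + pseries (u 2) t x y z * pseries (dsp4 2 (u \<alpha>)) t x y z))
       + (pseries (dsp4 \<alpha> P) t x y z + ((- \<mu>) * (pseries (dsp4 0 (dsp4 0 (u \<alpha>))) t x y z
         + pseries (dsp4 1 (dsp4 1 (u \<alpha>))) t x y z + pseries (dsp4 2 (dsp4 2 (u \<alpha>))) t x y z)
         + (- \<rho>) * pseries (g \<alpha>) t x y z))"
      have "\<rho> * (D_t (pseries (u \<alpha>)) t x y z + (\<Sum>\<beta>\<in>{0, 1, 2}. pseries (u \<beta>) t x y z * D_sp \<beta> (pseries (u \<alpha>)) t x y z))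
        = - D_sp \<alpha> (pseries P) t x y z + \<mu> * (\<Sum>\<beta>\<in>{0, 1, 2}. D_sp \<beta> (D_sp \<beta> (pseries (u \<alpha>))) t x y z)
          + \<rho> * pseries (g \<alpha>) t x y z"
        using ns[OF boxR[OF b]] \<alpha> unfolding navier_stokes_at_def by blast
      then have M: "?M = 0"
        using \<alpha> Du[OF \<alpha> _ boxS[OF b]] DDu[OF \<alpha> _ b] DtU[OF \<alpha> b] DP[OF \<alpha> b]
        by (simp add: algebra_simps)
      have "((\<lambda>v. \<rho> * (term4 (dt4 (u \<alpha>)) t x y z v + (term4 (conv4 (u 0) (dsp4 0 (u \<alpha>))) t x y z v
         + term4 (conv4 (u 1) (dsp4 1 (u \<alpha>))) t x y z v + term4 (conv4 (u 2) (dsp4 2 (u \<alpha>))) t x y z v))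
       + (term4 (dsp4 \<alpha> P) t x y z v + ((- \<mu>) * (term4 (dsp4 0 (dsp4 0 (u \<alpha>))) t x y z v
         + term4 (dsp4 1 (dsp4 1 (u \<alpha>))) t x y z v + term4 (dsp4 2 (dsp4 2 (u \<alpha>))) t x y z v)
         + (- \<rho>) * term4 (g \<alpha>) t x y z v))) has_sum ?M) UNIV"
        by (intro has_sum_add has_sum_cmult_right has_sum_pseries[OF _ b] hconv dtu ddu dP gT \<alpha>) simp_all
      moreover have "(\<lambda>v. \<rho> * (term4 (dt4 (u \<alpha>)) t x y z v + (term4 (conv4 (u 0) (dsp4 0 (u \<alpha>))) t x y z v
         + term4 (conv4 (u 1) (dsp4 1 (u \<alpha>))) t x y z v + term4 (conv4 (u 2) (dsp4 2 (u \<alpha>))) t x y z v))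
       + (term4 (dsp4 \<alpha> P) t x y z v + ((- \<mu>) * (term4 (dsp4 0 (dsp4 0 (u \<alpha>))) t x y z v
         + term4 (dsp4 1 (dsp4 1 (u \<alpha>))) t x y z v + term4 (dsp4 2 (dsp4 2 (u \<alpha>))) t x y z v)
         + (- \<rho>) * term4 (g \<alpha>) t x y z v))) = term4 ?m t x y z"
        by (rule ext) (auto simp: term4_def algebra_simps)
      ultimately show "(term4 ?m t x y z has_sum 0) UNIV" using M by simp
    qed
    then show ?thesis by (simp add: algebra_simps)
  qed
qed

section \<open>Elimination of the pressure\<close>

type_synonym arr = "int \<Rightarrow> int \<Rightarrow> int \<Rightarrow> real"

text \<open>On Taylor coefficients scaled by factorials, \<open>Dn n\<close> is the \<open>n\<close>-th power of the Laplacian in the two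
  outer variables.\<close>

definition Dn :: "nat \<Rightarrow> arr \<Rightarrow> arr" where
  "Dn n f i j k = (\<Sum>m\<le>n. of_nat (n choose m) * f (i + 2 * int (n - m)) j (k + 2 * int m))"

lemma Dn_0 [simp]: "Dn 0 f i j k = f i j k"
  by (simp add: Dn_def)

text \<open>Pascal's rule, for the powers of a sum of two commuting shifts.\<close>

lemma Dn_Suc: "Dn (Suc n) f i j k = Dn n f (i + 2) j k + Dn n f i j (k + 2)"
proof -
  let ?f = "\<lambda>m. f (i + 2 * (1 + int n - int m)) j (k + 2 * int m)"
  have "Dn (Suc n) f i j k = (\<Sum>m\<le>Suc n. of_nat (Suc n choose m) * ?f m)"
    unfolding Dn_def by (intro sum.cong refl) (simp add: of_nat_diff)
  also have "\<dots> = ?f 0 + (\<Sum>m\<le>n. of_nat (Suc n choose Suc m) * ?f (Suc m))"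
    by (subst sum.atMost_Suc_shift) simp
  also have "\<dots> = (?f 0 + (\<Sum>m\<le>n. of_nat (n choose Suc m) * ?f (Suc m)))
      + (\<Sum>m\<le>n. of_nat (n choose m) * ?f (Suc m))"
    by (simp add: sum.distrib distrib_right)
  also have "?f 0 + (\<Sum>m\<le>n. of_nat (n choose Suc m) * ?f (Suc m)) = (\<Sum>m\<le>Suc n. of_nat (n choose m) * ?f m)"
    by (subst sum.atMost_Suc_shift) simp
  also have "\<dots> = (\<Sum>m\<le>n. of_nat (n choose m) * ?f m)" by simp
  also have "\<dots> = Dn n f (i + 2) j k"
    unfolding Dn_def by (intro sum.cong refl) (simp add: of_nat_diff algebra_simps)
  also have "(\<Sum>m\<le>n. of_nat (n choose m) * ?f (Suc m)) = Dn n f i j (k + 2)"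
    unfolding Dn_def by (intro sum.cong refl) (simp add: of_nat_diff algebra_simps)
  finally show ?thesis .
qed

lemma Dn_cong:
  assumes "\<And>i' k'. i \<le> i' \<Longrightarrow> k \<le> k' \<Longrightarrow> f i' j k' = g i' j k'"
  shows "Dn n f i j k = Dn n g i j k"
  unfolding Dn_def by (intro sum.cong refl) (simp add: assms)

lemma Dn_add: "Dn n (\<lambda>i j k. f i j k + g i j k) i j k = Dn n f i j k + Dn n g i j k"
  by (simp add: Dn_def distrib_left sum.distrib)

lemma Dn_cmult: "Dn n (\<lambda>i j k. c * f i j k) i j k = c * Dn n f i j k"
  by (simp add: Dn_def sum_distrib_left mult_ac)

lemma Dn_shift: "Dn n (\<lambda>i j k. f (i + a) (j + b) (k + c)) i j k = Dn n f (i + a) (j + b) (k + c)"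
  by (simp add: Dn_def add_ac)

text \<open>The contribution of the force \<open>(fa, fb, f0)\<close> to the velocity once the pressure is eliminated, as
  in \<open>pressure_elimination\<close>.\<close>

definition Phi :: "nat \<Rightarrow> arr \<Rightarrow> arr \<Rightarrow> arr \<Rightarrow> arr" where
  "Phi e fa fb f0 i q k = - fa i q k
     + (\<Sum>n<e - 1. (-1) ^ n * (Dn n fa (i + 2) (q - 2 - 2 * int n) k
                             + Dn n fb (i + 1) (q - 2 - 2 * int n) (k + 1)))
     + (\<Sum>n<e. (-1) ^ n * Dn n f0 (i + 1) (q - 1 - 2 * int n) k)"

lemma Phi_add:
  "Phi e (\<lambda>i j k. fa i j k + ga i j k) (\<lambda>i j k. fb i j k + gb i j k) (\<lambda>i j k. f0 i j k + g0 i j k) i q k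
     = Phi e fa fb f0 i q k + Phi e ga gb g0 i q k"
  by (simp add: Phi_def Dn_add sum.distrib distrib_left)

lemma Phi_cmult:
  "Phi e (\<lambda>i j k. c * fa i j k) (\<lambda>i j k. c * fb i j k) (\<lambda>i j k. c * f0 i j k) i q k
     = c * Phi e fa fb f0 i q k"
  by (simp add: Phi_def Dn_cmult sum_distrib_left algebra_simps)

text \<open>With D the outer Laplacian, the equation reads: Q at j + 2 is -D Q + S at j. Iterating
  it e times gives the power (-D)^e applied to \<open>Q\<close> and a finite Neumann sum of (-D)^n
  applied to \<open>S\<close>.\<close>

lemma Poisson_iterated:
  assumes "\<And>i j k. 0 \<le> i \<Longrightarrow> 0 \<le> j \<Longrightarrow> 0 \<le> k \<Longrightarrow>
      Q i (j + 2) k = - (Q (i + 2) j k + Q i j (k + 2)) + S i j k"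
    and "0 \<le> i" "0 \<le> j" "0 \<le> k"
  shows "Q i (j + 2 * int e) k = (-1) ^ e * Dn e Q i j k
      + (\<Sum>n<e. (-1) ^ n * Dn n S i (j + 2 * int e - 2 - 2 * int n) k)"
  using assms(2-)
proof (induction e arbitrary: i k)
  case (Suc e)
  have Q: "Q i (j + 2 * int (Suc e)) k = - (Q (i + 2) (j + 2 * int e) k + Q i (j + 2 * int e) (k + 2))
      + S i (j + 2 * int e) k"
    using assms(1)[of i "j + 2 * int e" k] Suc.prems by (simp add: add_ac)
  have Q1: "Q (i + 2) (j + 2 * int e) k = (-1) ^ e * Dn e Q (i + 2) j k
      + (\<Sum>n<e. (-1) ^ n * Dn n S (i + 2) (j + 2 * int e - 2 - 2 * int n) k)"
    using Suc.IH Suc.prems by simp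
  have Q2: "Q i (j + 2 * int e) (k + 2) = (-1) ^ e * Dn e Q i j (k + 2)
      + (\<Sum>n<e. (-1) ^ n * Dn n S i (j + 2 * int e - 2 - 2 * int n) (k + 2))"
    using Suc.IH Suc.prems by simp
  have "(\<Sum>n<Suc e. (-1) ^ n * Dn n S i (j + 2 * int (Suc e) - 2 - 2 * int n) k)
      = S i (j + 2 * int e) k + (\<Sum>n<e. (-1) ^ Suc n * Dn (Suc n) S i (j + 2 * int e - 2 - 2 * int n) k)"
    by (subst sum.lessThan_Suc_shift) (simp add: algebra_simps)
  also have "(\<Sum>n<e. (-1) ^ Suc n * Dn (Suc n) S i (j + 2 * int e - 2 - 2 * int n) k)
      = - (\<Sum>n<e. (-1) ^ n * Dn n S (i + 2) (j + 2 * int e - 2 - 2 * int n) k)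
        - (\<Sum>n<e. (-1) ^ n * Dn n S i (j + 2 * int e - 2 - 2 * int n) (k + 2))"
    unfolding Dn_Suc by (simp add: sum_negf sum_subtractf distrib_left)
  finally show ?case unfolding Q Q1 Q2 by (simp add: Dn_Suc distrib_left)
qed simp

text \<open>
  The arrays are Taylor coefficients scaled by factorials, so differentiation is an index shift.
  If \<open>v + N\<close> is the gradient of \<open>Q\<close> and \<open>v\<close> is divergence free, then \<open>Q\<close> solves a Poisson equation,
  which lowers the middle index of \<open>Q\<close>, hence of \<open>v\<close>, by two at a time.
\<close>

lemma pressure_elimination:
  assumes "\<And>i j k. 0 \<le> i \<Longrightarrow> 0 \<le> j \<Longrightarrow> 0 \<le> k \<Longrightarrow> va i j k + fa i j k = Q (i + 1) j k"
    and "\<And>i j k. 0 \<le> i \<Longrightarrow> 0 \<le> j \<Longrightarrow> 0 \<le> k \<Longrightarrow> vb i j k + fb i j k = Q i j (k + 1)"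
    and "\<And>i j k. 0 \<le> i \<Longrightarrow> 0 \<le> j \<Longrightarrow> 0 \<le> k \<Longrightarrow> v0 i j k + f0 i j k = Q i (j + 1) k"
    and dv: "\<And>i j k. 0 \<le> i \<Longrightarrow> 0 \<le> j \<Longrightarrow> 0 \<le> k \<Longrightarrow> va (i + 1) j k + vb i j (k + 1) + v0 i (j + 1) k = 0"
    and nn: "0 \<le> i" "0 \<le> j" "0 \<le> k" and e: "e > 0"
  shows "va i (j + 2 * int e) k = (-1) ^ e * (Dn (e - 1) va (i + 2) j k + Dn (e - 1) vb (i + 1) j (k + 1))
      + Phi e fa fb f0 i (j + 2 * int e) k"
proof -
  obtain e' where e': "e = Suc e'" using e by (cases e) auto
  \<comment> \<open>\<open>S\<close> is the divergence of the force. As \<open>v\<close> is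
    divergence free, the full Laplacian of \<open>Q\<close> equals \<open>S\<close>.\<close>
  define S where "S i j k = fa (i + 1) j k + fb i j (k + 1) + f0 i (j + 1) k" for i j k
  have Pois: "Q i (j + 2) k = - (Q (i + 2) j k + Q i j (k + 2)) + S i j k"
    if "0 \<le> i" "0 \<le> j" "0 \<le> k" for i j k
    using that assms(1)[of "i + 1" j k] assms(2)[of i j "k + 1"] assms(3)[of i "j + 1" k] dv[of i j k]
    by (simp add: S_def add.assoc)
  have DS: "Dn n S i j k = Dn n fa (i + 1) j k + Dn n fb i j (k + 1) + Dn n f0 i (j + 1) k" for n i j k
    using Dn_shift[of n fa 1 0 0 i j k] Dn_shift[of n fb 0 0 1 i j k] Dn_shift[of n f0 0 1 0 i j k]
    by (simp add: S_def[abs_def] Dn_add)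
  \<comment> \<open>One of the e outer Laplacians is spent on expressing second derivatives of
    \<open>Q\<close> by first derivatives of \<open>va + fa\<close> and \<open>vb + fb\<close>;
    hence the order \<open>e - 1\<close> in the conclusion.\<close>
  have DQ: "Dn (Suc e') Q (i + 1) j k = Dn e' va (i + 2) j k + Dn e' vb (i + 1) j (k + 1)
      + (Dn e' fa (i + 2) j k + Dn e' fb (i + 1) j (k + 1))"
  proof -
    have "Dn e' Q (i + 1 + 2) j k = Dn e' (\<lambda>i j k. va i j k + fa i j k) (i + 2) j k"
      using Dn_shift[of e' Q 1 0 0 "i + 2" j k] nn
        Dn_cong[of "i + 2" k "\<lambda>i j k. va i j k + fa i j k" j "\<lambda>i j k. Q (i + 1) j k" e'] assms(1)
      by (simp add: add.assoc)
    moreover have "Dn e' Q (i + 1) j (k + 2) = Dn e' (\<lambda>i j k. vb i j k + fb i j k) (i + 1) j (k + 1)"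
      using Dn_shift[of e' Q 0 0 1 "i + 1" j "k + 1"] nn
        Dn_cong[of "i + 1" "k + 1" "\<lambda>i j k. vb i j k + fb i j k" j "\<lambda>i j k. Q i j (k + 1)" e'] assms(2)
      by (simp add: add.assoc)
    ultimately show ?thesis by (simp add: Dn_Suc Dn_add)
  qed
  define J where "J n = j + 2 * int e - 2 - 2 * int n" for n
  have J: "J e' = j" by (simp add: J_def e')
  \<comment> \<open>The top summand n = e' is split off: its parts with \<open>fa\<close> and
    \<open>fb\<close> cancel those from \<open>DQ\<close>. This is why in \<open>Phi\<close> the sum
    over \<open>f0\<close> is one term longer than the other.\<close>
  have SS: "(\<Sum>n<e. (-1) ^ n * Dn n S (i + 1) (J n) k)
     = (\<Sum>n<e'. (-1) ^ n * (Dn n fa (i + 2) (J n) k + Dn n fb (i + 1) (J n) (k + 1)))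
       + (\<Sum>n<e'. (-1) ^ n * Dn n f0 (i + 1) (J n + 1) k)
       + (-1) ^ e' * (Dn e' fa (i + 2) j k + Dn e' fb (i + 1) j (k + 1) + Dn e' f0 (i + 1) (j + 1) k)"
    by (simp add: e' DS J add.assoc distrib_left sum.distrib)
  have PP: "Phi e fa fb f0 i (j + 2 * int e) k = - fa i (j + 2 * int e) k
     + (\<Sum>n<e'. (-1) ^ n * (Dn n fa (i + 2) (J n) k + Dn n fb (i + 1) (J n) (k + 1)))
     + ((\<Sum>n<e'. (-1) ^ n * Dn n f0 (i + 1) (J n + 1) k) + (-1) ^ e' * Dn e' f0 (i + 1) (j + 1) k)"
    by (simp add: Phi_def e' J_def algebra_simps)
  have V: "va i (j + 2 * int e) k = Q (i + 1) (j + 2 * int e) k - fa i (j + 2 * int e) k"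
    using assms(1)[of i "j + 2 * int e" k] nn by simp
  have W: "Q (i + 1) (j + 2 * int e) k = (-1) ^ e * Dn e Q (i + 1) j k
      + (\<Sum>n<e. (-1) ^ n * Dn n S (i + 1) (J n) k)"
    unfolding J_def by (rule Poisson_iterated) (use nn Pois in auto)
  show ?thesis
    unfolding V W SS PP unfolding e' DQ by (simp add: algebra_simps)
qed

text \<open>If the force is minus the velocity, their sum is the gradient of the potential 0;
  \<open>pressure_elimination\<close> then evaluates \<open>Phi\<close>.\<close>

lemma Phi_of_divergence_free:
  assumes dv: "\<And>i j k. 0 \<le> i \<Longrightarrow> 0 \<le> j \<Longrightarrow> 0 \<le> k \<Longrightarrow> va (i + 1) j k + vb i j (k + 1) + v0 i (j + 1) k = 0"
    and nn: "0 \<le> i" "0 \<le> j" "0 \<le> k" and e: "e > 0"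
  shows "Phi e va vb v0 i (j + 2 * int e) k
    = (-1) ^ e * (Dn (e - 1) va (i + 2) j k + Dn (e - 1) vb (i + 1) j (k + 1)) - va i (j + 2 * int e) k"
  using pressure_elimination[of va "\<lambda>i j k. (-1) * va i j k" "\<lambda>i j k. 0" vb "\<lambda>i j k. (-1) * vb i j k"
      v0 "\<lambda>i j k. (-1) * v0 i j k" i j k e] assms Phi_cmult[of e "-1" va vb v0]
  by simp

definition Lap :: "arr \<Rightarrow> arr" where
  "Lap f i j k = f (i + 2) j k + f i (j + 2) k + f i j (k + 2)"

text \<open>The Laplacian commutes with the divergence, so \<open>Phi_of_divergence_free\<close>
  applies to it. The result is arranged so that its summands are the viscous terms z = 1, 2, 3, 4,
  then 5 and 6 together in \<open>Dn e v0\<close>, then 7 and 8.\<close>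

lemma Phi_Lap:
  assumes dv: "\<And>i j k. 0 \<le> i \<Longrightarrow> 0 \<le> j \<Longrightarrow> 0 \<le> k \<Longrightarrow> va (i + 1) j k + vb i j (k + 1) + v0 i (j + 1) k = 0"
    and nn: "0 \<le> i" "0 \<le> j" "0 \<le> k" and e: "e > 0"
  shows "- Phi e (Lap va) (Lap vb) (Lap v0) i (j + 2 * int e) k
    = va i (j + 2 * int e) (k + 2) + va i (j + 2 * int e + 2) k
      - v0 (i + 1) (j + 2 * int e + 1) k - vb (i + 1) (j + 2 * int e) (k + 1)
      + (-1) ^ e * Dn e v0 (i + 1) (j + 1) k
      - (-1) ^ e * (Dn (e - 1) va (i + 2) (j + 2) k + Dn (e - 1) vb (i + 1) (j + 2) (k + 1))"
proof -
  obtain e' where e': "e = Suc e'" using e by (cases e) auto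
  have "Lap va (i + 1) j k + Lap vb i j (k + 1) + Lap v0 i (j + 1) k = 0"
    if "0 \<le> i" "0 \<le> j" "0 \<le> k" for i j k
    using dv[of "i + 2" j k] dv[of i "j + 2" k] dv[of i j "k + 2"] that
    by (simp add: Lap_def add_ac)
  from Phi_of_divergence_free[of "Lap va" "Lap vb" "Lap v0", OF this nn e]
  have 1: "Phi e (Lap va) (Lap vb) (Lap v0) i (j + 2 * int e) k =
      (-1) ^ e * (Dn e' (Lap va) (i + 2) j k + Dn e' (Lap vb) (i + 1) j (k + 1))
      - Lap va i (j + 2 * int e) k" by (simp add: e')
  have DL: "Dn n (Lap f) i j k = Dn n f (i + 2) j k + Dn n f i (j + 2) k + Dn n f i j (k + 2)" for n f i j k
    using Dn_shift[of n f 2 0 0 i j k] Dn_shift[of n f 0 2 0 i j k] Dn_shift[of n f 0 0 2 i j k]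
    by (simp add: Lap_def[abs_def] Dn_add)
  \<comment> \<open>The divergence equation trades the two outer components for the middle one under
    \<open>Dn e\<close>. This lowers the number of terms and produces the summand with
    \<open>Dn e v0\<close>.\<close>
  have "Dn e (\<lambda>i j k. va (i + 1) j k + vb i j (k + 1)) (i + 1) j k
      = Dn e (\<lambda>i j k. (-1) * v0 i (j + 1) k) (i + 1) j k"
    by (rule Dn_cong) (use dv nn in \<open>simp add: eq_neg_iff_add_eq_0\<close>)
  then have 2: "Dn e va (i + 2) j k + Dn e vb (i + 1) j (k + 1) = - Dn e v0 (i + 1) (j + 1) k"
    using Dn_shift[of e va 1 0 0 "i + 1" j k] Dn_shift[of e vb 0 0 1 "i + 1" j k]
      Dn_shift[of e v0 0 1 0 "i + 1" j k] Dn_cmult[of e "-1" "\<lambda>i j k. v0 i (j + 1) k" "i + 1" j k]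
    by (simp add: Dn_add add.assoc)
  have 3: "Dn e' (Lap va) (i + 2) j k + Dn e' (Lap vb) (i + 1) j (k + 1)
     = - Dn e v0 (i + 1) (j + 1) k + (Dn e' va (i + 2) (j + 2) k + Dn e' vb (i + 1) (j + 2) (k + 1))"
    using 2 by (simp add: e' Dn_Suc DL algebra_simps)
  have "va (i + 2) (j + 2 * int e) k = - v0 (i + 1) (j + 2 * int e + 1) k - vb (i + 1) (j + 2 * int e) (k + 1)"
    using dv[of "i + 1" "j + 2 * int e" k] nn by (simp add: add.assoc)
  then show ?thesis unfolding 1 3 Lap_def by (simp add: e' algebra_simps)
qed

text \<open>\<open>Phi\<close> expanded into single coefficients. The summands that leave
  \<open>k\<close> unshifted are collected in the first sum, which gives the three sums of
  \<open>F0t\<close>.\<close>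

definition Phi_ex :: "nat \<Rightarrow> arr \<Rightarrow> arr \<Rightarrow> arr \<Rightarrow> arr" where
  "Phi_ex e fa fb f0 i q k =
     (\<Sum>n<e. (-1) ^ n * (f0 (i + 2 * int n + 1) (q - 2 * int n - 1) k - fa (i + 2 * int n) (q - 2 * int n) k))
   + (\<Sum>n<e - 1. \<Sum>m\<le>n. (-1) ^ n *
       (of_nat (n choose m) * fb (i + 2 * int n - 2 * int m + 1) (q - 2 * int n - 2) (k + 2 * int m + 1)
        - of_nat (Suc n choose Suc m) * f0 (i + 2 * int n - 2 * int m + 1) (q - 2 * int n - 3) (k + 2 * int m + 2)))
   - (\<Sum>n<e - 2. \<Sum>m\<le>n. (-1) ^ n * of_nat (Suc n choose Suc m)
       * fa (i + 2 * int n - 2 * int m + 2) (q - 2 * int n - 4) (k + 2 * int m + 2))"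

lemma Dn_split: "Dn (Suc n) f i j k = f (i + 2 * int n + 2) j k
    + (\<Sum>m\<le>n. of_nat (Suc n choose Suc m) * f (i + 2 * int n - 2 * int m) j (k + 2 * int m + 2))"
  unfolding Dn_def
  by (subst sum.atMost_Suc_shift) (simp add: of_nat_diff algebra_simps)

lemma Dn_alt: "Dn n f i j k = (\<Sum>m\<le>n. of_nat (n choose m) * f (i + 2 * int n - 2 * int m) j (k + 2 * int m))"
  unfolding Dn_def by (intro sum.cong refl) (simp add: of_nat_diff algebra_simps)

text \<open>\<open>Dn_split\<close> separates the summand with unshifted \<open>k\<close> and raises
  n by one in it; the lone term \<open>- fa i q k\<close> of \<open>Phi\<close> becomes the missing
  first summand for \<open>fa\<close>.\<close>

lemma Phi_eq_Phi_ex: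
  assumes "e > 0"
  shows "Phi e fa fb f0 i q k = Phi_ex e fa fb f0 i q k"
proof -
  obtain e' where e': "e = Suc e'" using assms by (cases e) auto
  have fa: "- fa i q k + (\<Sum>n<e'. (-1) ^ n * Dn n fa (i + 2) (q - 2 - 2 * int n) k)
    = (\<Sum>n<e. - ((-1) ^ n * fa (i + 2 * int n) (q - 2 * int n) k))
      - (\<Sum>n<e - 2. \<Sum>m\<le>n. (-1) ^ n * of_nat (Suc n choose Suc m)
       * fa (i + 2 * int n - 2 * int m + 2) (q - 2 * int n - 4) (k + 2 * int m + 2))"
  proof (cases e')
    case (Suc e'')
    have "(\<Sum>n<Suc e''. (-1) ^ n * Dn n fa (i + 2) (q - 2 - 2 * int n) k)
      = fa (i + 2) (q - 2) k + (\<Sum>n<e''. (-1) ^ Suc n * fa (i + 2 * int n + 4) (q - 2 * int n - 4) k)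
        - (\<Sum>n<e''. \<Sum>m\<le>n. (-1) ^ n * of_nat (Suc n choose Suc m)
            * fa (i + 2 * int n - 2 * int m + 2) (q - 2 * int n - 4) (k + 2 * int m + 2))"
      by (subst sum.lessThan_Suc_shift)
        (simp add: Dn_split sum_negf sum_subtractf sum_distrib_left algebra_simps
          del: sum.lessThan_Suc binomial_Suc_Suc)
    moreover have "(\<Sum>n<e. - ((-1) ^ n * fa (i + 2 * int n) (q - 2 * int n) k))
      = - fa i q k + (fa (i + 2) (q - 2) k + (\<Sum>n<e''. (-1) ^ Suc n * fa (i + 2 * int n + 4) (q - 2 * int n - 4) k))"
      unfolding e' Suc by (subst sum.lessThan_Suc_shift, subst sum.lessThan_Suc_shift)
        (simp add: algebra_simps del: sum.lessThan_Suc)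
    ultimately show ?thesis by (simp add: e' Suc del: sum.lessThan_Suc binomial_Suc_Suc)
  qed (simp add: e')
  have f0: "(\<Sum>n<e. (-1) ^ n * Dn n f0 (i + 1) (q - 1 - 2 * int n) k)
    = (\<Sum>n<e. (-1) ^ n * f0 (i + 2 * int n + 1) (q - 2 * int n - 1) k)
      - (\<Sum>n<e'. \<Sum>m\<le>n. (-1) ^ n * of_nat (Suc n choose Suc m)
        * f0 (i + 2 * int n - 2 * int m + 1) (q - 2 * int n - 3) (k + 2 * int m + 2))"
  proof -
    have 1: "(\<Sum>n<Suc e'. (-1) ^ n * Dn n f0 (i + 1) (q - 1 - 2 * int n) k)
      = f0 (i + 1) (q - 1) k + (\<Sum>n<e'. (-1) ^ Suc n * f0 (i + 2 * int n + 3) (q - 2 * int n - 3) k)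
        - (\<Sum>n<e'. \<Sum>m\<le>n. (-1) ^ n * of_nat (Suc n choose Suc m)
            * f0 (i + 2 * int n - 2 * int m + 1) (q - 2 * int n - 3) (k + 2 * int m + 2))"
      by (subst sum.lessThan_Suc_shift)
        (simp add: Dn_split sum_negf sum_subtractf sum_distrib_left algebra_simps
          del: sum.lessThan_Suc binomial_Suc_Suc)
    have 2: "(\<Sum>n<Suc e'. (-1) ^ n * f0 (i + 2 * int n + 1) (q - 2 * int n - 1) k)
      = f0 (i + 1) (q - 1) k + (\<Sum>n<e'. (-1) ^ Suc n * f0 (i + 2 * int n + 3) (q - 2 * int n - 3) k)"
      by (subst sum.lessThan_Suc_shift) (simp add: algebra_simps del: sum.lessThan_Suc)
    show ?thesis unfolding e' 1 2 ..
  qed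
  have fb: "(\<Sum>n<e'. (-1) ^ n * Dn n fb (i + 1) (q - 2 - 2 * int n) (k + 1))
    = (\<Sum>n<e'. \<Sum>m\<le>n. (-1) ^ n * of_nat (n choose m)
        * fb (i + 2 * int n - 2 * int m + 1) (q - 2 * int n - 2) (k + 2 * int m + 1))"
    by (simp add: Dn_alt sum_distrib_left algebra_simps)
  have "Phi e fa fb f0 i q k = (- fa i q k + (\<Sum>n<e'. (-1) ^ n * Dn n fa (i + 2) (q - 2 - 2 * int n) k))
     + (\<Sum>n<e'. (-1) ^ n * Dn n fb (i + 1) (q - 2 - 2 * int n) (k + 1))
     + (\<Sum>n<e. (-1) ^ n * Dn n f0 (i + 1) (q - 1 - 2 * int n) k)"
    by (simp add: Phi_def e' sum.distrib distrib_left del: sum.lessThan_Suc)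
  then show ?thesis
    unfolding fa f0 fb by (simp add: Phi_ex_def e' sum_subtractf sum_negf right_diff_distrib mult.assoc
        del: sum.lessThan_Suc binomial_Suc_Suc)
qed

section \<open>The summands of the recursion\<close>

text \<open>Only the space indices are scaled. The time derivative keeps its factor, which is the
  source of the quotients by w.\<close>

definition hat :: "coeffs \<Rightarrow> int \<Rightarrow> arr" where
  "hat a w p q r = fct p * fct q * fct r * cf a w p q r"

text \<open>For \<open>\<alpha> = 2\<close> the outer variables exchange their roles, so that only one direction has to be
  treated.\<close>

definition orient :: "int \<Rightarrow> arr \<Rightarrow> arr" where
  "orient \<alpha> f i j k = (if \<alpha> = 1 then f i j k else f k j i)"

lemma sum_int_from_1: "(\<Sum>n\<in>{1..int e}. f n) = (\<Sum>n<e. f (int n + 1))"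
proof -
  have "bij_betw (\<lambda>n. int n + 1) {..<e} {1..int e}"
    by (rule bij_betw_byWitness[where f' = "\<lambda>n. nat (n - 1)"]) auto
  then show ?thesis by (rule sum.reindex_bij_betw[symmetric])
qed

lemma sum_int_from_1_le: "(\<Sum>m\<in>{1..int n + 1}. f m) = (\<Sum>m\<le>n. f (int m + 1))"
  using sum_int_from_1[of f "Suc n"] by (simp add: lessThan_Suc_atMost add.commute)

lemma sum_int_from_1_diff: "(\<Sum>n\<in>{1..int e - int c}. f n) = (\<Sum>n<e - c. f (int n + 1))"
proof (cases "c \<le> e")
  case True
  then show ?thesis using sum_int_from_1[of f "e - c"] by (simp add: of_nat_diff)
qed simp

lemma sum_int_from_1_diff_1: "(\<Sum>n\<in>{1..int e - 1}. f n) = (\<Sum>n<e - 1. f (int n + 1))"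
  and sum_int_from_1_diff_2: "(\<Sum>n\<in>{1..int e - 2}. f n) = (\<Sum>n<e - 2. f (int n + 1))"
  using sum_int_from_1_diff[of f e 1] sum_int_from_1_diff[of f e 2] by simp_all

lemma sg_nat [simp]: "sg (int n) = (-1) ^ n"
  by (simp add: sg_def minus_one_power_iff)

lemma sg_Suc: "sg (n + 1) = - sg n" "sg (1 + n) = - sg n" "sg (n + 2) = sg n" "sg (2 + n) = sg n"
  by (simp_all add: sg_def)

lemma bin_nat [simp]: "bin (int n) (int m) = of_nat (n choose m)"
  by (simp add: bin_def)

text \<open>Here m counts the double shifts of the first index, as the index n does in
  \<open>F0\<close> and in the viscous terms.\<close>

lemma Dn_rev: "Dn n f i j k = (\<Sum>m\<le>n. of_nat (n choose m) * f (i + 2 * int m) j (k + 2 * int n - 2 * int m))"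
proof -
  have "Dn n f i j k = (\<Sum>m\<le>n. of_nat (n choose (n - m)) * f (i + 2 * int (n - (n - m))) j (k + 2 * int (n - m)))"
    unfolding Dn_def by (rule sum.nat_diff_reindex[of _ "Suc n", simplified lessThan_Suc_atMost, simplified, symmetric])
  also have "\<dots> = (\<Sum>m\<le>n. of_nat (n choose m) * f (i + 2 * int m) j (k + 2 * int n - 2 * int m))"
    by (intro sum.cong refl) (simp add: binomial_symmetric[symmetric] of_nat_diff algebra_simps)
  finally show ?thesis .
qed

text \<open>The situation of one reduction for the components 1 and 2: \<open>i\<close> is the outer
  index in the direction of the component, \<open>k\<close> the other outer index, and
  \<open>j\<close> the remainder 0 or 1 of \<open>q\<close> after \<open>e\<close> double
  steps.\<close>

locale cell =
  fixes p q r \<alpha> :: int and e :: nat and i j k :: int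
  assumes alpha: "\<alpha> = 1 \<or> \<alpha> = 2" and nonneg: "0 \<le> p" "0 \<le> r"
    and e: "q div 2 = int e" "e > 0"
    and ik: "i = X \<alpha> p q r" "k = X (3 - \<alpha>) p q r"
    and j: "j = q - 2 * int e"
begin

lemma j_01: "j = 0 \<or> j = 1"
  using e j by linarith

lemma q_eq: "q = j + 2 * int e"
  using j by simp

lemma fct_pos: "fct p > 0" "fct q > 0" "fct r > 0"
  by (simp_all add: fct_def)

text \<open>\<open>F0\<close> is the leading term of \<open>pressure_elimination\<close>. Its middle
  index is \<open>j\<close>, hence 0 or 1, so its coefficients are prescribed and the factorial of
  the middle index, being 1, does not show in \<open>F0\<close>.\<close>

lemma F0_eq:
  "fct p * fct q * fct r * F0 u w p q r \<alpha> =
    (-1) ^ e * (Dn (e - 1) (orient \<alpha> (hat (u \<alpha>) w)) (i + 2) j k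
              + Dn (e - 1) (orient \<alpha> (hat (u (3 - \<alpha>)) w)) (i + 1) j (k + 1))"
    if w: "w \<ge> 0"
proof -
  obtain e' where e': "e = Suc e'" using e by (cases e) auto
  have jf: "fct j = 1" using j_01 by (auto simp: fct_def)
  have cfu: "ucf u \<gamma> w P j R = cf (u \<gamma>) w P j R" if "P \<ge> 0" "R \<ge> 0" for \<gamma> P R
    using that w j_01 by (auto simp: ucf_def)
  have qe: "q - 2 * int (Suc e') = j" by (simp add: j e')
  let ?D = "fct p * fct q * fct r"
  have D: "?D \<noteq> 0" using fct_pos by simp
  have canc: "?D * (s * b * (x / ?D * v + y / ?D * v')) = s * (b * (x * v) + b * (y * v'))" for s b x v y v'
    using D by (simp add: field_simps)
  have "?D * F0 u w p q r \<alpha> = (\<Sum>n\<le>e'. (-1) ^ e * (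
      of_nat (e' choose n) * orient \<alpha> (hat (u \<alpha>) w) (i + 2 + 2 * int n) j (k + 2 * int e' - 2 * int n)
      + of_nat (e' choose n) * orient \<alpha> (hat (u (3 - \<alpha>)) w) (i + 1 + 2 * int n) j (k + 1 + 2 * int e' - 2 * int n)))"
    unfolding F0_def e sum_int_from_1 sum_distrib_left canc sg_nat lessThan_Suc_atMost[symmetric] e'
  proof (rule sum.cong[OF refl], goal_cases)
    case (1 n)
    then have n: "n \<le> e'" by simp
    from alpha show ?case
    proof
      assume [simp]: "\<alpha> = 1"
      have 2: "ucf u 1 w (p + sg (1 + 1) * (2 * (int n + 1)) + (1 - 1) * (2 * int (Suc e'))) (q - 2 * int (Suc e'))
          (r + sg 1 * (2 * (int n + 1)) + 2 * (2 - 1) * int (Suc e'))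
        = cf (u 1) w (i + 2 + 2 * int n) j (k + 2 * int e' - 2 * int n)"
        unfolding qe using n nonneg cfu[of "i + 2 + 2 * int n" "k + 2 * int e' - 2 * int n" 1]
        by (simp add: ik X_def sg_def algebra_simps)
      have 3: "ucf u (3 - 1) w (p + sg (1 + 1) * (2 * (int n + 1) - 1) + (1 - 1) * (2 * int (Suc e'))) (q - 2 * int (Suc e'))
          (r + sg 1 * (2 * (int n + 1) - 1) + 2 * (2 - 1) * int (Suc e'))
        = cf (u 2) w (i + 1 + 2 * int n) j (k + 1 + 2 * int e' - 2 * int n)"
        unfolding qe using n nonneg cfu[of "i + 1 + 2 * int n" "k + 1 + 2 * int e' - 2 * int n" 2]
        by (simp add: ik X_def sg_def algebra_simps)
      show ?case
        unfolding \<open>\<alpha> = 1\<close> 2 3 by (simp add: orient_def hat_def jf ik X_def algebra_simps)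
    next
      assume [simp]: "\<alpha> = 2"
      have 2: "ucf u 2 w (p + sg (2 + 1) * (2 * (int n + 1)) + (2 - 1) * (2 * int (Suc e'))) (q - 2 * int (Suc e'))
          (r + sg 2 * (2 * (int n + 1)) + 2 * (2 - 2) * int (Suc e'))
        = cf (u 2) w (k + 2 * int e' - 2 * int n) j (i + 2 + 2 * int n)"
        unfolding qe using n nonneg cfu[of "k + 2 * int e' - 2 * int n" "i + 2 + 2 * int n" 2]
        by (simp add: ik X_def sg_def algebra_simps)
      have 3: "ucf u (3 - 2) w (p + sg (2 + 1) * (2 * (int n + 1) - 1) + (2 - 1) * (2 * int (Suc e'))) (q - 2 * int (Suc e'))
          (r + sg 2 * (2 * (int n + 1) - 1) + 2 * (2 - 2) * int (Suc e'))
        = cf (u 1) w (k + 1 + 2 * int e' - 2 * int n) j (i + 1 + 2 * int n)"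
        unfolding qe using n nonneg cfu[of "k + 1 + 2 * int e' - 2 * int n" "i + 1 + 2 * int n" 1]
        by (simp add: ik X_def sg_def algebra_simps)
      show ?case
        unfolding \<open>\<alpha> = 2\<close> 2 3 by (simp add: orient_def hat_def jf ik X_def algebra_simps)
    qed
  qed
  then show ?thesis
    by (simp add: e' Dn_rev sum.distrib sum_distrib_left distrib_left sum_negf sum_subtractf)
qed

text \<open>In \<open>pressure_elimination\<close> the body acceleration enters as the force -g,
  whence the minus sign.\<close>

lemma F0t_eq:
  assumes w: "w > 0"
  shows "of_int w * (fct p * fct q * fct r) * F0t g w p q r \<alpha> =
    - Phi_ex e (orient \<alpha> (hat (g \<alpha>) (w - 1))) (orient \<alpha> (hat (g (3 - \<alpha>)) (w - 1)))
        (orient \<alpha> (hat (g 0) (w - 1))) i q k"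
proof -
  let ?D = "fct p * fct q * fct r"
  let ?a = "orient \<alpha> (hat (g \<alpha>) (w - 1))" and ?b = "orient \<alpha> (hat (g (3 - \<alpha>)) (w - 1))"
  let ?z = "orient \<alpha> (hat (g 0) (w - 1))"
  have D: "?D \<noteq> 0" using fct_pos by simp
  have w0: "real_of_int w \<noteq> 0" using w by simp
  \<comment> \<open>The first sum of \<open>F0t\<close> leaves \<open>k\<close> unshifted; its
    denominators lack the factorial of \<open>k\<close>, which has already been cancelled.\<close>
  have fk: "fct (X \<alpha> p q r) * fct q * fct k = ?D"
    using alpha by (auto simp: ik X_def)
  have fk': "fct (X \<alpha> p q r) \<noteq> 0" "fct q \<noteq> 0" by (simp_all add: fct_def)
  have 1: "?D * (\<Sum>n\<in>{1..int e}. of_int (sg (n + 1)) *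
      (fct (q - 2 * n + 2) * fct (X \<alpha> p q r + 2 * n - 2) / (fct (X \<alpha> p q r) * fct q)
         * cf (g \<alpha>) (w - 1) (p + (2 - \<alpha>) * (2 * n - 2)) (q - 2 * n + 2) (r + (\<alpha> - 1) * (2 * n - 2))
       - fct (q - 2 * n + 1) * fct (X \<alpha> p q r + 2 * n - 1) / (fct (X \<alpha> p q r) * fct q)
         * cf (g 0) (w - 1) (p + (2 - \<alpha>) * (2 * n - 1)) (q - 2 * n + 1) (r + (\<alpha> - 1) * (2 * n - 1))))
    = - (\<Sum>n<e. (-1) ^ n * (?z (i + 2 * int n + 1) (q - 2 * int n - 1) k - ?a (i + 2 * int n) (q - 2 * int n) k))"
    unfolding fk[symmetric] sum_int_from_1 sum_distrib_left sum_negf[symmetric]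
  proof (rule sum.cong[OF refl], goal_cases)
    case (1 n)
    have c: "fct (X \<alpha> p q r) * fct q * fct k * (s * (x / (fct (X \<alpha> p q r) * fct q) * v - y / (fct (X \<alpha> p q r) * fct q) * v'))
      = s * (x * fct k * v - y * fct k * v')" for s x v y v'
      using fk' by (simp add: field_simps)
    show ?case
      unfolding c using alpha
      by (elim disjE) (simp_all add: orient_def hat_def ik X_def sg_Suc algebra_simps)
  qed
  have 2: "?D * (\<Sum>n\<in>{1..int e - 1}. \<Sum>m\<in>{1..n}. of_int (sg n) *
      (bin (n - 1) (m - 1)
         * (fct (X (3 - \<alpha>) p q r + 2 * m - 1) * fct (q - 2 * n) * fct (X \<alpha> p q r - 2 * m + 2 * n + 1) / ?D)
         * cf (g (3 - \<alpha>)) (w - 1) (p + sg \<alpha> * (2 * m - 1) + 2 * n * (2 - \<alpha>)) (q - 2 * n)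
             (r + sg (\<alpha> + 1) * (2 * m - 1) + 2 * (\<alpha> - 1) * n)
       - bin n m
         * (fct (X (3 - \<alpha>) p q r + 2 * m) * fct (q - 1 - 2 * n) * fct (X \<alpha> p q r - 2 * m + 2 * n + 1) / ?D)
         * cf (g 0) (w - 1) (p + 2 * m * sg \<alpha> + (2 - \<alpha>) * (2 * n + 1)) (q - 1 - 2 * n)
             (r + 2 * m * sg (\<alpha> + 1) + (\<alpha> - 1) * (2 * n + 1))))
    = - (\<Sum>n<e - 1. \<Sum>m\<le>n. (-1) ^ n *
       (of_nat (n choose m) * ?b (i + 2 * int n - 2 * int m + 1) (q - 2 * int n - 2) (k + 2 * int m + 1)
        - of_nat (Suc n choose Suc m) * ?z (i + 2 * int n - 2 * int m + 1) (q - 2 * int n - 3) (k + 2 * int m + 2)))"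
    unfolding sum_int_from_1_diff_1 sum_int_from_1_le sum_distrib_left sum_negf[symmetric]
  proof (intro sum.cong[OF refl], goal_cases)
    case (1 n m)
    have b: "bin (int n + 1) (int m + 1) = of_nat (Suc n choose Suc m)"
      using bin_nat[of "Suc n" "Suc m"] by (simp add: add.commute)
    have c: "?D * (s * (x * (y / ?D) * v - x' * (y' / ?D) * v')) = s * (x * (y * v) - x' * (y' * v'))" for s x y v x' y' v'
      using D by (simp add: field_simps)
    show ?case
      unfolding c b using alpha
      by (elim disjE) (simp_all add: orient_def hat_def ik X_def sg_Suc sg_def[of 1] sg_def[of 2] sg_def[of 3] algebra_simps
          del: binomial_Suc_Suc)
  qed
  have 3: "?D * (\<Sum>n\<in>{1..int e - 2}. \<Sum>m\<in>{1..n}. of_int (sg (n + 1)) * bin n m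
         * (fct (X (3 - \<alpha>) p q r + 2 * m) * fct (q - 2 - 2 * n) * fct (X \<alpha> p q r - 2 * m + 2 * n + 2) / ?D)
         * cf (g \<alpha>) (w - 1) (p + 2 * m * sg \<alpha> + (2 - \<alpha>) * (2 * n + 2)) (q - 2 - 2 * n)
             (r + 2 * m * sg (\<alpha> + 1) + (\<alpha> - 1) * (2 * n + 2)))
    = (\<Sum>n<e - 2. \<Sum>m\<le>n. (-1) ^ n * of_nat (Suc n choose Suc m)
       * ?a (i + 2 * int n - 2 * int m + 2) (q - 2 * int n - 4) (k + 2 * int m + 2))"
    unfolding sum_int_from_1_diff_2 sum_int_from_1_le sum_distrib_left
  proof (intro sum.cong[OF refl], goal_cases)
    case (1 n m)
    have b: "bin (int n + 1) (int m + 1) = of_nat (Suc n choose Suc m)"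
      using bin_nat[of "Suc n" "Suc m"] by (simp add: add.commute)
    have c: "?D * (s * x * (y / ?D) * v) = s * x * (y * v)" for s x y v
      using D by (simp add: field_simps)
    show ?case
      unfolding c b using alpha
      by (elim disjE) (simp_all add: orient_def hat_def ik X_def sg_Suc sg_def[of 1] sg_def[of 2] sg_def[of 3] algebra_simps
          del: binomial_Suc_Suc)
  qed
  have "of_int w * ?D * (1 / of_int w * x + 1 / of_int w * y + 1 / of_int w * z) = ?D * x + ?D * y + ?D * z" for x y z
    using w0 by (simp add: field_simps)
  then show ?thesis
    unfolding F0t_def e by (simp only: 1 2 3 Phi_ex_def minus_add_distrib diff_minus_eq_add minus_diff_eq add_uminus_conv_diff minus_minus)
qed

end

text \<open>For fixed \<open>B\<close> and \<open>\<phi>\<close> the triples \<open>(A, N, M)\<close> run through three triangles, of sizes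
  \<open>e (e + 1) / 2\<close>, \<open>e (e - 1) / 2\<close> and \<open>(e - 1) (e - 2) / 2\<close>.\<close>

definition enum_sum :: "int \<Rightarrow> (int \<Rightarrow> int \<Rightarrow> int \<Rightarrow> 'a) \<Rightarrow> 'a::comm_monoid_add" where
  "enum_sum e f = (\<Sum>n\<in>{1..e}. \<Sum>m\<in>{1..n}. f 0 n m) + (\<Sum>n\<in>{1..e - 1}. \<Sum>m\<in>{1..n}. f 1 n m)
     + (\<Sum>n\<in>{1..e - 2}. \<Sum>m\<in>{1..n}. f 2 n m)"

text \<open>In \<open>Phi_ex\<close> the array \<open>f0\<close> has a single triangle with upper
  binomial index n + 1. Pascal's rule splits it into a triangle with the binomials of A = 1 and one,
  moved by a row, with those of A = 2.\<close>

lemma Pascal_triangle_sum: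
  "(\<Sum>n<e. \<Sum>m\<le>n. (-1) ^ n * of_nat (Suc n choose Suc m) * h n m)
   = (\<Sum>n<e. \<Sum>m\<le>n. (-1) ^ n * of_nat (n choose m) * h n m)
     + (\<Sum>n<e - 1. \<Sum>m\<le>n. (-1) ^ Suc n * of_nat (Suc n choose Suc m) * (h (Suc n) m :: real))"
proof (cases e)
  case (Suc e')
  have "(\<Sum>n<Suc e'. \<Sum>m\<le>n. (-1) ^ n * of_nat (n choose Suc m) * h n m)
    = (\<Sum>n<e'. \<Sum>m\<le>n. (-1) ^ Suc n * of_nat (Suc n choose Suc m) * (h (Suc n) m :: real))"
    by (subst sum.lessThan_Suc_shift) (simp add: binomial_eq_0 del: sum.lessThan_Suc binomial_Suc_Suc)
  then show ?thesis
    by (simp add: Suc sum.distrib distrib_left distrib_right del: sum.lessThan_Suc)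
qed simp

lemma fct_quotient_binomial:
  assumes "m \<le> n"
  shows "fct (int n) / (fct (int m) * fct (int n - int m)) = of_nat (n choose m)"
  using assms by (simp add: fct_def binomial_fact flip: of_nat_diff)

context cell begin

text \<open>B = 0 collects the terms with the middle component. B = 1 collects the outer ones: the
  component number becomes \<open>\<alpha>\<close> for A = 0 and A = 2, and
  \<open>3 - \<alpha>\<close> for A = 1.\<close>

lemma enum_sum_H_cf:
  fixes arr :: "int \<Rightarrow> arr"
  shows "(\<Sum>b\<in>{0, 1}. enum_sum (int e) (\<lambda>a n m. H_cf q a n m b
      * arr (b * (\<alpha> + a * (a - 2) * (2 * \<alpha> - 3))) (Y1 p q \<alpha> a n m b) (Y0 q a n b) (Y2 q r \<alpha> a n m b)))
    = Phi_ex e (orient \<alpha> (arr \<alpha>)) (orient \<alpha> (arr (3 - \<alpha>))) (orient \<alpha> (arr 0)) i q k"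
proof -
  let ?a = "orient \<alpha> (arr \<alpha>)" and ?b = "orient \<alpha> (arr (3 - \<alpha>))" and ?z = "orient \<alpha> (arr 0)"
  let ?t = "\<lambda>b a n m. H_cf q a n m b
      * arr (b * (\<alpha> + a * (a - 2) * (2 * \<alpha> - 3))) (Y1 p q \<alpha> a n m b) (Y0 q a n b) (Y2 q r \<alpha> a n m b)"
  \<comment> \<open>For A = 0 the Kronecker delta in \<open>H_cf\<close> keeps only the diagonal of
    the triangle.\<close>
  have diag: "(\<Sum>m\<in>{1..int n + 1}. ?t b 0 (int n + 1) m) = ?t b 0 (int n + 1) (int n + 1)" for b n
    by (subst sum.remove[of _ "int n + 1"]) (auto simp: H_cf_def intro!: sum.neutral)
  have A00: "(\<Sum>n\<in>{1..int e}. \<Sum>m\<in>{1..n}. ?t 0 0 n m)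
      = (\<Sum>n<e. (-1) ^ n * ?z (i + 2 * int n + 1) (q - 2 * int n - 1) k)"
    \<comment> \<open>In triangle 0 the shifts decrease with n (they contain
      \<open>2 * e - 2 * n\<close>), so the sum has to be reversed.\<close>
    unfolding sum_int_from_1 diag
      sum.nat_diff_reindex[of "\<lambda>n. (-1) ^ n * ?z (i + 2 * int n + 1) (q - 2 * int n - 1) k" e, symmetric]
  proof (rule sum.cong[OF refl], goal_cases)
    case (1 n)
    then have n: "n < e" by simp
    have s: "(-1) ^ (e - Suc n) = real_of_int (sg (int n + 1 + 0 + int e))"
      using n unfolding sg_def minus_one_power_iff by (simp add: even_diff_nat)
    show ?case
      using alpha n unfolding s
      by (elim disjE) (simp_all add: H_cf_def Y0_def Y1_def Y2_def e orient_def ik X_def of_nat_diff algebra_simps)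
  qed
  have A01: "(\<Sum>n\<in>{1..int e}. \<Sum>m\<in>{1..n}. ?t 1 0 n m)
      = (\<Sum>n<e. (-1) ^ n * - ?a (i + 2 * int n) (q - 2 * int n) k)"
    unfolding sum_int_from_1 diag
      sum.nat_diff_reindex[of "\<lambda>n. (-1) ^ n * - ?a (i + 2 * int n) (q - 2 * int n) k" e, symmetric]
  proof (rule sum.cong[OF refl], goal_cases)
    case (1 n)
    then have n: "n < e" by simp
    have s: "(-1) ^ (e - Suc n) = - real_of_int (sg (int n + 1 + 1 + int e))"
      using n unfolding sg_def minus_one_power_iff by (simp add: even_diff_nat)
    show ?case
      using alpha n unfolding s
      by (elim disjE) (simp_all add: H_cf_def Y0_def Y1_def Y2_def e orient_def ik X_def of_nat_diff algebra_simps)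
  qed
  have H1: "H_cf q 1 (int n + 1) (int m + 1) b = of_int (sg (int n + 1 + b)) * of_nat (n choose m)" if "m \<le> n" for n m b
    using fct_quotient_binomial[OF that] by (simp add: H_cf_def)
  have H2: "H_cf q 2 (int n + 1) (int m + 1) b = of_int (sg (int n + b)) * of_nat (Suc n choose Suc m)" if "m \<le> n" for n m b
    using fct_quotient_binomial[of "Suc m" "Suc n"] that
    by (simp add: H_cf_def sg_def add.commute del: binomial_Suc_Suc)
  have A10: "(\<Sum>n\<in>{1..int e - 1}. \<Sum>m\<in>{1..n}. ?t 0 1 n m)
      = - (\<Sum>n<e - 1. \<Sum>m\<le>n. (-1) ^ n * of_nat (n choose m)
          * ?z (i + 2 * int n - 2 * int m + 1) (q - 2 * int n - 3) (k + 2 * int m + 2))"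
    unfolding sum_int_from_1_diff_1 sum_int_from_1_le sum_negf[symmetric]
  proof (intro sum.cong[OF refl], goal_cases)
    case (1 n m)
    then have "m \<le> n" by simp
    show ?case
      using alpha unfolding H1[OF \<open>m \<le> n\<close>]
      by (elim disjE) (simp_all add: Y0_def Y1_def Y2_def orient_def ik X_def sg_Suc sg_def[of 1] sg_def[of 2] sg_def[of 3] algebra_simps)
  qed
  have A11: "(\<Sum>n\<in>{1..int e - 1}. \<Sum>m\<in>{1..n}. ?t 1 1 n m)
      = (\<Sum>n<e - 1. \<Sum>m\<le>n. (-1) ^ n * of_nat (n choose m)
          * ?b (i + 2 * int n - 2 * int m + 1) (q - 2 * int n - 2) (k + 2 * int m + 1))"
    unfolding sum_int_from_1_diff_1 sum_int_from_1_le
  proof (intro sum.cong[OF refl], goal_cases)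
    case (1 n m)
    then have "m \<le> n" by simp
    show ?case
      using alpha unfolding H1[OF \<open>m \<le> n\<close>]
      by (elim disjE) (simp_all add: Y0_def Y1_def Y2_def orient_def ik X_def sg_Suc sg_def[of 1] sg_def[of 2] sg_def[of 3] algebra_simps)
  qed
  have A20: "(\<Sum>n\<in>{1..int e - 2}. \<Sum>m\<in>{1..n}. ?t 0 2 n m)
      = - (\<Sum>n<e - 2. \<Sum>m\<le>n. (-1) ^ Suc n * of_nat (Suc n choose Suc m)
          * ?z (i + 2 * int (Suc n) - 2 * int m + 1) (q - 2 * int (Suc n) - 3) (k + 2 * int m + 2))"
    unfolding sum_int_from_1_diff_2 sum_int_from_1_le sum_negf[symmetric]
  proof (intro sum.cong[OF refl], goal_cases)
    case (1 n m)
    then have "m \<le> n" by simp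
    show ?case
      using alpha unfolding H2[OF \<open>m \<le> n\<close>]
      by (elim disjE) (simp_all add: Y0_def Y1_def Y2_def orient_def ik X_def sg_Suc sg_def[of 1] sg_def[of 2] sg_def[of 3] algebra_simps del: binomial_Suc_Suc)
  qed
  have A21: "(\<Sum>n\<in>{1..int e - 2}. \<Sum>m\<in>{1..n}. ?t 1 2 n m)
      = - (\<Sum>n<e - 2. \<Sum>m\<le>n. (-1) ^ n * of_nat (Suc n choose Suc m)
          * ?a (i + 2 * int n - 2 * int m + 2) (q - 2 * int n - 4) (k + 2 * int m + 2))"
    unfolding sum_int_from_1_diff_2 sum_int_from_1_le sum_negf[symmetric]
  proof (intro sum.cong[OF refl], goal_cases)
    case (1 n m)
    then have "m \<le> n" by simp
    show ?case
      using alpha unfolding H2[OF \<open>m \<le> n\<close>]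
      by (elim disjE) (simp_all add: Y0_def Y1_def Y2_def orient_def ik X_def sg_Suc sg_def[of 1] sg_def[of 2] sg_def[of 3] algebra_simps del: binomial_Suc_Suc)
  qed
  have "e - 1 - 1 = e - 2" by simp
  note P = Pascal_triangle_sum[where e = "e - 1" and h = "\<lambda>n m. ?z (i + 2 * int n - 2 * int m + 1) (q - 2 * int n - 3) (k + 2 * int m + 2)",
      unfolded this]
  have PE: "Phi_ex e ?a ?b ?z i q k = (\<Sum>n<e. (-1) ^ n * ?z (i + 2 * int n + 1) (q - 2 * int n - 1) k)
     + (\<Sum>n<e. (-1) ^ n * - ?a (i + 2 * int n) (q - 2 * int n) k)
     + (\<Sum>n<e - 1. \<Sum>m\<le>n. (-1) ^ n * of_nat (n choose m)
          * ?b (i + 2 * int n - 2 * int m + 1) (q - 2 * int n - 2) (k + 2 * int m + 1))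
     - (\<Sum>n<e - 1. \<Sum>m\<le>n. (-1) ^ n * of_nat (Suc n choose Suc m)
          * ?z (i + 2 * int n - 2 * int m + 1) (q - 2 * int n - 3) (k + 2 * int m + 2))
     - (\<Sum>n<e - 2. \<Sum>m\<le>n. (-1) ^ n * of_nat (Suc n choose Suc m)
          * ?a (i + 2 * int n - 2 * int m + 2) (q - 2 * int n - 4) (k + 2 * int m + 2))"
    by (simp add: Phi_ex_def right_diff_distrib sum_subtractf sum_negf mult.assoc del: binomial_Suc_Suc)
  have "(\<Sum>b\<in>{0, 1}. enum_sum (int e) (?t b)) = enum_sum (int e) (?t 0) + enum_sum (int e) (?t 1)"
    by simp
  then show ?thesis
    unfolding PE P enum_sum_def A00 A01 A10 A11 A20 A21 by linarith
qed

text \<open>The sum over z lists the summands of \<open>Phi_Lap\<close>. The kinds 1 to 5 occur for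
  n = 1 only; kind 6 gives the binomial summands of \<open>Dn e\<close> except the last, and kind 5
  is that last one.\<close>

lemma viscous_terms:
  assumes w: "w > 0"
    and dv: "\<And>P Q R. 0 \<le> P \<Longrightarrow> 0 \<le> Q \<Longrightarrow> 0 \<le> R \<Longrightarrow>
      hat (u 1) (w - 1) (P + 1) Q R + hat (u 2) (w - 1) P Q (R + 1) + hat (u 0) (w - 1) P (Q + 1) R = 0"
  shows "of_int w * (fct p * fct q * fct r) * (\<Sum>n\<in>{1..int e}. \<Sum>z\<in>{1..8}. F_cf \<nu> g u z w p q r \<alpha> n
        * ucf u (kapp z \<alpha>) (w - 1) (xi z p q \<alpha> n) (Delt z q) (epsi z q r \<alpha> n))
    = - \<nu> * Phi e (Lap (orient \<alpha> (hat (u \<alpha>) (w - 1)))) (Lap (orient \<alpha> (hat (u (3 - \<alpha>)) (w - 1))))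
         (Lap (orient \<alpha> (hat (u 0) (w - 1)))) i q k"
proof -
  let ?a = "orient \<alpha> (hat (u \<alpha>) (w - 1))" and ?b = "orient \<alpha> (hat (u (3 - \<alpha>)) (w - 1))"
  let ?z = "orient \<alpha> (hat (u 0) (w - 1))"
  let ?D = "fct p * fct q * fct r"
  let ?W = "of_int w * ?D"
  let ?t = "\<lambda>n z. F_cf \<nu> g u z w p q r \<alpha> n
        * ucf u (kapp z \<alpha>) (w - 1) (xi z p q \<alpha> n) (Delt z q) (epsi z q r \<alpha> n)"
  obtain e' where e': "e = Suc e'" using e by (cases e) auto
  have D: "?D \<noteq> 0" and w0: "real_of_int w \<noteq> 0" using fct_pos w by simp_all
  have qpos: "q \<ge> 0" using q_eq j_01 by auto
  have qe: "q = j + 2 * int e" by (rule q_eq)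
  \<comment> \<open>For e = 1 the kinds 4 and 8 refer to the same coefficient with opposite signs
    and cancel in \<open>Phi_Lap\<close>; the Heaviside factors drop both of them.\<close>
  have h: "heav (of_int (q - 4)) = (if e' = 0 then 0 else 1)"
    using q_eq j_01 e' by (auto simp: heav_def)
  \<comment> \<open>At the two possible values j = 0 and j = 1 these factorials agree with linear
    functions of \<open>j\<close>. This is the origin of the factors 1 + q - 2 e and 2 (1 + 2 q - 4
    e) in \<open>F_cf\<close>.\<close>
  have jf: "fct (j + 1) = of_int (j + 1)" "fct (j + 2) = 2 * of_int (1 + 2 * j)"
    using j_01 by (auto simp: fct_def fact_numeral)
  have fs: "fct (x + 1) = of_int (x + 1) * fct x" "fct (1 + x) = of_int (x + 1) * fct x" if "x \<ge> 0" for x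
    using that by (simp_all add: fct_def nat_add_distrib)
  have fs2: "fct (x + 2) = of_int ((x + 1) * (x + 2)) * fct x" if "x \<ge> 0" for x
    using fs(1)[of x] fs(1)[of "x + 1"] that by (simp add: add.commute mult_ac)
  have cfu: "ucf u \<gamma> (w - 1) P Q R = cf (u \<gamma>) (w - 1) P Q R" if "P \<ge> 0" "Q \<ge> 0" "R \<ge> 0" for \<gamma> P Q R
    using that w by (auto simp: ucf_def)
  have z1: "?W * ?t 1 1 = \<nu> * ?a i q (k + 2)"
    using alpha w0 D nonneg qpos fs2
    by (elim disjE) (simp_all add: F_cf_def xi_def Delt_def epsi_def kapp_def cfu orient_def hat_def ik X_def field_simps)
  have z2: "?W * ?t 1 2 = \<nu> * ?a i (q + 2) k"
    using alpha w0 D nonneg qpos fs2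
    by (elim disjE) (simp_all add: F_cf_def xi_def Delt_def epsi_def kapp_def cfu orient_def hat_def ik X_def field_simps)
  have z3: "?W * ?t 1 3 = - \<nu> * ?z (i + 1) (q + 1) k"
    using alpha
  proof (elim disjE)
    assume [simp]: "\<alpha> = 1"
    show ?thesis
      using w0 D nonneg qpos fs(1)[of p] fs(1)[of q] fs(1)[of r] h
      by (simp add: F_cf_def xi_def Delt_def epsi_def kapp_def cfu orient_def hat_def ik X_def) (simp add: field_simps)?
  next
    assume [simp]: "\<alpha> = 2"
    show ?thesis
      using w0 D nonneg qpos fs(1)[of p] fs(1)[of q] fs(1)[of r] h
      by (simp add: F_cf_def xi_def Delt_def epsi_def kapp_def cfu orient_def hat_def ik X_def) (simp add: field_simps)?
  qed
  have z4: "?W * ?t 1 4 = - \<nu> * (if e' = 0 then 0 else 1) * ?b (i + 1) q (k + 1)"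
    using alpha
  proof (elim disjE)
    assume [simp]: "\<alpha> = 1"
    show ?thesis
      using w0 D nonneg qpos fs(1)[of p] fs(1)[of q] fs(1)[of r] h
      by (simp add: F_cf_def xi_def Delt_def epsi_def kapp_def cfu orient_def hat_def ik X_def) (simp add: field_simps)?
  next
    assume [simp]: "\<alpha> = 2"
    show ?thesis
      using w0 D nonneg qpos fs(1)[of p] fs(1)[of q] fs(1)[of r] h
      by (simp add: F_cf_def xi_def Delt_def epsi_def kapp_def cfu orient_def hat_def ik X_def) (simp add: field_simps)?
  qed
  have z5: "?W * ?t 1 5 = \<nu> * (-1) ^ e * ?z (i + 2 * int e + 1) (j + 1) k"
    using alpha w0 D nonneg j_01 jf(1) qe
    by (elim disjE) (simp_all add: F_cf_def e xi_def Delt_def epsi_def kapp_def cfu orient_def hat_def ik X_def field_simps)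
  have z0: "?t (int n + 1) z = 0" if "n > 0" "z \<in> {1, 2, 3, 4, 5}" for n z
    using that by (auto simp: F_cf_def)
  have z6: "?W * ?t (int n + 1) 6 = \<nu> * (-1) ^ e * of_nat (e choose n) * ?z (i + 2 * int n + 1) (j + 1) (k + 2 * int e - 2 * int n)"
    if "n < e" for n
    using alpha w0 D nonneg j_01 jf(1) that qe
    by (elim disjE) (simp_all add: F_cf_def e xi_def Delt_def epsi_def kapp_def cfu orient_def hat_def ik X_def sg_def[of 1] sg_def[of 2] sg_def[of 3] field_simps)
  have z7: "?W * ?t (int n + 1) 7 = - \<nu> * (-1) ^ e * of_nat (e' choose n) * ?a (i + 2 * int n + 2) (j + 2) (k + 2 * int e' - 2 * int n)"
    if "n < e" for n
    using alpha w0 D nonneg j_01 jf(2) that qe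
    by (elim disjE) (simp_all add: F_cf_def e e' xi_def Delt_def epsi_def kapp_def cfu orient_def hat_def ik X_def sg_Suc sg_def[of 1] sg_def[of 2] sg_def[of 3] field_simps)
  have z8: "?W * ?t (int n + 1) 8 = - \<nu> * (-1) ^ e * (if e' = 0 then 0 else 1) * of_nat (e' choose n) * ?b (i + 1 + 2 * int n) (j + 2) (k + 1 + 2 * int e' - 2 * int n)"
    if "n < e" for n
    using alpha w0 D nonneg j_01 jf(2) that qe h
    by (elim disjE) (simp_all add: F_cf_def e e' xi_def Delt_def epsi_def kapp_def cfu orient_def hat_def ik X_def sg_Suc sg_def[of 1] sg_def[of 2] sg_def[of 3] field_simps)
  have "{1..8::int} = {1, 2, 3, 4, 5, 6, 7, 8}" by auto
  then have split: "(\<Sum>z\<in>{1..8}. f z) = (\<Sum>z\<in>{1, 2, 3, 4, 5}. f z) + f 6 + f 7 + f 8" for f :: "int \<Rightarrow> real"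
    by simp
  have first: "(\<Sum>n<e. \<Sum>z\<in>{1, 2, 3, 4, 5}. ?t (int n + 1) z) = (\<Sum>z\<in>{1, 2, 3, 4, 5}. ?t 1 z)"
  proof -
    have "(\<Sum>n<e. \<Sum>z\<in>{1, 2, 3, 4, 5}. ?t (int n + 1) z)
      = (\<Sum>z\<in>{1, 2, 3, 4, 5}. ?t (int 0 + 1) z) + (\<Sum>n<e'. \<Sum>z\<in>{1, 2, 3, 4, 5}. ?t (int (Suc n) + 1) z)"
      unfolding e' by (rule sum.lessThan_Suc_shift)
    also have "(\<Sum>n<e'. \<Sum>z\<in>{1, 2, 3, 4, 5}. ?t (int (Suc n) + 1) z) = 0"
      by (intro sum.neutral ballI z0) auto
    finally show ?thesis by simp
  qed
  have "?W * (\<Sum>n\<in>{1..int e}. \<Sum>z\<in>{1..8}. ?t n z)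
    = (?W * ?t 1 1 + ?W * ?t 1 2 + ?W * ?t 1 3 + ?W * ?t 1 4 + ?W * ?t 1 5)
      + (\<Sum>n<e. ?W * ?t (int n + 1) 6) + (\<Sum>n<e. ?W * ?t (int n + 1) 7) + (\<Sum>n<e. ?W * ?t (int n + 1) 8)"
    unfolding sum_int_from_1 split sum.distrib first
    by (simp only: distrib_left sum_distrib_left) (simp add: algebra_simps)
  also have "(\<Sum>n<e. ?W * ?t (int n + 1) 6) = (\<Sum>n<e. \<nu> * (-1) ^ e * of_nat (e choose n) * ?z (i + 2 * int n + 1) (j + 1) (k + 2 * int e - 2 * int n))"
    by (rule sum.cong[OF refl], rule z6) simp
  also have "\<dots> = \<nu> * (-1) ^ e * Dn e ?z (i + 1) (j + 1) k - \<nu> * (-1) ^ e * ?z (i + 2 * int e + 1) (j + 1) k"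
    by (simp add: Dn_rev sum_distrib_left distrib_left lessThan_Suc_atMost[symmetric] mult_ac add_ac)
  also have "(\<Sum>n<e. ?W * ?t (int n + 1) 7) = (\<Sum>n<e. - \<nu> * (-1) ^ e * of_nat (e' choose n) * ?a (i + 2 * int n + 2) (j + 2) (k + 2 * int e' - 2 * int n))"
    by (rule sum.cong[OF refl], rule z7) simp
  also have "\<dots> = - \<nu> * (-1) ^ e * Dn e' ?a (i + 2) (j + 2) k"
    by (simp add: Dn_rev sum_distrib_left distrib_left e' lessThan_Suc_atMost mult_ac add_ac)
  also have "(\<Sum>n<e. ?W * ?t (int n + 1) 8) = (\<Sum>n<e. - \<nu> * (-1) ^ e * (if e' = 0 then 0 else 1) * of_nat (e' choose n) * ?b (i + 1 + 2 * int n) (j + 2) (k + 1 + 2 * int e' - 2 * int n))"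
    by (rule sum.cong[OF refl], rule z8) simp
  also have "\<dots> = - \<nu> * (-1) ^ e * (if e' = 0 then 0 else 1) * Dn e' ?b (i + 1) (j + 2) (k + 1)"
    unfolding Dn_rev sum_distrib_left e' lessThan_Suc_atMost
    by (intro sum.cong refl) (simp only: mult.assoc)
  finally have *: "?W * (\<Sum>n\<in>{1..int e}. \<Sum>z\<in>{1..8}. ?t n z)
    = (?W * ?t 1 1 + ?W * ?t 1 2 + ?W * ?t 1 3 + ?W * ?t 1 4 + ?W * ?t 1 5)
      + (\<nu> * (-1) ^ e * Dn e ?z (i + 1) (j + 1) k - \<nu> * (-1) ^ e * ?z (i + 2 * int e + 1) (j + 1) k)
      + - \<nu> * (-1) ^ e * Dn e' ?a (i + 2) (j + 2) k
      + - \<nu> * (-1) ^ e * (if e' = 0 then 0 else 1) * Dn e' ?b (i + 1) (j + 2) (k + 1)" .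
  have dv': "?a (i + 1) j k + ?b i j (k + 1) + ?z i (j + 1) k = 0" if "0 \<le> i" "0 \<le> j" "0 \<le> k" for i j k
    using alpha dv[of i j k] dv[of k j i] that by (elim disjE) (simp_all add: orient_def)
  have nn: "0 \<le> i" "0 \<le> j" "0 \<le> k" using ik alpha nonneg j_01 by (auto simp: X_def)
  have L: "- Phi e (Lap ?a) (Lap ?b) (Lap ?z) i q k
    = ?a i q (k + 2) + ?a i (q + 2) k - ?z (i + 1) (q + 1) k - ?b (i + 1) q (k + 1)
      + (-1) ^ e * Dn e ?z (i + 1) (j + 1) k
      - (-1) ^ e * (Dn e' ?a (i + 2) (j + 2) k + Dn e' ?b (i + 1) (j + 2) (k + 1))"
    using Phi_Lap[of ?a ?b ?z i j k e, OF dv' nn] e(2) unfolding qe by (simp add: e')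
  have "- \<nu> * Phi e (Lap ?a) (Lap ?b) (Lap ?z) i q k = \<nu> * (- Phi e (Lap ?a) (Lap ?b) (Lap ?z) i q k)"
    by simp
  also have "\<dots> = ?W * (\<Sum>n\<in>{1..int e}. \<Sum>z\<in>{1..8}. ?t n z)"
    unfolding L * z1 z2 z3 z4 z5
    by (cases "e' = 0") (simp_all add: e' qe algebra_simps)
  finally show ?thesis by (rule sym)
qed

end

lemma atLeastAtMost_minus_1_int: "{0..j - 1} = {0..<j::int}"
  by auto

section \<open>Enumeration of the summands\<close>

definition prefix_sum :: "(int \<Rightarrow> int) \<Rightarrow> int \<Rightarrow> int" where
  "prefix_sum S j = (\<Sum>d\<in>{0..<j}. S d)"

lemma prefix_sum_0 [simp]: "prefix_sum S 0 = 0"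
  by (simp add: prefix_sum_def)

lemma prefix_sum_Suc: "j \<ge> 0 \<Longrightarrow> prefix_sum S (j + 1) = prefix_sum S j + S j"
proof -
  assume "j \<ge> 0"
  then have "{0..<j + 1} = insert j {0..<j}" by auto
  then show ?thesis by (simp add: prefix_sum_def)
qed

lemma prefix_sum_mono:
  assumes "\<And>d. 0 \<le> d \<Longrightarrow> d < l \<Longrightarrow> 0 \<le> S d" "j \<le> l"
  shows "prefix_sum S j \<le> prefix_sum S l"
  unfolding prefix_sum_def by (rule sum_mono2) (use assms in auto)

text \<open>The basic numbering: consecutive blocks of lengths \<open>S d\<close>, with a code
  consisting of the start of its block and an offset. The numberings of convective terms, triangles
  and tree branches are instances.\<close>

lemma sum_prefix_blocks:
  fixes S :: "int \<Rightarrow> int"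
  assumes "\<And>d. 0 \<le> d \<Longrightarrow> d < j \<Longrightarrow> 0 \<le> S d" "0 \<le> j"
  shows "(\<Sum>\<tau>\<in>{0..<prefix_sum S j}. h \<tau>) = (\<Sum>d\<in>{0..<j}. \<Sum>\<iota>\<in>{0..<S d}. h (prefix_sum S d + \<iota>))"
  using assms(2,1)
proof (induction j rule: int_ge_induct)
  case (step j)
  have le: "0 \<le> prefix_sum S j" unfolding prefix_sum_def by (rule sum_nonneg) (use step.prems in auto)
  have "0 \<le> S j" using step by simp
  then have "{0..<prefix_sum S (j + 1)} = {0..<prefix_sum S j} \<union> {prefix_sum S j..<prefix_sum S j + S j}"
    using le step.hyps by (auto simp: prefix_sum_Suc)
  then have "(\<Sum>\<tau>\<in>{0..<prefix_sum S (j + 1)}. h \<tau>)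
      = (\<Sum>\<tau>\<in>{0..<prefix_sum S j}. h \<tau>) + (\<Sum>\<tau>\<in>{prefix_sum S j..<prefix_sum S j + S j}. h \<tau>)"
    by (simp add: sum.union_disjoint)
  also have "(\<Sum>\<tau>\<in>{prefix_sum S j..<prefix_sum S j + S j}. h \<tau>) = (\<Sum>\<iota>\<in>{0..<S j}. h (prefix_sum S j + \<iota>))"
    by (rule sum.reindex_bij_betw[symmetric], rule bij_betw_byWitness[where f' = "\<lambda>x. x - prefix_sum S j"]) auto
  also have "(\<Sum>\<tau>\<in>{0..<prefix_sum S j}. h \<tau>) = (\<Sum>d\<in>{0..<j}. \<Sum>\<iota>\<in>{0..<S d}. h (prefix_sum S d + \<iota>))"
    using step by simp
  also have "\<dots> + (\<Sum>\<iota>\<in>{0..<S j}. h (prefix_sum S j + \<iota>)) = (\<Sum>d\<in>insert j {0..<j}. \<Sum>\<iota>\<in>{0..<S d}. h (prefix_sum S d + \<iota>))"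
    by (simp add: add.commute)
  also have "insert j {0..<j} = {0..<j + 1}" using step.hyps by auto
  finally show ?case .
qed simp

lemma sum_div_mod:
  fixes c m :: int
  assumes "c > 0" "m \<ge> 0"
  shows "(\<Sum>d\<in>{0..<m * c}. h (d div c) (d mod c)) = (\<Sum>x\<in>{0..<m}. \<Sum>y\<in>{0..<c}. h x y)"
proof -
  have P: "prefix_sum (\<lambda>_. c) j = j * c" if "j \<ge> 0" for j
    using that by (simp add: prefix_sum_def)
  have "(\<Sum>d\<in>{0..<m * c}. h (d div c) (d mod c))
    = (\<Sum>x\<in>{0..<m}. \<Sum>y\<in>{0..<c}. h ((prefix_sum (\<lambda>_. c) x + y) div c) ((prefix_sum (\<lambda>_. c) x + y) mod c))"
    using sum_prefix_blocks[of m "\<lambda>_. c" "\<lambda>d. h (d div c) (d mod c)"] assms by (simp add: P)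
  also have "\<dots> = (\<Sum>x\<in>{0..<m}. \<Sum>y\<in>{0..<c}. h x y)"
    by (intro sum.cong refl) (simp add: P add.commute)
  finally show ?thesis .
qed

text \<open>If g is the m-th number in row n + 1 of the triangular numbering, then 8 g - 7 lies
  between (2 n + 1)^2, inclusive, and (2 n + 3)^2, exclusive.\<close>

lemma floor_triangular_root:
  assumes "1 \<le> m" "m \<le> n + 1" "0 \<le> n"
  shows "\<lfloor>(1 + sqrt (8 * real_of_int (n * (n + 1) div 2 + m) - 7)) / 2\<rfloor> = n + 1"
proof -
  define g where "g = n * (n + 1) div 2 + m"
  have g: "8 * g = 4 * n\<^sup>2 + 4 * n + 8 * m"
  proof -
    have "even (n * (n + 1))" by simp
    then obtain t where "n * (n + 1) = 2 * t" by blast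
    then show ?thesis unfolding g_def by (simp add: power2_eq_square algebra_simps)
  qed
  have "(2 * n + 1)\<^sup>2 \<le> 8 * g - 7" "8 * g - 7 < (2 * n + 3)\<^sup>2"
    using assms unfolding g by (simp_all add: power2_eq_square algebra_simps)
  then have "real_of_int ((2 * n + 1)\<^sup>2) \<le> real_of_int (8 * g - 7)" "real_of_int (8 * g - 7) < real_of_int ((2 * n + 3)\<^sup>2)"
    by (simp_all only: of_int_le_iff of_int_less_iff)
  then have "real_of_int (2 * n + 1) \<le> sqrt (real_of_int (8 * g - 7))"
    "sqrt (real_of_int (8 * g - 7)) < real_of_int (2 * n + 3)"
    using assms by (auto intro!: real_le_rsqrt real_less_lsqrt)
  then show ?thesis
    unfolding g_def[symmetric] by (intro floor_unique) (simp_all add: field_simps)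
qed

text \<open>Rows of lengths 1, 2, ..., N are blocks. The value N = -1 must be covered because the
  third triangle has N = e - 2.\<close>

lemma sum_triangular:
  assumes "\<And>n m. 1 \<le> n \<Longrightarrow> n \<le> N \<Longrightarrow> 1 \<le> m \<Longrightarrow> m \<le> n \<Longrightarrow> h (n * (n - 1) div 2 + m - 1) = g n m"
    and "-1 \<le> N"
  shows "(\<Sum>y\<in>{0..<N * (N + 1) div 2}. h y) = (\<Sum>n\<in>{1..N::int}. \<Sum>m\<in>{1..n}. g n m)"
proof (cases "N \<ge> 0")
  case True
  have P: "prefix_sum (\<lambda>d. d + 1) j = j * (j + 1) div 2" if "j \<ge> 0" for j
    using that
  proof (induction j rule: int_ge_induct)
    case (step j)
    have "(j + 1) * (j + 1 + 1) = j * (j + 1) + 2 * (j + 1)" by (simp add: algebra_simps)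
    then show ?case using step by (simp add: prefix_sum_Suc)
  qed simp
  have "(\<Sum>y\<in>{0..<N * (N + 1) div 2}. h y) = (\<Sum>d\<in>{0..<N}. \<Sum>\<iota>\<in>{0..<d + 1}. h (prefix_sum (\<lambda>d. d + 1) d + \<iota>))"
    using sum_prefix_blocks[of N "\<lambda>d. d + 1" h] True by (simp add: P)
  also have "\<dots> = (\<Sum>d\<in>{0..<N}. \<Sum>\<iota>\<in>{0..<d + 1}. g (d + 1) (\<iota> + 1))"
  proof (intro sum.cong refl)
    fix d \<iota> assume "d \<in> {0..<N}" "\<iota> \<in> {0..<d + 1}"
    then show "h (prefix_sum (\<lambda>d. d + 1) d + \<iota>) = g (d + 1) (\<iota> + 1)"
      using assms(1)[of "d + 1" "\<iota> + 1"] P[of d] by (simp add: mult.commute)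
  qed
  also have "\<dots> = (\<Sum>d\<in>{0..<N}. \<Sum>m\<in>{1..d + 1}. g (d + 1) m)"
    by (intro sum.cong refl sum.reindex_bij_betw, rule bij_betw_byWitness[where f' = "\<lambda>x. x - 1"]) auto
  also have "\<dots> = (\<Sum>n\<in>{1..N}. \<Sum>m\<in>{1..n}. g n m)"
    by (rule sum.reindex_bij_betw[of "\<lambda>d. d + 1" _ _ "\<lambda>n. \<Sum>m\<in>{1..n}. g n m"],
        rule bij_betw_byWitness[where f' = "\<lambda>x. x - 1"]) auto
  finally show ?thesis .
next
  case False
  then have "N = -1" using assms(2) by simp
  then show ?thesis by simp
qed

lemma triangular_decode:
  assumes "1 \<le> n" "1 \<le> m" "m \<le> n" "\<gamma> = n * (n - 1) div 2 + m"
  shows "\<lfloor>(1 + sqrt (8 * real_of_int \<gamma> - 7)) / 2\<rfloor> = (n::int)"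
    and "\<gamma> - ((n - 1)\<^sup>2 + n - 1) div 2 = m"
proof -
  show "\<lfloor>(1 + sqrt (8 * real_of_int \<gamma> - 7)) / 2\<rfloor> = n"
    using floor_triangular_root[of m "n - 1"] assms by (simp add: mult.commute)
  have "(n - 1)\<^sup>2 + n - 1 = n * (n - 1)" by (simp add: power2_eq_square algebra_simps)
  then show "\<gamma> - ((n - 1)\<^sup>2 + n - 1) div 2 = m" using assms(4) by simp
qed

lemma two_triangular: "2 * (n * (n + 1) div 2) = n * (n + 1 :: int)"
  by simp

lemma sum_shift_int: "(\<Sum>y\<in>{a..<a + b}. f y) = (\<Sum>y\<in>{0..<b::int}. f (a + y))"
  by (rule sum.reindex_bij_betw[symmetric], rule bij_betw_byWitness[where f' = "\<lambda>x. x - a"]) auto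

lemma cc_eq:
  assumes "q div 2 = e"
  shows "2 * cc q = 3 * e\<^sup>2 - 3 * e + 2"
proof -
  have "even (3 * e\<^sup>2 - 3 * e + 2)" by (simp add: power2_eq_square)
  then show ?thesis unfolding cc_def assms by simp
qed

text \<open>In base \<open>cc q\<close> the leading digit of \<open>d\<close>, one of 0 to 5,
  encodes B and \<open>\<phi>\<close>. The last digit runs through the three triangles one after
  another, and \<open>gamma_ix\<close> is the position within the current triangle, counted from
  1.\<close>

lemma sum_index_functions:
  fixes f :: "int \<Rightarrow> int \<Rightarrow> int \<Rightarrow> int \<Rightarrow> int \<Rightarrow> 'a::comm_monoid_add"
  assumes q: "q div 2 = e" and e: "e \<ge> 1"
  shows "(\<Sum>d\<in>{0..<9 * e\<^sup>2 - 9 * e + 6}. f (B_ix d q) (phi_ix d q) (A_ix d q) (N_ix d q) (M_ix d q))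
    = (\<Sum>x\<in>{0..<6}. enum_sum e (f ((1 + x) div 4) (x - 3 * ((1 + x) div 4))))"
proof -
  define c where "c = cc q"
  define T where "T n = n * (n + 1) div 2" for n :: int
  have c2: "2 * c = 3 * e\<^sup>2 - 3 * e + 2" unfolding c_def by (rule cc_eq[OF q])
  have T2: "2 * T n = n * (n + 1)" for n unfolding T_def by (rule two_triangular)
  have c6: "9 * e\<^sup>2 - 9 * e + 6 = 6 * c" using c2 by simp
  \<comment> \<open>With T the triangular numbers, the triangles start at 0, T e and T e + T (e -
    1), which is the square of e. This explains the thresholds in \<open>A_ix\<close> and the length
    \<open>c\<close> of the period.\<close>
  have eT: "e\<^sup>2 = T e + T (e - 1)" using T2[of e] T2[of "e - 1"] by (simp add: power2_eq_square algebra_simps)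
  have cT: "c = e\<^sup>2 + T (e - 2)" using c2 T2[of "e - 2"] by (simp add: power2_eq_square algebra_simps)
  have Tn: "T n \<ge> 0" for n
  proof -
    have "0 \<le> n * (n + 1)"
    proof (cases "n \<ge> 0")
      case False
      then have "0 \<le> (- n) * (- (n + 1))" by (intro mult_nonneg_nonneg) auto
      then show ?thesis by (simp add: algebra_simps)
    qed simp
    then show ?thesis using T2[of n] by linarith
  qed
  have "e\<^sup>2 \<ge> 1" using e by (simp add: one_le_power)
  then have cpos: "c > 0" using cT Tn[of "e - 2"] by linarith
  define A where "A y = (if y < T e then 0 else if T e - 1 < y \<and> y < e\<^sup>2 then 1 else 2 :: int)" for y
  define Ga where "Ga y = y + 1 - (A y * e\<^sup>2 + A y * (2 - A y) * e) div 2" for y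
  define Nn where "Nn \<gamma> = \<lfloor>(1 + sqrt (8 * real_of_int \<gamma> - 7)) / 2\<rfloor>" for \<gamma>
  define Mm where "Mm \<gamma> = \<gamma> - ((Nn \<gamma> - 1)\<^sup>2 + Nn \<gamma> - 1) div 2" for \<gamma>
  have A: "A_ix d q = A (d mod c)" for d
    unfolding A_ix_def A_def q c_def T_def ..
  have Ga: "gamma_ix d q = Ga (d mod c)" for d
    unfolding gamma_ix_def Ga_def A q c_def[symmetric] by (simp add: minus_mult_div_eq_mod)
  have N: "N_ix d q = Nn (Ga (d mod c))" for d
    unfolding N_ix_def Nn_def Ga ..
  have M: "M_ix d q = Mm (Ga (d mod c))" for d
    unfolding M_ix_def Mm_def N Ga ..
  have tri: "(\<Sum>y\<in>{0..<T n}. F (Nn (y + 1)) (Mm (y + 1))) = (\<Sum>n\<in>{1..n}. \<Sum>m\<in>{1..n}. F n m)"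
    if "n \<ge> -1" for n and F :: "int \<Rightarrow> int \<Rightarrow> 'a"
    unfolding T_def
  proof (rule sum_triangular[OF _ that])
    fix n m :: int assume *: "1 \<le> n" "1 \<le> m" "m \<le> n"
    let ?g = "n * (n - 1) div 2 + m"
    have "Nn ?g = n" unfolding Nn_def by (rule triangular_decode(1)[OF * refl])
    moreover have "Mm ?g = m" unfolding Mm_def \<open>Nn ?g = n\<close> by (rule triangular_decode(2)[OF * refl])
    ultimately show "F (Nn (?g - 1 + 1)) (Mm (?g - 1 + 1)) = F n m" by simp
  qed
  have enum: "(\<Sum>y\<in>{0..<c}. F (A y) (Nn (Ga y)) (Mm (Ga y))) = enum_sum e F" for F :: "int \<Rightarrow> int \<Rightarrow> int \<Rightarrow> 'a"
  proof -
    let ?K = "\<lambda>y. F (A y) (Nn (Ga y)) (Mm (Ga y))"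
    have "{0..<c} = {0..<T e} \<union> ({T e..<T e + T (e - 1)} \<union> {e\<^sup>2..<e\<^sup>2 + T (e - 2)})"
      using Tn[of e] Tn[of "e - 1"] Tn[of "e - 2"] cT eT by auto
    then have "(\<Sum>y\<in>{0..<c}. ?K y) = (\<Sum>y\<in>{0..<T e}. ?K y)
        + (\<Sum>y\<in>{T e..<T e + T (e - 1)} \<union> {e\<^sup>2..<e\<^sup>2 + T (e - 2)}. ?K y)"
      using Tn[of "e - 1"] eT by (simp only:) (rule sum.union_disjoint, auto)
    also have "(\<Sum>y\<in>{T e..<T e + T (e - 1)} \<union> {e\<^sup>2..<e\<^sup>2 + T (e - 2)}. ?K y)
        = (\<Sum>y\<in>{T e..<T e + T (e - 1)}. ?K y) + (\<Sum>y\<in>{e\<^sup>2..<e\<^sup>2 + T (e - 2)}. ?K y)"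
      using eT by (intro sum.union_disjoint) auto
    also have "(\<Sum>y\<in>{0..<T e}. ?K y) = (\<Sum>y\<in>{0..<T e}. F 0 (Nn (y + 1)) (Mm (y + 1)))"
      by (intro sum.cong refl) (simp add: A_def Ga_def)
    also have "(\<Sum>y\<in>{T e..<T e + T (e - 1)}. ?K y) = (\<Sum>y\<in>{0..<T (e - 1)}. F 1 (Nn (y + 1)) (Mm (y + 1)))"
      unfolding sum_shift_int
    proof (intro sum.cong refl)
      fix y assume y: "y \<in> {0..<T (e - 1)}"
      then have A1: "A (T e + y) = 1" using eT by (simp add: A_def)
      have "e\<^sup>2 + e = 2 * T e" using T2[of e] by (simp add: power2_eq_square algebra_simps)
      then have "Ga (T e + y) = y + 1" unfolding Ga_def A1 by simp
      then show "?K (T e + y) = F 1 (Nn (y + 1)) (Mm (y + 1))" by (simp add: A1)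
    qed
    also have "(\<Sum>y\<in>{e\<^sup>2..<e\<^sup>2 + T (e - 2)}. ?K y) = (\<Sum>y\<in>{0..<T (e - 2)}. F 2 (Nn (y + 1)) (Mm (y + 1)))"
      unfolding sum_shift_int
    proof (intro sum.cong refl)
      fix y assume y: "y \<in> {0..<T (e - 2)}"
      then have A2: "A (e\<^sup>2 + y) = 2" using eT Tn[of "e - 1"] by (simp add: A_def)
      have "Ga (e\<^sup>2 + y) = y + 1" unfolding Ga_def A2 by simp
      then show "?K (e\<^sup>2 + y) = F 2 (Nn (y + 1)) (Mm (y + 1))" by (simp add: A2)
    qed
    finally show ?thesis using e by (simp add: enum_sum_def tri add.assoc)
  qed
  have "(\<Sum>d\<in>{0..<6 * c}. f (B_ix d q) (phi_ix d q) (A_ix d q) (N_ix d q) (M_ix d q))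
    = (\<Sum>d\<in>{0..<6 * c}. (\<lambda>x y. f ((1 + x) div 4) (x - 3 * ((1 + x) div 4)) (A y) (Nn (Ga y)) (Mm (Ga y))) (d div c) (d mod c))"
    unfolding B_ix_def phi_ix_def A N M c_def[symmetric] ..
  also have "\<dots> = (\<Sum>x\<in>{0..<6}. \<Sum>y\<in>{0..<c}. f ((1 + x) div 4) (x - 3 * ((1 + x) div 4)) (A y) (Nn (Ga y)) (Mm (Ga y)))"
    by (rule sum_div_mod) (use cpos in auto)
  also have "\<dots> = (\<Sum>x\<in>{0..<6}. enum_sum e (f ((1 + x) div 4) (x - 3 * ((1 + x) div 4))))"
    by (intro sum.cong refl enum)
  finally show ?thesis unfolding c6 .
qed

text \<open>For x below 6 the quotient (1 + x) div 4 equals x div 3, so the two expressions are the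
  base 3 digits of x.\<close>

lemma sum_six:
  "(\<Sum>x\<in>{0..<6::int}. F ((1 + x) div 4) (x - 3 * ((1 + x) div 4))) = (\<Sum>b\<in>{0, 1}. \<Sum>\<phi>\<in>{0, 1, 2}. F b \<phi>)"
proof -
  have "{0..<6::int} = {0, 1, 2, 3, 4, 5}" by auto
  then show ?thesis by (simp add: add.assoc)
qed

section \<open>The number of convective codes per time level in closed form\<close>

lemma sum_quadratic:
  fixes u v :: real
  shows "(\<Sum>m<n. (u + 2 * real m) * (v - 2 * real m))
    = real n * u * v + (v - u) * (real n * (real n - 1)) - 2 * (real n * (real n - 1) * (2 * real n - 1)) / 3"
  by (induction n) (simp_all add: field_simps)

text \<open>The three sums of \<open>tot\<close> add up the block sizes of the triangles 0, 1, 2 for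
  B = b, and \<open>Q n u v\<close> is a row sum of (u - 2 m) (v + 2 m). The factor 3 counts the
  values of \<open>\<phi>\<close>. Induction on e reduces the claim to a polynomial identity for the
  increments.\<close>

lemma block_size_closed_form:
  fixes i k q :: real
  defines "Q \<equiv> \<lambda>n u v. real n * u * v + (u - v) * (real n * (real n + 1))
      - 2 * (real n * (real n + 1) * (2 * real n + 1)) / 3"
  defines "tot \<equiv> \<lambda>e b. (\<Sum>n<Suc e. (real (Suc e) - real n) * ((i + 2 - b + 2 * real n) * (q + b - 2 * real n)) * (k + 1))
      + (\<Sum>n<Suc e. (q - 2 * real n + b) * Q n (i + 2 * real n + 2) (k + 1 - b))
      + (\<Sum>n<e. (q - 2 * real n - 2 + b) * Q n (i + 2 * real n + 4 - b) (k + 1))"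
  assumes E: "E = real (Suc e)"
  shows "3 * (tot e 0 + tot e 1) =
     (2 * E ^ 4 + (4 * i + 6 * k + 8) * E ^ 3 + (9 * i * k + 1.5 * i + 3 * k - 8) * E ^ 2
        - (9 * k * i + 5.5 * i + 9 * k + 2) * E + 6 * i * k + 6 * i + 9 * k + 9) * q
     - 3.2 * E ^ 5 - (6 * i + 8 * k + 8) * E ^ 4
     + (6 * k + 6 * i - 10 * k * i + 24) * E ^ 3
     + (14 * k + 9 * i + 22.5 * i * k - 7) * E ^ 2
     - (9 * i + 12 * k + 12.5 * i * k - 2.2) * E
     + 3 * (k + 1) * (i + 1) - 8 * E"
  using E
proof (induction e arbitrary: E)
  case 0
  then show ?case by (simp add: tot_def Q_def field_simps)
next
  case (Suc e)
  define x where "x = real (Suc e)"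
  \<comment> \<open>From e to e + 1 every existing row of the first triangle gains one entry and a
    new row appears, whereas each of the other two sums gains one term.\<close>
  have step: "tot (Suc e) b = tot e b
     + ((x + 1) * (i + 2 - b) * (q + b) + ((q + b) - (i + 2 - b)) * ((x + 1) * x) - 2 * ((x + 1) * x * (2 * x + 1)) / 3) * (k + 1)
     + (q - 2 * x + b) * Q (Suc e) (i + 2 * x + 2) (k + 1 - b)
     + (q - 2 * (x - 1) - 2 + b) * Q e (i + 2 * (x - 1) + 4 - b) (k + 1)" for b
  proof -
    let ?G = "\<lambda>n. (i + 2 - b + 2 * real n) * (q + b - 2 * real n)"
    have "(\<Sum>n<Suc (Suc e). (real (Suc (Suc e)) - real n) * ?G n * (k + 1))
      = (\<Sum>n<Suc (Suc e). (real (Suc e) - real n) * ?G n * (k + 1)) + (\<Sum>n<Suc (Suc e). ?G n) * (k + 1)"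
      unfolding sum_distrib_right sum.distrib[symmetric]
      by (intro sum.cong refl) (simp add: algebra_simps)
    also have "(\<Sum>n<Suc (Suc e). (real (Suc e) - real n) * ?G n * (k + 1)) = (\<Sum>n<Suc e. (real (Suc e) - real n) * ?G n * (k + 1))"
      by (subst sum.lessThan_Suc) simp
    also have "(\<Sum>n<Suc (Suc e). ?G n) = (x + 1) * (i + 2 - b) * (q + b) + ((q + b) - (i + 2 - b)) * ((x + 1) * x) - 2 * ((x + 1) * x * (2 * x + 1)) / 3"
      unfolding sum_quadratic by (simp add: x_def)
    finally show ?thesis
      unfolding tot_def
      by (subst sum.lessThan_Suc[of _ "Suc e"], subst (3) sum.lessThan_Suc) (simp add: x_def del: sum.lessThan_Suc)
  qed
  note IH = Suc.IH[of x, OF x_def]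
  have E: "E = x + 1" using Suc.prems by (simp add: x_def)
  have Qe: "Q (Suc e) u v = x * u * v + (u - v) * (x * (x + 1)) - 2 * (x * (x + 1) * (2 * x + 1)) / 3"
     "Q e u v = (x - 1) * u * v + (u - v) * ((x - 1) * x) - 2 * ((x - 1) * x * (2 * x - 1)) / 3" for u v
    unfolding Q_def x_def by (simp_all add: algebra_simps)
  have "3 * (tot (Suc e) 0 + tot (Suc e) 1) - 3 * (tot e 0 + tot e 1)
     = 3 * (tot (Suc e) 0 - tot e 0) + 3 * (tot (Suc e) 1 - tot e 1)" by simp
  then have "3 * (tot (Suc e) 0 + tot (Suc e) 1) = 3 * (tot e 0 + tot e 1)
     + (3 * (tot (Suc e) 0 - tot e 0) + 3 * (tot (Suc e) 1 - tot e 1))" by simp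
  then show ?case
    unfolding IH step E Qe by (simp add: field_simps power2_eq_square power3_eq_cube power4_eq_xxxx eval_nat_numeral)
qed

context cell begin

text \<open>The extents of a block are the degrees of the Cauchy coefficient that it enumerates, so
  a block lists all ways of splitting the multi-index Y.\<close>

lemma s_eq_Y:
  "s1 p q \<alpha> a n m b = Y1 p q \<alpha> a n m b" "s2 q a n b = Y0 q a n b" "s3 q r \<alpha> a n m b = Y2 q r \<alpha> a n m b"
  using alpha by (auto simp: s1_def s2_def s3_def Y0_def Y1_def Y2_def sg_def algebra_simps)

definition J :: int where
  "J = 9 * (int e)\<^sup>2 - 9 * int e + 6"

definition in_range :: "int \<Rightarrow> int \<Rightarrow> int \<Rightarrow> int \<Rightarrow> int \<Rightarrow> bool" where
  "in_range b \<phi> a n m \<longleftrightarrow> b \<in> {0, 1} \<and> \<phi> \<in> {0, 1, 2} \<and> a \<in> {0, 1, 2} \<and> 1 \<le> m \<and> m \<le> n \<and> n \<le> int e - a"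

text \<open>\<open>sum_index_functions\<close> is applied to the indicator of the tuples out of
  range. The right-hand side vanishes, so no \<open>d\<close> produces such a tuple, and the floor
  formulas need not be estimated.\<close>

lemma in_range_index_functions:
  assumes "0 \<le> d" "d < J"
  shows "in_range (B_ix d q) (phi_ix d q) (A_ix d q) (N_ix d q) (M_ix d q)"
proof -
  let ?f = "\<lambda>b \<phi> a n m. if in_range b \<phi> a n m then 0 else 1 :: nat"
  have "(\<Sum>d\<in>{0..<J}. ?f (B_ix d q) (phi_ix d q) (A_ix d q) (N_ix d q) (M_ix d q)) = 0"
    unfolding J_def
  proof (subst sum_index_functions[OF e(1)])
    show "1 \<le> int e" using e(2) by simp
    show "(\<Sum>x\<in>{0..<6}. enum_sum (int e) (?f ((1 + x) div 4) (x - 3 * ((1 + x) div 4)))) = 0"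
    proof (rule sum.neutral, rule ballI)
      fix x :: int assume "x \<in> {0..<6}"
      then have "x \<in> {0, 1, 2, 3, 4, 5}" by auto
      then have x: "(1 + x) div 4 \<in> {0, 1}" "x - 3 * ((1 + x) div 4) \<in> {0, 1, 2}" by auto
      have "enum_sum (int e) (?f b \<phi>) = 0" if "b \<in> {0, 1}" "\<phi> \<in> {0, 1, 2}" for b \<phi>
        using that unfolding enum_sum_def by (simp add: in_range_def)
      then show "enum_sum (int e) (?f ((1 + x) div 4) (x - 3 * ((1 + x) div 4))) = 0" using x .
    qed
  qed
  then have "?f (B_ix d q) (phi_ix d q) (A_ix d q) (N_ix d q) (M_ix d q) = 0"
    using assms by (subst (asm) sum_eq_0_iff) auto
  then show ?thesis by (auto split: if_splits)
qed

lemma Y_nonneg: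
  assumes "in_range b \<phi> a n m"
  shows "0 \<le> Y1 p q \<alpha> a n m b" "0 \<le> Y0 q a n b" "0 \<le> Y2 q r \<alpha> a n m b"
proof -
  have q: "q = j + 2 * int e" "0 \<le> j" using q_eq j_01 by auto
  show "0 \<le> Y0 q a n b"
    using assms q by (auto simp: in_range_def Y0_def e)
  show "0 \<le> Y1 p q \<alpha> a n m b" "0 \<le> Y2 q r \<alpha> a n m b"
    using assms nonneg alpha by (auto simp: in_range_def Y1_def Y2_def e sg_def)
qed

lemma S_blk_eq: "S_blk p q r \<alpha> d = (Y1b p q \<alpha> d + 1) * (Y0b q d + 1) * (Y2b q r \<alpha> d + 1)"
  by (simp add: S_blk_def s1b_def s2b_def s3b_def Y0b_def Y1b_def Y2b_def s_eq_Y)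

lemma Yb_nonneg:
  assumes "0 \<le> d" "d < J"
  shows "0 \<le> Y1b p q \<alpha> d" "0 \<le> Y0b q d" "0 \<le> Y2b q r \<alpha> d"
  unfolding Y0b_def Y1b_def Y2b_def by (rule Y_nonneg[OF in_range_index_functions[OF assms]])+

lemma S_blk_pos: "0 \<le> d \<Longrightarrow> d < J \<Longrightarrow> S_blk p q r \<alpha> d > 0"
  unfolding S_blk_eq by (intro mult_pos_pos) (use Yb_nonneg in fastforce)+

lemma sum_J:
  "(\<Sum>d\<in>{0..<J}. f (B_ix d q) (phi_ix d q) (A_ix d q) (N_ix d q) (M_ix d q))
    = (\<Sum>b\<in>{0, 1}. \<Sum>\<phi>\<in>{0, 1, 2}. enum_sum (int e) (f b \<phi>))"
  unfolding J_def
proof (subst sum_index_functions[OF e(1)])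
  show "1 \<le> int e" using e(2) by simp
qed (rule sum_six)

text \<open>Block sizes do not depend on \<open>\<phi>\<close>, hence the factor 3. The block size
  sums are brought into the shape of \<open>block_size_closed_form\<close>; triangle 0 is reversed
  once more.\<close>

lemma sigma_eq_prefix_sum: "sigma p q r \<alpha> = prefix_sum (S_blk p q r \<alpha>) J"
proof -
  obtain e' where e': "e = Suc e'" using e by (cases e) auto
  define Q where "Q = (\<lambda>n u v. real n * u * v + (u - v) * (real n * (real n + 1))
      - 2 * (real n * (real n + 1) * (2 * real n + 1)) / 3)"
  let ?f = "\<lambda>b a n m. (Y1 p q \<alpha> a n m b + 1) * (Y0 q a n b + 1) * (Y2 q r \<alpha> a n m b + 1)"
  have "prefix_sum (S_blk p q r \<alpha>) J = (\<Sum>b\<in>{0, 1}. \<Sum>\<phi>\<in>{0::int, 1, 2}. enum_sum (int e) (?f b))"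
    unfolding prefix_sum_def S_blk_eq Y0b_def Y1b_def Y2b_def
    by (rule sum_J[of "\<lambda>b \<phi>. ?f b"])
  also have "\<dots> = 3 * (enum_sum (int e) (?f 0) + enum_sum (int e) (?f 1))" by simp
  finally have P: "prefix_sum (S_blk p q r \<alpha>) J = \<dots>" .
  have QS: "(\<Sum>m\<in>{1..int n}. (u - 2 * real_of_int m) * (v + 2 * real_of_int m)) = Q n u v" for n u v
    unfolding sum_int_from_1 Q_def by (induction n) (simp_all add: field_simps)
  have E: "real_of_int (enum_sum (int e) (?f b)) =
      (\<Sum>n<Suc e'. (real (Suc e') - real n) * ((of_int i + 2 - of_int b + 2 * real n) * (of_int q + of_int b - 2 * real n)) * (of_int k + 1))
      + (\<Sum>n<Suc e'. (of_int q - 2 * real n + of_int b) * Q n (of_int i + 2 * real n + 2) (of_int k + 1 - of_int b))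
      + (\<Sum>n<e'. (of_int q - 2 * real n - 2 + of_int b) * Q n (of_int i + 2 * real n + 4 - of_int b) (of_int k + 1))" for b
  proof -
    have "(\<Sum>n\<in>{1..int e}. \<Sum>m\<in>{1..n}. real_of_int (?f b 0 n m))
      = (\<Sum>n<Suc e'. (real n + 1) * ((of_int i + 2 * real (Suc e') - of_int b - 2 * real n) * (of_int q + of_int b - 2 * real e' + 2 * real n) * (of_int k + 1)))"
      unfolding sum_int_from_1 e'
    proof (rule sum.cong[OF refl])
      fix n
      have "?f b 0 (int n + 1) m = (i + 2 * int (Suc e') - b - 2 * int n) * (q + b - 2 * int e' + 2 * int n) * (k + 1)" for m
        using alpha by (elim disjE) (simp_all add: Y0_def Y1_def Y2_def e e' ik X_def algebra_simps)
      then show "(\<Sum>m\<in>{1..int n + 1}. real_of_int (?f b 0 (int n + 1) m)) = (real n + 1) * ((of_int i + 2 * real (Suc e') - of_int b - 2 * real n) * (of_int q + of_int b - 2 * real e' + 2 * real n) * (of_int k + 1))"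
        by simp
    qed
    also have "\<dots> = (\<Sum>n<Suc e'. (real (Suc e') - real n) * ((of_int i + 2 - of_int b + 2 * real n) * (of_int q + of_int b - 2 * real n)) * (of_int k + 1))"
      unfolding sum.nat_diff_reindex[of "\<lambda>n. (real (Suc e') - real n) * ((of_int i + 2 - of_int b + 2 * real n) * (of_int q + of_int b - 2 * real n)) * (of_int k + 1)", symmetric]
      by (rule sum.cong[OF refl]) (simp add: of_nat_diff algebra_simps)
    finally have 0: "(\<Sum>n\<in>{1..int e}. \<Sum>m\<in>{1..n}. real_of_int (?f b 0 n m)) = \<dots>" .
    have Q0: "Q 0 u v = 0" for u v by (simp add: Q_def)
    have 1: "(\<Sum>n\<in>{1..int e - 1}. \<Sum>m\<in>{1..n}. real_of_int (?f b 1 n m))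
      = (\<Sum>n<Suc e'. (of_int q - 2 * real n + of_int b) * Q n (of_int i + 2 * real n + 2) (of_int k + 1 - of_int b))"
    proof -
      have "(\<Sum>m\<in>{1..int (Suc n)}. real_of_int (?f b 1 (int (Suc n)) m)) = (of_int q - 2 * real (Suc n) + of_int b) * Q (Suc n) (of_int i + 2 * real (Suc n) + 2) (of_int k + 1 - of_int b)" for n
        unfolding QS[symmetric] sum_distrib_left
      proof (rule sum.cong[OF refl])
        fix m
        show "real_of_int (?f b 1 (int (Suc n)) m) = (of_int q - 2 * real (Suc n) + of_int b) * ((of_int i + 2 * real (Suc n) + 2 - 2 * of_int m) * (of_int k + 1 - of_int b + 2 * of_int m))"
          using alpha by (elim disjE) (simp_all add: Y0_def Y1_def Y2_def ik X_def sg_def algebra_simps)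
      qed
      then show ?thesis
        unfolding sum_int_from_1_diff_1 e' by (subst sum.lessThan_Suc_shift) (simp add: Q0 add.commute del: sum.lessThan_Suc)
    qed
    have 2: "(\<Sum>n\<in>{1..int e - 2}. \<Sum>m\<in>{1..n}. real_of_int (?f b 2 n m))
      = (\<Sum>n<e'. (of_int q - 2 * real n - 2 + of_int b) * Q n (of_int i + 2 * real n + 4 - of_int b) (of_int k + 1))"
    proof -
      have *: "(\<Sum>m\<in>{1..int (Suc n)}. real_of_int (?f b 2 (int (Suc n)) m)) = (of_int q - 2 * real (Suc n) - 2 + of_int b) * Q (Suc n) (of_int i + 2 * real (Suc n) + 4 - of_int b) (of_int k + 1)" for n
        unfolding QS[symmetric] sum_distrib_left
      proof (rule sum.cong[OF refl])
        fix m
        show "real_of_int (?f b 2 (int (Suc n)) m) = (of_int q - 2 * real (Suc n) - 2 + of_int b) * ((of_int i + 2 * real (Suc n) + 4 - of_int b - 2 * of_int m) * (of_int k + 1 + 2 * of_int m))"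
          using alpha by (elim disjE) (simp_all add: Y0_def Y1_def Y2_def ik X_def sg_def algebra_simps)
      qed
      show ?thesis
      proof (cases e')
        case (Suc e'')
        show ?thesis
          unfolding sum_int_from_1_diff_2 e' Suc using *
          by (subst sum.lessThan_Suc_shift) (simp add: Q0 add.commute del: sum.lessThan_Suc)
      qed (simp add: e')
    qed
    show ?thesis unfolding enum_sum_def of_int_add of_int_sum 0 1 2 ..
  qed
  note C = block_size_closed_form[where i = "of_int i" and k = "of_int k" and q = "of_int q" and e = e', OF refl]
  have "real_of_int (prefix_sum (S_blk p q r \<alpha>) J) = real_of_int 3 * (real_of_int (enum_sum (int e) (?f 0)) + real_of_int (enum_sum (int e) (?f 1)))"
    unfolding P by (simp only: of_int_mult of_int_add)
  also have "\<dots> = sigma_real p q r \<alpha>"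
    unfolding E unfolding Q_def of_int_0 of_int_1 of_int_numeral sigma_real_def Let_def e e' of_int_of_nat_eq ik[symmetric]
    by (rule C)
  finally have "real_of_int (sigma p q r \<alpha>) = real_of_int (prefix_sum (S_blk p q r \<alpha>) J)"
    unfolding of_int_sigma ..
  then show ?thesis by simp
qed

lemma prefix_sum_S_blk_mono: "l \<le> J \<Longrightarrow> l' \<le> l \<Longrightarrow> prefix_sum (S_blk p q r \<alpha>) l' \<le> prefix_sum (S_blk p q r \<alpha>) l"
  by (rule prefix_sum_mono) (use S_blk_pos in \<open>auto simp: less_le\<close>)

lemma prefix_sum_S_blk_pos:
  assumes "1 \<le> l" "l \<le> J"
  shows "prefix_sum (S_blk p q r \<alpha>) l > 0"
proof -
  have "prefix_sum (S_blk p q r \<alpha>) (0 + 1) > 0"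
    using prefix_sum_Suc[of 0 "S_blk p q r \<alpha>"] S_blk_pos[of 0] assms by simp
  then show ?thesis using prefix_sum_S_blk_mono[of l 1] assms by simp
qed

lemma J_pos: "J \<ge> 1"
proof -
  have "int e * int e \<ge> int e" using e(2) by (simp add: mult_le_cancel_left1)
  then show ?thesis by (simp add: J_def power2_eq_square)
qed

lemma sigma_pos: "sigma p q r \<alpha> > 0"
  unfolding sigma_eq_prefix_sum using prefix_sum_S_blk_pos J_pos by simp

text \<open>The l-th Heaviside value is 1 exactly if the first l blocks end before the position.
  Adding these values counts the completed blocks, and weighting them by the sizes gives the start
  of the current block. Positions are counted from 1.\<close>

lemma D_pos_I_pos:
  assumes d: "0 \<le> d" "d < J" and \<iota>: "0 \<le> \<iota>" "\<iota> < S_blk p q r \<alpha> d"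
  shows "D_pos p q r \<alpha> (prefix_sum (S_blk p q r \<alpha>) d + \<iota> + 1) = d"
    and "I_pos p q r \<alpha> (prefix_sum (S_blk p q r \<alpha>) d + \<iota> + 1) = \<iota> + 1"
proof -
  let ?P = "prefix_sum (S_blk p q r \<alpha>)"
  let ?\<tau> = "?P d + \<iota> + 1"
  have h: "heav (of_int (?\<tau> - 1) / of_int (\<Sum>k\<in>{0..l - 1}. S_blk p q r \<alpha> k) - 1) = (if l \<le> d then 1 else 0)"
    if l: "l \<in> {1..J}" for l
  proof -
    have P: "?P l > 0" using prefix_sum_S_blk_pos l by simp
    have "heav (of_int (?\<tau> - 1) / of_int (\<Sum>k\<in>{0..l - 1}. S_blk p q r \<alpha> k) - 1) = (if ?P l \<le> ?\<tau> - 1 then 1 else 0)"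
      unfolding atLeastAtMost_minus_1_int prefix_sum_def[symmetric] heav_def
      using P by (simp add: field_simps)
    also have "?P l \<le> ?\<tau> - 1 \<longleftrightarrow> l \<le> d"
    proof (cases "l \<le> d")
      case True
      then show ?thesis using prefix_sum_S_blk_mono[of d l] d \<iota> by simp
    next
      case False
      then have "?P (d + 1) \<le> ?P l" using prefix_sum_S_blk_mono[of l "d + 1"] l by simp
      then show ?thesis using False \<iota> d by (simp add: prefix_sum_Suc)
    qed
    finally show ?thesis .
  qed
  have split: "{1..J} = {1..d} \<union> {d + 1..J}" using d by auto
  have J: "9 * (ee q)\<^sup>2 - 9 * ee q + 6 = J" by (simp add: J_def e)
  have "D_pos p q r \<alpha> ?\<tau> = (\<Sum>l\<in>{1..J}. if l \<le> d then 1 else 0)"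
    unfolding D_pos_def J by (rule sum.cong[OF refl h])
  also have "\<dots> = d" using d unfolding split by (subst sum.union_disjoint) auto
  finally show "D_pos p q r \<alpha> ?\<tau> = d" .
  have "I_pos p q r \<alpha> ?\<tau> = ?\<tau> - (\<Sum>l\<in>{1..J}. S_blk p q r \<alpha> (l - 1) * (if l \<le> d then 1 else 0))"
    unfolding I_pos_def J by (intro arg_cong2[of _ _ _ _ "(-)"] sum.cong refl) (simp only: h)
  also have "(\<Sum>l\<in>{1..J}. S_blk p q r \<alpha> (l - 1) * (if l \<le> d then 1 else 0)) = (\<Sum>l\<in>{1..d}. S_blk p q r \<alpha> (l - 1))"
    unfolding split by (subst sum.union_disjoint) auto
  also have "\<dots> = ?P d"
    unfolding prefix_sum_def
    by (rule sum.reindex_bij_betw, rule bij_betw_byWitness[where f' = "\<lambda>x. x + 1"]) auto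
  finally show "I_pos p q r \<alpha> ?\<tau> = \<iota> + 1" by simp
qed

lemma sum_sigma_blocks:
  assumes "0 \<le> w"
  shows "(\<Sum>i\<in>{0..<sigma p q r \<alpha> * w}. h (i div sigma p q r \<alpha>) (d_star p q r \<alpha> i) (i_star p q r \<alpha> i))
    = (\<Sum>l\<in>{0..<w}. \<Sum>d\<in>{0..<J}. \<Sum>\<iota>\<in>{0..<S_blk p q r \<alpha> d}. h l d (\<iota> + 1))"
proof -
  let ?s = "sigma p q r \<alpha>"
  have T: "T_pos p q r \<alpha> i = i mod ?s + 1" for i
    by (simp add: T_pos_def minus_mult_div_eq_mod algebra_simps)
  have "(\<Sum>i\<in>{0..<w * ?s}. h (i div ?s) (d_star p q r \<alpha> i) (i_star p q r \<alpha> i))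
    = (\<Sum>l\<in>{0..<w}. \<Sum>\<tau>\<in>{0..<?s}. h l (D_pos p q r \<alpha> (\<tau> + 1)) (I_pos p q r \<alpha> (\<tau> + 1)))"
    unfolding d_star_def i_star_def T
    by (rule sum_div_mod[of ?s w "\<lambda>l \<tau>. h l (D_pos p q r \<alpha> (\<tau> + 1)) (I_pos p q r \<alpha> (\<tau> + 1))"])
      (use sigma_pos assms in auto)
  also have "\<dots> = (\<Sum>l\<in>{0..<w}. \<Sum>d\<in>{0..<J}. \<Sum>\<iota>\<in>{0..<S_blk p q r \<alpha> d}. h l d (\<iota> + 1))"
  proof (rule sum.cong[OF refl])
    fix l
    have "(\<Sum>\<tau>\<in>{0..<?s}. h l (D_pos p q r \<alpha> (\<tau> + 1)) (I_pos p q r \<alpha> (\<tau> + 1)))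
      = (\<Sum>d\<in>{0..<J}. \<Sum>\<iota>\<in>{0..<S_blk p q r \<alpha> d}.
          h l (D_pos p q r \<alpha> (prefix_sum (S_blk p q r \<alpha>) d + \<iota> + 1)) (I_pos p q r \<alpha> (prefix_sum (S_blk p q r \<alpha>) d + \<iota> + 1)))"
      unfolding sigma_eq_prefix_sum
      by (rule sum_prefix_blocks) (use S_blk_pos J_pos in \<open>auto simp: less_le\<close>)
    also have "\<dots> = (\<Sum>d\<in>{0..<J}. \<Sum>\<iota>\<in>{0..<S_blk p q r \<alpha> d}. h l d (\<iota> + 1))"
      by (intro sum.cong refl) (simp add: D_pos_I_pos)
    finally show "(\<Sum>\<tau>\<in>{0..<?s}. h l (D_pos p q r \<alpha> (\<tau> + 1)) (I_pos p q r \<alpha> (\<tau> + 1))) = \<dots>" .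
  qed
  finally show ?thesis by (simp add: mult.commute)
qed

text \<open>Within a block the offset is a number with three digits of radices Y1 + 1, Y0 + 1 and Y2
  + 1, the one belonging to Y2 being the lowest.\<close>

lemma sum_mixed_radix:
  assumes "0 \<le> d" "d < J"
  shows "(\<Sum>\<iota>\<in>{0..<S_blk p q r \<alpha> d}. h (L1 q r \<alpha> d (\<iota> + 1)) (L0 q r \<alpha> d (\<iota> + 1) - (s2b q d + 1) * L1 q r \<alpha> d (\<iota> + 1)) (\<iota> mod (s3b q r \<alpha> d + 1)))
    = (\<Sum>l1\<in>{0..Y1b p q \<alpha> d}. \<Sum>l0\<in>{0..Y0b q d}. \<Sum>l2\<in>{0..Y2b q r \<alpha> d}. h l1 l0 l2)"
proof -
  let ?a = "Y1b p q \<alpha> d + 1" and ?b = "Y0b q d + 1" and ?c = "Y2b q r \<alpha> d + 1"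
  have pos: "?a > 0" "?b > 0" "?c > 0" using Yb_nonneg[OF assms] by simp_all
  have s: "s2b q d = Y0b q d" "s3b q r \<alpha> d = Y2b q r \<alpha> d"
    by (simp_all add: s2b_def s3b_def Y0b_def Y2b_def s_eq_Y)
  have L: "L0 q r \<alpha> d (\<iota> + 1) = \<iota> div ?c" "L1 q r \<alpha> d (\<iota> + 1) = \<iota> div ?c div ?b" for \<iota>
    using pos by (simp_all add: L0_def L1_def s zdiv_zmult2_eq)
  have at: "{0..x} = {0..<x + 1}" for x :: int by auto
  have "(\<Sum>\<iota>\<in>{0..<?a * ?b * ?c}. (\<lambda>z l2. h (z div ?b) (z - ?b * (z div ?b)) l2) (\<iota> div ?c) (\<iota> mod ?c))
    = (\<Sum>z\<in>{0..<?a * ?b}. \<Sum>l2\<in>{0..<?c}. h (z div ?b) (z - ?b * (z div ?b)) l2)"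
    by (rule sum_div_mod) (use pos in auto)
  also have "\<dots> = (\<Sum>z\<in>{0..<?a * ?b}. (\<lambda>l1 l0. \<Sum>l2\<in>{0..<?c}. h l1 l0 l2) (z div ?b) (z mod ?b))"
    by (simp add: minus_mult_div_eq_mod)
  also have "\<dots> = (\<Sum>l1\<in>{0..<?a}. \<Sum>l0\<in>{0..<?b}. \<Sum>l2\<in>{0..<?c}. h l1 l0 l2)"
    by (rule sum_div_mod) (use pos in auto)
  finally show ?thesis unfolding S_blk_eq L s at .
qed

end

section \<open>The one-step recursion\<close>

text \<open>The coefficient equations after division by \<open>\<rho>\<close>; \<open>Q\<close>
  stands for the family of -P / \<open>\<rho>\<close>.\<close>

locale ns_coeffs =
  fixes u g :: "int \<Rightarrow> coeffs" and Q :: coeffs and \<nu> :: real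
  assumes divergence: "\<And>w p q r. dsp4 0 (u 0) w p q r + dsp4 1 (u 1) w p q r + dsp4 2 (u 2) w p q r = 0"
    and momentum: "\<And>\<alpha> w p q r. \<alpha> \<in> {0, 1, 2} \<Longrightarrow>
      dt4 (u \<alpha>) w p q r + (\<Sum>\<phi>\<in>{0, 1, 2}. conv4 (u \<phi>) (dsp4 \<phi> (u \<alpha>)) w p q r)
      = dsp4 \<alpha> Q w p q r + \<nu> * (\<Sum>\<phi>\<in>{0, 1, 2}. dsp4 \<phi> (dsp4 \<phi> (u \<alpha>)) w p q r) + g \<alpha> w p q r"

definition conv_arr :: "(int \<Rightarrow> coeffs) \<Rightarrow> int \<Rightarrow> int \<Rightarrow> arr" where
  "conv_arr u w \<gamma> p q r = (\<Sum>\<phi>\<in>{0, 1, 2}. hat (conv4 (u \<phi>) (dsp4 \<phi> (u \<gamma>))) w p q r)"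

lemma fct_Suc:
  assumes "x \<ge> 0"
  shows "fct (x + 1) = of_int (x + 1) * fct x"
  using assms by (simp add: fct_def nat_add_distrib)

lemma cf_dsp4:
  assumes "0 \<le> p" "0 \<le> q" "0 \<le> r"
  shows "cf (dsp4 1 a) w p q r = of_int (p + 1) * cf a w (p + 1) q r"
    and "cf (dsp4 0 a) w p q r = of_int (q + 1) * cf a w p (q + 1) r"
    and "cf (dsp4 2 a) w p q r = of_int (r + 1) * cf a w p q (r + 1)"
  using assms by (simp_all add: cf_def dsp4_def nat_add_distrib)

lemma hat_dsp4:
  assumes "0 \<le> p" "0 \<le> q" "0 \<le> r"
  shows "hat (dsp4 1 a) w p q r = hat a w (p + 1) q r"
    and "hat (dsp4 0 a) w p q r = hat a w p (q + 1) r"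
    and "hat (dsp4 2 a) w p q r = hat a w p q (r + 1)"
  using assms by (simp_all add: hat_def cf_dsp4 fct_Suc)

lemma hat_dt4:
  assumes "1 \<le> w"
  shows "hat (dt4 a) (w - 1) p q r = of_int w * hat a w p q r"
proof -
  have "real (nat (w - 1) + 1) = of_int w" "nat (w - 1) + 1 = nat w" using assms by auto
  then show ?thesis by (simp add: hat_def cf_def dt4_def)
qed

lemma sum_int_atLeast0AtMost:
  assumes "0 \<le> n"
  shows "(\<Sum>k\<in>{0..n}. f k) = (\<Sum>k\<le>nat n. f (int k))"
proof -
  have "bij_betw int {..nat n} {0..n}"
    by (rule bij_betw_byWitness[where f' = nat]) (use assms in auto)
  then show ?thesis by (rule sum.reindex_bij_betw[symmetric])
qed

lemma cf_conv4:
  assumes "0 \<le> w" "0 \<le> p" "0 \<le> q" "0 \<le> r"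
  shows "cf (conv4 a b) w p q r = (\<Sum>k\<in>{0..w}. \<Sum>i\<in>{0..p}. \<Sum>j\<in>{0..q}. \<Sum>l\<in>{0..r}.
      cf a (w - k) (p - i) (q - j) (r - l) * cf b k i j l)"
  unfolding sum_int_atLeast0AtMost[OF assms(1)] sum_int_atLeast0AtMost[OF assms(2)]
    sum_int_atLeast0AtMost[OF assms(3)] sum_int_atLeast0AtMost[OF assms(4)]
  using assms by (simp add: cf_def conv4_def nat_diff_distrib)

lemma int_div_less_iff:
  fixes s i w :: int
  assumes "0 < s"
  shows "i div s < w \<longleftrightarrow> i < s * w"
proof
  assume "i div s < w"
  then have "s * (i div s + 1) \<le> s * w" using assms by (intro mult_left_mono) auto
  moreover have "i < s * (i div s + 1)"
    using mult_div_mod_eq[of s i] pos_mod_bound[OF assms, of i]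
    unfolding distrib_left mult_1_right by linarith
  ultimately show "i < s * w" by linarith
next
  assume "i < s * w"
  show "i div s < w"
  proof (rule ccontr)
    assume "\<not> i div s < w"
    then have "s * w \<le> s * (i div s)" using assms by (intro mult_left_mono) auto
    then show False
      using \<open>i < s * w\<close> mult_div_mod_eq[of s i] pos_mod_sign[OF assms, of i] by linarith
  qed
qed

context cell begin

text \<open>Summed over the time levels, a block is one coefficient of the product of component
  \<open>\<phi>\<close> with the derivative in direction \<open>\<phi>\<close> of component
  \<open>\<gamma>\<close>; the digits of the offset are the indices of the differentiated
  factor.\<close>

lemma convective_block:
  assumes d: "0 \<le> d" "d < J" and w: "w \<ge> 1"
  defines "\<phi> \<equiv> phi_ix d q" and "\<gamma> \<equiv> B_ix d q * (\<alpha> + A_ix d q * (A_ix d q - 2) * (2 * \<alpha> - 3))"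
  shows "(\<Sum>l\<in>{0..<w}. \<Sum>\<iota>\<in>{0..<S_blk p q r \<alpha> d}. G_cf p q r \<alpha> d (\<iota> + 1)
      * ucf u \<gamma> l (W1 p q r \<alpha> d (\<iota> + 1)) (W0 p q r \<alpha> d (\<iota> + 1)) (W2 p q r \<alpha> d (\<iota> + 1))
      * ucf u \<phi> (w - 1 - l) (V1 p q r \<alpha> d (\<iota> + 1)) (V0 q r \<alpha> d (\<iota> + 1)) (V2 q r \<alpha> d (\<iota> + 1)))
    = H_cf q (A_ix d q) (N_ix d q) (M_ix d q) (B_ix d q)
      * hat (conv4 (u \<phi>) (dsp4 \<phi> (u \<gamma>))) (w - 1) (Y1b p q \<alpha> d) (Y0b q d) (Y2b q r \<alpha> d) / (fct p * fct q * fct r)"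
proof -
  let ?H = "H_cf q (A_ix d q) (N_ix d q) (M_ix d q) (B_ix d q)"
  let ?y1 = "Y1b p q \<alpha> d" and ?y0 = "Y0b q d" and ?y2 = "Y2b q r \<alpha> d"
  let ?K = "?H * (fct ?y0 * fct ?y1 * fct ?y2 / (fct p * fct q * fct r))"
  have y: "0 \<le> ?y1" "0 \<le> ?y0" "0 \<le> ?y2" using Yb_nonneg[OF d] by simp_all
  have \<phi>: "\<phi> \<in> {0, 1, 2}" using in_range_index_functions[OF d] by (simp add: \<phi>_def in_range_def)
  \<comment> \<open>The three quadratic polynomials in \<open>\<phi>\<close> are the indicators of
    the values 0, 1 and 2. They raise the index in direction \<open>\<phi>\<close> by one and select
    the matching factor of the derivative.\<close>
  have summand: "of_int ((\<phi> - 1) * (\<phi> - 2) div 2 * l0 + \<phi> * (2 - \<phi>) * l1 + \<phi> * (\<phi> - 1) div 2 * l2 + 1)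
      * ucf u \<gamma> l (\<phi> * (2 - \<phi>) + l1) ((\<phi> - 1) * (\<phi> - 2) div 2 + l0) (\<phi> * (\<phi> - 1) div 2 + l2)
      = cf (dsp4 \<phi> (u \<gamma>)) l l1 l0 l2"
    if "0 \<le> l" "0 \<le> l0" "0 \<le> l1" "0 \<le> l2" for l l0 l1 l2
    using \<phi> that by (auto simp: cf_dsp4 ucf_def add.commute)
  have "(\<Sum>l\<in>{0..<w}. \<Sum>\<iota>\<in>{0..<S_blk p q r \<alpha> d}. G_cf p q r \<alpha> d (\<iota> + 1)
      * ucf u \<gamma> l (W1 p q r \<alpha> d (\<iota> + 1)) (W0 p q r \<alpha> d (\<iota> + 1)) (W2 p q r \<alpha> d (\<iota> + 1))
      * ucf u \<phi> (w - 1 - l) (V1 p q r \<alpha> d (\<iota> + 1)) (V0 q r \<alpha> d (\<iota> + 1)) (V2 q r \<alpha> d (\<iota> + 1)))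
    = (\<Sum>l\<in>{0..<w}. \<Sum>l1\<in>{0..?y1}. \<Sum>l0\<in>{0..?y0}. \<Sum>l2\<in>{0..?y2}.
        ?K * (of_int ((\<phi> - 1) * (\<phi> - 2) div 2 * l0 + \<phi> * (2 - \<phi>) * l1 + \<phi> * (\<phi> - 1) div 2 * l2 + 1)
        * ucf u \<gamma> l (\<phi> * (2 - \<phi>) + l1) ((\<phi> - 1) * (\<phi> - 2) div 2 + l0) (\<phi> * (\<phi> - 1) div 2 + l2))
        * ucf u \<phi> (w - 1 - l) (?y1 - l1) (?y0 - l0) (?y2 - l2))"
  proof (rule sum.cong[OF refl])
    fix l
    show "(\<Sum>\<iota>\<in>{0..<S_blk p q r \<alpha> d}. G_cf p q r \<alpha> d (\<iota> + 1)
      * ucf u \<gamma> l (W1 p q r \<alpha> d (\<iota> + 1)) (W0 p q r \<alpha> d (\<iota> + 1)) (W2 p q r \<alpha> d (\<iota> + 1))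
      * ucf u \<phi> (w - 1 - l) (V1 p q r \<alpha> d (\<iota> + 1)) (V0 q r \<alpha> d (\<iota> + 1)) (V2 q r \<alpha> d (\<iota> + 1)))
    = (\<Sum>l1\<in>{0..?y1}. \<Sum>l0\<in>{0..?y0}. \<Sum>l2\<in>{0..?y2}.
        ?K * (of_int ((\<phi> - 1) * (\<phi> - 2) div 2 * l0 + \<phi> * (2 - \<phi>) * l1 + \<phi> * (\<phi> - 1) div 2 * l2 + 1)
        * ucf u \<gamma> l (\<phi> * (2 - \<phi>) + l1) ((\<phi> - 1) * (\<phi> - 2) div 2 + l0) (\<phi> * (\<phi> - 1) div 2 + l2))
        * ucf u \<phi> (w - 1 - l) (?y1 - l1) (?y0 - l0) (?y2 - l2))"
      unfolding sum_mixed_radix[OF d, symmetric]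
      by (rule sum.cong[OF refl])
        (simp add: G_cf_def W0_def W1_def W2_def V0_def V1_def V2_def \<phi>_def[symmetric] algebra_simps)
  qed
  also have "\<dots> = (\<Sum>l\<in>{0..w - 1}. \<Sum>l1\<in>{0..?y1}. \<Sum>l0\<in>{0..?y0}. \<Sum>l2\<in>{0..?y2}.
        ?K * (cf (u \<phi>) (w - 1 - l) (?y1 - l1) (?y0 - l0) (?y2 - l2) * cf (dsp4 \<phi> (u \<gamma>)) l l1 l0 l2))"
    unfolding atLeastAtMost_minus_1_int
  proof (intro sum.cong refl)
    fix l l1 l0 l2 assume "l \<in> {0..<w}" "l1 \<in> {0..?y1}" "l0 \<in> {0..?y0}" "l2 \<in> {0..?y2}"
    then have *: "0 \<le> l" "0 \<le> l0" "0 \<le> l1" "0 \<le> l2"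
      and "ucf u \<phi> (w - 1 - l) (?y1 - l1) (?y0 - l0) (?y2 - l2) = cf (u \<phi>) (w - 1 - l) (?y1 - l1) (?y0 - l0) (?y2 - l2)"
      by (auto simp: ucf_def)
    then show "?K * (of_int ((\<phi> - 1) * (\<phi> - 2) div 2 * l0 + \<phi> * (2 - \<phi>) * l1 + \<phi> * (\<phi> - 1) div 2 * l2 + 1)
        * ucf u \<gamma> l (\<phi> * (2 - \<phi>) + l1) ((\<phi> - 1) * (\<phi> - 2) div 2 + l0) (\<phi> * (\<phi> - 1) div 2 + l2))
        * ucf u \<phi> (w - 1 - l) (?y1 - l1) (?y0 - l0) (?y2 - l2)
      = ?K * (cf (u \<phi>) (w - 1 - l) (?y1 - l1) (?y0 - l0) (?y2 - l2) * cf (dsp4 \<phi> (u \<gamma>)) l l1 l0 l2)"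
      unfolding summand[OF *] by (simp only: mult_ac)
  qed
  also have "\<dots> = ?K * cf (conv4 (u \<phi>) (dsp4 \<phi> (u \<gamma>))) (w - 1) ?y1 ?y0 ?y2"
    using w y by (simp only: cf_conv4 sum_distrib_left)
  finally show ?thesis by (simp add: hat_def mult_ac)
qed

lemma enum_sum_distrib:
  fixes f :: "'b \<Rightarrow> int \<Rightarrow> int \<Rightarrow> int \<Rightarrow> real"
  shows "(\<Sum>\<phi>\<in>S. enum_sum E (f \<phi>)) = enum_sum E (\<lambda>a n m. \<Sum>\<phi>\<in>S. f \<phi> a n m)"
  unfolding enum_sum_def sum.distrib
  by (intro arg_cong2[of _ _ _ _ "(+)"]) (subst sum.swap, intro sum.cong refl, rule sum.swap)+

text \<open>\<open>Gamma'\<close> and the block data do not depend on the time level beyond the code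
  itself, so the sums over levels and blocks can be exchanged. Summing the blocks over
  \<open>\<phi>\<close> gives \<open>conv_arr\<close>, and \<open>enum_sum_H_cf\<close> assembles
  \<open>Phi_ex\<close>.\<close>

lemma convective_terms:
  assumes w: "w \<ge> 1" and pqr: "p \<ge> 2" "q \<ge> 2" "r \<ge> 2"
  shows "(\<Sum>i\<in>{0..<sigma p q r \<alpha> * w}. Gamma' \<nu> g u w p q r \<alpha> i
      * ucf u (T\<alpha>' w p q r \<alpha> i) (T\<omega>' w p q r \<alpha> i) (T1' w p q r \<alpha> i) (T0' w p q r \<alpha> i) (T2' w p q r \<alpha> i)
      * ucf u (Z\<alpha>' w p q r \<alpha> i) (Z\<omega>' w p q r \<alpha> i) (Z1' w p q r \<alpha> i) (Z0' w p q r \<alpha> i) (Z2' w p q r \<alpha> i))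
    = Phi_ex e (orient \<alpha> (conv_arr u (w - 1) \<alpha>)) (orient \<alpha> (conv_arr u (w - 1) (3 - \<alpha>))) (orient \<alpha> (conv_arr u (w - 1) 0)) i q k
      / (of_int w * (fct p * fct q * fct r))"
proof -
  let ?D = "fct p * fct q * fct r"
  let ?\<gamma> = "\<lambda>d. B_ix d q * (\<alpha> + A_ix d q * (A_ix d q - 2) * (2 * \<alpha> - 3))"
  let ?h = "\<lambda>l d \<iota>. 1 / of_int w * G_cf p q r \<alpha> d \<iota>
      * ucf u (?\<gamma> d) l (W1 p q r \<alpha> d \<iota>) (W0 p q r \<alpha> d \<iota>) (W2 p q r \<alpha> d \<iota>)
      * ucf u (phi_ix d q) (w - 1 - l) (V1 p q r \<alpha> d \<iota>) (V0 q r \<alpha> d \<iota>) (V2 q r \<alpha> d \<iota>)"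
  have P: "\<not> P2 w p q r" "\<not> P3 w p q r" using pqr w by (auto simp: P2_def P3_def)
  have "(\<Sum>i\<in>{0..<sigma p q r \<alpha> * w}. Gamma' \<nu> g u w p q r \<alpha> i
      * ucf u (T\<alpha>' w p q r \<alpha> i) (T\<omega>' w p q r \<alpha> i) (T1' w p q r \<alpha> i) (T0' w p q r \<alpha> i) (T2' w p q r \<alpha> i)
      * ucf u (Z\<alpha>' w p q r \<alpha> i) (Z\<omega>' w p q r \<alpha> i) (Z1' w p q r \<alpha> i) (Z0' w p q r \<alpha> i) (Z2' w p q r \<alpha> i))
    = (\<Sum>i\<in>{0..<sigma p q r \<alpha> * w}. ?h (i div sigma p q r \<alpha>) (d_star p q r \<alpha> i) (i_star p q r \<alpha> i))"
  proof (rule sum.cong[OF refl])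
    fix i assume i: "i \<in> {0..<sigma p q r \<alpha> * w}"
    then have "i div sigma p q r \<alpha> < w"
      using int_div_less_iff[OF sigma_pos] by simp
    then show "Gamma' \<nu> g u w p q r \<alpha> i
      * ucf u (T\<alpha>' w p q r \<alpha> i) (T\<omega>' w p q r \<alpha> i) (T1' w p q r \<alpha> i) (T0' w p q r \<alpha> i) (T2' w p q r \<alpha> i)
      * ucf u (Z\<alpha>' w p q r \<alpha> i) (Z\<omega>' w p q r \<alpha> i) (Z1' w p q r \<alpha> i) (Z0' w p q r \<alpha> i) (Z2' w p q r \<alpha> i)
      = ?h (i div sigma p q r \<alpha>) (d_star p q r \<alpha> i) (i_star p q r \<alpha> i)"
      using P i by (simp add: Gamma'_def R1_def T\<alpha>'_def T\<omega>'_def T1'_def T0'_def T2'_def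
          Z\<alpha>'_def Z\<omega>'_def Z1'_def Z0'_def Z2'_def)
  qed
  also have "\<dots> = (\<Sum>l\<in>{0..<w}. \<Sum>d\<in>{0..<J}. \<Sum>\<iota>\<in>{0..<S_blk p q r \<alpha> d}. ?h l d (\<iota> + 1))"
    by (rule sum_sigma_blocks) (use w in simp)
  also have "\<dots> = (\<Sum>d\<in>{0..<J}. \<Sum>l\<in>{0..<w}. \<Sum>\<iota>\<in>{0..<S_blk p q r \<alpha> d}. ?h l d (\<iota> + 1))"
    by (rule sum.swap)
  also have "\<dots> = (\<Sum>d\<in>{0..<J}. 1 / (of_int w * ?D) * (\<lambda>b \<phi> a n m. H_cf q a n m b
      * hat (conv4 (u \<phi>) (dsp4 \<phi> (u (b * (\<alpha> + a * (a - 2) * (2 * \<alpha> - 3)))))) (w - 1) (Y1 p q \<alpha> a n m b) (Y0 q a n b) (Y2 q r \<alpha> a n m b))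
        (B_ix d q) (phi_ix d q) (A_ix d q) (N_ix d q) (M_ix d q))"
  proof (rule sum.cong[OF refl])
    fix d assume "d \<in> {0..<J}"
    then have d: "0 \<le> d" "d < J" by auto
    have "(\<Sum>l\<in>{0..<w}. \<Sum>\<iota>\<in>{0..<S_blk p q r \<alpha> d}. ?h l d (\<iota> + 1))
      = 1 / of_int w * (\<Sum>l\<in>{0..<w}. \<Sum>\<iota>\<in>{0..<S_blk p q r \<alpha> d}. G_cf p q r \<alpha> d (\<iota> + 1)
      * ucf u (?\<gamma> d) l (W1 p q r \<alpha> d (\<iota> + 1)) (W0 p q r \<alpha> d (\<iota> + 1)) (W2 p q r \<alpha> d (\<iota> + 1))
      * ucf u (phi_ix d q) (w - 1 - l) (V1 p q r \<alpha> d (\<iota> + 1)) (V0 q r \<alpha> d (\<iota> + 1)) (V2 q r \<alpha> d (\<iota> + 1)))"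
      by (simp only: sum_distrib_left mult.assoc)
    then show "(\<Sum>l\<in>{0..<w}. \<Sum>\<iota>\<in>{0..<S_blk p q r \<alpha> d}. ?h l d (\<iota> + 1)) = 1 / (of_int w * ?D) * (\<lambda>b \<phi> a n m. H_cf q a n m b
      * hat (conv4 (u \<phi>) (dsp4 \<phi> (u (b * (\<alpha> + a * (a - 2) * (2 * \<alpha> - 3)))))) (w - 1) (Y1 p q \<alpha> a n m b) (Y0 q a n b) (Y2 q r \<alpha> a n m b))
        (B_ix d q) (phi_ix d q) (A_ix d q) (N_ix d q) (M_ix d q)"
      unfolding convective_block[OF d w] Y0b_def Y1b_def Y2b_def by simp
  qed
  also have "\<dots> = 1 / (of_int w * ?D) * (\<Sum>b\<in>{0, 1}. \<Sum>\<phi>\<in>{0, 1, 2}. enum_sum (int e) (\<lambda>a n m. H_cf q a n m b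
      * hat (conv4 (u \<phi>) (dsp4 \<phi> (u (b * (\<alpha> + a * (a - 2) * (2 * \<alpha> - 3)))))) (w - 1) (Y1 p q \<alpha> a n m b) (Y0 q a n b) (Y2 q r \<alpha> a n m b)))"
    unfolding sum_distrib_left[symmetric]
    by (rule arg_cong[OF sum_J[of "\<lambda>b \<phi> a n m. H_cf q a n m b * hat (conv4 (u \<phi>)
          (dsp4 \<phi> (u (b * (\<alpha> + a * (a - 2) * (2 * \<alpha> - 3)))))) (w - 1)
          (Y1 p q \<alpha> a n m b) (Y0 q a n b) (Y2 q r \<alpha> a n m b)"]])
  also have "\<dots> = 1 / (of_int w * ?D) * (\<Sum>b\<in>{0, 1}. enum_sum (int e) (\<lambda>a n m. H_cf q a n m b
      * conv_arr u (w - 1) (b * (\<alpha> + a * (a - 2) * (2 * \<alpha> - 3))) (Y1 p q \<alpha> a n m b) (Y0 q a n b) (Y2 q r \<alpha> a n m b)))"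
    unfolding enum_sum_distrib conv_arr_def sum_distrib_left[symmetric] ..
  finally show ?thesis unfolding enum_sum_H_cf by simp
qed

text \<open>The codes form three stretches: the convective ones below \<open>sigma * w\<close>, the
  single code \<open>sigma * w\<close> with the force and prescribed terms, and 8 e viscous codes,
  numbered by n and z with z running fastest.\<close>

lemma one_step_cell:
  assumes ns: "ns_coeffs u g Q \<nu>" and w: "w \<ge> 1" and pqr: "p \<ge> 2" "q \<ge> 2" "r \<ge> 2"
  shows "ucf u \<alpha> w p q r = (\<Sum>i\<in>{0..FF p q r \<alpha> w}. Gamma' \<nu> g u w p q r \<alpha> i
      * ucf u (T\<alpha>' w p q r \<alpha> i) (T\<omega>' w p q r \<alpha> i) (T1' w p q r \<alpha> i) (T0' w p q r \<alpha> i) (T2' w p q r \<alpha> i)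
      * ucf u (Z\<alpha>' w p q r \<alpha> i) (Z\<omega>' w p q r \<alpha> i) (Z1' w p q r \<alpha> i) (Z0' w p q r \<alpha> i) (Z2' w p q r \<alpha> i))"
    (is "_ = sum ?t _")
proof -
  interpret ns_coeffs u g Q \<nu> by (rule ns)
  let ?s = "sigma p q r \<alpha>"
  let ?W = "of_int w * (fct p * fct q * fct r)"
  have spos: "?s > 0" by (rule sigma_pos)
  have sw: "0 \<le> ?s * w" using spos w by simp
  have P: "\<not> P2 w p q r" "\<not> P3 w p q r" "P1 w p q r" using pqr w by (auto simp: P1_def P2_def P3_def)
  have W: "?W \<noteq> 0" using w fct_pos by simp
  have FF: "FF p q r \<alpha> w = ?s * w + 8 * int e"
    using pqr w alpha by (auto simp: FF_def e)
  \<comment> \<open>From code \<open>sigma * w\<close> on, the time index of the second factor is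
    negative; the factor is 1 by convention and the summand becomes linear.\<close>
  have late: "\<not> R1 w p q r \<alpha> i" "T\<omega>' w p q r \<alpha> i = w - 1"
    "ucf u (Z\<alpha>' w p q r \<alpha> i) (Z\<omega>' w p q r \<alpha> i) (Z1' w p q r \<alpha> i) (Z0' w p q r \<alpha> i) (Z2' w p q r \<alpha> i) = 1"
    if "i \<ge> ?s * w" for i
  proof -
    have "\<not> i div ?s < w" using that int_div_less_iff[OF spos] by simp
    then show "T\<omega>' w p q r \<alpha> i = w - 1" using P by (simp add: T\<omega>'_def)
    show "\<not> R1 w p q r \<alpha> i" using that by (simp add: R1_def)
    have "Z\<omega>' w p q r \<alpha> i < 0" using \<open>\<not> i div ?s < w\<close> P by (simp add: Z\<omega>'_def)
    then show "ucf u (Z\<alpha>' w p q r \<alpha> i) (Z\<omega>' w p q r \<alpha> i) (Z1' w p q r \<alpha> i) (Z0' w p q r \<alpha> i) (Z2' w p q r \<alpha> i) = 1"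
      by (simp add: ucf_def)
  qed
  \<comment> \<open>\<open>E_plus\<close> in place of the floor is what makes this kind 0 and not 8.
    For kind 0 the first factor has index -1 as well, hence is 1.\<close>
  have zs0: "z_star w p q r \<alpha> (?s * w) = 0" "N_pos w p q r \<alpha> (?s * w) = 0"
    by (simp_all add: z_star_def N_pos_def chi_def E_plus_def)
  have t0: "?t (?s * w) = F0 u w p q r \<alpha> + F0t g w p q r \<alpha>"
    unfolding late(3)[OF order_refl]
    using P by (simp add: Gamma'_def late(1) zs0 F_cf_def T0'_def Delt_def ucf_def)
  have zsy: "z_star w p q r \<alpha> (?s * w + 1 + y) = y mod 8 + 1" "N_pos w p q r \<alpha> (?s * w + 1 + y) = y div 8 + 1"
    if "y \<ge> 0" for y
  proof -
    have "\<lfloor>real_of_int y / 8\<rfloor> = y div 8"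
      using floor_divide_of_int_eq[of y 8] by simp
    then show "z_star w p q r \<alpha> (?s * w + 1 + y) = y mod 8 + 1"
      using that minus_mult_div_eq_mod[of y 8] by (simp add: z_star_def chi_def E_plus_def)
    show "N_pos w p q r \<alpha> (?s * w + 1 + y) = y div 8 + 1"
      by (simp add: N_pos_def chi_def)
  qed
  let ?v = "\<lambda>n z. F_cf \<nu> g u z w p q r \<alpha> n
        * ucf u (kapp z \<alpha>) (w - 1) (xi z p q \<alpha> n) (Delt z q) (epsi z q r \<alpha> n)"
  have ty: "?t (?s * w + 1 + y) = ?v (y div 8 + 1) (y mod 8 + 1)" if "y \<ge> 0" for y
  proof -
    have ge: "?s * w + 1 + y \<ge> ?s * w" using that by simp
    show ?thesis
      unfolding late(2,3)[OF ge]
      using P late(1)[OF ge] by (simp add: Gamma'_def zsy[OF that] T\<alpha>'_def T1'_def T0'_def T2'_def)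
  qed
  have "{0..FF p q r \<alpha> w} = {0..<?s * w} \<union> insert (?s * w) {?s * w + 1..<?s * w + 1 + int e * 8}"
    unfolding FF using sw by auto
  then have "sum ?t {0..FF p q r \<alpha> w} = sum ?t {0..<?s * w} + sum ?t (insert (?s * w) {?s * w + 1..<?s * w + 1 + int e * 8})"
    by (simp only:) (rule sum.union_disjoint, auto)
  also have "sum ?t (insert (?s * w) {?s * w + 1..<?s * w + 1 + int e * 8})
      = ?t (?s * w) + (\<Sum>y\<in>{0..<int e * 8}. ?t (?s * w + 1 + y))"
    by (subst sum.insert) (simp_all only: sum_shift_int finite_atLeastLessThan_int, auto)
  also have "(\<Sum>y\<in>{0..<int e * 8}. ?t (?s * w + 1 + y)) = (\<Sum>y\<in>{0..<int e * 8}. ?v (y div 8 + 1) (y mod 8 + 1))"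
    by (rule sum.cong[OF refl], rule ty) simp
  also have "\<dots> = (\<Sum>n\<in>{0..<int e}. \<Sum>z\<in>{0..<8}. ?v (n + 1) (z + 1))"
    by (rule sum_div_mod[of 8 "int e" "\<lambda>n z. ?v (n + 1) (z + 1)"]) simp_all
  also have "\<dots> = (\<Sum>n\<in>{0..<int e}. \<Sum>z\<in>{1..8}. ?v (n + 1) z)"
    by (intro sum.cong refl sum.reindex_bij_betw, rule bij_betw_byWitness[where f' = "\<lambda>x. x - 1"]) auto
  also have "\<dots> = (\<Sum>n\<in>{1..int e}. \<Sum>z\<in>{1..8}. ?v n z)"
    by (rule sum.reindex_bij_betw[of "\<lambda>n. n + 1" _ _ "\<lambda>n. \<Sum>z\<in>{1..8}. ?v n z"],
        rule bij_betw_byWitness[where f' = "\<lambda>x. x - 1"]) auto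
  finally have total: "sum ?t {0..FF p q r \<alpha> w} = sum ?t {0..<?s * w}
      + (F0 u w p q r \<alpha> + F0t g w p q r \<alpha> + (\<Sum>n\<in>{1..int e}. \<Sum>z\<in>{1..8}. ?v n z))"
    unfolding t0 .
  let ?h = "\<lambda>\<gamma>. hat (u \<gamma>) (w - 1)" and ?G = "\<lambda>\<gamma>. hat (g \<gamma>) (w - 1)"
  \<comment> \<open>The force for \<open>pressure_elimination\<close>: convection minus viscosity
    minus acceleration. The velocity there is w times level w, i.e. the time derivative at level w -
    1. By linearity of \<open>Phi\<close> the three parts of the force are matched
    separately.\<close>
  let ?N = "\<lambda>\<gamma> P Q R. conv_arr u (w - 1) \<gamma> P Q R + ((- \<nu>) * Lap (?h \<gamma>) P Q R + (- 1) * ?G \<gamma> P Q R)"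
  have mom: "of_int w * hat (u \<gamma>) w P R S + ?N \<gamma> P R S = hat (dsp4 \<gamma> Q) (w - 1) P R S"
    if \<gamma>: "\<gamma> \<in> {0, 1, 2}" and nn: "0 \<le> P" "0 \<le> R" "0 \<le> S" for \<gamma> P R S
  proof -
    have "Lap (?h \<gamma>) P R S = (\<Sum>\<phi>\<in>{0, 1, 2}. hat (dsp4 \<phi> (dsp4 \<phi> (u \<gamma>))) (w - 1) P R S)"
      using nn by (simp add: Lap_def hat_dsp4 add_ac)
    moreover have "hat (dt4 (u \<gamma>)) (w - 1) P R S + conv_arr u (w - 1) \<gamma> P R S
      = hat (dsp4 \<gamma> Q) (w - 1) P R S + \<nu> * (\<Sum>\<phi>\<in>{0, 1, 2}. hat (dsp4 \<phi> (dsp4 \<phi> (u \<gamma>))) (w - 1) P R S) + ?G \<gamma> P R S"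
      using arg_cong[OF momentum[OF \<gamma>, of "nat (w - 1)" "nat P" "nat R" "nat S"], of "\<lambda>x. fct P * fct R * fct S * x"]
      by (simp add: conv_arr_def hat_def cf_def algebra_simps)
    ultimately show ?thesis unfolding hat_dt4[OF w] by simp
  qed
  have div: "hat (u 1) w' (P + 1) R S + hat (u 2) w' P R (S + 1) + hat (u 0) w' P (R + 1) S = 0"
    if nn: "0 \<le> P" "0 \<le> R" "0 \<le> S" for w' P R S
  proof -
    have "fct P * fct R * fct S * (cf (dsp4 0 (u 0)) w' P R S + cf (dsp4 1 (u 1)) w' P R S + cf (dsp4 2 (u 2)) w' P R S) = 0"
      unfolding cf_def divergence by simp
    then have "hat (dsp4 1 (u 1)) w' P R S + hat (dsp4 2 (u 2)) w' P R S + hat (dsp4 0 (u 0)) w' P R S = 0"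
      unfolding hat_def by (simp add: algebra_simps)
    then show ?thesis using hat_dsp4[OF nn] by simp
  qed
  let ?o = "orient \<alpha>"
  let ?va = "?o (\<lambda>P R S. of_int w * hat (u \<alpha>) w P R S)"
  let ?vb = "?o (\<lambda>P R S. of_int w * hat (u (3 - \<alpha>)) w P R S)"
  let ?vz = "?o (\<lambda>P R S. of_int w * hat (u 0) w P R S)"
  have nn: "0 \<le> i" "0 \<le> j" "0 \<le> k" using ik alpha nonneg j_01 by (auto simp: X_def)
  have main: "?va i (j + 2 * int e) k = (-1) ^ e * (Dn (e - 1) ?va (i + 2) j k + Dn (e - 1) ?vb (i + 1) j (k + 1))
      + Phi e (?o (?N \<alpha>)) (?o (?N (3 - \<alpha>))) (?o (?N 0)) i (j + 2 * int e) k"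
  proof (rule pressure_elimination[of ?va "?o (?N \<alpha>)" "?o (hat Q (w - 1))" ?vb "?o (?N (3 - \<alpha>))" ?vz "?o (?N 0)"])
    fix i j k :: int assume n: "0 \<le> i" "0 \<le> j" "0 \<le> k"
    note m = mom[of 1 i j k] mom[of 2 i j k] mom[of 0 i j k] mom[of 1 k j i] mom[of 2 k j i] mom[of 0 k j i]
    note d = hat_dsp4[OF n] hat_dsp4[OF n(3,2,1)]
    show "?va i j k + ?o (?N \<alpha>) i j k = ?o (hat Q (w - 1)) (i + 1) j k"
      using alpha m n by (elim disjE) (simp_all add: orient_def d)
    show "?vb i j k + ?o (?N (3 - \<alpha>)) i j k = ?o (hat Q (w - 1)) i j (k + 1)"
      using alpha m n by (elim disjE) (simp_all add: orient_def d)
    show "?vz i j k + ?o (?N 0) i j k = ?o (hat Q (w - 1)) i (j + 1) k"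
      using alpha m n by (elim disjE) (simp_all add: orient_def d)
    show "?va (i + 1) j k + ?vb i j (k + 1) + ?vz i (j + 1) k = 0"
      using alpha div[OF n, of w] div[OF n(3,2,1), of w]
      by (elim disjE) (simp_all add: orient_def distrib_left[symmetric] add.commute)
  qed (use nn e in auto)
  have va: "?va i (j + 2 * int e) k = ?W * ucf u \<alpha> w p q r"
    using alpha pqr w by (elim disjE) (simp_all add: orient_def hat_def ik X_def flip: q_eq, simp_all add: ucf_def)
  have DD: "Dn (e - 1) ?va x y z = of_int w * Dn (e - 1) (?o (hat (u \<alpha>) w)) x y z"
    "Dn (e - 1) ?vb x y z = of_int w * Dn (e - 1) (?o (hat (u (3 - \<alpha>)) w)) x y z" for x y z
  proof -
    have "?o (\<lambda>P R S. c * f P R S) = (\<lambda>i j k. c * ?o f i j k)" for c f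
      by (auto simp: orient_def fun_eq_iff)
    then show "Dn (e - 1) ?va x y z = of_int w * Dn (e - 1) (?o (hat (u \<alpha>) w)) x y z"
      "Dn (e - 1) ?vb x y z = of_int w * Dn (e - 1) (?o (hat (u (3 - \<alpha>)) w)) x y z"
      by (simp_all only: Dn_cmult)
  qed
  have oN: "?o (?N \<gamma>) = (\<lambda>i j k. ?o (conv_arr u (w - 1) \<gamma>) i j k
      + ((- \<nu>) * Lap (?o (?h \<gamma>)) i j k + (- 1) * ?o (?G \<gamma>) i j k))" for \<gamma>
    by (auto simp: orient_def Lap_def fun_eq_iff algebra_simps)
  have conv: "?W * sum ?t {0..<?s * w}
      = Phi e (?o (conv_arr u (w - 1) \<alpha>)) (?o (conv_arr u (w - 1) (3 - \<alpha>))) (?o (conv_arr u (w - 1) 0)) i q k"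
    unfolding convective_terms[OF w pqr] Phi_eq_Phi_ex[OF e(2), symmetric] using W by simp
  have F0: "fct p * fct q * fct r * F0 u w p q r \<alpha> = (-1) ^ e * (Dn (e - 1) (?o (hat (u \<alpha>) w)) (i + 2) j k
      + Dn (e - 1) (?o (hat (u (3 - \<alpha>)) w)) (i + 1) j (k + 1))"
    by (rule F0_eq) (use w in simp)
  have F0t: "?W * F0t g w p q r \<alpha> = - Phi e (?o (?G \<alpha>)) (?o (?G (3 - \<alpha>))) (?o (?G 0)) i q k"
    unfolding Phi_eq_Phi_ex[OF e(2)] by (rule F0t_eq) (use w in simp)
  have visc: "?W * (\<Sum>n\<in>{1..int e}. \<Sum>z\<in>{1..8}. ?v n z)
      = - \<nu> * Phi e (Lap (?o (?h \<alpha>))) (Lap (?o (?h (3 - \<alpha>)))) (Lap (?o (?h 0))) i q k"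
    by (rule viscous_terms) (use w div in auto)
  have "?W * sum ?t {0..FF p q r \<alpha> w} = ?W * sum ?t {0..<?s * w} + of_int w * (fct p * fct q * fct r * F0 u w p q r \<alpha>)
      + ?W * F0t g w p q r \<alpha> + ?W * (\<Sum>n\<in>{1..int e}. \<Sum>z\<in>{1..8}. ?v n z)"
    unfolding total by (simp add: algebra_simps)
  also have "\<dots> = ?va i (j + 2 * int e) k"
    unfolding main unfolding DD oN Phi_add Phi_cmult conv F0 F0t visc unfolding q_eq[symmetric]
    by (simp add: algebra_simps)
  also have "\<dots> = ?W * ucf u \<alpha> w p q r" by (rule va)
  finally show ?thesis using W by simp
qed

end

section \<open>Ranges and levels of the states reached by the recursion\<close>

lemma cellI:
  assumes "\<alpha> = 1 \<or> \<alpha> = 2" "p \<ge> 0" "q \<ge> 2" "r \<ge> 0"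
  shows "cell p q r \<alpha> (nat (q div 2)) (X \<alpha> p q r) (q - 2 * int (nat (q div 2))) (X (3 - \<alpha>) p q r)"
  using assms by unfold_locales auto

lemma not_P2_P3:
  "\<not> P2 w p q r \<and> \<not> P3 w p q r \<longleftrightarrow> w \<ge> 1 \<and> p \<ge> 2 \<and> q \<ge> 2 \<and> r \<ge> 2"
  by (auto simp: P2_def P3_def)

lemma P2_P3_cases:
  obtains "P2 w p q r" | "\<not> P2 w p q r" "P3 w p q r"
    | "w \<ge> 1" "p \<ge> 2" "q \<ge> 2" "r \<ge> 2" "\<not> P2 w p q r" "\<not> P3 w p q r"
  using not_P2_P3 by blast

lemma FF_trivial: "P2 w p q r \<or> P3 w p q r \<Longrightarrow> FF p q r \<alpha> w = 0"
  by (auto simp: FF_def P2_def P3_def)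

lemma sigma_pos_of_ge_2:
  assumes "\<alpha> = 1 \<or> \<alpha> = 2" "p \<ge> 0" "q \<ge> 2" "r \<ge> 0"
  shows "sigma p q r \<alpha> > 0"
  by (rule cell.sigma_pos[OF cellI[OF assms]])

text \<open>The codes for the middle component are those of its two reductions side by side; both
  ranges start at 0, hence the additional 1. For q = 2 both bounds are 0.\<close>

lemma FF_alpha_0:
  assumes "w \<ge> 1" "p \<ge> 2" "q \<ge> 2" "r \<ge> 2"
  shows "FF p q r 0 w = FF (p + 1) (q - 1) r 1 w + FF p (q - 1) (r + 1) 2 w + 1"
  using assms by (auto simp: FF_def)

lemma FF_nonneg_12: "\<alpha> = 1 \<or> \<alpha> = 2 \<Longrightarrow> FF p q r \<alpha> w \<ge> 0"
  using sigma_pos_of_ge_2[of \<alpha> p q r] by (auto simp: FF_def less_imp_le)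

lemma FF_nonneg:
  assumes "\<alpha> \<in> {0, 1, 2} \<or> P2 w p q r"
  shows "FF p q r \<alpha> w \<ge> 0"
proof (cases rule: P2_P3_cases[of w p q r])
  case 3
  then show ?thesis
    using assms FF_alpha_0[of w p q r] FF_nonneg_12[of 1 "p + 1" "q - 1" r w]
      FF_nonneg_12[of 2 p "q - 1" "r + 1" w] FF_nonneg_12[of \<alpha> p q r w] by auto
qed (simp_all add: FF_trivial)

text \<open>Kind 0 produces the component number -1, but together with negative indices, where the
  coefficient is 1 for any component.\<close>

definition state_ok :: "state \<Rightarrow> bool" where
  "state_ok = (\<lambda>(p, q, r, \<alpha>, w). \<alpha> \<in> {0, 1, 2} \<or> P2 w p q r)"

text \<open>Both factors of a nontrivial state have a lower time level, so this bounds the number of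
  steps until only prescribed or negative indices remain.\<close>

definition within_level :: "nat \<Rightarrow> state \<Rightarrow> bool" where
  "within_level n = (\<lambda>(p, q, r, \<alpha>, w). P2 w p q r \<or> P3 w p q r \<or> w \<le> int n)"

definition FF_at :: "state \<Rightarrow> int" where
  "FF_at = (\<lambda>(p, q, r, \<alpha>, w). FF p q r \<alpha> w)"

definition pick' :: "int \<Rightarrow> state \<Rightarrow> int \<Rightarrow> state" where
  "pick' b = (\<lambda>(p, q, r, \<alpha>, w) i.
    if b = 1 then (T1' w p q r \<alpha> i, T0' w p q r \<alpha> i, T2' w p q r \<alpha> i, T\<alpha>' w p q r \<alpha> i, T\<omega>' w p q r \<alpha> i)
    else (Z1' w p q r \<alpha> i, Z0' w p q r \<alpha> i, Z2' w p q r \<alpha> i, Z\<alpha>' w p q r \<alpha> i, Z\<omega>' w p q r \<alpha> i))"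

lemma pick_eq_pick':
  "pick b (p, q, r, \<alpha>, w) i =
    (if \<not> P2 w p q r \<and> \<not> P3 w p q r \<and> \<alpha> = 0 then
       (if R2 w p q r i then pick' b (p + 1, q - 1, r, 1, w) i
        else pick' b (p, q - 1, r + 1, 2, w) (i - FF (p + 1) (q - 1) r 1 w - 1))
     else pick' b (p, q, r, \<alpha>, w) i)"
  by (simp add: pick_def pick'_def reduce0_def T0_def T1_def T2_def T\<alpha>_def T\<omega>_def
      Z0_def Z1_def Z2_def Z\<alpha>_def Z\<omega>_def)

text \<open>The indicator argument again. It has to cover arbitrary nonnegative codes because Z is
  evaluated at \<open>d_star\<close> on the viscous stretch too.\<close>

lemma d_star_range:
  assumes c: "cell p q r \<alpha> e i j k" and x: "x \<ge> 0"
  shows "0 \<le> d_star p q r \<alpha> x \<and> d_star p q r \<alpha> x < cell.J e"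
proof -
  interpret cell p q r \<alpha> e i j k by (rule c)
  let ?f = "\<lambda>d. if 0 \<le> d \<and> d < J then 0 else 1 :: nat"
  \<comment> \<open>One level more than the level of \<open>x\<close>, so that \<open>x\<close> is
    among the codes enumerated by \<open>sum_sigma_blocks\<close>.\<close>
  define w where "w = x div sigma p q r \<alpha> + 1"
  have w: "0 \<le> w" "x < sigma p q r \<alpha> * w"
    using x sigma_pos int_div_less_iff[OF sigma_pos, of x w]
    by (simp_all add: w_def pos_imp_zdiv_nonneg_iff)
  have "(\<Sum>i\<in>{0..<sigma p q r \<alpha> * w}. ?f (d_star p q r \<alpha> i)) = (\<Sum>l\<in>{0..<w}. \<Sum>d\<in>{0..<J}. \<Sum>\<iota>\<in>{0..<S_blk p q r \<alpha> d}. ?f d)"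
    by (rule sum_sigma_blocks[OF w(1), of "\<lambda>l d \<iota>. ?f d"])
  also have "\<dots> = 0" by simp
  finally have "?f (d_star p q r \<alpha> x) = 0"
    using w x by (subst (asm) sum_eq_0_iff) auto
  then show ?thesis by (auto split: if_splits)
qed

lemma pick'_state_ok:
  assumes \<alpha>: "\<alpha> = 1 \<or> \<alpha> = 2" and i: "i \<ge> 0" and q: "b = 1 \<or> b = 2"
  shows "state_ok (pick' b (p, q, r, \<alpha>, w) i)"
proof (cases rule: P2_P3_cases[of w p q r])
  case 1
  then show ?thesis by (auto simp: pick'_def T0'_def Z0'_def state_ok_def P2_def[of _ _ "-1"])
next
  case 2
  then show ?thesis using \<alpha> by (auto simp: pick'_def T\<alpha>'_def Z0'_def state_ok_def P2_def[of _ _ "-1"])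
next
  case 3
  note c = cellI[OF \<alpha>, of p q r]
  have "0 \<le> p" "0 \<le> r" using 3 by simp_all
  note c = cellI[OF \<alpha> this(1) 3(3) this(2)]
  interpret cell p q r \<alpha> "nat (q div 2)" "X \<alpha> p q r" "q - 2 * int (nat (q div 2))" "X (3 - \<alpha>) p q r"
    by (rule c)
  have d: "0 \<le> d_star p q r \<alpha> i" "d_star p q r \<alpha> i < J" using d_star_range[OF c i] by simp_all
  have inr: "B_ix (d_star p q r \<alpha> i) q \<in> {0, 1}" "phi_ix (d_star p q r \<alpha> i) q \<in> {0, 1, 2}"
    "A_ix (d_star p q r \<alpha> i) q \<in> {0, 1, 2}"
    using in_range_index_functions[OF d] by (auto simp: in_range_def)
  have "T\<alpha>' w p q r \<alpha> i \<in> {0, 1, 2} \<or> T0' w p q r \<alpha> i < 0"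
  proof (cases "R1 w p q r \<alpha> i")
    case True
    then show ?thesis using \<alpha> inr 3 by (auto simp: T\<alpha>'_def)
  next
    case False
    then show ?thesis using \<alpha> 3 by (auto simp: T\<alpha>'_def T0'_def kapp_def Delt_def)
  qed
  moreover have "Z\<alpha>' w p q r \<alpha> i \<in> {0, 1, 2}" using inr 3 by (simp add: Z\<alpha>'_def)
  ultimately show ?thesis using q by (auto simp: pick'_def state_ok_def P2_def)
qed

lemma R2_neg: "\<not> R2 w p q r i \<Longrightarrow> i - FF (p + 1) (q - 1) r 1 w - 1 \<ge> 0"
  by (simp add: R2_def)

lemma pick_state_ok:
  assumes "state_ok s" "i \<ge> 0" "b = 1 \<or> b = 2"
  shows "state_ok (pick b s i)"
proof -
  obtain p q r \<alpha> w where s: "s = (p, q, r, \<alpha>, w)" by (cases s)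
  show ?thesis
  proof (cases "P2 w p q r")
    case True
    then show ?thesis
      using assms(3) by (auto simp: s pick_eq_pick' pick'_def T0'_def Z0'_def state_ok_def P2_def[of _ _ "-1"])
  next
    case F2: False
    then have \<alpha>: "\<alpha> \<in> {0, 1, 2}" using assms(1) by (simp add: s state_ok_def)
    show ?thesis
    proof (cases "P3 w p q r \<or> \<alpha> \<noteq> 0")
      case True
      show ?thesis
      proof (cases "\<alpha> = 0")
        case True
        then show ?thesis using \<open>P3 w p q r \<or> \<alpha> \<noteq> 0\<close> F2 assms(3)
          by (auto simp: s pick_eq_pick' pick'_def T\<alpha>'_def Z0'_def state_ok_def P2_def[of _ _ "-1"])
      next
        case False
        then show ?thesis using pick'_state_ok[of \<alpha> i b p q r w] \<alpha> assms by (auto simp: s pick_eq_pick')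
      qed
    next
      case False
      then show ?thesis
        using F2 assms(2,3) R2_neg[of w p q r i] by (auto simp: s pick_eq_pick' intro!: pick'_state_ok)
    qed
  qed
qed

lemma pick'_within_level:
  assumes \<alpha>: "\<alpha> = 1 \<or> \<alpha> = 2 \<or> P2 w p q r \<or> P3 w p q r" and i: "i \<ge> 0" and q: "b = 1 \<or> b = 2"
    and lev: "P2 w p q r \<or> P3 w p q r \<or> w \<le> int n + 1"
  shows "within_level n (pick' b (p, q, r, \<alpha>, w) i)"
proof (cases rule: P2_P3_cases[of w p q r])
  case 1
  then show ?thesis using q by (auto simp: pick'_def T0'_def Z0'_def within_level_def P2_def[of _ _ "-1"])
next
  case 2
  then show ?thesis
    using q by (auto simp: pick'_def T0'_def T1'_def T2'_def T\<omega>'_def Z0'_def within_level_def P2_def[of _ _ "-1"])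
next
  case 3
  then have "sigma p q r \<alpha> > 0" using \<alpha> sigma_pos_of_ge_2[of \<alpha> p q r] by auto
  then have "i div sigma p q r \<alpha> \<ge> 0" using i by (simp add: pos_imp_zdiv_nonneg_iff)
  then show ?thesis using 3 lev q by (auto simp: pick'_def T\<omega>'_def Z\<omega>'_def within_level_def)
qed

lemma pick_within_level:
  assumes "state_ok s" "i \<ge> 0" "b = 1 \<or> b = 2" "within_level (Suc n) s"
  shows "within_level n (pick b s i)"
proof -
  obtain p q r \<alpha> w where s: "s = (p, q, r, \<alpha>, w)" by (cases s)
  have lev: "P2 w p q r \<or> P3 w p q r \<or> w \<le> int n + 1" using assms(4) by (auto simp: s within_level_def)
  show ?thesis
  proof (cases "\<not> P2 w p q r \<and> \<not> P3 w p q r \<and> \<alpha> = 0")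
    case True
    then have "w \<le> int n + 1" using lev by simp
    then show ?thesis
      using True assms(2,3) R2_neg[of w p q r i] by (auto simp: s pick_eq_pick' intro!: pick'_within_level)
  next
    case False
    have "pick b s i = pick' b (p, q, r, \<alpha>, w) i" using False by (simp only: s pick_eq_pick' if_False)
    moreover have "\<alpha> = 1 \<or> \<alpha> = 2 \<or> P2 w p q r \<or> P3 w p q r"
      using assms(1) False by (auto simp: s state_ok_def)
    ultimately show ?thesis using pick'_within_level[OF _ assms(2,3) lev] by simp
  qed
qed

definition step_sum :: "real \<Rightarrow> (int \<Rightarrow> coeffs) \<Rightarrow> (int \<Rightarrow> coeffs) \<Rightarrow> int \<Rightarrow> int \<Rightarrow> int \<Rightarrow> int \<Rightarrow> int \<Rightarrow> int \<Rightarrow> real" where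
  "step_sum \<nu> g u w p q r \<alpha> i = Gamma' \<nu> g u w p q r \<alpha> i
     * ucf_at u (pick' 1 (p, q, r, \<alpha>, w) i) * ucf_at u (pick' 2 (p, q, r, \<alpha>, w) i)"

text \<open>There is a single code, its \<open>Gamma'\<close> is 1, T preserves the coefficient and
  Z yields the factor 1. This is the padding of the recursion tree.\<close>

lemma step_sum_trivial:
  assumes "P2 w p q r \<or> P3 w p q r"
  shows "ucf u \<alpha> w p q r = (\<Sum>i\<in>{0..FF p q r \<alpha> w}. step_sum \<nu> g u w p q r \<alpha> i)"
proof (cases "P2 w p q r")
  case True
  then show ?thesis
    by (auto simp: FF_trivial step_sum_def Gamma'_def pick'_def ucf_at_def T0'_def Z0'_def ucf_def P2_def)
next
  case False
  then show ?thesis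
    using assms by (simp add: FF_trivial step_sum_def Gamma'_def pick'_def ucf_at_def T0'_def T1'_def T2'_def
       T\<alpha>'_def T\<omega>'_def Z0'_def Z1'_def ucf_def[of _ _ _ "-1"])
qed

lemma (in ns_coeffs) step_sum_12:
  assumes "\<alpha> = 1 \<or> \<alpha> = 2"
  shows "ucf u \<alpha> w p q r = (\<Sum>i\<in>{0..FF p q r \<alpha> w}. step_sum \<nu> g u w p q r \<alpha> i)"
proof (cases rule: P2_P3_cases[of w p q r])
  case 3
  have "ns_coeffs u g Q \<nu>" by (rule ns_coeffs_axioms)
  then show ?thesis
    unfolding step_sum_def using cell.one_step_cell[OF cellI[OF assms, of p q r]] 3
    by (simp add: pick'_def ucf_at_def)
qed (simp_all add: step_sum_trivial)

lemma (in ns_coeffs) ucf_0_divergence: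
  assumes "w \<ge> 0" "p \<ge> 0" "q \<ge> 1" "r \<ge> 0"
  shows "ucf u 0 w p q r = - (of_int (p + 1) / of_int q) * ucf u 1 w (p + 1) (q - 1) r
     - (of_int (r + 1) / of_int q) * ucf u 2 w p (q - 1) (r + 1)"
proof -
  have "cf (dsp4 0 (u 0)) w p (q - 1) r + cf (dsp4 1 (u 1)) w p (q - 1) r + cf (dsp4 2 (u 2)) w p (q - 1) r = 0"
    unfolding cf_def by (rule divergence)
  then have "of_int q * cf (u 0) w p q r + of_int (p + 1) * cf (u 1) w (p + 1) (q - 1) r
      + of_int (r + 1) * cf (u 2) w p (q - 1) (r + 1) = 0"
    using assms by (simp add: cf_dsp4)
  then have "cf (u 0) w p q r = (- (of_int (p + 1) * cf (u 1) w (p + 1) (q - 1) r)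
      - of_int (r + 1) * cf (u 2) w p (q - 1) (r + 1)) / of_int q"
  proof -
    assume "of_int q * cf (u 0) w p q r + of_int (p + 1) * cf (u 1) w (p + 1) (q - 1) r
      + of_int (r + 1) * cf (u 2) w p (q - 1) (r + 1) = 0"
    then have "of_int q * cf (u 0) w p q r = - (of_int (p + 1) * cf (u 1) w (p + 1) (q - 1) r)
      - of_int (r + 1) * cf (u 2) w p (q - 1) (r + 1)" by linarith
    then show ?thesis using assms by (simp only: eq_divide_eq mult.commute[of _ "real_of_int q"]) simp
  qed
  then show ?thesis using assms by (simp add: ucf_def diff_divide_distrib)
qed

lemma (in ns_coeffs) one_step:
  assumes "state_ok s"
  shows "ucf_at u s = (\<Sum>i\<in>{0..FF_at s}. Gamma_at \<nu> g u s i * ucf_at u (pick 1 s i) * ucf_at u (pick 2 s i))"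
proof -
  obtain p q r \<alpha> w where s: "s = (p, q, r, \<alpha>, w)" by (cases s)
  show ?thesis
  proof (cases "\<not> P2 w p q r \<and> \<not> P3 w p q r \<and> \<alpha> = 0")
    case False
    then have "Gamma_at \<nu> g u s i * ucf_at u (pick 1 s i) * ucf_at u (pick 2 s i) = step_sum \<nu> g u w p q r \<alpha> i" for i
      unfolding s pick_eq_pick' Gamma_at_def step_sum_def Gamma_cf_def by (simp only: if_False prod.case)
    moreover have "\<alpha> = 1 \<or> \<alpha> = 2 \<or> (P2 w p q r \<or> P3 w p q r)"
      using assms False by (auto simp: s state_ok_def)
    then have "ucf u \<alpha> w p q r = (\<Sum>i\<in>{0..FF p q r \<alpha> w}. step_sum \<nu> g u w p q r \<alpha> i)"
      using step_sum_12[of \<alpha> w p q r] step_sum_trivial[of w p q r u \<alpha> \<nu> g] by auto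
    ultimately show ?thesis by (simp add: s ucf_at_def FF_at_def)
  next
    case True
    then have ge: "w \<ge> 1" "p \<ge> 2" "q \<ge> 2" "r \<ge> 2" using not_P2_P3[of w p q r] by auto
    let ?F1 = "FF (p + 1) (q - 1) r 1 w" and ?F2 = "FF p (q - 1) (r + 1) 2 w"
    let ?t = "\<lambda>i. Gamma_at \<nu> g u s i * ucf_at u (pick 1 s i) * ucf_at u (pick 2 s i)"
    have F: "FF_at s = ?F1 + ?F2 + 1" using True FF_alpha_0[OF ge] by (simp add: s FF_at_def)
    have F0: "?F1 \<ge> 0" "?F2 \<ge> 0" using FF_nonneg_12 by simp_all
    have t1: "?t i = - (of_int (p + 1) / of_int q) * step_sum \<nu> g u w (p + 1) (q - 1) r 1 i" if "i \<le> ?F1" for i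
      using that True unfolding s pick_eq_pick' Gamma_at_def step_sum_def Gamma_cf_def R2_def by simp
    have t2: "?t (?F1 + 1 + i) = - (of_int (r + 1) / of_int q) * step_sum \<nu> g u w p (q - 1) (r + 1) 2 i" if "i \<ge> 0" for i
      using that True unfolding s pick_eq_pick' Gamma_at_def step_sum_def Gamma_cf_def R2_def by simp
    \<comment> \<open>The two stretches of codes match the two summands of
      \<open>ucf_0_divergence\<close>.\<close>
    have "{0..FF_at s} = {0..?F1} \<union> {?F1 + 1..<?F1 + 1 + (?F2 + 1)}" unfolding F using F0 by auto
    then have "sum ?t {0..FF_at s} = sum ?t {0..?F1} + sum ?t {?F1 + 1..<?F1 + 1 + (?F2 + 1)}"
      by (simp only:) (rule sum.union_disjoint, auto)
    also have "sum ?t {0..?F1} = - (of_int (p + 1) / of_int q) * ucf u 1 w (p + 1) (q - 1) r"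
      unfolding step_sum_12[OF disjI1[OF refl]] sum_distrib_left
      by (rule sum.cong[OF refl], rule t1) simp
    also have "sum ?t {?F1 + 1..<?F1 + 1 + (?F2 + 1)} = - (of_int (r + 1) / of_int q) * ucf u 2 w p (q - 1) (r + 1)"
    proof -
      have "{0..<?F2 + 1} = {0..?F2}" by auto
      then show ?thesis
        unfolding step_sum_12[OF disjI2[OF refl]] sum_distrib_left sum_shift_int
        by (simp only:) (rule sum.cong[OF refl], rule t2, simp)
    qed
    finally show ?thesis using ucf_0_divergence[of w p q r] True ge by (simp add: s ucf_at_def)
  qed
qed

section \<open>The recursion tree\<close>

declare eta.simps [simp del]

definition eta_at :: "state \<Rightarrow> nat \<Rightarrow> int" where
  "eta_at = (\<lambda>(p, q, r, \<alpha>, w) n. eta p q r \<alpha> w n)"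

fun tree_sum :: "real \<Rightarrow> (int \<Rightarrow> coeffs) \<Rightarrow> (int \<Rightarrow> coeffs) \<Rightarrow> nat \<Rightarrow> state \<Rightarrow> real" where
  "tree_sum \<nu> g u 0 s = ucf_at u s"
| "tree_sum \<nu> g u (Suc n) s = (\<Sum>c\<in>{0..FF_at s}. Gamma_at \<nu> g u s c
     * tree_sum \<nu> g u n (pick 1 s c) * tree_sum \<nu> g u n (pick 2 s c))"

text \<open>\<open>i\<close> encodes the branches at all inner nodes of the tree. At its root,
  \<open>theta_at\<close> with selector 0 extracts the branch, with 1 and 2 the codes of the two
  subtrees.\<close>

fun tree_term :: "real \<Rightarrow> (int \<Rightarrow> coeffs) \<Rightarrow> (int \<Rightarrow> coeffs) \<Rightarrow> nat \<Rightarrow> state \<Rightarrow> int \<Rightarrow> real" where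
  "tree_term \<nu> g u 0 s i = ucf_at u s"
| "tree_term \<nu> g u (Suc n) s i =
     (let c = theta_at i s 0 (int n) in Gamma_at \<nu> g u s c
      * tree_term \<nu> g u n (pick 1 s c) (theta_at i s 1 (int n))
      * tree_term \<nu> g u n (pick 2 s c) (theta_at i s 2 (int n)))"

lemma eta_0: "eta p q r \<alpha> w 0 = FF p q r \<alpha> w"
  using not_P2_P3[of w p q r] by (auto simp: eta.simps FF_trivial FF_def)

lemma eta_at_0: "eta_at s 0 = FF_at s"
  by (auto simp: eta_at_def FF_at_def eta_0 split: prod.splits)

lemma (in ns_coeffs) tree_sum_eq:
  assumes "state_ok s"
  shows "tree_sum \<nu> g u n s = ucf_at u s"
  using assms
proof (induction n arbitrary: s)
  case (Suc n)
  have "tree_sum \<nu> g u (Suc n) s = (\<Sum>i\<in>{0..FF_at s}. Gamma_at \<nu> g u s i * ucf_at u (pick 1 s i) * ucf_at u (pick 2 s i))"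
    unfolding tree_sum.simps
    by (rule sum.cong[OF refl]) (simp add: Suc.IH pick_state_ok[OF Suc.prems])
  also have "\<dots> = ucf_at u s" by (rule one_step[OF Suc.prems, symmetric])
  finally show ?case .
qed simp

text \<open>The number of indices below the \<open>c\<close>-th branch at a node of height \<open>n + 2\<close>.\<close>

definition branch_size :: "nat \<Rightarrow> state \<Rightarrow> int \<Rightarrow> int" where
  "branch_size n s c = (eta_at (pick 1 s c) n + 1) * (eta_at (pick 2 s c) n + 1)"

definition trivial_state :: "state \<Rightarrow> bool" where
  "trivial_state = (\<lambda>(p, q, r, \<alpha>, w). P2 w p q r \<or> P3 w p q r)"

lemma eta_trivial: "trivial_state s \<Longrightarrow> eta_at s n = 0"
  by (cases n) (auto simp: eta_at_def trivial_state_def eta.simps)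

lemma FF_at_trivial: "trivial_state s \<Longrightarrow> FF_at s = 0"
  by (auto simp: FF_at_def trivial_state_def FF_trivial)

lemma pick_trivial:
  assumes "trivial_state s" "b = 1 \<or> b = 2"
  shows "trivial_state (pick b s c)"
proof -
  obtain p q r \<alpha> w where s: "s = (p, q, r, \<alpha>, w)" by (cases s)
  have "P2 w p q r \<or> P3 w p q r" using assms(1) by (simp add: s trivial_state_def)
  then have "pick b s c = pick' b s c" unfolding s pick_eq_pick' by auto
  moreover have "trivial_state (pick' b s c)"
  proof (cases "P2 w p q r")
    case True
    then show ?thesis
      using assms(2) by (auto simp: s trivial_state_def pick'_def T0'_def Z0'_def P2_def[of _ _ "-1"])
  next
    case False
    then show ?thesis
      using assms by (auto simp: s trivial_state_def pick'_def T0'_def T1'_def T2'_def T\<omega>'_def Z0'_def P2_def[of _ _ "-1"])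
  qed
  ultimately show ?thesis by simp
qed

text \<open>The reduction of the middle component lowers q from 2 to 1, where everything is
  prescribed. This justifies the constant value 1 in \<open>eta\<close> for this case.\<close>

lemma pick_alpha_0_q_2:
  assumes "b = 1 \<or> b = 2"
  shows "trivial_state (pick b (p, 2, r, 0, w) c)"
proof (cases "P2 w p 2 r \<or> P3 w p 2 r")
  case True
  then show ?thesis using assms by (intro pick_trivial) (auto simp: trivial_state_def)
next
  case False
  have "trivial_state (pick' b (p', 1, r', \<alpha>, w) c)" for p' r' \<alpha> c
    using assms by (auto simp: trivial_state_def pick'_def T0'_def T1'_def T2'_def T\<omega>'_def Z0'_def
        P2_def P3_def[of _ _ 1])
  then show ?thesis using False by (simp add: pick_eq_pick')
qed

text \<open>\<open>eta\<close> is the largest code, so \<open>eta + 1\<close> counts the trees. The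
  clauses of \<open>eta\<close> with constant values have to be shown to agree with this
  count.\<close>

lemma eta_at_Suc: "eta_at s (Suc n) + 1 = prefix_sum (branch_size n s) (FF_at s + 1)"
proof -
  obtain p q r \<alpha> w where s: "s = (p, q, r, \<alpha>, w)" by (cases s)
  have at: "{0..<x + 1} = {0..x}" for x :: int by auto
  show ?thesis
  proof (cases "trivial_state s")
    case True
    have "branch_size n s 0 = 1"
      using eta_trivial[OF pick_trivial[OF True]] by (simp add: branch_size_def)
    then show ?thesis
      using prefix_sum_Suc[of 0 "branch_size n s"] by (simp add: eta_trivial[OF True] FF_at_trivial[OF True])
  next
    case F: False
    show ?thesis
    proof (cases "\<alpha> = 0 \<and> q = 2")
      case True
      have "branch_size n s c = 1" for c
        using eta_trivial[OF pick_alpha_0_q_2] True by (simp add: branch_size_def s)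
      moreover have "FF_at s = 1" "eta_at s (Suc n) = 1"
        using F True not_P2_P3[of w p q r] by (auto simp: s FF_at_def FF_def eta_at_def trivial_state_def eta.simps)
      ultimately show ?thesis by (simp add: prefix_sum_def)
    next
      case False
      have "eta_at s (Suc n) + 1 = (\<Sum>c\<in>{0..FF_at s}. branch_size n s c)"
        using F False unfolding s by (auto simp: eta_at_def FF_at_def branch_size_def pick_def trivial_state_def eta.simps)
      then show ?thesis by (simp add: prefix_sum_def at)
    qed
  qed
qed

lemma FF_at_nonneg: "state_ok s \<Longrightarrow> FF_at s \<ge> 0"
  by (cases s) (simp add: state_ok_def FF_at_def FF_nonneg)

lemma eta_at_nonneg: "state_ok s \<Longrightarrow> eta_at s n \<ge> 0"
proof (induction n arbitrary: s)
  case 0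
  then show ?case by (simp add: eta_at_0 FF_at_nonneg)
next
  case (Suc n)
  have b: "branch_size n s c \<ge> 1" if "c \<ge> 0" for c
  proof -
    have "1 * 1 \<le> branch_size n s c"
      unfolding branch_size_def by (rule mult_mono) (use Suc.IH[OF pick_state_ok[OF Suc.prems that]] in auto)
    then show ?thesis by simp
  qed
  have "prefix_sum (branch_size n s) 1 \<le> prefix_sum (branch_size n s) (FF_at s + 1)"
    by (rule prefix_sum_mono) (use b FF_at_nonneg[OF Suc.prems] in \<open>fastforce+\<close>)
  moreover have "prefix_sum (branch_size n s) 1 = branch_size n s 0"
    using prefix_sum_Suc[of 0 "branch_size n s"] by simp
  ultimately show ?case using b[of 0] eta_at_Suc[of s n] by simp
qed

lemma branch_size_pos:
  assumes "state_ok s" "c \<ge> 0"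
  shows "branch_size n s c > 0"
  unfolding branch_size_def
  by (rule mult_pos_pos) (use eta_at_nonneg[OF pick_state_ok[OF assms]] in \<open>simp_all add: add_nonneg_pos\<close>)

lemma S_eta_eq: "S_eta j p q r \<alpha> w n = prefix_sum (branch_size n (p, q, r, \<alpha>, w)) j"
proof -
  have "eta1 p q r \<alpha> w c n = eta_at (pick 1 (p, q, r, \<alpha>, w) c) n"
    "eta2 p q r \<alpha> w c n = eta_at (pick 2 (p, q, r, \<alpha>, w) c) n" for c
    by (simp_all add: eta1_def eta2_def pick_def eta_at_def eta_0)
  then show ?thesis
    by (simp add: S_eta_def prefix_sum_def atLeastAtMost_minus_1_int branch_size_def)
qed

text \<open>Branches are blocks of positive length, so the prefix sums are strictly increasing on
  nonnegative arguments and the description in \<open>theta\<close> is unique. For trivial states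
  \<open>theta\<close> returns 0, which is then the only code.\<close>

lemma theta_at_decode:
  assumes ok: "state_ok s" and c: "0 \<le> c" "c \<le> FF_at s" and \<iota>: "0 \<le> \<iota>" "\<iota> < branch_size n s c"
  defines "i \<equiv> prefix_sum (branch_size n s) c + \<iota>"
  shows "theta_at i s 0 (int (Suc n)) = c"
    and "theta_at i s 1 (int (Suc n)) = \<iota> div (eta_at (pick 2 s c) n + 1)"
    and "theta_at i s 2 (int (Suc n)) = \<iota> mod (eta_at (pick 2 s c) n + 1)"
proof -
  obtain p q r \<alpha> w where s: "s = (p, q, r, \<alpha>, w)" by (cases s)
  let ?P = "prefix_sum (branch_size n s)"
  have "theta_at i s 0 (int (Suc n)) = c \<and> theta_at i s 1 (int (Suc n)) = \<iota> div (eta_at (pick 2 s c) n + 1)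
    \<and> theta_at i s 2 (int (Suc n)) = \<iota> mod (eta_at (pick 2 s c) n + 1)"
  proof (cases "trivial_state s")
    case True
    then have "c = 0" using c FF_at_trivial[OF True] by simp
    moreover have "eta_at (pick b s 0) n = 0" if "b = 1 \<or> b = 2" for b
      by (rule eta_trivial[OF pick_trivial[OF True that]])
    ultimately have "c = 0" "\<iota> = 0" "eta_at (pick 2 s c) n = 0" using \<iota> by (simp_all add: branch_size_def)
    then show ?thesis using True by (simp add: s theta_at_def theta_def trivial_state_def)
  next
    case False
    have the: "(THE j. S_eta j p q r \<alpha> w n \<le> i \<and> i < S_eta (j + 1) p q r \<alpha> w n) = c"
      unfolding S_eta_eq s[symmetric]
    proof (rule the_equality)
      show "?P c \<le> i \<and> i < ?P (c + 1)" using \<iota> c by (simp add: i_def prefix_sum_Suc)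
      fix j assume j: "?P j \<le> i \<and> i < ?P (j + 1)"
      have mono: "?P x \<le> ?P y" if "x \<le> y" for x y
        by (rule prefix_sum_mono) (use that branch_size_pos[OF ok] in \<open>auto simp: less_imp_le\<close>)
      have "\<not> j < c" using mono[of "j + 1" c] j \<iota> by (auto simp: i_def)
      moreover have "\<not> c < j" using mono[of "c + 1" j] j \<iota> c by (auto simp: i_def prefix_sum_Suc)
      ultimately show "j = c" by simp
    qed
    have e2: "eta2 p q r \<alpha> w c n = eta_at (pick 2 s c) n"
      by (simp add: eta2_def pick_def eta_at_def eta_0 s)
    have th: "theta i p q r \<alpha> w m (int (Suc n)) =
       (if m = 0 then c else if m = 1 then \<iota> div (eta_at (pick 2 s c) n + 1) else \<iota> mod (eta_at (pick 2 s c) n + 1))" for m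
    proof -
      have nt: "\<not> (P2 w p q r \<or> P3 w p q r)" "int (Suc n) \<noteq> 0" "nat (int (Suc n) - 1) = n"
        using False by (simp_all add: trivial_state_def s)
      have a: "i - S_eta c p q r \<alpha> w n = \<iota>" by (simp add: S_eta_eq i_def s)
      show ?thesis
        unfolding theta_def if_not_P[OF nt(1)] if_not_P[OF nt(2)] nt(3) Let_def the e2 a ..
    qed
    show ?thesis using th[of 0] th[of 1] th[of 2] by (simp add: s theta_at_def)
  qed
  then show "theta_at i s 0 (int (Suc n)) = c"
    "theta_at i s 1 (int (Suc n)) = \<iota> div (eta_at (pick 2 s c) n + 1)"
    "theta_at i s 2 (int (Suc n)) = \<iota> mod (eta_at (pick 2 s c) n + 1)" by simp_all
qed

text \<open>A code of a tree of height n + 2 amounts to a branch at the root and codes of two trees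
  of height n + 1; the sum over codes then factors. At height 1 the code is the branch
  itself.\<close>

lemma sum_tree_term:
  assumes "state_ok s"
  shows "(\<Sum>i\<in>{0..eta_at s n}. tree_term \<nu> g u (Suc n) s i) = tree_sum \<nu> g u (Suc n) s"
  using assms
proof (induction n arbitrary: s)
  case 0
  have "theta_at i s 0 0 = i" if "i \<in> {0..FF_at s}" for i
  proof (cases "trivial_state s")
    case True
    then show ?thesis using that FF_at_trivial[OF True]
      by (auto simp: theta_at_def theta_def split: prod.splits)
  next
    case False
    then show ?thesis by (auto simp: theta_at_def theta_def trivial_state_def split: prod.splits)
  qed
  then show ?case by (simp add: eta_at_0 Let_def)
next
  case (Suc n)
  let ?S = "branch_size n s"
  have at: "{0..x} = {0..<x + 1}" for x :: int by auto
  have "(\<Sum>i\<in>{0..eta_at s (Suc n)}. tree_term \<nu> g u (Suc (Suc n)) s i)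
    = (\<Sum>i\<in>{0..<prefix_sum ?S (FF_at s + 1)}. tree_term \<nu> g u (Suc (Suc n)) s i)"
    unfolding at eta_at_Suc ..
  also have "\<dots> = (\<Sum>c\<in>{0..<FF_at s + 1}. \<Sum>\<iota>\<in>{0..<?S c}. tree_term \<nu> g u (Suc (Suc n)) s (prefix_sum ?S c + \<iota>))"
    by (rule sum_prefix_blocks)
      (use branch_size_pos[OF Suc.prems] FF_at_nonneg[OF Suc.prems] in \<open>auto simp: less_imp_le\<close>)
  also have "\<dots> = (\<Sum>c\<in>{0..<FF_at s + 1}. Gamma_at \<nu> g u s c * tree_sum \<nu> g u (Suc n) (pick 1 s c) * tree_sum \<nu> g u (Suc n) (pick 2 s c))"
  proof (rule sum.cong[OF refl])
    fix c assume "c \<in> {0..<FF_at s + 1}"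
    then have c: "0 \<le> c" "c \<le> FF_at s" by auto
    let ?b = "eta_at (pick 2 s c) n + 1" and ?a = "eta_at (pick 1 s c) n + 1"
    have ok: "state_ok (pick 1 s c)" "state_ok (pick 2 s c)"
      by (rule pick_state_ok[OF Suc.prems c(1)], simp)+
    let ?f = "\<lambda>x y. Gamma_at \<nu> g u s c * tree_term \<nu> g u (Suc n) (pick 1 s c) x * tree_term \<nu> g u (Suc n) (pick 2 s c) y"
    have "(\<Sum>\<iota>\<in>{0..<?S c}. tree_term \<nu> g u (Suc (Suc n)) s (prefix_sum ?S c + \<iota>)) = (\<Sum>\<iota>\<in>{0..<?a * ?b}. ?f (\<iota> div ?b) (\<iota> mod ?b))"
    proof (rule sum.cong)
      fix \<iota> assume "\<iota> \<in> {0..<?a * ?b}"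
      then have \<iota>: "0 \<le> \<iota>" "\<iota> < ?S c" by (auto simp: branch_size_def)
      show "tree_term \<nu> g u (Suc (Suc n)) s (prefix_sum ?S c + \<iota>) = ?f (\<iota> div ?b) (\<iota> mod ?b)"
        unfolding tree_term.simps(2)[of _ _ _ "Suc n"] theta_at_decode[OF Suc.prems c \<iota>] Let_def ..
    qed (simp add: branch_size_def)
    also have "\<dots> = (\<Sum>x\<in>{0..<?a}. \<Sum>y\<in>{0..<?b}. ?f x y)"
      by (rule sum_div_mod) (use eta_at_nonneg ok in \<open>simp_all add: add_nonneg_pos\<close>)
    also have "\<dots> = Gamma_at \<nu> g u s c * (\<Sum>x\<in>{0..<?a}. tree_term \<nu> g u (Suc n) (pick 1 s c) x) * (\<Sum>y\<in>{0..<?b}. tree_term \<nu> g u (Suc n) (pick 2 s c) y)"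
      unfolding mult.assoc unfolding sum_product unfolding sum_distrib_left ..
    also have "\<dots> = Gamma_at \<nu> g u s c * tree_sum \<nu> g u (Suc n) (pick 1 s c) * tree_sum \<nu> g u (Suc n) (pick 2 s c)"
      by (simp only: at[symmetric] Suc.IH[OF ok(1)] Suc.IH[OF ok(2)])
    finally show "(\<Sum>\<iota>\<in>{0..<?S c}. tree_term \<nu> g u (Suc (Suc n)) s (prefix_sum ?S c + \<iota>)) = \<dots>" .
  qed
  also have "\<dots> = tree_sum \<nu> g u (Suc (Suc n)) s"
    unfolding tree_sum.simps(2)[of _ _ _ "Suc n"] at ..
  finally show ?case .
qed

section \<open>Heap numbering of the recursion tree\<close>

text \<open>In the numbering of the nodes used here, \<open>lam m\<close> is the depth of node
  m.\<close>

lemma lam_eqI: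
  assumes "2 ^ k \<le> m + 1" "m + 1 < 2 ^ (k + 1)"
  shows "lam m = k"
proof -
  have "\<lfloor>log (real 2) (real (m + 1))\<rfloor> = int k"
    by (rule floor_log_nat_eq_if) (use assms in auto)
  then show ?thesis by (simp add: lam_def log_def add.commute)
qed

lemma lam_bounds: "2 ^ lam m \<le> m + 1" "m + 1 < 2 ^ (lam m + 1)"
proof -
  obtain k where k: "2 ^ k \<le> m + 1" "m + 1 < 2 ^ (k + 1)"
    using ex_power_ivl1[of 2 "m + 1"] by auto
  then have "lam m = k" by (rule lam_eqI)
  then show "2 ^ lam m \<le> m + 1" "m + 1 < 2 ^ (lam m + 1)" using k by auto
qed

text \<open>The nodes of the recursion tree are numbered as in a binary heap: the children of \<open>m\<close> are
  \<open>2 m + 1\<close> and \<open>2 m + 2\<close>, and \<open>ancestor k m\<close> is the \<open>k\<close>-fold parent.\<close>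

definition ancestor :: "nat \<Rightarrow> nat \<Rightarrow> nat" where
  "ancestor k m = (m + 1) div 2 ^ k - 1"

lemma ancestor_0 [simp]: "ancestor 0 m = m"
  by (simp add: ancestor_def)

lemma ancestor_pos:
  assumes "k \<le> lam m"
  shows "ancestor k m + 1 = (m + 1) div 2 ^ k"
proof -
  have "2 ^ k \<le> m + 1" by (rule order_trans[OF power_increasing[OF assms] lam_bounds(1)]) simp
  then have "(m + 1) div 2 ^ k > 0" by (simp add: div_greater_zero_iff)
  then show ?thesis by (simp add: ancestor_def)
qed

lemma lam_ancestor:
  assumes "k \<le> lam m"
  shows "lam (ancestor k m) = lam m - k"
proof (rule lam_eqI)
  have e: "(2::nat) ^ lam m = 2 ^ (lam m - k) * 2 ^ k" "(2::nat) ^ (lam m + 1) = 2 ^ (lam m - k + 1) * 2 ^ k"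
    using assms by (simp_all flip: power_add)
  show "2 ^ (lam m - k) \<le> ancestor k m + 1"
    unfolding ancestor_pos[OF assms] using lam_bounds(1)[of m] e(1)
    by (simp add: less_eq_div_iff_mult_less_eq)
  show "ancestor k m + 1 < 2 ^ (lam m - k + 1)"
    unfolding ancestor_pos[OF assms] using lam_bounds(2)[of m] e(2)
    by (simp add: div_less_iff_less_mult)
qed

lemma lam_eq_0_iff: "lam m = 0 \<longleftrightarrow> m = 0"
proof
  assume "lam m = 0"
  then show "m = 0" using lam_bounds(2)[of m] by simp
qed simp

lemma ancestor_lam: "ancestor (lam m) m = 0"
  using lam_ancestor[of "lam m" m] lam_eq_0_iff by simp

lemma ancestor_Suc:
  assumes "k < lam m"
  shows "(ancestor k m - 1) div 2 = ancestor (Suc k) m" and "ancestor k m > 0"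
proof -
  have "lam (ancestor k m) \<noteq> 0" using lam_ancestor[of k m] assms by simp
  then show pos: "ancestor k m > 0" using lam_eq_0_iff by simp
  have "ancestor (Suc k) m + 1 = (ancestor k m + 1) div 2"
    using ancestor_pos[of k m] ancestor_pos[of "Suc k" m] assms by (simp only: power_Suc2 div_mult2_eq)
  then show "(ancestor k m - 1) div 2 = ancestor (Suc k) m" using pos by linarith
qed

lemma int_ancestor:
  assumes "k \<le> lam m"
  shows "(int m + 1 - 2 ^ k) div 2 ^ k = int (ancestor k m)"
proof -
  have "(int m + 1 - 2 ^ k) div 2 ^ k = (int m + 1) div 2 ^ k - 1"
    using div_mult_self1[of "2 ^ k" "int m + 1" "- 1"] by simp
  also have "(int m + 1) div 2 ^ k = int ((m + 1) div 2 ^ k)" by (simp add: zdiv_int add.commute)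
  also have "\<dots> - 1 = int (ancestor k m)" unfolding ancestor_pos[OF assms, symmetric] by simp
  finally show ?thesis .
qed

definition side :: "nat \<Rightarrow> int" where
  "side m = Ip (int m)"

text \<open>\<open>node \<psi> i m\<close> is the argument list at the node \<open>m\<close>, together with the encoded choices of
  branches in the subtree of \<open>m\<close>.\<close>

function node :: "state \<Rightarrow> int \<Rightarrow> nat \<Rightarrow> state \<times> int" where
  "node \<psi> i 0 = (\<psi>, i)"
| "node \<psi> i (Suc m) =
    (let (s, x) = node \<psi> i (m div 2); d = omega_of \<psi> - 1 - int (lam (m div 2))
     in (pick (side (Suc m)) s (theta_at x s 0 d), theta_at x s (side (Suc m)) d))"
  by pat_completeness auto
termination by (relation "Wellfounded.measure (\<lambda>(\<psi>, i, m). m)") auto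

definition node_state :: "state \<Rightarrow> int \<Rightarrow> nat \<Rightarrow> state" where
  "node_state \<psi> i m = fst (node \<psi> i m)"

definition node_index :: "state \<Rightarrow> int \<Rightarrow> nat \<Rightarrow> int" where
  "node_index \<psi> i m = snd (node \<psi> i m)"

definition node_choice :: "state \<Rightarrow> int \<Rightarrow> nat \<Rightarrow> int" where
  "node_choice \<psi> i m = theta_at (node_index \<psi> i m) (node_state \<psi> i m) 0 (omega_of \<psi> - 1 - int (lam m))"

lemma node_0: "node_state \<psi> i 0 = \<psi>" "node_index \<psi> i 0 = i"
  by (simp_all add: node_state_def node_index_def)

lemma node_child:
  assumes "m > 0" "(m - 1) div 2 = n"
  shows "node_state \<psi> i m = pick (side m) (node_state \<psi> i n) (node_choice \<psi> i n)"
    and "node_index \<psi> i m = theta_at (node_index \<psi> i n) (node_state \<psi> i n) (side m) (omega_of \<psi> - 1 - int (lam n))"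
proof -
  obtain m' where m': "m = Suc m'" using assms(1) by (cases m) auto
  show "node_state \<psi> i m = pick (side m) (node_state \<psi> i n) (node_choice \<psi> i n)"
    "node_index \<psi> i m = theta_at (node_index \<psi> i n) (node_state \<psi> i n) (side m) (omega_of \<psi> - 1 - int (lam n))"
    using assms(2) unfolding m' node_choice_def
    by (simp_all add: node_state_def node_index_def Let_def split: prod.splits)
qed

text \<open>h + l counts generations above m, and the recursion of \<open>C_st\<close> climbs to the
  root, where h + l = \<open>lam m\<close>. The assumption on \<open>Theta\<close> is the induction
  hypothesis of \<open>Theta_node\<close>; the argument of \<open>Theta\<close> in
  \<open>C_st\<close> is a proper ancestor.\<close>

lemma C_st_node_aux:
  assumes "\<And>m'. m' < m \<Longrightarrow> Theta m' i \<psi> 0 = node_choice \<psi> i m'" "h + l \<le> lam m"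
  shows "C_st m h l i \<psi> = node_state \<psi> i (ancestor (h + l) m)"
  using assms(2)
proof (induction "lam m - h - l" arbitrary: l)
  case 0
  then have hl: "h + l = lam m" by simp
  then show ?case by (subst C_st.simps) (auto simp: ancestor_lam node_0)
next
  case (Suc x)
  then have lt: "h + l < lam m" by simp
  have anc: "nat ((int m + 1 - 2 ^ (l + 1 + h)) div 2 ^ (l + 1 + h)) = ancestor (Suc (h + l)) m"
    using int_ancestor[of "Suc (h + l)" m] lt by (simp add: add_ac)
  have "ancestor (Suc (h + l)) m < m"
    using C_argument_decreases[of m l h] lt unfolding anc by simp
  note th = assms(1)[OF this]
  have IH: "C_st m h (l + 1) i \<psi> = node_state \<psi> i (ancestor (Suc (h + l)) m)"
    using Suc.hyps(1)[of "l + 1"] Suc.hyps(2) lt by simp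
  have Ip: "Ip ((int m + 1 - 2 ^ (l + h)) div 2 ^ (l + h)) = side (ancestor (h + l) m)"
    using int_ancestor[of "h + l" m] lt by (simp add: side_def add_ac)
  have "C_st m h l i \<psi> = pick (side (ancestor (h + l) m)) (node_state \<psi> i (ancestor (Suc (h + l)) m)) (node_choice \<psi> i (ancestor (Suc (h + l)) m))"
    using lt by (subst C_st.simps) (auto simp only: IH Ip anc th split: if_splits)
  also have "\<dots> = node_state \<psi> i (ancestor (h + l) m)"
    using node_child(1)[OF ancestor_Suc(2) ancestor_Suc(1)] lt by simp
  finally show ?case .
qed

text \<open>For positive h, \<open>Theta\<close> is the code handed down to the ancestor h - 1
  generations above m. At h = 0 the selector \<open>Ip_b\<close> is 0, so the branch is extracted in
  place of a subtree code.\<close>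

lemma Theta_node_aux:
  assumes "\<And>m'. m' < m \<Longrightarrow> Theta m' i \<psi> 0 = node_choice \<psi> i m'" "h \<le> lam m"
  shows "Theta m i \<psi> h = (if h = 0 then node_choice \<psi> i m else node_index \<psi> i (ancestor (h - 1) m))"
  using assms(2)
proof (induction "lam m - h" arbitrary: h)
  case 0
  then have h: "h = lam m" by simp
  have T: "Theta m i \<psi> h = theta_at i \<psi> (Ip_b h m) (omega_of \<psi> - 1)"
    using h by (subst Theta.simps) simp
  show ?case
  proof (cases h)
    case 0
    then have "m = 0" using h lam_eq_0_iff by simp
    then show ?thesis using T 0 by (simp add: node_choice_def node_0 Ip_b_def)
  next
    case (Suc h')
    have "h' \<le> lam m" using h Suc by simp
    then have "Ip_b h m = side (ancestor h' m)"
      unfolding Suc using int_ancestor[of h' m] by (simp add: Ip_b_def side_def)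
    moreover have "ancestor (Suc h') m = 0" using h Suc ancestor_lam[of m] by simp
    then have "node_index \<psi> i (ancestor h' m) = theta_at i \<psi> (side (ancestor h' m)) (omega_of \<psi> - 1)"
      using node_child(2)[OF ancestor_Suc(2,1), of h' m \<psi> i] h Suc by (simp add: node_0)
    ultimately show ?thesis using T by (simp add: Suc)
  qed
next
  case (Suc x)
  then have h: "h < lam m" by simp
  have IH: "Theta m i \<psi> (h + 1) = node_index \<psi> i (ancestor h m)"
    using Suc.hyps(1)[of "h + 1"] Suc.hyps(2) h by simp
  have C: "C_st m h 0 i \<psi> = node_state \<psi> i (ancestor h m)"
    using C_st_node_aux[of m i \<psi> h 0, OF assms(1)] h by simp
  have lam: "omega_of \<psi> - 1 + int h - int (lam m) = omega_of \<psi> - 1 - int (lam (ancestor h m))"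
    using lam_ancestor[of h m] h by simp
  have T: "Theta m i \<psi> h = theta_at (node_index \<psi> i (ancestor h m)) (node_state \<psi> i (ancestor h m)) (Ip_b h m)
      (omega_of \<psi> - 1 - int (lam (ancestor h m)))"
    using h by (subst Theta.simps) (simp add: IH[simplified] C lam)
  show ?case
  proof (cases h)
    case 0
    then show ?thesis using T by (simp add: node_choice_def Ip_b_def)
  next
    case (Suc h')
    have "h' \<le> lam m" using h Suc by simp
    then have "Ip_b h m = side (ancestor h' m)"
      unfolding Suc using int_ancestor[of h' m] by (simp add: Ip_b_def side_def)
    then show ?thesis
      using T node_child(2)[OF ancestor_Suc(2,1), of h' m \<psi> i] h Suc by simp
  qed
qed

lemma Theta_node: "Theta m i \<psi> 0 = node_choice \<psi> i m"
proof (induction m rule: less_induct)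
  case (less m)
  then show ?case using Theta_node_aux[of m i \<psi> 0] by simp
qed

lemma int_ancestor':
  assumes "k \<le> lam m"
  shows "(int m + 1) div 2 ^ k - 1 = int (ancestor k m)"
  unfolding int_ancestor[OF assms, symmetric]
  using div_mult_self1[of "2 ^ k" "int m + 1" "- 1"] by simp

lemma rho_st_node_aux:
  assumes lam: "lam m = j - 1" and m: "int m = int k - 2 + 2 ^ (j - 1)" and j: "j \<ge> 2"
    and "1 \<le> l" "l \<le> j - 1"
  shows "rho_st i l k j \<psi> = node_state \<psi> i (ancestor (l - 1) m)"
  using assms(4-)
proof (induction "j - 1 - l" arbitrary: l)
  have unfold: "rho_st i l k j \<psi> = pick (side (ancestor (l - 1) m))
      (if l < j - 1 then rho_st i (l + 1) k j \<psi> else \<psi>) (node_choice \<psi> i (ancestor l m))"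
    if l: "1 \<le> l" "l \<le> j - 1" for l
  proof -
    have e: "int k - 1 + 2 ^ (j - 1) = int m + 1" using m by simp
    have Ip: "Ip ((int k - 1 + 2 ^ (j - 1)) div 2 ^ (l - 1) - 1) = side (ancestor (l - 1) m)"
      unfolding e side_def by (rule arg_cong[OF int_ancestor']) (use l lam in simp)
    have Th: "nat ((int k - 1 + 2 ^ (j - 1) - 2 ^ l) div 2 ^ l) = ancestor l m"
      unfolding e by (subst int_ancestor) (use l lam in simp_all)
    show ?thesis
      unfolding rho_st.simps[of i l k j \<psi>] Ip Th Theta_node using j by simp
  qed
  {
    case (0 l)
    then have l: "l = j - 1" "1 \<le> l" "l - 1 < lam m" "Suc (l - 1) = l" using lam by simp_all
    have a: "ancestor l m = 0" using ancestor_lam[of m] l(1) lam by simp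
    show ?case
      using node_child(1)[OF ancestor_Suc(2)[OF l(3)] ancestor_Suc(1)[OF l(3)], of \<psi> i]
      unfolding unfold[OF l(2) eq_imp_le[OF l(1)]] l(4) a node_0 using l(1) by simp
  next
    case (Suc x l)
    have l: "l < j - 1" using Suc.hyps(2) by simp
    have "rho_st i (l + 1) k j \<psi> = node_state \<psi> i (ancestor l m)"
      using Suc.hyps(1)[of "l + 1"] Suc.hyps(2) l by simp
    then show ?case
      using unfold[of l] node_child(1)[OF ancestor_Suc(2,1), of "l - 1" m \<psi> i] Suc.prems lam l by simp
  }
qed

text \<open>The nodes of depth j - 1 are numbered from 2^(j-1) - 1 on, and k counts them from
  1.\<close>

lemma rho_st_node:
  assumes "j \<ge> 1" "1 \<le> k" "k \<le> 2 ^ (j - 1)"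
  shows "rho_st i 1 k j \<psi> = node_state \<psi> i (2 ^ (j - 1) - 1 + (k - 1))"
    and "Theta (nat (int k - 2 + 2 ^ (j - 1))) i \<psi> 0 = node_choice \<psi> i (2 ^ (j - 1) - 1 + (k - 1))"
proof -
  define m where "m = 2 ^ (j - 1) - 1 + (k - 1)"
  have m1: "m + 1 = 2 ^ (j - 1) + (k - 1)" by (simp add: m_def)
  have "int m + 1 = int (m + 1)" by simp
  also have "\<dots> = int (2 ^ (j - 1) + (k - 1))" by (simp only: m1)
  also have "\<dots> = 2 ^ (j - 1) + (int k - 1)" using assms(2) by (simp add: of_nat_diff)
  finally have m: "int m = int k - 2 + 2 ^ (j - 1)" by simp
  then have nm: "nat (int k - 2 + 2 ^ (j - 1)) = m" by linarith
  show "Theta (nat (int k - 2 + 2 ^ (j - 1))) i \<psi> 0 = node_choice \<psi> i (2 ^ (j - 1) - 1 + (k - 1))"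
    unfolding nm m_def[symmetric] by (rule Theta_node)
  have lam: "lam m = j - 1"
  proof (rule lam_eqI)
    show "m + 1 < 2 ^ (j - 1 + 1)"
      unfolding m1 power_add power_one_right using assms(2,3) by linarith
    show "2 ^ (j - 1) \<le> m + 1" unfolding m1 by simp
  qed
  show "rho_st i 1 k j \<psi> = node_state \<psi> i (2 ^ (j - 1) - 1 + (k - 1))"
  proof (cases "j \<ge> 2")
    case True
    then show ?thesis unfolding m_def[symmetric] using rho_st_node_aux[OF lam m True, of 1 i \<psi>] by simp
  next
    case False
    then have "j = 1" "k = 1" using assms by auto
    then show ?thesis by (subst rho_st.simps) (simp add: node_0)
  qed
qed

lemma Ip_add_even: "even y \<Longrightarrow> Ip (x + y) = Ip x"
  by (simp add: Ip_def)

lemma aleph_st_node_aux: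
  assumes lam: "lam m = W" and m: "int m = int k - 2 + 2 ^ W" and W: "omega_of \<psi> = int W"
    and "1 \<le> l" "l \<le> W"
  shows "aleph_st i l k \<psi> = node_state \<psi> i (ancestor (l - 1) m)"
  using assms(4-)
proof (induction "W - l" arbitrary: l)
  have unfold: "aleph_st i l k \<psi> = pick (side (ancestor (l - 1) m))
      (if l < W then aleph_st i (l + 1) k \<psi> else \<psi>) (node_choice \<psi> i (ancestor l m))"
    if l: "1 \<le> l" "l \<le> W" for l
  proof -
    have pw: "(2::int) ^ W = 2 ^ (W - x) * 2 ^ x" if "x \<le> W" for x
      using that by (simp flip: power_add)
    have anc: "(int k - 1) div 2 ^ x + 2 ^ (W - x) - 1 = int (ancestor x m)" if x: "x \<le> W" for x
    proof -
      have e: "int m + 1 = (int k - 1) + 2 ^ (W - x) * 2 ^ x" using m pw[OF x] by simp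
      have "(int m + 1) div 2 ^ x = (int k - 1) div 2 ^ x + 2 ^ (W - x)" unfolding e by simp
      then show ?thesis using int_ancestor'[of x m] x lam by linarith
    qed
    \<comment> \<open>The argument of \<open>Ip\<close> in \<open>aleph_st\<close> differs from the
      ancestor's number by this even summand, which does not change which child it is.\<close>
    have "even ((2::int) ^ (W - (l - 1)) - 2)" using l by simp
    then have "Ip ((int k - 1) div 2 ^ (l - 1) + 1) = Ip ((int k - 1) div 2 ^ (l - 1) + 1 + (2 ^ (W - (l - 1)) - 2))"
      by (rule Ip_add_even[symmetric])
    also have "\<dots> = side (ancestor (l - 1) m)"
      unfolding side_def anc[of "l - 1", symmetric, OF le_trans[OF diff_le_self l(2)]]
      by (simp add: algebra_simps)
    finally have Ip: "Ip ((int k - 1) div 2 ^ (l - 1) + 1) = side (ancestor (l - 1) m)" .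
    have "nat ((int k - 1) div 2 ^ l - 1 + 2 ^ nat (omega_of \<psi> - int l)) = ancestor l m"
      using anc[OF l(2)] l W by (simp add: nat_diff_distrib algebra_simps flip: of_nat_diff)
    then show ?thesis
      unfolding aleph_st.simps[of i l k \<psi>] Ip by (simp add: W Theta_node)
  qed
  {
    case (0 l)
    then have l: "l = W" "1 \<le> l" "l - 1 < lam m" "Suc (l - 1) = l" using lam by simp_all
    have a: "ancestor l m = 0" using ancestor_lam[of m] l(1) lam by simp
    show ?case
      using node_child(1)[OF ancestor_Suc(2)[OF l(3)] ancestor_Suc(1)[OF l(3)], of \<psi> i]
      unfolding unfold[OF l(2) eq_imp_le[OF l(1)]] l(4) a node_0 using l(1) by simp
  next
    case (Suc x l)
    have l: "l < W" using Suc.hyps(2) by simp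
    have "aleph_st i (l + 1) k \<psi> = node_state \<psi> i (ancestor l m)"
      using Suc.hyps(1)[of "l + 1"] Suc.hyps(2) l by simp
    then show ?case
      using unfold[of l] node_child(1)[OF ancestor_Suc(2,1), of "l - 1" m \<psi> i] Suc.prems lam l by simp
  }
qed

lemma aleph_st_node:
  assumes "omega_of \<psi> = int W" "W \<ge> 1" "1 \<le> k" "k \<le> 2 ^ W"
  shows "aleph_st i 1 k \<psi> = node_state \<psi> i (2 ^ W - 1 + (k - 1))"
proof -
  define m where "m = 2 ^ W - 1 + (k - 1)"
  have m1: "m + 1 = 2 ^ W + (k - 1)" by (simp add: m_def)
  have "int m + 1 = int (m + 1)" by simp
  also have "\<dots> = int (2 ^ W + (k - 1))" by (simp only: m1)
  also have "\<dots> = 2 ^ W + (int k - 1)" using assms(3) by (simp add: of_nat_diff)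
  finally have m: "int m = int k - 2 + 2 ^ W" by simp
  have lam: "lam m = W"
    by (rule lam_eqI) (use m1 assms in auto)
  show ?thesis
    unfolding m_def[symmetric] using aleph_st_node_aux[OF lam m assms(1), of 1 i] assms(2) by simp
qed

section \<open>Products over the levels of the recursion tree\<close>

lemma prod_lessThan_add:
  fixes h :: "nat \<Rightarrow> real"
  shows "(\<Prod>t<a + b. h t) = (\<Prod>t<a. h t) * (\<Prod>t<b. h (a + t))"
  by (induction b) (simp_all add: mult_ac)

text \<open>The descendants of m at relative depth j + 1 are consecutive; the first half lies below
  the child 2 m + 1, the second half below 2 m + 2.\<close>

lemma heap_level_split:
  fixes f :: "nat \<Rightarrow> real"
  shows "(\<Prod>t<2 ^ Suc j. f ((m + 1) * 2 ^ Suc j - 1 + t))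
    = (\<Prod>t<2 ^ j. f ((2 * m + 1 + 1) * 2 ^ j - 1 + t)) * (\<Prod>t<2 ^ j. f ((2 * m + 2 + 1) * 2 ^ j - 1 + t))"
proof -
  let ?A = "(m + 1) * 2 ^ Suc j"
  have A: "?A > 0" "(2 * m + 1 + 1) * 2 ^ j = ?A" "(2 * m + 2 + 1) * 2 ^ j = ?A + 2 ^ j"
    by (simp_all add: algebra_simps)
  have "a - 1 + (b + t) = a + b - 1 + t" if "a > 0" for a b t :: nat using that by simp
  from this[OF A(1)] have "?A - 1 + (2 ^ j + t) = (2 * m + 2 + 1) * 2 ^ j - 1 + t" for t unfolding A(3) .
  moreover have "(2::nat) ^ Suc j = 2 ^ j + 2 ^ j" by simp
  ultimately show ?thesis
    using prod_lessThan_add[of "\<lambda>t. f (?A - 1 + t)" "2 ^ j" "2 ^ j"] unfolding A(2) by (simp only:)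
qed

lemma lam_child: "lam (2 * m + 1) = lam m + 1" "lam (2 * m + 2) = lam m + 1"
proof -
  show "lam (2 * m + 1) = lam m + 1" "lam (2 * m + 2) = lam m + 1"
    by (rule lam_eqI; use lam_bounds[of m] in simp)+
qed

text \<open>The recursion over the two subtrees becomes a product over levels: inner nodes
  contribute their \<open>Gamma_at\<close>, the nodes at relative depth d their
  coefficients.\<close>

lemma tree_term_node:
  assumes "omega_of \<psi> = int W" "lam m + d = W"
  shows "tree_term \<nu> g u d (node_state \<psi> i m) (node_index \<psi> i m)
    = (\<Prod>j<d. \<Prod>t<2 ^ j. Gamma_at \<nu> g u (node_state \<psi> i ((m + 1) * 2 ^ j - 1 + t)) (node_choice \<psi> i ((m + 1) * 2 ^ j - 1 + t)))
      * (\<Prod>t<2 ^ d. ucf_at u (node_state \<psi> i ((m + 1) * 2 ^ d - 1 + t)))"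
  using assms(2)
proof (induction d arbitrary: m)
  case (Suc d)
  let ?f = "\<lambda>m. Gamma_at \<nu> g u (node_state \<psi> i m) (node_choice \<psi> i m)"
  let ?l = "\<lambda>m. ucf_at u (node_state \<psi> i m)"
  have d: "omega_of \<psi> - 1 - int (lam m) = int d" using Suc.prems assms(1) by simp
  have par: "(2 * m + 1 - 1) div 2 = m" "(2 * m + 2 - 1) div 2 = m" by simp_all
  have side: "side (2 * m + 1) = 1" "side (2 * m + 2) = 2" by (simp_all add: side_def Ip_def)
  have "tree_term \<nu> g u (Suc d) (node_state \<psi> i m) (node_index \<psi> i m)
    = ?f m * tree_term \<nu> g u d (node_state \<psi> i (2 * m + 1)) (node_index \<psi> i (2 * m + 1))
        * tree_term \<nu> g u d (node_state \<psi> i (2 * m + 2)) (node_index \<psi> i (2 * m + 2))"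
  proof -
    have "node_state \<psi> i (2 * m + 1) = pick 1 (node_state \<psi> i m) (node_choice \<psi> i m)"
      "node_index \<psi> i (2 * m + 1) = theta_at (node_index \<psi> i m) (node_state \<psi> i m) 1 (int d)"
      "node_state \<psi> i (2 * m + 2) = pick 2 (node_state \<psi> i m) (node_choice \<psi> i m)"
      "node_index \<psi> i (2 * m + 2) = theta_at (node_index \<psi> i m) (node_state \<psi> i m) 2 (int d)"
      using node_child[of "2 * m + 1" m \<psi> i, OF _ par(1)] node_child[of "2 * m + 2" m \<psi> i, OF _ par(2)]
      unfolding side d by simp_all
    then show ?thesis unfolding tree_term.simps Let_def node_choice_def d by (simp only:)
  qed
  also have "\<dots> = ?f m
     * ((\<Prod>j<d. \<Prod>t<2 ^ j. ?f ((2 * m + 1 + 1) * 2 ^ j - 1 + t)) * (\<Prod>t<2 ^ d. ?l ((2 * m + 1 + 1) * 2 ^ d - 1 + t)))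
     * ((\<Prod>j<d. \<Prod>t<2 ^ j. ?f ((2 * m + 2 + 1) * 2 ^ j - 1 + t)) * (\<Prod>t<2 ^ d. ?l ((2 * m + 2 + 1) * 2 ^ d - 1 + t)))"
    using Suc.IH[of "2 * m + 1"] Suc.IH[of "2 * m + 2"] Suc.prems by (simp only: lam_child)
  also have "\<dots> = (?f m * (\<Prod>j<d. \<Prod>t<2 ^ Suc j. ?f ((m + 1) * 2 ^ Suc j - 1 + t)))
     * (\<Prod>t<2 ^ Suc d. ?l ((m + 1) * 2 ^ Suc d - 1 + t))"
  proof -
    have "x * (a * b) * (c * d) = (x * (a * c)) * (b * d)" for x a b c d :: real by simp
    then show ?thesis unfolding heap_level_split[of ?f] heap_level_split[of ?l] prod.distrib .
  qed
  also have "?f m * (\<Prod>j<d. \<Prod>t<2 ^ Suc j. ?f ((m + 1) * 2 ^ Suc j - 1 + t))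
     = (\<Prod>j<Suc d. \<Prod>t<2 ^ j. ?f ((m + 1) * 2 ^ j - 1 + t))"
    by (subst prod.lessThan_Suc_shift) (simp del: power_Suc)
  finally show ?case .
qed simp

definition velocity_rhs :: "real \<Rightarrow> (int \<Rightarrow> coeffs) \<Rightarrow> (int \<Rightarrow> coeffs) \<Rightarrow> state \<Rightarrow> real" where
  "velocity_rhs \<nu> g u \<psi> = (\<Sum>i\<in>{0..eta_at \<psi> (nat (omega_of \<psi> - 1))}.
     (\<Prod>j\<in>{1..nat (omega_of \<psi>)}. \<Prod>k\<in>{1..2 ^ (j - 1)}.
        Gamma_at \<nu> g u (rho_st i 1 k j \<psi>) (Theta (nat (int k - 2 + 2 ^ (j - 1))) i \<psi> 0))
     * (\<Prod>k\<in>{1..2 ^ nat (omega_of \<psi>)}. ucf_at u (aleph_st i 1 k \<psi>)))"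

lemma prod_from_1: "(\<Prod>k\<in>{1..n}. f k) = (\<Prod>t<n. f (Suc t))"
  by (rule prod.reindex_bij_betw[symmetric], rule bij_betw_byWitness[where f' = "\<lambda>x. x - 1"]) auto

lemma velocity_rhs_eq_tree_sum:
  assumes ok: "state_ok \<psi>" and w: "omega_of \<psi> \<ge> 1"
  shows "velocity_rhs \<nu> g u \<psi> = tree_sum \<nu> g u (nat (omega_of \<psi>)) \<psi>"
proof -
  obtain d where d: "nat (omega_of \<psi>) = Suc d" using w by (cases "nat (omega_of \<psi>)") auto
  have W: "omega_of \<psi> = int (Suc d)" and d': "nat (omega_of \<psi> - 1) = d" using d w by linarith+
  have "(\<Prod>j\<in>{1..Suc d}. \<Prod>k\<in>{1..2 ^ (j - 1)}.
        Gamma_at \<nu> g u (rho_st i 1 k j \<psi>) (Theta (nat (int k - 2 + 2 ^ (j - 1))) i \<psi> 0))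
     * (\<Prod>k\<in>{1..2 ^ Suc d}. ucf_at u (aleph_st i 1 k \<psi>)) = tree_term \<nu> g u (Suc d) \<psi> i" for i
  proof -
    have "(\<Prod>j\<in>{1..Suc d}. \<Prod>k\<in>{1..2 ^ (j - 1)}.
        Gamma_at \<nu> g u (rho_st i 1 k j \<psi>) (Theta (nat (int k - 2 + 2 ^ (j - 1))) i \<psi> 0))
      = (\<Prod>j<Suc d. \<Prod>t<2 ^ j. Gamma_at \<nu> g u (node_state \<psi> i ((0 + 1) * 2 ^ j - 1 + t)) (node_choice \<psi> i ((0 + 1) * 2 ^ j - 1 + t)))"
      unfolding prod_from_1
    proof (intro prod.cong refl)
      fix j t assume "t \<in> {..<(2::nat) ^ j}"
      then show "Gamma_at \<nu> g u (rho_st i 1 (Suc t) (Suc j) \<psi>) (Theta (nat (int (Suc t) - 2 + 2 ^ (Suc j - 1))) i \<psi> 0)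
        = Gamma_at \<nu> g u (node_state \<psi> i ((0 + 1) * 2 ^ j - 1 + t)) (node_choice \<psi> i ((0 + 1) * 2 ^ j - 1 + t))"
        using rho_st_node[of "Suc j" "Suc t" i \<psi>] by simp
    qed simp
    moreover have "(\<Prod>k\<in>{1..2 ^ Suc d}. ucf_at u (aleph_st i 1 k \<psi>))
      = (\<Prod>t<2 ^ Suc d. ucf_at u (node_state \<psi> i ((0 + 1) * 2 ^ Suc d - 1 + t)))"
      unfolding prod_from_1
    proof (intro prod.cong refl)
      fix t assume "t \<in> {..<(2::nat) ^ Suc d}"
      then show "ucf_at u (aleph_st i 1 (Suc t) \<psi>) = ucf_at u (node_state \<psi> i ((0 + 1) * 2 ^ Suc d - 1 + t))"
        using aleph_st_node[OF W, of "Suc t" i] by simp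
    qed
    ultimately show ?thesis
      using tree_term_node[OF W, of 0 "Suc d" \<nu> g u i] by (simp only: node_0 lam_0 add_0)
  qed
  then show ?thesis
    unfolding velocity_rhs_def d d' using sum_tree_term[OF ok, of \<nu> g u d] by simp
qed

section \<open>The coefficient formulas\<close>

lemma ns_coeffs_of_solution:
  assumes \<rho>: "\<rho> \<noteq> 0" and \<nu>: "\<nu> = \<mu> / \<rho>" and sol: "power_series_solution \<rho> \<mu> g u P"
  shows "ns_coeffs u g (\<lambda>w p q r. - (1 / \<rho>) * P w p q r) \<nu>"
proof
  fix w p q r
  show "dsp4 0 (u 0) w p q r + dsp4 1 (u 1) w p q r + dsp4 2 (u 2) w p q r = 0"
    by (rule coefficient_equations(1)[OF sol])
  fix \<alpha> :: int assume \<alpha>: "\<alpha> \<in> {0, 1, 2}"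
  have "dsp4 \<alpha> (\<lambda>w p q r. - (1 / \<rho>) * P w p q r) w p q r = - dsp4 \<alpha> P w p q r / \<rho>"
    by (simp add: dsp4_def)
  then show "dt4 (u \<alpha>) w p q r + (\<Sum>\<phi>\<in>{0, 1, 2}. conv4 (u \<phi>) (dsp4 \<phi> (u \<alpha>)) w p q r)
      = dsp4 \<alpha> (\<lambda>w p q r. - (1 / \<rho>) * P w p q r) w p q r
        + \<nu> * (\<Sum>\<phi>\<in>{0, 1, 2}. dsp4 \<phi> (dsp4 \<phi> (u \<alpha>)) w p q r) + g \<alpha> w p q r"
    using coefficient_equations(2)[OF sol \<alpha>, of w p q r] \<rho> by (simp add: \<nu> field_simps)
qed

lemma velocity_formula_iff:
  "velocity_formula \<nu> g u \<longleftrightarrow> (\<forall>\<alpha>\<in>{0, 1, 2}. \<forall>w\<ge>1. \<forall>p\<ge>0. \<forall>q\<ge>0. \<forall>r\<ge>0.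
     ucf u \<alpha> w p q r = velocity_rhs \<nu> g u (p, q, r, \<alpha>, w))"
  unfolding velocity_formula_def velocity_rhs_def Let_def eta_at_def omega_of_def prod.case ..

lemma velocity_rhs_state:
  assumes "\<alpha> \<in> {0, 1, 2}" "w \<ge> 1"
  shows "velocity_rhs \<nu> g u (p, q, r, \<alpha>, w) = tree_sum \<nu> g u (nat w) (p, q, r, \<alpha>, w)"
proof -
  have "state_ok (p, q, r, \<alpha>, w)" "omega_of (p, q, r, \<alpha>, w) \<ge> 1"
    using assms by (auto simp: state_ok_def omega_of_def)
  from velocity_rhs_eq_tree_sum[OF this] show ?thesis
    unfolding omega_of_def prod.case .
qed

lemma (in ns_coeffs) velocity_formula: "velocity_formula \<nu> g u"
  unfolding velocity_formula_iff
  by (auto simp: velocity_rhs_state tree_sum_eq state_ok_def ucf_at_def)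

text \<open>The momentum equation of component 1, solved for the coefficient of the x-derivative of
  the pressure.\<close>

lemma (in ns_coeffs) pressure_formula_aux:
  assumes "0 \<le> w" "0 \<le> p" "0 \<le> q" "0 \<le> r"
  shows "cf Q w (p + 1) q r = 1 / of_int (p + 1) *
       (of_int (w + 1) * ucf u 1 (w + 1) p q r
        + (\<Sum>k\<in>{0..w}. \<Sum>i\<in>{0..p}. \<Sum>j\<in>{0..q}. \<Sum>l\<in>{0..r}.
             of_int (i + 1) * ucf u 1 (w - k) (p - i) (q - j) (r - l) * ucf u 1 k (i + 1) j l
           + of_int (j + 1) * ucf u 0 (w - k) (p - i) (q - j) (r - l) * ucf u 1 k i (j + 1) l
           + of_int (l + 1) * ucf u 2 (w - k) (p - i) (q - j) (r - l) * ucf u 1 k i j (l + 1))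
        - \<nu> * (of_int ((p + 1) * (p + 2)) * ucf u 1 w (p + 2) q r
              + of_int ((q + 1) * (q + 2)) * ucf u 1 w p (q + 2) r
              + of_int ((r + 1) * (r + 2)) * ucf u 1 w p q (r + 2))
        - cf (g 1) w p q r)"
proof -
  have "cf (dt4 (u 1)) w p q r + (\<Sum>\<phi>\<in>{0, 1, 2}. cf (conv4 (u \<phi>) (dsp4 \<phi> (u 1))) w p q r)
    = cf (dsp4 1 Q) w p q r + \<nu> * (\<Sum>\<phi>\<in>{0, 1, 2}. cf (dsp4 \<phi> (dsp4 \<phi> (u 1))) w p q r) + cf (g 1) w p q r"
    unfolding cf_def by (rule momentum) simp
  moreover have "cf (dt4 (u 1)) w p q r = of_int (w + 1) * ucf u 1 (w + 1) p q r"
    using assms by (simp add: cf_def dt4_def ucf_def nat_add_distrib)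
  moreover have "(\<Sum>\<phi>\<in>{0, 1, 2}. cf (conv4 (u \<phi>) (dsp4 \<phi> (u 1))) w p q r)
    = (\<Sum>k\<in>{0..w}. \<Sum>i\<in>{0..p}. \<Sum>j\<in>{0..q}. \<Sum>l\<in>{0..r}.
             of_int (i + 1) * ucf u 1 (w - k) (p - i) (q - j) (r - l) * ucf u 1 k (i + 1) j l
           + of_int (j + 1) * ucf u 0 (w - k) (p - i) (q - j) (r - l) * ucf u 1 k i (j + 1) l
           + of_int (l + 1) * ucf u 2 (w - k) (p - i) (q - j) (r - l) * ucf u 1 k i j (l + 1))"
  proof -
    have "(\<Sum>\<phi>\<in>{0, 1, 2}. cf (conv4 (u \<phi>) (dsp4 \<phi> (u 1))) w p q r)
      = cf (conv4 (u 1) (dsp4 1 (u 1))) w p q r + cf (conv4 (u 0) (dsp4 0 (u 1))) w p q r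
        + cf (conv4 (u 2) (dsp4 2 (u 1))) w p q r" by simp
    also have "\<dots> = (\<Sum>k\<in>{0..w}. \<Sum>i\<in>{0..p}. \<Sum>j\<in>{0..q}. \<Sum>l\<in>{0..r}.
        cf (u 1) (w - k) (p - i) (q - j) (r - l) * cf (dsp4 1 (u 1)) k i j l
        + cf (u 0) (w - k) (p - i) (q - j) (r - l) * cf (dsp4 0 (u 1)) k i j l
        + cf (u 2) (w - k) (p - i) (q - j) (r - l) * cf (dsp4 2 (u 1)) k i j l)"
      unfolding cf_conv4[OF assms] sum.distrib ..
    also have "\<dots> = (\<Sum>k\<in>{0..w}. \<Sum>i\<in>{0..p}. \<Sum>j\<in>{0..q}. \<Sum>l\<in>{0..r}.
             of_int (i + 1) * ucf u 1 (w - k) (p - i) (q - j) (r - l) * ucf u 1 k (i + 1) j l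
           + of_int (j + 1) * ucf u 0 (w - k) (p - i) (q - j) (r - l) * ucf u 1 k i (j + 1) l
           + of_int (l + 1) * ucf u 2 (w - k) (p - i) (q - j) (r - l) * ucf u 1 k i j (l + 1))"
      by (intro sum.cong refl) (simp add: cf_dsp4 ucf_def)
    finally show ?thesis .
  qed
  moreover have "cf (dsp4 1 (dsp4 1 (u 1))) w p q r = of_int ((p + 1) * (p + 2)) * ucf u 1 w (p + 2) q r"
    "cf (dsp4 0 (dsp4 0 (u 1))) w p q r = of_int ((q + 1) * (q + 2)) * ucf u 1 w p (q + 2) r"
    "cf (dsp4 2 (dsp4 2 (u 1))) w p q r = of_int ((r + 1) * (r + 2)) * ucf u 1 w p q (r + 2)"
    using assms by (simp_all add: cf_dsp4 ucf_def add.commute)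
  moreover have "cf (dsp4 1 Q) w p q r = of_int (p + 1) * cf Q w (p + 1) q r"
    using assms by (simp add: cf_dsp4)
  ultimately have "of_int (p + 1) * cf Q w (p + 1) q r = of_int (w + 1) * ucf u 1 (w + 1) p q r
        + (\<Sum>k\<in>{0..w}. \<Sum>i\<in>{0..p}. \<Sum>j\<in>{0..q}. \<Sum>l\<in>{0..r}.
             of_int (i + 1) * ucf u 1 (w - k) (p - i) (q - j) (r - l) * ucf u 1 k (i + 1) j l
           + of_int (j + 1) * ucf u 0 (w - k) (p - i) (q - j) (r - l) * ucf u 1 k i (j + 1) l
           + of_int (l + 1) * ucf u 2 (w - k) (p - i) (q - j) (r - l) * ucf u 1 k i j (l + 1))
        - \<nu> * (of_int ((p + 1) * (p + 2)) * ucf u 1 w (p + 2) q r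
              + of_int ((q + 1) * (q + 2)) * ucf u 1 w p (q + 2) r
              + of_int ((r + 1) * (r + 2)) * ucf u 1 w p q (r + 2))
        - cf (g 1) w p q r" (is "_ = ?R")
    by (simp add: algebra_simps)
  then have eq: "cf Q w (p + 1) q r * of_int (p + 1) = ?R" by (subst mult.commute)
  have "real_of_int (p + 1) \<noteq> 0" using assms by simp
  then have "cf Q w (p + 1) q r = ?R / of_int (p + 1)" using eq by (rule eq_divide_imp)
  then show ?thesis by simp
qed

lemma pressure_formula_of_solution:
  assumes "ns_coeffs u g (\<lambda>w p q r. - (1 / \<rho>) * P w p q r) \<nu>"
  shows "pressure_formula \<rho> \<nu> g u P"
  unfolding pressure_formula_def
proof (intro allI impI)
  fix w p q r :: int
  assume a: "0 \<le> w" "0 \<le> p" "-1 \<le> q" "-1 \<le> r"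
  have "0 \<le> q + 1" "0 \<le> r + 1" using a by simp_all
  note * = ns_coeffs.pressure_formula_aux[OF assms a(1,2) this]
  have e: "q + 1 + 1 = q + 2" "q + 1 + 2 = q + 3" "r + 1 + 1 = r + 2" "r + 1 + 2 = r + 3" by simp_all
  have "- (1 / \<rho>) * cf P w (p + 1) (q + 1) (r + 1) = cf (\<lambda>w p q r. - (1 / \<rho>) * P w p q r) w (p + 1) (q + 1) (r + 1)"
    by (simp add: cf_def)
  also note *[unfolded e]
  finally show "- (1 / \<rho>) * cf P w (p + 1) (q + 1) (r + 1) =
      1 / of_int (p + 1) *
       (of_int (w + 1) * ucf u 1 (w + 1) p (q + 1) (r + 1)
        + (\<Sum>k\<in>{0..w}. \<Sum>i\<in>{0..p}. \<Sum>j\<in>{0..q + 1}. \<Sum>l\<in>{0..r + 1}.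
             of_int (i + 1) * ucf u 1 (w - k) (p - i) (q + 1 - j) (r + 1 - l) * ucf u 1 k (i + 1) j l
           + of_int (j + 1) * ucf u 0 (w - k) (p - i) (q + 1 - j) (r + 1 - l) * ucf u 1 k i (j + 1) l
           + of_int (l + 1) * ucf u 2 (w - k) (p - i) (q + 1 - j) (r + 1 - l) * ucf u 1 k i j (l + 1))
        - \<nu> * (of_int ((p + 1) * (p + 2)) * ucf u 1 w (p + 2) (q + 1) (r + 1)
              + of_int ((q + 2) * (q + 3)) * ucf u 1 w p (q + 3) (r + 1)
              + of_int ((r + 2) * (r + 3)) * ucf u 1 w p (q + 1) (r + 3))
        - cf (g 1) w p (q + 1) (r + 1))" .
qed

section \<open>Uniqueness of the coefficients with given prescribed data\<close>

definition same_boundary :: "(int \<Rightarrow> coeffs) \<Rightarrow> (int \<Rightarrow> coeffs) \<Rightarrow> bool" where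
  "same_boundary u u' \<longleftrightarrow> (\<forall>\<alpha>\<in>{0, 1, 2}. \<forall>w p q r.
     w = 0 \<or> p \<in> {0, 1} \<or> q \<in> {0, 1} \<or> r \<in> {0, 1} \<longrightarrow> u' \<alpha> w p q r = u \<alpha> w p q r)"

lemma ucf_same_boundary:
  assumes "same_boundary u u'" "\<alpha> \<in> {0, 1, 2}"
    and "P2 w p q r \<or> w \<le> 0 \<or> p \<in> {0, 1} \<or> q \<in> {0, 1} \<or> r \<in> {0, 1}"
  shows "ucf u' \<alpha> w p q r = ucf u \<alpha> w p q r"
proof (cases "P2 w p q r")
  case True
  then show ?thesis by (auto simp: ucf_def P2_def)
next
  case False
  then have "nat w = 0 \<or> nat p \<in> {0, 1} \<or> nat q \<in> {0, 1} \<or> nat r \<in> {0, 1}"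
    using assms(3) by auto
  then have "u' \<alpha> (nat w) (nat p) (nat q) (nat r) = u \<alpha> (nat w) (nat p) (nat q) (nat r)"
    using assms(1,2) unfolding same_boundary_def by blast
  then show ?thesis by (simp add: ucf_def cf_def)
qed

text \<open>The middle index of every coefficient in \<open>F0\<close> is the parity of q. Hence the
  factors \<open>Gamma\<close> do not vary with the unknown coefficients.\<close>

lemma F0_same_boundary:
  assumes "same_boundary u u'" "\<alpha> = 1 \<or> \<alpha> = 2"
  shows "F0 u' w p q r \<alpha> = F0 u w p q r \<alpha>"
proof -
  have "q - 2 * ee q \<in> {0, 1}" by (auto simp: minus_mult_div_eq_mod)
  then have "ucf u' \<beta> w x (q - 2 * ee q) y = ucf u \<beta> w x (q - 2 * ee q) y" if "\<beta> \<in> {0, 1, 2}" for \<beta> x y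
    using ucf_same_boundary[OF assms(1) that] by blast
  moreover have "\<alpha> \<in> {0, 1, 2}" "3 - \<alpha> \<in> {0, 1, 2}" using assms(2) by auto
  ultimately show ?thesis unfolding F0_def by simp
qed

lemma Gamma'_same_boundary:
  assumes "same_boundary u u'" "\<alpha> = 1 \<or> \<alpha> = 2 \<or> P2 w p q r \<or> P3 w p q r"
  shows "Gamma' \<nu> g u' w p q r \<alpha> i = Gamma' \<nu> g u w p q r \<alpha> i"
proof (cases "P2 w p q r \<or> P3 w p q r")
  case False
  then have "P1 w p q r" "\<alpha> = 1 \<or> \<alpha> = 2" using assms(2) not_P2_P3[of w p q r] by (auto simp: P1_def)
  then show ?thesis
    using F0_same_boundary[OF assms(1)] by (simp add: Gamma'_def F_cf_def)
qed (auto simp: Gamma'_def)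

lemma Gamma_at_same_boundary:
  assumes "same_boundary u u'" "state_ok s"
  shows "Gamma_at \<nu> g u' s i = Gamma_at \<nu> g u s i"
proof -
  obtain p q r \<alpha> w where s: "s = (p, q, r, \<alpha>, w)" by (cases s)
  have "\<alpha> = 1 \<or> \<alpha> = 2 \<or> P2 w p q r \<or> P3 w p q r" if "\<not> (\<not> P2 w p q r \<and> \<not> P3 w p q r \<and> \<alpha> = 0)"
    using assms(2) that by (auto simp: s state_ok_def)
  then show ?thesis
    using Gamma'_same_boundary[OF assms(1)] by (auto simp: s Gamma_at_def Gamma_cf_def)
qed

text \<open>Each of the n steps lowers the level, so all leaves are prescribed or have a negative
  index.\<close>

lemma tree_sum_same_boundary:
  assumes "same_boundary u u'"
  shows "state_ok s \<Longrightarrow> within_level n s \<Longrightarrow> tree_sum \<nu> g u' n s = tree_sum \<nu> g u n s"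
proof (induction n arbitrary: s)
  case 0
  obtain p q r \<alpha> w where s: "s = (p, q, r, \<alpha>, w)" by (cases s)
  show ?case
  proof (cases "P2 w p q r")
    case True
    then show ?thesis by (auto simp: s ucf_at_def ucf_def P2_def)
  next
    case False
    then have "\<alpha> \<in> {0, 1, 2}" "w \<le> 0 \<or> p \<in> {0, 1} \<or> q \<in> {0, 1} \<or> r \<in> {0, 1}"
      using 0 by (auto simp: s state_ok_def within_level_def P3_def)
    then show ?thesis using ucf_same_boundary[OF assms, of \<alpha> w p q r] by (simp add: s ucf_at_def)
  qed
next
  case (Suc n)
  show ?case
    unfolding tree_sum.simps
    by (rule sum.cong[OF refl])
      (simp add: Gamma_at_same_boundary[OF assms Suc.prems(1)] Suc.IH
        pick_state_ok[OF Suc.prems(1)] pick_within_level[OF Suc.prems(1) _ _ Suc.prems(2)])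
qed

lemma velocity_unique:
  assumes "same_boundary u u'" "velocity_formula \<nu> g u" "velocity_formula \<nu> g u'" "\<alpha> \<in> {0, 1, 2}"
  shows "u' \<alpha> = u \<alpha>"
proof (intro ext)
  fix w p q r
  show "u' \<alpha> w p q r = u \<alpha> w p q r"
  proof (cases "w = 0")
    case True
    then show ?thesis using assms(1,4) unfolding same_boundary_def by blast
  next
    case False
    then have w: "int w \<ge> 1" by simp
    have tree: "ucf v \<alpha> (int w) (int p) (int q) (int r) = tree_sum \<nu> g v w (int p, int q, int r, \<alpha>, int w)"
      if v: "velocity_formula \<nu> g v" for v
    proof -
      have "ucf v \<alpha> (int w) (int p) (int q) (int r) = velocity_rhs \<nu> g v (int p, int q, int r, \<alpha>, int w)"
        by (rule v[unfolded velocity_formula_iff, rule_format, OF assms(4) w]) simp_all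
      also note velocity_rhs_state[OF assms(4) w]
      finally show ?thesis unfolding nat_int .
    qed
    have eq: "tree_sum \<nu> g u' w (int p, int q, int r, \<alpha>, int w) = tree_sum \<nu> g u w (int p, int q, int r, \<alpha>, int w)"
      by (rule tree_sum_same_boundary[OF assms(1)])
        (use assms(4) in \<open>auto simp: state_ok_def within_level_def\<close>)
    have "ucf u' \<alpha> (int w) (int p) (int q) (int r) = ucf u \<alpha> (int w) (int p) (int q) (int r)"
      unfolding tree[OF assms(2)] tree[OF assms(3)] by (rule eq)
    then show ?thesis by (simp add: ucf_def cf_def)
  qed
qed

lemma pressure_unique:
  assumes "\<rho> \<noteq> 0" "\<And>\<alpha>. \<alpha> \<in> {0, 1, 2} \<Longrightarrow> u' \<alpha> = u \<alpha>"
    and "pressure_formula \<rho> \<nu> g u P" "pressure_formula \<rho> \<nu> g u' P'"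
    and "\<And>w p q r. p = 0 \<or> q = 0 \<or> r = 0 \<Longrightarrow> P' w p q r = P w p q r"
  shows "P' = P"
proof (intro ext)
  fix w p q r
  have ucf: "ucf u' 0 = ucf u 0" "ucf u' 1 = ucf u 1" "ucf u' 2 = ucf u 2"
    using assms(2)[of 0] assms(2)[of 1] assms(2)[of 2] by (simp_all add: ucf_def cf_def fun_eq_iff)
  show "P' w p q r = P w p q r"
  proof (cases "p = 0 \<or> q = 0 \<or> r = 0")
    case False
    \<comment> \<open>\<open>pressure_formula\<close> speaks of indices raised by one, so away from
      the prescribed faces it is used at p - 1, q - 1, r - 1.\<close>
    then have *: "0 \<le> int p - 1" "-1 \<le> int q - 1" "-1 \<le> int r - 1" "0 \<le> int w" by simp_all
    have "- (1 / \<rho>) * cf P' (int w) (int p - 1 + 1) (int q - 1 + 1) (int r - 1 + 1)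
        = - (1 / \<rho>) * cf P (int w) (int p - 1 + 1) (int q - 1 + 1) (int r - 1 + 1)"
      unfolding assms(3)[unfolded pressure_formula_def, rule_format, OF *(4,1,2,3)]
        assms(4)[unfolded pressure_formula_def ucf, rule_format, OF *(4,1,2,3)] ..
    then show ?thesis using assms(1) by (simp add: cf_def)
  qed (rule assms(5))
qed

theorem theorem3p3:
  fixes \<rho> \<mu> \<nu> :: real
    and g u :: "int \<Rightarrow> coeffs"
    and P :: coeffs
  assumes "\<rho> \<noteq> 0"
    and "\<nu> = \<mu> / \<rho>"
    and "power_series_solution \<rho> \<mu> g u P"
  shows "velocity_formula \<nu> g u
       \<and> pressure_formula \<rho> \<nu> g u P
       \<and> (\<forall>u' P'. same_prescribed_coeffs u P u' P'
             \<and> velocity_formula \<nu> g u' \<and> pressure_formula \<rho> \<nu> g u' P'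
             \<longrightarrow> power_series_solution \<rho> \<mu> g u' P')"
proof -
  have ns: "ns_coeffs u g (\<lambda>w p q r. - (1 / \<rho>) * P w p q r) \<nu>"
    by (rule ns_coeffs_of_solution[OF assms])
  have vel: "velocity_formula \<nu> g u" by (rule ns_coeffs.velocity_formula[OF ns])
  have pres: "pressure_formula \<rho> \<nu> g u P" by (rule pressure_formula_of_solution[OF ns])
  \<comment> \<open>The competing families equal \<open>u\<close> on the three components and
    \<open>P\<close>, so the property is transferred from the given solution.\<close>
  have "power_series_solution \<rho> \<mu> g u' P'"
    if same: "same_prescribed_coeffs u P u' P'" and vel': "velocity_formula \<nu> g u'"
      and pres': "pressure_formula \<rho> \<nu> g u' P'" for u' P'
  proof -
    have sb: "same_boundary u u'"
      using same unfolding same_prescribed_coeffs_def same_boundary_def by simp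
    have u: "u' \<alpha> = u \<alpha>" if "\<alpha> \<in> {0, 1, 2}" for \<alpha>
      by (rule velocity_unique[OF sb vel vel' that])
    have "P' = P"
      by (rule pressure_unique[OF assms(1) u pres pres'])
        (use same in \<open>auto simp: same_prescribed_coeffs_def\<close>)
    then show ?thesis
      using assms(3) u[of 0] u[of 1] u[of 2]
      by (simp add: power_series_solution_def navier_stokes_at_def)
  qed
  with vel pres show ?thesis by blast
qed

end
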